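(* Let $k$ be an algebraic number field of degree $d=[k:\mathbb{Q}]\geq 3$ that is not a CM-field. Let $r$ be the rank of the unit group $O_k^{\times}$, let $D_k$ be the absolute value of the discriminant of $k$, and let $\mathrm{Reg}(k)$ be the regulator of $k$. Let \[ \rho(k)=\max\{\operatorname{rank} O_{k'}^{\times} : k'\subseteq k,\ k'\neq k\}, \] the maximum being over all proper subfields $k'$ of $k$. Let $\gamma_d=d^{-d}$ and assume $1<\gamma_d D_k$. Then \[ \frac{(2r)!}{(r!)^3}\left(\frac{\log\log d}{2\log d}\right)^{3\rho(k)}\left(\frac{\log(\gamma_d D_k)}{4d}\right)^{r-\rho(k)}\le \mathrm{Reg}(k). \]
   Context: $O_k$ denotes the ring of integers of $k$ and $O_k^{\times}$ its unit group. A CM-field is a totally imaginary quadratic extension of a totally real number field. *)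

theory Defs
  imports "HOL-Computational_Algebra.Computational_Algebra" "HOL-Library.FuncSet"
    "Jordan_Normal_Form.Determinant"
begin

text \<open>
  Fields are subsets of an ambient field of characteristic \<open>0\<close>; taking the ambient type to be
  the number field itself (and the set to be \<open>UNIV\<close>), or the complex numbers, are special cases.
\<close>

definition is_subfield :: "'a::field_char_0 set \<Rightarrow> bool" where
  "is_subfield K \<longleftrightarrow> 0 \<in> K \<and> 1 \<in> K \<and>
     (\<forall>x\<in>K. \<forall>y\<in>K. x - y \<in> K \<and> x * y \<in> K) \<and> (\<forall>x\<in>K. inverse x \<in> K)"

text \<open>
  A finite basis of \<open>M\<close> over \<open>R\<close>. It is used with \<open>R\<close> a subfield of a field \<open>M\<close>, and with
  \<open>R = \<int>\<close> and \<open>M\<close> a ring of integers.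
\<close>

definition is_basis :: "'a::field_char_0 set \<Rightarrow> 'a set \<Rightarrow> 'a set \<Rightarrow> bool" where
  "is_basis R M B \<longleftrightarrow> finite B \<and> B \<subseteq> M \<and>
     (\<forall>x\<in>M. \<exists>!c. c \<in> B \<rightarrow>\<^sub>E R \<and> x = (\<Sum>b\<in>B. c b * b))"

definition ext_degree :: "'a::field_char_0 set \<Rightarrow> 'a set \<Rightarrow> nat" where
  "ext_degree F K = (THE n. \<exists>B. is_basis F K B \<and> card B = n)"

definition number_field :: "'a::field_char_0 set \<Rightarrow> bool" where
  "number_field K \<longleftrightarrow> is_subfield K \<and> (\<exists>B. is_basis \<rat> K B)"

text \<open>Extensionality makes distinct functions distinct as maps on \<open>K\<close>.\<close>

definition embeddings :: "'a::field_char_0 set \<Rightarrow> ('a \<Rightarrow> complex) set" where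
  "embeddings K = {\<sigma> \<in> extensional K. \<sigma> 1 = 1 \<and>
     (\<forall>x\<in>K. \<forall>y\<in>K. \<sigma> (x + y) = \<sigma> x + \<sigma> y \<and> \<sigma> (x * y) = \<sigma> x * \<sigma> y)}"

definition real_embedding :: "'a::field_char_0 set \<Rightarrow> ('a \<Rightarrow> complex) \<Rightarrow> bool" where
  "real_embedding K \<sigma> \<longleftrightarrow> \<sigma> ` K \<subseteq> \<real>"

definition totally_real :: "'a::field_char_0 set \<Rightarrow> bool" where
  "totally_real K \<longleftrightarrow> (\<forall>\<sigma>\<in>embeddings K. real_embedding K \<sigma>)"

definition totally_imaginary :: "'a::field_char_0 set \<Rightarrow> bool" where
  "totally_imaginary K \<longleftrightarrow> (\<forall>\<sigma>\<in>embeddings K. \<not> real_embedding K \<sigma>)"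

definition CM_field :: "'a::field_char_0 set \<Rightarrow> bool" where
  "CM_field K \<longleftrightarrow> number_field K \<and> totally_imaginary K \<and>
     (\<exists>F. number_field F \<and> totally_real F \<and> F \<subseteq> K \<and> ext_degree F K = 2)"

definition ring_of_integers :: "'a::field_char_0 set \<Rightarrow> 'a set" where
  "ring_of_integers K = {x \<in> K. algebraic_int x}"

definition integer_units :: "'a::field_char_0 set \<Rightarrow> 'a set" where
  "integer_units K = {u \<in> ring_of_integers K. \<exists>v\<in>ring_of_integers K. u * v = 1}"

definition mult_independent :: "'a::field_char_0 list \<Rightarrow> bool" where
  "mult_independent us \<longleftrightarrow>
     (\<forall>a :: nat \<Rightarrow> int. (\<Prod>i<length us. (us ! i) powi a i) = 1 \<longrightarrow> (\<forall>i<length us. a i = 0))"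

text \<open>The rank of an abelian group is the maximal number of independent elements.\<close>

definition unit_rank :: "'a::field_char_0 set \<Rightarrow> nat" where
  "unit_rank K = Max {length us | us. set us \<subseteq> integer_units K \<and> mult_independent us}"

definition max_subfield_unit_rank :: "'a::field_char_0 set \<Rightarrow> nat" where
  "max_subfield_unit_rank K = Max {unit_rank F | F. is_subfield F \<and> F \<subset> K}"

text \<open>\<open>det (\<sigma>\<^sub>i(\<omega>\<^sub>j))\<^sup>2\<close> for an integral basis \<open>\<omega>\<close>, with \<open>\<sigma>\<^sub>i\<close> running through all embeddings.\<close>

definition discriminant :: "'a::field_char_0 set \<Rightarrow> int" where
  "discriminant K = (THE \<Delta>. \<exists>\<omega> \<sigma>.
     distinct \<omega> \<and> is_basis \<int> (ring_of_integers K) (set \<omega>) \<and>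
     distinct \<sigma> \<and> set \<sigma> = embeddings K \<and>
     of_int \<Delta> = (det (mat (length \<omega>) (length \<omega>) (\<lambda>(i, j). (\<sigma> ! i) (\<omega> ! j))))\<^sup>2)"

definition roots_of_unity_in :: "'a::field_char_0 set \<Rightarrow> 'a set" where
  "roots_of_unity_in K = {z \<in> K. \<exists>n>0. z ^ n = 1}"

definition fundamental_units :: "'a::field_char_0 set \<Rightarrow> 'a list \<Rightarrow> bool" where
  "fundamental_units K us \<longleftrightarrow> set us \<subseteq> integer_units K \<and>
     (\<forall>u\<in>integer_units K. \<exists>!(z, a). z \<in> roots_of_unity_in K \<and>
        a \<in> {..<length us} \<rightarrow>\<^sub>E (UNIV :: int set) \<and>
        u = z * (\<Prod>i<length us. (us ! i) powi a i))"

text \<open>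
  The archimedean places, each represented by one embedding from its class
  \<open>{\<sigma>, cnj \<circ> \<sigma>}\<close>.
\<close>

definition arch_places :: "'a::field_char_0 set \<Rightarrow> ('a \<Rightarrow> complex) list \<Rightarrow> bool" where
  "arch_places K vs \<longleftrightarrow> distinct vs \<and> set vs \<subseteq> embeddings K \<and>
     (\<forall>\<sigma>\<in>embeddings K. \<exists>!\<tau>. \<tau> \<in> set vs \<and> (\<tau> = \<sigma> \<or> \<tau> = restrict (\<lambda>x. cnj (\<sigma> x)) K))"

definition local_degree :: "'a::field_char_0 set \<Rightarrow> ('a \<Rightarrow> complex) \<Rightarrow> nat" where
  "local_degree K \<sigma> = (if real_embedding K \<sigma> then 1 else 2)"

text \<open>
  By Dirichlet's unit theorem there is one more archimedean place than there are fundamental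
  units, so the rows of the matrix below run over all places but the last.
\<close>

definition regulator :: "'a::field_char_0 set \<Rightarrow> real" where
  "regulator K = (THE R. \<exists>\<epsilon> vs. fundamental_units K \<epsilon> \<and> arch_places K vs \<and>
     R = \<bar>det (mat (length \<epsilon>) (length \<epsilon>)
           (\<lambda>(i, j). real (local_degree K (vs ! i)) * ln (cmod ((vs ! i) (\<epsilon> ! j)))))\<bar>)"

end

theory Submission
 imports Defs "HOL-Analysis.Lebesgue_Measure" "HOL-Analysis.Interval_Integral" "HOL-Analysis.Harmonic_Numbers"
 "Jordan_Normal_Form.Char_Poly"
begin

text \<open>
 Under the logarithmic embedding, the units modulo torsion form a lattice of rank \<open>r\<close> whose
 covolume is the regulator, and \<open>max (\<Sum> x\<^sub>i\<^sup>+) (\<Sum> x\<^sub>i\<^sup>-)\<close> over \<open>r\<close> places is the logarithmic Mahler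
 measure of a unit. The unit ball of this norm has volume \<open>(2r choose r) / r!\<close>, so Minkowski's second
 theorem bounds the regulator from below in terms of the Mahler measures of independent units.
 By Dobrowolski's theorem, proved with the confluent Vandermonde determinant of Cantor and Straus, a
 unit of infinite order has logarithmic measure at least \<open>(ln (ln d) / ln d)\<^sup>3 / 4\<close>. Integers of
 logarithmic measure below \<open>ln (\<gamma> D) / (2 d)\<close> cannot generate \<open>K\<close>: by Hadamard's inequality the
 discriminant of a basis made of their products would be smaller than \<open>D\<close>. Hence the units below
 this bound lie in one proper subfield and span rank at most \<open>\<rho>\<close>.
\<close>

no_notation Finite_Cartesian_Product.vec_nth (infixl "$" 90)
no_notation fps_nth (infixl "$" 75)
no_notation Inner_Product.real_inner_class.inner (infix "\<bullet>" 70)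
hide_const (open) Finite_Cartesian_Product.mat Finite_Cartesian_Product.vec
hide_type (open) Finite_Cartesian_Product.vec

text \<open>The claim covers every d >= 3, so Dobrowolski's theorem is needed with the constant 1/4
  and no threshold. The determinant inequality has free parameters: the multiplicity k of the
  conjugates and a finite set of primes. For ln d <= 155 they come from a table checked by rational
  arithmetic; for ln d >= 150 they are k about 1.7 y and about 1.3 y^2 primes, y = ln d / ln (ln d),
  supplied by Chebyshev-type estimates. The inequality works only if the conjugates of the p-th
  powers of the unit are distinct; if two collide, the unit is replaced by one in a field of smaller
  degree without raising the measure. On the lattice side two values suffice: \<open>\<mu>1\<close>
  for units of infinite order and \<open>\<mu>2\<close> outside one proper subfield. Their halves
  are the bases of the two powers in the claim, and (2r choose r) / r! is its factor (2r)! / (r!)^3.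
  Since \<open>regulator\<close> and \<open>discriminant\<close> are definite descriptions, the
  existence of integral bases and fundamental units and the independence of all choices belong to
  the proof.\<close>

section \<open>Algebraic integers form a ring\<close>

lemma algebraic_int_eigenI:
 fixes x :: "'a::field_char_0" and w :: "nat => 'a" and A :: "nat => nat => int"
 assumes "i0 < n" "w i0 ~= 0"
 and eq: "!!i. i < n ==> x * w i = (\<Sum>j<n. of_int (A i j) * w j)"
 shows "algebraic_int x"
proof -
 let ?A = "mat n n (%(i, j). A i j)"
 let ?B = "map_mat of_int ?A :: 'a mat"
 let ?w = "vec n w"
 have c: "?A : carrier_mat n n" "?B : carrier_mat n n" by auto
 have "?B *\<^sub>v ?w = x \<cdot>\<^sub>v ?w"
 by (intro eq_vecI) (auto simp: eq scalar_prod_def lessThan_atLeast0)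
 moreover have "?w ~= 0\<^sub>v n"
 using assms(1,2) by (metis index_vec index_zero_vec(1))
 ultimately have "eigenvalue ?B x"
 unfolding eigenvalue_def eigenvector_def by (auto intro!: exI[of _ ?w])
 hence "poly (char_poly ?B) x = 0" using eigenvalue_root_char_poly[OF c(2)] by simp
 hence "poly (map_poly of_int (char_poly ?A)) x = 0" by (simp add: of_int_hom.char_poly_hom[OF c(1)])
 with degree_monic_char_poly[OF c(1)] show ?thesis unfolding algebraic_int_altdef_ipoly by auto
qed

lemma rat_poly_eigenE:
 fixes x :: "'a::field_char_0" and w :: "nat => 'a" and A :: "nat => nat => rat"
 assumes "i0 < n" "w i0 ~= 0"
 and eq: "!!i. i < n ==> x * w i = (\<Sum>j<n. of_rat (A i j) * w j)"
 obtains p :: "rat poly" where "p ~= 0" "poly (map_poly of_rat p) x = 0"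
proof -
 let ?A = "mat n n (%(i, j). A i j)"
 let ?B = "map_mat of_rat ?A :: 'a mat"
 let ?w = "vec n w"
 have c: "?A : carrier_mat n n" "?B : carrier_mat n n" by auto
 have "?B *\<^sub>v ?w = x \<cdot>\<^sub>v ?w"
 by (intro eq_vecI) (auto simp: eq scalar_prod_def lessThan_atLeast0)
 moreover have "?w ~= 0\<^sub>v n"
 using assms(1,2) by (metis index_vec index_zero_vec(1))
 ultimately have "eigenvalue ?B x"
 unfolding eigenvalue_def eigenvector_def by (auto intro!: exI[of _ ?w])
 hence "poly (char_poly ?B) x = 0" using eigenvalue_root_char_poly[OF c(2)] by simp
 hence "poly (map_poly of_rat (char_poly ?A)) x = 0" by (simp add: of_rat_hom.char_poly_hom[OF c(1)])
 moreover have "char_poly ?A ~= 0" using degree_monic_char_poly[OF c(1)] by auto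
 ultimately show ?thesis using that by blast
qed

definition int_combs :: "nat => (nat => 'a::field_char_0) => 'a set" where
 "int_combs n w = {\<Sum>j<n. of_int (c j) * w j | c. True}"

lemma int_combs_add: "a : int_combs n w ==> b : int_combs n w ==> a + b : int_combs n w"
 unfolding int_combs_def
 by (clarsimp, rule_tac x = "%j. c j + ca j" in exI) (simp add: sum.distrib algebra_simps)

lemma int_combs_scale: "a : int_combs n w ==> of_int k * a : int_combs n w"
 unfolding int_combs_def
 by (clarsimp, rule_tac x = "%j. k * c j" in exI) (simp add: sum_distrib_left algebra_simps)

lemma int_combs_0: "0 : int_combs n w"
 unfolding int_combs_def by (auto intro!: exI[of _ "%_. 0"])

lemma int_combs_sum: "(!!i. i : I ==> f i : int_combs n w) ==> sum f I : int_combs n w"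
 by (induction I rule: infinite_finite_induct) (auto intro: int_combs_add int_combs_0)

lemma int_combs_gen: "j < n ==> w j : int_combs n w"
proof -
 assume "j < n"
 have "(\<Sum>i<n. of_int (if i = j then 1 else 0) * w i) = (\<Sum>i<n. if i = j then w i else 0)"
 by (intro sum.cong) auto
 also have "... = w j" using \<open>j < n\<close> by simp
 finally show ?thesis unfolding int_combs_def by (auto intro!: exI[of _ "%i. if i = j then 1 else 0"])
qed

text \<open>The determinant trick: if multiplication by x maps the \<int>-module generated by the
  \<open>w i\<close> into itself, then x is an eigenvalue of an integer matrix and hence a root of
  its monic characteristic polynomial.\<close>

lemma algebraic_int_combsI:
 assumes "i0 < n" "w i0 ~= 0" and "!!i. i < n ==> x * w i : int_combs n w"
 shows "algebraic_int x"
proof -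
 have "ALL i. EX c. i < n --> x * w i = (\<Sum>j<n. of_int (c j) * w j)"
 using assms(3) unfolding int_combs_def by blast
 then obtain A where "!!i. i < n ==> x * w i = (\<Sum>j<n. of_int (A i j) * w j)" by metis
 with assms show ?thesis by (blast intro: algebraic_int_eigenI)
qed

lemma monic_root_power:
 fixes x :: "'a::field_char_0" and p :: "int poly"
 assumes "poly (map_poly of_int p) x = 0" "lead_coeff p = 1"
 shows "x ^ degree p = (\<Sum>l<degree p. of_int (- coeff p l) * x ^ l)" "degree p > 0"
proof -
 have "0 = (\<Sum>l\<le>degree p. of_int (coeff p l) * x ^ l)"
 using assms(1) by (simp add: poly_altdef)
 also have "... = (\<Sum>l<degree p. of_int (coeff p l) * x ^ l) + x ^ degree p"
 using assms(2) by (simp flip: lessThan_Suc_atMost)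
 finally show "x ^ degree p = (\<Sum>l<degree p. of_int (- coeff p l) * x ^ l)"
 by (simp add: sum_negf eq_neg_iff_add_eq_0 add.commute)
 show "degree p > 0"
 proof (rule ccontr)
 assume "~ degree p > 0"
 then obtain c where "p = [:c:]" by (auto elim: degree_eq_zeroE)
 with assms show False by (auto simp: map_poly_pCons)
 qed
qed

text \<open>The products \<open>x ^ i * y ^ j\<close>, with exponents below the degrees of monic
  equations for x and y, generate a \<int>-module stable under x and y, hence under their sum and
  product. The index k of a generator encodes the pair (k div n, k mod n).\<close>

lemma algebraic_int_add_mult:
 fixes x y :: "'a::field_char_0"
 assumes "algebraic_int x" "algebraic_int y"
 shows "algebraic_int (x + y)" "algebraic_int (x * y)"
proof -
 obtain p where p: "poly (map_poly of_int p) x = 0" "lead_coeff p = 1"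
 using assms(1) unfolding algebraic_int_altdef_ipoly by blast
 obtain q where q: "poly (map_poly of_int q) y = 0" "lead_coeff q = 1"
 using assms(2) unfolding algebraic_int_altdef_ipoly by blast
 define m n where "m = degree p" and "n = degree q"
 have mn: "m > 0" "n > 0" using monic_root_power(2)[OF p] monic_root_power(2)[OF q] m_def n_def by auto
 have xm: "x ^ m = (\<Sum>l<m. of_int (- coeff p l) * x ^ l)"
 using monic_root_power(1)[OF p] m_def by simp
 have yn: "y ^ n = (\<Sum>l<n. of_int (- coeff q l) * y ^ l)"
 using monic_root_power(1)[OF q] n_def by simp
 define w where "w = (%k. x ^ (k div n) * y ^ (k mod n))"
 define S where "S = int_combs (m * n) w"
 have gen: "x ^ i * y ^ j : S" if "i < m" "j < n" for i j
 proof -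
 have "i * n + j < (i + 1) * n" using that by simp
 also have "... <= m * n" using that by (intro mult_right_mono) auto
 finally have "i * n + j < m * n" .
 moreover have "w (i * n + j) = x ^ i * y ^ j" using that mn by (simp add: w_def)
 ultimately show ?thesis unfolding S_def by (metis int_combs_gen)
 qed
 have decomp: "k div n < m" "k mod n < n" if "k < m * n" for k
 using that mn by (auto simp: less_mult_imp_div_less)
 have xw: "x * w k : S" if k: "k < m * n" for k
 proof (cases "Suc (k div n) < m")
 case True
 thus ?thesis using gen[OF True decomp(2)[OF k]] by (simp add: w_def mult_ac)
 next
 case False
 hence "Suc (k div n) = m" using decomp[OF k] by simp
 hence "x * w k = x ^ m * y ^ (k mod n)" by (auto simp: w_def mult_ac)
 also have "... = (\<Sum>l<m. of_int (- coeff p l) * (x ^ l * y ^ (k mod n)))"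
 by (simp only: xm sum_distrib_right sum_distrib_left mult_ac)
 also have "... : S" unfolding S_def
 by (intro int_combs_sum int_combs_scale) (use gen decomp[OF k] S_def in auto)
 finally show ?thesis .
 qed
 have yw: "y * w k : S" if k: "k < m * n" for k
 proof (cases "Suc (k mod n) < n")
 case True
 thus ?thesis using gen[OF decomp(1)[OF k] True] by (simp add: w_def mult_ac)
 next
 case False
 hence "Suc (k mod n) = n" using decomp[OF k] by simp
 hence "y * w k = x ^ (k div n) * y ^ n" unfolding w_def
 by (metis mult.left_commute power_Suc)
 also have "... = (\<Sum>l<n. of_int (- coeff q l) * (x ^ (k div n) * y ^ l))"
 by (simp only: yn sum_distrib_left sum_distrib_right mult_ac)
 also have "... : S" unfolding S_def
 by (intro int_combs_sum int_combs_scale) (use gen decomp[OF k] S_def in auto)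
 finally show ?thesis .
 qed
 have w0: "0 < m * n" "w 0 ~= 0" using mn by (auto simp: w_def)
 show "algebraic_int (x + y)"
 by (rule algebraic_int_combsI[of 0 "m * n" w], use w0 in simp, use w0 in simp)
 (use xw yw S_def in "auto simp: algebra_simps intro: int_combs_add")
 have "x * y * w k : S" if k: "k < m * n" for k
 proof -
 from yw[OF k] obtain c where "y * w k = (\<Sum>j<m * n. of_int (c j) * w j)"
 unfolding S_def int_combs_def by blast
 hence "x * y * w k = (\<Sum>j<m * n. of_int (c j) * (x * w j))"
 by (simp add: mult.assoc sum_distrib_left mult.left_commute)
 also have "... : S" unfolding S_def
 by (intro int_combs_sum int_combs_scale) (use xw S_def in auto)
 finally show ?thesis .
 qed
 thus "algebraic_int (x * y)"
 by (intro algebraic_int_combsI[of 0 "m * n" w]) (use w0 S_def in auto)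
qed

lemma algebraic_int_diff:
 "algebraic_int (x :: 'a::field_char_0) ==> algebraic_int y ==> algebraic_int (x - y)"
 using algebraic_int_add_mult(1)[of x "- y"] by simp

lemma algebraic_int_sum:
 "(!!i. i : I ==> algebraic_int (f i :: 'a::field_char_0)) ==> algebraic_int (sum f I)"
 by (induction I rule: infinite_finite_induct) (auto intro: algebraic_int_add_mult)

lemma algebraic_int_prod:
 "(!!i. i : I ==> algebraic_int (f i :: 'a::field_char_0)) ==> algebraic_int (prod f I)"
 by (induction I rule: infinite_finite_induct) (auto intro: algebraic_int_add_mult)

lemma algebraic_int_power:
 "algebraic_int (x :: 'a::field_char_0) ==> algebraic_int (x ^ n)"
 by (induction n) (auto intro: algebraic_int_add_mult)

text \<open>Applied to the conjugates of an integer of K, where it turns the rational coefficients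
  of the characteristic polynomial into integers.\<close>

lemma algebraic_int_coeff_prod:
 fixes f :: "'b => 'a::field_char_0"
 assumes "finite I" "!!i. i : I ==> algebraic_int (f i)"
 shows "algebraic_int (coeff (PROD i:I. [:- f i, 1:]) n)"
 using assms
proof (induction I arbitrary: n rule: finite_induct)
 case empty
 thus ?case by (auto simp: coeff_1)
next
 case (insert i I)
 show ?case using insert
 by (cases n) (auto intro!: algebraic_int_add_mult algebraic_int_diff simp: coeff_pCons algebraic_int_minus)
qed

section \<open>Subfields\<close>

lemma subfield_0: "is_subfield K ==> 0 : K"
 and subfield_1: "is_subfield K ==> 1 : K"
 and subfield_diff: "is_subfield K ==> x : K ==> y : K ==> x - y : K"
 and subfield_mult: "is_subfield K ==> x : K ==> y : K ==> x * y : K"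
 and subfield_inverse: "is_subfield K ==> x : K ==> inverse x : K"
 unfolding is_subfield_def by auto

lemma subfield_uminus: "is_subfield K ==> x : K ==> - x : K"
 using subfield_diff[of K 0 x] subfield_0 by auto

lemma subfield_add: "is_subfield K ==> x : K ==> y : K ==> x + y : K"
 using subfield_diff[of K x "- y"] subfield_uminus by auto

lemma subfield_divide: "is_subfield K ==> x : K ==> y : K ==> x / y : K"
 unfolding divide_inverse by (simp add: subfield_mult subfield_inverse)

lemma subfield_power: "is_subfield K ==> x : K ==> x ^ n : K"
 by (induction n) (auto intro: subfield_mult subfield_1)

lemma subfield_sum: "is_subfield K ==> (!!i. i : I ==> f i : K) ==> sum f I : K"
 by (induction I rule: infinite_finite_induct) (auto intro: subfield_add subfield_0)

lemma subfield_prod: "is_subfield K ==> (!!i. i : I ==> f i : K) ==> prod f I : K"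
 by (induction I rule: infinite_finite_induct) (auto intro: subfield_mult subfield_1)

lemma subfield_of_nat: "is_subfield K ==> of_nat n : K"
 by (induction n) (auto intro: subfield_add subfield_1 subfield_0)

lemma subfield_of_int: "is_subfield K ==> of_int n : K"
 by (cases n) (auto simp del: of_nat_Suc intro!: subfield_uminus subfield_of_nat)

lemma subfield_of_rat: "is_subfield K ==> of_rat q : K"
 by (cases q) (auto simp: of_rat_rat intro: subfield_divide subfield_of_int)

lemma subfield_Rats: "is_subfield K ==> \<rat> <= K"
 unfolding Rats_def using subfield_of_rat by auto

lemma is_subfield_Rats: "is_subfield \<rat>"
 unfolding is_subfield_def by auto

section \<open>Polynomials over a subfield\<close>

definition poly_over :: "'a::zero set => 'a poly => bool" where
 "poly_over F p \<longleftrightarrow> (ALL i. coeff p i : F)"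

context
 fixes F :: "'a::field_char_0 set"
 assumes F: "is_subfield F"
begin

lemma poly_over_0: "poly_over F 0" and poly_over_1: "poly_over F 1"
 using F by (auto simp: poly_over_def coeff_1 subfield_0 subfield_1)

lemma poly_over_const: "c : F ==> poly_over F [:c:]"
 using F by (auto simp: poly_over_def coeff_pCons subfield_0 split: nat.splits)

lemma poly_over_monom: "c : F ==> poly_over F (monom c n)"
 using F by (auto simp: poly_over_def subfield_0)

lemma poly_over_add: "poly_over F p ==> poly_over F q ==> poly_over F (p + q)"
 using F by (auto simp: poly_over_def subfield_add)

lemma poly_over_diff: "poly_over F p ==> poly_over F q ==> poly_over F (p - q)"
 using F by (auto simp: poly_over_def subfield_diff)

lemma poly_over_mult: "poly_over F p ==> poly_over F q ==> poly_over F (p * q)"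
 using F by (auto simp: poly_over_def coeff_mult intro!: subfield_sum subfield_mult)

lemma poly_over_smult: "c : F ==> poly_over F p ==> poly_over F (Polynomial.smult c p)"
 using F by (auto simp: poly_over_def subfield_mult)

lemma poly_over_pderiv: "poly_over F p ==> poly_over F (pderiv p)"
 using F by (auto simp: poly_over_def coeff_pderiv intro!: subfield_mult subfield_add subfield_1 subfield_of_nat)

text \<open>A monic divisor requires no division of coefficients, so the usual descent on the degree
  stays inside the polynomials over \<open>F\<close>.\<close>

lemma poly_over_div:
 assumes m: "poly_over F m" "lead_coeff m = 1" and g: "poly_over F g"
 obtains q r where "poly_over F q" "poly_over F r" "g = q * m + r" "r = 0 \<or> degree r < degree m"
proof -
 have "EX q r. poly_over F q & poly_over F r & g = q * m + r & (r = 0 \<or> degree r < degree m)"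
 using g
 proof (induction "degree g" arbitrary: g rule: less_induct)
 case less
 show ?case
 proof (cases "degree g < degree m")
 case True
 thus ?thesis using less.prems poly_over_0 by (intro exI[of _ 0] exI[of _ g]) auto
 next
 case False
 define t where "t = monom (lead_coeff g) (degree g - degree m)"
 define h where "h = g - t * m"
 have t: "poly_over F t" using less.prems unfolding t_def by (intro poly_over_monom) (auto simp: poly_over_def)
 have h: "poly_over F h" using t m less.prems by (auto simp: h_def intro!: poly_over_diff poly_over_mult)
 have m0: "m ~= 0" using m by auto
 show ?thesis
 \<comment> \<open>Cancelling the leading term lowers the degree only if it is positive. For a
   constant g the divisor is 1 and divides exactly.\<close>
 proof (cases "g = 0 \<or> degree g = 0")
 case True
 with False have "degree m = 0" by auto
 with m have "m = 1" using monic_degree_0 by blast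
 thus ?thesis using less.prems poly_over_0 by (intro exI[of _ g] exI[of _ 0]) auto
 next
 case g0: False
 have tm: "coeff (t * m) (degree g) = lead_coeff g"
 using False m coeff_monom_mult[of "lead_coeff g" "degree g - degree m" m "degree g"]
 by (simp add: t_def)
 have "degree (t * m) <= degree g"
 using False g0 m0 by (simp add: t_def degree_mult_eq degree_monom_eq)
 hence "degree h <= degree g" unfolding h_def by (simp add: degree_diff_le)
 moreover have "coeff h (degree g) = 0" using tm by (simp add: h_def)
 ultimately have "degree h < degree g" using g0
 by (metis le_neq_implies_less leading_coeff_0_iff degree_0 not_gr_zero)
 from less.hyps[OF this h] obtain q r where
 "poly_over F q" "poly_over F r" "h = q * m + r" "r = 0 \<or> degree r < degree m" by blast
 thus ?thesis using t
 by (intro exI[of _ "q + t"] exI[of _ r]) (auto simp: h_def algebra_simps intro: poly_over_add)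
 qed
 qed
 qed
 thus ?thesis using that by blast
qed

lemma poly_over_eval: "poly_over F p ==> x : F ==> poly p x : F"
 using F by (auto simp: poly_over_def poly_altdef intro!: subfield_sum subfield_mult subfield_power)

end

section \<open>Embeddings\<close>

abbreviation Emb :: "'a::field_char_0 set => ('a => complex) set" where
 "Emb == embeddings"

lemma embeddingsD:
 assumes "sg : Emb K"
 shows "sg 1 = 1" "x : K ==> y : K ==> sg (x + y) = sg x + sg y"
 "x : K ==> y : K ==> sg (x * y) = sg x * sg y" "sg : extensional K"
 using assms unfolding embeddings_def by auto

context
 fixes K :: "'a::field_char_0 set" and sg :: "'a => complex"
 assumes K: "is_subfield K" and sg: "sg : Emb K"
begin

lemma emb_1: "sg 1 = 1"
 and emb_add: "x : K ==> y : K ==> sg (x + y) = sg x + sg y"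
 and emb_mult: "x : K ==> y : K ==> sg (x * y) = sg x * sg y"
 using embeddingsD[OF sg] by auto

lemma emb_0: "sg 0 = 0"
 using emb_add[of 0 0] subfield_0[OF K] by simp

lemma emb_uminus: "x : K ==> sg (- x) = - sg x"
 using emb_add[of x "- x"] subfield_uminus[OF K] emb_0 by (simp add: eq_neg_iff_add_eq_0 add.commute)

lemma emb_diff: "x : K ==> y : K ==> sg (x - y) = sg x - sg y"
 using emb_add[of x "- y"] emb_uminus subfield_uminus[OF K] by simp

lemma emb_eq_0_iff: "x : K ==> sg x = 0 \<longleftrightarrow> x = 0"
 using emb_mult[of x "inverse x"] emb_1 emb_0 subfield_inverse[OF K, of x] by (cases "x = 0") auto

lemma emb_inverse: "x : K ==> sg (inverse x) = inverse (sg x)"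
proof (cases "x = 0")
 case True thus ?thesis by (simp add: emb_0)
next
 case False
 assume "x : K"
 hence "sg x * sg (inverse x) = 1"
 using False emb_mult[of x "inverse x"] emb_1 subfield_inverse[OF K, of x] by simp
 from inverse_unique[OF this] show ?thesis by simp
qed

lemma emb_power: "x : K ==> sg (x ^ n) = sg x ^ n"
 by (induction n) (auto simp: emb_1 emb_mult subfield_power[OF K])

lemma emb_sum: "(!!i. i : I ==> f i : K) ==> sg (sum f I) = (SUM i:I. sg (f i))"
 by (induction I rule: infinite_finite_induct) (auto simp: emb_0 emb_add subfield_sum[OF K])

lemma emb_of_nat: "sg (of_nat n) = of_nat n"
 by (induction n) (auto simp: emb_0 emb_1 emb_add subfield_1[OF K] subfield_of_nat[OF K])

lemma emb_of_int: "sg (of_int n) = of_int n"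
 by (cases n) (auto simp del: of_nat_Suc simp: emb_uminus emb_of_nat subfield_of_nat[OF K])

lemma emb_of_rat: "sg (of_rat q) = of_rat q"
 by (cases q) (auto simp: of_rat_rat divide_inverse emb_mult emb_inverse emb_of_int
 subfield_of_int[OF K] subfield_inverse[OF K])

lemma coeff_map_emb: "coeff (map_poly sg p) i = sg (coeff p i)"
 by (simp add: coeff_map_poly emb_0)

lemma map_emb_add: "poly_over K p ==> poly_over K q ==> map_poly sg (p + q) = map_poly sg p + map_poly sg q"
 by (intro poly_eqI) (auto simp: coeff_map_emb emb_add poly_over_def)

lemma map_emb_diff: "poly_over K p ==> poly_over K q ==> map_poly sg (p - q) = map_poly sg p - map_poly sg q"
 by (intro poly_eqI) (auto simp: coeff_map_emb emb_diff poly_over_def)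

lemma map_emb_mult: "poly_over K p ==> poly_over K q ==> map_poly sg (p * q) = map_poly sg p * map_poly sg q"
 by (intro poly_eqI)
 (auto simp: coeff_map_emb coeff_mult emb_sum emb_mult poly_over_def subfield_mult[OF K])

lemma map_emb_pderiv: "poly_over K p ==> map_poly sg (pderiv p) = pderiv (map_poly sg p)"
 by (intro poly_eqI)
 (simp add: coeff_map_emb coeff_pderiv emb_mult poly_over_def emb_add emb_1 emb_of_nat
 subfield_of_nat[OF K] subfield_1[OF K] subfield_add[OF K])

lemma degree_map_emb: "poly_over K p ==> degree (map_poly sg p) = degree p"
proof -
 assume p: "poly_over K p"
 have "degree (map_poly sg p) <= degree p"
 by (rule degree_le) (auto simp: coeff_map_emb emb_0 coeff_eq_0)
 moreover have "degree p <= degree (map_poly sg p)"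
 using emb_eq_0_iff[of "lead_coeff p"] p unfolding poly_over_def
 by (cases "p = 0") (simp_all add: le_degree coeff_map_emb)
 ultimately show ?thesis by simp
qed

lemma emb_poly: "poly_over K p ==> x : K ==> sg (poly p x) = poly (map_poly sg p) (sg x)"
 by (simp add: poly_altdef degree_map_emb coeff_map_emb emb_sum emb_mult emb_power poly_over_def
 subfield_mult[OF K] subfield_power[OF K])

lemma map_emb_of_int: "map_poly sg (map_poly of_int p) = map_poly of_int p"
 by (intro poly_eqI) (simp add: coeff_map_emb coeff_map_poly emb_of_int)

lemma poly_over_of_int: "poly_over K (map_poly of_int p)"
 by (auto simp: poly_over_def coeff_map_poly subfield_of_int[OF K])

lemma emb_poly_int: "x : K ==> sg (poly (map_poly of_int p) x) = poly (map_poly of_int p) (sg x)"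
 by (simp add: emb_poly poly_over_of_int map_emb_of_int)

lemma algebraic_int_emb_iff: "x : K ==> algebraic_int (sg x) \<longleftrightarrow> algebraic_int x"
 unfolding algebraic_int_altdef_ipoly
 by (subst emb_poly_int[symmetric], assumption)
 (simp add: emb_eq_0_iff poly_over_eval[OF K] poly_over_of_int)

end

section \<open>Simple extensions\<close>

text \<open>An equation of least degree for x has a nonzero constant term, since otherwise x could
  be divided out. Solving it for this term writes the inverse as a polynomial in x.\<close>

lemma ring_inverse_closed:
 fixes x :: "'a::field_char_0"
 assumes R: "\<rat> <= R" "!!x y. x : R ==> y : R ==> x + y : R" "!!x y. x : R ==> y : R ==> x * y : R"
 and x: "x : R" "algebraic x"
 shows "inverse x : R"
proof (cases "x = 0")
 case True thus ?thesis using R(1) by auto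
next
 case False
 define P where "P = (%p::'a poly. poly_over \<rat> p & p ~= 0 & poly p x = 0)"
 have "EX p. P p" using x(2) unfolding algebraic_altdef P_def poly_over_def by blast
 then obtain p where p: "P p" and min: "!!q. P q ==> degree p <= degree q"
 using ex_has_least_nat[of P _ degree] by blast
 obtain c q where pq: "p = pCons c q" by (cases p)
 have q: "poly_over \<rat> q" "c : \<rat>"
 using p unfolding P_def pq poly_over_def by (metis coeff_pCons_Suc, metis coeff_pCons_0)
 have eq: "c + x * poly q x = 0" using p unfolding P_def pq by simp
 have "c ~= 0"
 proof
 assume "c = 0"
 with eq False p pq q have "P q" unfolding P_def by auto
 with min[of q] show False using \<open>c = 0\<close> p pq unfolding P_def by auto
 qed
 have pw: "x ^ n : R" for n using R x by (induction n) auto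
 have sumR: "sum f I : R" if "!!i. i : I ==> f i : R" for f and I :: "nat set"
 using that R by (induction I rule: infinite_finite_induct) auto
 have "poly q x : R" unfolding poly_altdef
 by (intro sumR R(3) pw) (use q R(1) in "auto simp: poly_over_def")
 moreover have "- inverse c : R" using q R(1) by auto
 moreover have "inverse x = poly q x * (- inverse c)"
 using eq \<open>c ~= 0\<close> False by (simp add: field_simps eq_neg_iff_add_eq_0 add.commute)
 ultimately show ?thesis using R(3) by metis
qed

text \<open>The ring F[bt]. It is a field as soon as its elements are algebraic, so inside a number
  field it is F(bt).\<close>

definition adjoin :: "'a::field_char_0 set => 'a => 'a set" where
 "adjoin F bt = {poly g bt | g. poly_over F g}"

lemma adjoin_closed:
 assumes "is_subfield F" "x : adjoin F bt" "y : adjoin F bt"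
 shows "x + y : adjoin F bt" "x - y : adjoin F bt" "x * y : adjoin F bt"
proof -
 obtain g h where gh: "poly_over F g" "x = poly g bt" "poly_over F h" "y = poly h bt"
 using assms unfolding adjoin_def by blast
 show "x + y : adjoin F bt" "x - y : adjoin F bt" "x * y : adjoin F bt" unfolding adjoin_def
 using gh poly_over_add[OF assms(1) gh(1,3)] poly_over_diff[OF assms(1) gh(1,3)]
 poly_over_mult[OF assms(1) gh(1,3)]
 by (auto intro: exI[of _ "g + h"] exI[of _ "g - h"] exI[of _ "g * h"])
qed

lemma adjoin_base: "is_subfield F ==> F <= adjoin F bt"
 unfolding adjoin_def by (auto intro!: exI[of _ "[:_:]"] poly_over_const)

lemma poly_over_X: "is_subfield F ==> poly_over F [:0, 1:]"
 by (auto simp: poly_over_def coeff_pCons subfield_0 subfield_1 split: nat.splits)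

lemma adjoin_gen: "is_subfield F ==> bt : adjoin F bt"
 unfolding adjoin_def by (auto intro!: exI[of _ "[:0,1:]"] poly_over_X)

lemma adjoin_minimal: "is_subfield E ==> F <= E ==> bt : E ==> adjoin F bt <= E"
proof
 fix x assume a: "is_subfield E" "F <= E" "bt : E" "x : adjoin F bt"
 then obtain g where "poly_over F g" "x = poly g bt" unfolding adjoin_def by blast
 moreover from this a(2) have "poly_over E g" unfolding poly_over_def by blast
 ultimately show "x : E" using poly_over_eval[OF a(1)] a(3) by simp
qed

lemma adjoin_subfield:
 assumes F: "is_subfield F" and alg: "!!x. x : adjoin F bt ==> algebraic x"
 shows "is_subfield (adjoin F bt)"
 unfolding is_subfield_def
proof (intro conjI ballI)
 show "0 : adjoin F bt" "1 : adjoin F bt" using adjoin_base[OF F] subfield_0[OF F] subfield_1[OF F] by auto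
 fix x assume x: "x : adjoin F bt"
 show "inverse x : adjoin F bt"
 by (rule ring_inverse_closed[OF subset_trans[OF subfield_Rats[OF F] adjoin_base[OF F]]
 adjoin_closed(1)[OF F] adjoin_closed(3)[OF F] x alg[OF x]])
qed (use adjoin_closed[OF F] in auto)

definition minpoly_over :: "'a::field_char_0 set => 'a => 'a poly => bool" where
 "minpoly_over F bt m \<longleftrightarrow> poly_over F m & lead_coeff m = 1 & poly m bt = 0 &
 (ALL g. poly_over F g --> g ~= 0 --> poly g bt = 0 --> degree m <= degree g)"

lemma minpoly_over_exists:
 assumes F: "is_subfield F" and bt: "algebraic bt"
 obtains m where "minpoly_over F bt m"
proof -
 define P where "P = (%p::'a poly. poly_over F p & p ~= 0 & poly p bt = 0)"
 have "EX p. P p" using bt subfield_Rats[OF F] unfolding algebraic_altdef P_def poly_over_def by blast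
 then obtain p where p: "P p" and min: "!!q. P q ==> degree p <= degree q"
 using ex_has_least_nat[of P _ degree] by blast
 have "minpoly_over F bt (Polynomial.smult (inverse (lead_coeff p)) p)"
 unfolding minpoly_over_def
 proof (intro conjI allI impI)
 show "poly_over F (Polynomial.smult (inverse (lead_coeff p)) p)" using p F unfolding P_def
 by (auto intro!: poly_over_smult subfield_inverse) (auto simp: poly_over_def)
 qed (use p min in "auto simp: P_def")
 thus ?thesis using that by blast
qed

context
 fixes F :: "'a::field_char_0 set" and bt :: 'a and m :: "'a poly"
 assumes F: "is_subfield F" and m: "minpoly_over F bt m"
begin

lemma minpoly_props: "poly_over F m" "lead_coeff m = 1" "poly m bt = 0" "m ~= 0"
 using m unfolding minpoly_over_def by auto

lemma minpoly_min: "poly_over F g ==> degree g < degree m ==> poly g bt = 0 ==> g = 0"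
 using m unfolding minpoly_over_def by (meson not_less)

lemma minpoly_degree_pos: "degree m > 0"
proof (rule ccontr)
 assume "~ degree m > 0"
 hence "m = 1" using minpoly_props monic_degree_0 by blast
 thus False using minpoly_props by simp
qed

lemma minpoly_dvd:
 assumes g: "poly_over F g" "poly g bt = 0"
 obtains q where "poly_over F q" "g = q * m"
proof -
 obtain q r where qr: "poly_over F q" "poly_over F r" "g = q * m + r" "r = 0 \<or> degree r < degree m"
 using poly_over_div[OF F minpoly_props(1,2) g(1)] by blast
 hence "poly r bt = 0" using g minpoly_props by simp
 hence "r = 0" using qr minpoly_min by blast
 thus ?thesis using that qr by auto
qed

lemma adjoin_reduced:
 assumes "x : adjoin F bt"
 obtains g where "poly_over F g" "degree g < degree m" "x = poly g bt"
proof -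
 obtain h where h: "poly_over F h" "x = poly h bt" using assms unfolding adjoin_def by blast
 obtain q r where qr: "poly_over F q" "poly_over F r" "h = q * m + r" "r = 0 \<or> degree r < degree m"
 using poly_over_div[OF F minpoly_props(1,2) h(1)] by blast
 show ?thesis using that[of r] qr h minpoly_props minpoly_degree_pos by auto
qed

context
 fixes sg assumes sg: "sg : Emb F"
begin

text \<open>Irreducibility survives the embedding: a polynomial h of least degree over
  \<open>F\<close> whose image vanishes at z divides m. The cofactor has degree below that of m, so
  it does not vanish at \<open>bt\<close>; hence h does, and h is no proper divisor.\<close>

lemma emb_minpoly_min:
 assumes z: "poly (map_poly sg m) z = 0" and g: "poly_over F g" "g ~= 0" "poly (map_poly sg g) z = 0"
 shows "degree m <= degree g"
proof -
 define P where "P = (%p::'a poly. poly_over F p & p ~= 0 & poly (map_poly sg p) z = 0)"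
 have "P g" using g P_def by simp
 then obtain p where p: "P p" and min: "!!q. P q ==> degree p <= degree q"
 using ex_has_least_nat[of P _ degree] by blast
 define h where "h = Polynomial.smult (inverse (lead_coeff p)) p"
 have h: "poly_over F h" "lead_coeff h = 1" "degree h = degree p"
 using p F unfolding P_def h_def
 by (auto intro!: poly_over_smult subfield_inverse) (auto simp: poly_over_def)
 have "h = [:inverse (lead_coeff p):] * p" by (simp add: h_def)
 moreover have "inverse (lead_coeff p) : F" using p F unfolding P_def poly_over_def
 by (intro subfield_inverse) auto
 ultimately have hz: "poly (map_poly sg h) z = 0"
 using p map_emb_mult[OF F sg poly_over_const[OF F]] unfolding P_def by (simp add: poly_mult)
 obtain q r where qr: "poly_over F q" "poly_over F r" "m = q * h + r" "r = 0 \<or> degree r < degree h"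
 using poly_over_div[OF F h(1,2) minpoly_props(1)] by blast
 have "map_poly sg m = map_poly sg q * map_poly sg h + map_poly sg r"
 unfolding qr(3) using qr h map_emb_add[OF F sg] map_emb_mult[OF F sg] poly_over_mult[OF F] by metis
 hence "poly (map_poly sg r) z = 0" using z hz by simp
 hence r0: "r = 0" using min[of r] qr h unfolding P_def by (cases "r = 0") auto
 hence mq: "m = q * h" using qr by simp
 have h0: "degree h > 0"
 proof (rule ccontr)
 assume "~ degree h > 0"
 hence "h = 1" using h monic_degree_0 by blast
 thus False using hz by (simp add: emb_1[OF F sg] one_pCons map_poly_pCons emb_0[OF F sg])
 qed
 have q0: "q ~= 0" "h ~= 0" using mq minpoly_props by auto
 have "degree q < degree m" using mq h0 q0 by (simp add: degree_mult_eq)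
 hence "poly q bt ~= 0" using minpoly_min qr q0 by blast
 hence "poly h bt = 0" using mq minpoly_props by auto
 hence "degree m <= degree h" using m h q0 unfolding minpoly_over_def by blast
 also have "... <= degree g" using min[OF \<open>P g\<close>] h by simp
 finally show ?thesis .
qed

text \<open>A double root would be a root of the image of \<open>pderiv m\<close>, whose degree is
  too small. So the roots are as many as the degree, which lets extensions of \<open>sg\<close> be
  counted by degrees.\<close>

lemma emb_minpoly_split:
 "map_poly sg m = (\<Prod>z | poly (map_poly sg m) z = 0. [:- z, 1:])"
 "card {z. poly (map_poly sg m) z = 0} = degree m" "finite {z. poly (map_poly sg m) z = 0}"
proof -
 let ?p = "map_poly sg m"
 have deg: "degree ?p = degree m" by (rule degree_map_emb[OF F sg minpoly_props(1)])
 have lc: "lead_coeff ?p = 1" using deg minpoly_props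
 by (simp add: coeff_map_emb[OF F sg] emb_1[OF F sg])
 hence p0: "?p ~= 0" by auto
 have "rsquarefree ?p" unfolding rsquarefree_roots
 proof (intro allI notI)
 fix z assume z: "poly ?p z = 0 & poly (pderiv ?p) z = 0"
 have "degree (pderiv m) < degree m" using minpoly_degree_pos by (simp add: degree_pderiv)
 moreover have "pderiv m ~= 0" using minpoly_degree_pos by (simp add: pderiv_eq_0_iff)
 moreover have "poly (map_poly sg (pderiv m)) z = 0"
 using z map_emb_pderiv[OF F sg minpoly_props(1)] by simp
 ultimately show False
 using emb_minpoly_min[of z "pderiv m"] z poly_over_pderiv[OF F minpoly_props(1)] by auto
 qed
 from complex_poly_decompose_rsquarefree[OF this] lc
 show eq: "?p = (\<Prod>z | poly ?p z = 0. [:- z, 1:])" by simp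
 show fin: "finite {z. poly ?p z = 0}" using poly_roots_finite[OF p0] .
 have "degree ?p = degree (\<Prod>z | poly ?p z = 0. [:- z, 1:])" using eq by simp
 also have "... = card {z. poly ?p z = 0}" by (subst degree_prod_eq_sum_degree) auto
 finally show "card {z. poly ?p z = 0} = degree m" using deg by simp
qed

text \<open>\<open>sel x\<close> is an arbitrary polynomial expressing x in \<open>bt\<close>. Two
  such polynomials differ by a multiple of m, which vanishes at z, so the value of \<open>tu\<close>
  does not depend on the choice.\<close>

lemma emb_adjoin_extend:
 assumes E: "is_subfield (adjoin F bt)" and z: "poly (map_poly sg m) z = 0"
 obtains tu where "tu : Emb (adjoin F bt)" "restrict tu F = sg" "tu bt = z"
proof -
 let ?E = "adjoin F bt"
 define sel where "sel = (%x. SOME g. poly_over F g & poly g bt = x)"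
 define tu where "tu = restrict (%x. poly (map_poly sg (sel x)) z) ?E"
 have sel: "poly_over F (sel x) & poly (sel x) bt = x" if "x : ?E" for x
 unfolding sel_def by (rule someI_ex) (use that in "auto simp: adjoin_def")
 have tu: "tu (poly g bt) = poly (map_poly sg g) z" if g: "poly_over F g" for g
 proof -
 have mem: "poly g bt : ?E" using g unfolding adjoin_def by blast
 let ?h = "sel (poly g bt)"
 have h: "poly_over F ?h" "poly ?h bt = poly g bt" using sel[OF mem] by auto
 obtain q where q: "poly_over F q" "?h - g = q * m"
 using minpoly_dvd[of "?h - g"] h poly_over_diff[OF F h(1) g] by auto
 have "map_poly sg ?h - map_poly sg g = map_poly sg q * map_poly sg m"
 using map_emb_diff[OF F sg h(1) g] map_emb_mult[OF F sg q(1) minpoly_props(1)] q(2) by simp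
 hence "poly (map_poly sg ?h) z - poly (map_poly sg g) z = 0"
 using z by (metis mult_zero_right poly_diff poly_mult)
 thus ?thesis using mem by (simp add: tu_def)
 qed
 have "tu : Emb ?E" unfolding embeddings_def
 proof (intro CollectI conjI ballI)
 show "tu : extensional ?E" by (simp add: tu_def)
 show "tu 1 = 1" using tu[OF poly_over_1[OF F]]
 by (simp add: one_pCons map_poly_pCons emb_1[OF F sg] emb_0[OF F sg])
 fix x y assume "x : ?E" "y : ?E"
 then obtain g h where gh: "poly_over F g" "x = poly g bt" "poly_over F h" "y = poly h bt"
 unfolding adjoin_def by blast
 show "tu (x + y) = tu x + tu y"
 using tu[OF gh(1)] tu[OF gh(3)] tu[OF poly_over_add[OF F gh(1,3)]] gh map_emb_add[OF F sg gh(1,3)] by simp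
 show "tu (x * y) = tu x * tu y"
 using tu[OF gh(1)] tu[OF gh(3)] tu[OF poly_over_mult[OF F gh(1,3)]] gh map_emb_mult[OF F sg gh(1,3)] by simp
 qed
 moreover have "restrict tu F = sg"
 proof
 fix x show "restrict tu F x = sg x"
 proof (cases "x : F")
 case True
 have "poly (map_poly sg [:x:]) z = sg x"
 by (cases "x = 0") (auto simp: map_poly_pCons emb_0[OF F sg])
 with tu[OF poly_over_const[OF F True]] True show ?thesis by simp
 next
 case False thus ?thesis using embeddingsD(4)[OF sg] by (simp add: extensional_def)
 qed
 qed
 moreover have "tu bt = z" using tu[OF poly_over_X[OF F]]
 by (simp add: map_poly_pCons emb_0[OF F sg] emb_1[OF F sg])
 ultimately show ?thesis using that by blast
qed

lemma emb_adjoin_bij: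
 assumes E: "is_subfield (adjoin F bt)"
 shows "bij_betw (%tu. tu bt) {tu : Emb (adjoin F bt). restrict tu F = sg} {z. poly (map_poly sg m) z = 0}"
proof (rule bij_betwI')
 let ?E = "adjoin F bt"
 have eval: "tu (poly g bt) = poly (map_poly sg g) (tu bt)"
 if tu: "tu : Emb ?E" "restrict tu F = sg" and g: "poly_over F g" for tu g
 proof -
 have gE: "poly_over ?E g" using g adjoin_base[OF F] unfolding poly_over_def by blast
 have "map_poly tu g = map_poly sg g"
 by (intro poly_eqI) (use g that(2) in "auto simp: coeff_map_emb[OF E tu(1)] coeff_map_emb[OF F sg] poly_over_def")
 thus ?thesis using emb_poly[OF E tu(1) gE adjoin_gen[OF F]] by simp
 qed
 fix tu tu' assume t: "tu : {tu : Emb ?E. restrict tu F = sg}" "tu' : {tu : Emb ?E. restrict tu F = sg}"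
 show "(tu bt = tu' bt) = (tu = tu')"
 proof
 assume b: "tu bt = tu' bt"
 show "tu = tu'"
 proof
 fix x show "tu x = tu' x"
 proof (cases "x : ?E")
 case True
 then obtain g where "poly_over F g" "x = poly g bt" unfolding adjoin_def by blast
 thus ?thesis using eval[of tu g] eval[of tu' g] t b by auto
 next
 case False
 have "tu : extensional ?E" "tu' : extensional ?E" using t by (auto dest: embeddingsD(4))
 thus ?thesis using False by (simp add: extensional_def)
 qed
 qed
 qed simp
next
 fix tu assume t: "tu : {tu : Emb (adjoin F bt). restrict tu F = sg}"
 let ?E = "adjoin F bt"
 have tu: "tu : Emb ?E" "restrict tu F = sg" using t by auto
 have gE: "poly_over ?E m" using minpoly_props adjoin_base[OF F] unfolding poly_over_def by blast
 have "map_poly tu m = map_poly sg m"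
 by (intro poly_eqI) (use minpoly_props(1) tu(2) in "auto simp: coeff_map_emb[OF E tu(1)] coeff_map_emb[OF F sg] poly_over_def")
 thus "tu bt : {z. poly (map_poly sg m) z = 0}"
 using emb_poly[OF E tu(1) gE adjoin_gen[OF F]] minpoly_props emb_0[OF E tu(1)] by simp
next
 fix z assume "z : {z. poly (map_poly sg m) z = 0}"
 then obtain tu where "tu : Emb (adjoin F bt)" "restrict tu F = sg" "tu bt = z"
 using emb_adjoin_extend[OF E, of z] by auto
 thus "EX tu:{tu : Emb (adjoin F bt). restrict tu F = sg}. z = tu bt" by auto
qed

end
end

section \<open>Bases as finite families\<close>

lemma field_kernel:
 fixes A :: "nat => nat => 'f::field"
 assumes "n < m"
 obtains c where "EX i<m. c i ~= 0" "!!j. j < n ==> (\<Sum>i<m. c i * A i j) = 0"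
proof -
 \<comment> \<open>Zero columns pad the coefficients to a square matrix. Column n is one of them
   because n < m, so the determinant vanishes.\<close>
 define C where "C = mat m m (%(i, j). if j < n then A i j else 0)"
 have C: "C : carrier_mat m m" by (simp add: C_def)
 have "C *\<^sub>v unit_vec m n = 0\<^sub>v m"
 using assms by (intro eq_vecI) (auto simp: C_def)
 moreover have "unit_vec m n ~= (0\<^sub>v m :: 'f vec)" using assms by (simp add: unit_vec_nonzero)
 ultimately have "det C = 0" using det_0_iff_vec_prod_zero[OF C] by (metis unit_vec_carrier)
 hence "det (transpose_mat C) = 0" using det_transpose[OF C] by simp
 then obtain v where v: "v : carrier_vec m" "v ~= 0\<^sub>v m" "transpose_mat C *\<^sub>v v = 0\<^sub>v m"
 using det_0_iff_vec_prod_zero[of "transpose_mat C" m] C by auto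
 have "EX i<m. v $ i ~= 0" using v(1,2) by (metis carrier_vecD eq_vecI index_zero_vec(1) index_zero_vec(2))
 moreover have "(\<Sum>i<m. v $ i * A i j) = 0" if "j < n" for j
 proof -
 have "0 = (transpose_mat C *\<^sub>v v) $ j" using v(3) that assms by simp
 also have "... = (\<Sum>i<m. v $ i * A i j)" using v(1) that assms
 by (auto simp: C_def scalar_prod_def lessThan_atLeast0 mult.commute intro!: sum.cong)
 finally show ?thesis by simp
 qed
 ultimately show ?thesis using that by blast
qed

text \<open>The indexed form of \<open>is_basis\<close>. Families allow plain coefficient functions
  on indices instead of extensional functions on a set, and they serve directly as columns of
  matrices.\<close>

definition fam_basis :: "'a::field_char_0 set => 'a set => nat => (nat => 'a) => bool" where
 "fam_basis R M n b \<longleftrightarrow> (ALL i<n. b i : M) &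
 (ALL x:M. EX c. (ALL i<n. c i : R) & x = (\<Sum>i<n. c i * b i)) &
 (ALL c. (ALL i<n. c i : R) --> (\<Sum>i<n. c i * b i) = 0 --> (ALL i<n. c i = 0))"

lemma fam_basis_indep:
 "fam_basis R M n b ==> ALL i<n. c i : R ==> (\<Sum>i<n. c i * b i) = 0 ==> i < n ==> c i = 0"
 unfolding fam_basis_def by blast

text \<open>With h = \<open>of_rat\<close> or h = \<open>of_int\<close>, coefficients get the type
  rat or int instead of lying in a subset of the ambient field.\<close>

lemma fam_basis_range:
 fixes h :: "'s::zero => 'a::field_char_0"
 assumes R: "R = range h" and h: "!!x. h x = 0 \<longleftrightarrow> x = 0"
 shows "fam_basis R M n b \<longleftrightarrow> (ALL i<n. b i : M) & (ALL x:M. EX c. x = (\<Sum>i<n. h (c i) * b i)) &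
 (ALL c. (\<Sum>i<n. h (c i) * b i) = 0 --> (ALL i<n. c i = 0))"
proof -
 have lift: "EX c'. ALL i<n. c i = h (c' i)" if "ALL i<n. c i : R" for c
 using that unfolding R by (intro exI[of _ "%i. inv_into UNIV h (c i)"]) (auto simp: f_inv_into_f)
 have 1: "(EX c. (ALL i<n. c i : R) & x = (\<Sum>i<n. c i * b i)) \<longleftrightarrow> (EX c. x = (\<Sum>i<n. h (c i) * b i))" for x
 proof
 assume "EX c. (ALL i<n. c i : R) & x = (\<Sum>i<n. c i * b i)"
 then obtain c c' where "x = (\<Sum>i<n. c i * b i)" "ALL i<n. c i = h (c' i)" using lift by blast
 thus "EX c. x = (\<Sum>i<n. h (c i) * b i)" by (auto intro!: exI[of _ c'])
 next
 assume "EX c. x = (\<Sum>i<n. h (c i) * b i)"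
 then obtain c where "x = (\<Sum>i<n. h (c i) * b i)" by blast
 thus "EX c. (ALL i<n. c i : R) & x = (\<Sum>i<n. c i * b i)"
 by (intro exI[of _ "%i. h (c i)"]) (auto simp: R)
 qed
 have 2: "(ALL c. (ALL i<n. c i : R) --> (\<Sum>i<n. c i * b i) = 0 --> (ALL i<n. c i = 0)) \<longleftrightarrow>
 (ALL c. (\<Sum>i<n. h (c i) * b i) = 0 --> (ALL i<n. c i = 0))" (is "?A \<longleftrightarrow> ?B")
 proof
 assume ?A show ?B
 proof (intro allI impI)
 fix c i assume "(\<Sum>i<n. h (c i) * b i) = 0" "i < n"
 with \<open>?A\<close>[rule_format, of "%i. h (c i)" i] h R show "c i = 0" by auto
 qed
 next
 assume ?B show ?A
 proof (intro allI impI)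
 fix c i assume c: "ALL i<n. c i : R" "(\<Sum>i<n. c i * b i) = 0" "i < n"
 obtain c' where "ALL i<n. c i = h (c' i)" using lift c by blast
 with c \<open>?B\<close>[rule_format, of c' i] h show "c i = 0" by auto
 qed
 qed
 show ?thesis unfolding fam_basis_def using 1 2 by simp
qed

lemma fam_basis_rat: "fam_basis \<rat> M n b \<longleftrightarrow> (ALL i<n. b i : M) &
 (ALL x:M. EX c::nat=>rat. x = (\<Sum>i<n. of_rat (c i) * b i)) &
 (ALL c::nat=>rat. (\<Sum>i<n. of_rat (c i) * b i) = 0 --> (ALL i<n. c i = 0))"
 by (rule fam_basis_range) (auto simp: Rats_def)

lemma fam_basis_rat_indep:
 "fam_basis \<rat> M n b ==> (\<Sum>i<n. of_rat (c i) * b i) = 0 ==> i < n ==> c i = 0"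
 unfolding fam_basis_rat by blast

lemma fam_basis_int: "fam_basis \<int> M n b \<longleftrightarrow> (ALL i<n. b i : M) &
 (ALL x:M. EX c::nat=>int. x = (\<Sum>i<n. of_int (c i) * b i)) &
 (ALL c::nat=>int. (\<Sum>i<n. of_int (c i) * b i) = 0 --> (ALL i<n. c i = 0))"
 by (rule fam_basis_range) (auto simp: Ints_def)

lemma is_basis_imp_family:
 assumes B: "is_basis R M B" and b: "bij_betw b {..<n} B" and 0: "0 : R" "0 : M"
 shows "fam_basis R M n b"
proof -
 have re: "(SUM v:B. f v * v) = (\<Sum>i<n. f (b i) * b i)" for f
 using sum.reindex_bij_betw[OF b, of "%v. f v * v"] by simp
 have bB: "b i : B" if "i < n" for i using b that by (auto simp: bij_betw_def)
 show ?thesis unfolding fam_basis_def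
 proof (intro conjI allI impI ballI)
 fix i assume "i < n" thus "b i : M" using bB B unfolding is_basis_def by blast
 next
 fix x assume "x : M"
 then obtain c where "c : B \<rightarrow>\<^sub>E R" "x = (SUM v:B. c v * v)" using B unfolding is_basis_def by blast
 thus "EX c. (ALL i<n. c i : R) & x = (\<Sum>i<n. c i * b i)"
 using bB by (intro exI[of _ "%i. c (b i)"]) (auto simp: re)
 next
 fix c i assume c: "ALL i<n. c i : R" "(\<Sum>i<n. c i * b i) = 0" and i: "i < n"
 define e where "e = restrict (%v. c (inv_into {..<n} b v)) B"
 have inv: "inv_into {..<n} b (b j) = j" if "j < n" for j
 using b that by (simp add: bij_betw_def)
 have invB: "inv_into {..<n} b v < n" if "v : B" for v
 using b that by (metis bij_betw_imp_surj_on inv_into_into lessThan_iff)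
 have eb: "e (b j) = c j" if "j < n" for j using that bB inv by (simp add: e_def)
 have "e : B \<rightarrow>\<^sub>E R" using c invB by (auto simp: e_def)
 moreover have "0 = (SUM v:B. e v * v)" using c(2) eb by (simp add: re)
 moreover have "restrict (%_. 0) B : B \<rightarrow>\<^sub>E R" "0 = (SUM v:B. restrict (%_. 0) B v * v)"
 using 0 by (auto simp: re bB)
 moreover have "\<exists>!c. c : B \<rightarrow>\<^sub>E R & 0 = (SUM v:B. c v * v)" using B 0 unfolding is_basis_def by blast
 ultimately have "e = restrict (%_. 0) B" by blast
 thus "c i = 0" using eb[OF i] bB[OF i] by simp
 qed
qed

lemma family_imp_is_basis:
 assumes b: "fam_basis R M n b" and R: "!!x y. x : R ==> y : R ==> x - y : R" "1 : R"
 shows "is_basis R M (b ` {..<n})" "inj_on b {..<n}"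
proof -
 have R0: "0 : R" using R(1)[OF R(2) R(2)] by simp
 have Rm: "-1 : R" using R(1)[OF R0 R(2)] by simp
 show inj: "inj_on b {..<n}"
 proof (rule inj_onI, rule ccontr)
 fix i j assume ij: "i : {..<n}" "j : {..<n}" "b i = b j" "i ~= j"
 define c where "c = (%k. if k = i then 1 else if k = j then - 1 else (0::'a))"
 have "(\<Sum>k<n. c k * b k) = (SUM k:{i, j}. c k * b k)"
 by (rule sum.mono_neutral_right) (use ij in "auto simp: c_def")
 also have "... = 0" using ij by (simp add: c_def)
 finally have "(\<Sum>k<n. c k * b k) = 0" .
 moreover have "ALL k<n. c k : R" using R R0 Rm by (auto simp: c_def)
 ultimately have "ALL k<n. c k = 0" using b unfolding fam_basis_def by blast
 thus False using ij by (auto simp: c_def)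
 qed
 have re: "(SUM v:b ` {..<n}. f v * v) = (\<Sum>i<n. f (b i) * b i)" for f
 using sum.reindex[OF inj, of "%v. f v * v"] by simp
 show "is_basis R M (b ` {..<n})" unfolding is_basis_def
 proof (intro conjI ballI)
 show "b ` {..<n} <= M" using b unfolding fam_basis_def by auto
 fix x assume x: "x : M"
 then obtain c where c: "ALL i<n. c i : R" "x = (\<Sum>i<n. c i * b i)"
 using b unfolding fam_basis_def by blast
 define e where "e = restrict (%v. c (inv_into {..<n} b v)) (b ` {..<n})"
 have eb: "e (b j) = c j" if "j < n" for j using that inj by (simp add: e_def)
 show "\<exists>!e. e : b ` {..<n} \<rightarrow>\<^sub>E R & x = (SUM v:b ` {..<n}. e v * v)"
 proof (rule ex1I[of _ e])
 have "e : b ` {..<n} \<rightarrow>\<^sub>E R"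
 proof
 fix v assume "v : b ` {..<n}" thus "e v : R" using eb c by auto
 qed (simp add: e_def)
 thus "e : b ` {..<n} \<rightarrow>\<^sub>E R & x = (SUM v:b ` {..<n}. e v * v)"
 using c eb by (simp add: re)
 fix f assume f: "f : b ` {..<n} \<rightarrow>\<^sub>E R & x = (SUM v:b ` {..<n}. f v * v)"
 have s0: "(\<Sum>i<n. (f (b i) - c i) * b i) = 0"
 using f c(2) by (simp add: re left_diff_distrib sum_subtractf)
 have r0: "ALL i<n. f (b i) - c i : R" using f c R by (auto simp: PiE_iff)
 have fc: "ALL i<n. f (b i) = c i" using fam_basis_indep[OF b r0 s0] by (metis right_minus_eq)
 show "f = e"
 proof
 fix v show "f v = e v"
 proof (cases "v : b ` {..<n}")
 case True thus ?thesis using fc eb by auto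
 next
 case False thus ?thesis using f by (auto simp: e_def PiE_iff extensional_def)
 qed
 qed
 qed
 qed simp
qed

lemma rat_dependent:
 fixes a b :: "nat => 'a::field_char_0"
 assumes "n < m" and a: "!!i. i < m ==> EX c::nat=>rat. a i = (\<Sum>j<n. of_rat (c j) * b j)"
 obtains c :: "nat => rat" where "EX i<m. c i ~= 0" "(\<Sum>i<m. of_rat (c i) * a i) = 0"
proof -
 obtain P :: "nat => nat => rat" where P: "!!i. i < m ==> a i = (\<Sum>j<n. of_rat (P i j) * b j)"
 using a by metis
 obtain c where c: "EX i<m. c i ~= 0" "!!j. j < n ==> (\<Sum>i<m. c i * P i j) = 0"
 using field_kernel[OF assms(1), of P] by blast
 have "(\<Sum>i<m. of_rat (c i) * a i) = (\<Sum>i<m. \<Sum>j<n. of_rat (c i * P i j) * b j)"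
 by (simp add: P sum_distrib_left of_rat_mult mult.assoc)
 also have "... = (\<Sum>j<n. of_rat (\<Sum>i<m. c i * P i j) * b j)"
 by (subst sum.swap) (simp add: of_rat_sum sum_distrib_right)
 also have "... = 0" by (simp add: c)
 finally show ?thesis using that c by blast
qed

lemma fam_basis_card_le:
 assumes "fam_basis \<rat> K n b" "!!i. i < m ==> a i : K"
 and "ALL c::nat=>rat. (\<Sum>i<m. of_rat (c i) * a i) = 0 --> (ALL i<m. c i = 0)"
 shows "m <= n"
proof (rule ccontr)
 assume "~ m <= n"
 hence nm: "n < m" by simp
 have ex: "!!i. i < m ==> EX c::nat=>rat. a i = (\<Sum>j<n. of_rat (c j) * b j)"
 using assms(1,2) unfolding fam_basis_rat by blast
 from rat_dependent[OF nm, of a b, OF ex] obtain c :: "nat => rat"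
 where "EX i<m. c i ~= 0" "(\<Sum>i<m. of_rat (c i) * a i) = 0" by blast
 thus False using assms(3) by blast
qed

lemma fam_basis_unique: "fam_basis \<rat> K n b ==> fam_basis \<rat> K m a ==> n = m"
 by (rule antisym; rule fam_basis_card_le) (auto simp: fam_basis_rat)

lemma number_field_basis:
 assumes "number_field K" obtains n b where "fam_basis \<rat> K n b"
proof -
 obtain B where B: "is_basis \<rat> K B" "is_subfield K" using assms unfolding number_field_def by blast
 then obtain b where "bij_betw b {..<card B} B"
 using ex_bij_betw_nat_finite[of B] unfolding is_basis_def by (auto simp: lessThan_atLeast0)
 from is_basis_imp_family[OF B(1) this] show ?thesis using that subfield_0[OF B(2)] by auto
qed

lemma number_fieldI: "is_subfield K ==> fam_basis \<rat> K n b ==> number_field K"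
 using family_imp_is_basis[of \<rat> K n b] unfolding number_field_def by (auto intro: Rats_diff)

lemma number_field_subfield: "number_field K ==> is_subfield K"
 unfolding number_field_def by blast

lemma ext_degree_eq:
 assumes K: "is_subfield K" and b: "fam_basis \<rat> K n b"
 shows "ext_degree \<rat> K = n"
 unfolding ext_degree_def
proof (rule the_equality)
 have "is_basis \<rat> K (b ` {..<n})" "card (b ` {..<n}) = n"
 using family_imp_is_basis[OF b] by (auto simp: card_image)
 thus "EX B. is_basis \<rat> K B & card B = n" by blast
 fix k assume "EX B. is_basis \<rat> K B & card B = k"
 then obtain B where B: "is_basis \<rat> K B" "card B = k" by blast
 obtain a where "bij_betw a {..<card B} B"
 using B ex_bij_betw_nat_finite[of B] unfolding is_basis_def by (auto simp: lessThan_atLeast0)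
 from is_basis_imp_family[OF B(1) this] have "fam_basis \<rat> K k a" using B subfield_0[OF K] by auto
 thus "k = n" using fam_basis_unique[OF _ b] by blast
qed

text \<open>Rationally independent families in F are at most as long as a basis of K, so a longest
  one exists. Adding any x makes it dependent, so it spans F.\<close>

lemma subfield_number_field:
 assumes K: "number_field K" and F: "is_subfield F" "F <= K"
 shows "number_field F"
proof -
 obtain d b where b: "fam_basis \<rat> K d b" using number_field_basis[OF K] by blast
 define P where "P = (%n. EX a. (ALL i<n. a i : F) &
 (ALL c::nat=>rat. (\<Sum>i<n. of_rat (c i) * a i) = 0 --> (ALL i<n. c i = 0)))"
 have "P 0" by (simp add: P_def)
 have bd: "n <= d" if "P n" for n
 proof -
 obtain a where a: "ALL i<n. a i : F"
 "ALL c::nat=>rat. (\<Sum>i<n. of_rat (c i) * a i) = 0 --> (ALL i<n. c i = 0)"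
 using \<open>P n\<close> unfolding P_def by blast
 show ?thesis by (rule fam_basis_card_le[OF b _ a(2)]) (use a(1) F in auto)
 qed
 define n where "n = Greatest P"
 have n: "P n" unfolding n_def by (rule GreatestI_nat[of P 0 d]) (use \<open>P 0\<close> bd in auto)
 have max: "k <= n" if "P k" for k unfolding n_def by (rule Greatest_le_nat[of P k d]) (use that bd in auto)
 obtain a where a: "ALL i<n. a i : F"
 "ALL c::nat=>rat. (\<Sum>i<n. of_rat (c i) * a i) = 0 --> (ALL i<n. c i = 0)"
 using n unfolding P_def by blast
 have "fam_basis \<rat> F n a" unfolding fam_basis_rat
 proof (intro conjI ballI)
 fix x assume x: "x : F"
 have "~ P (Suc n)" using max[of "Suc n"] by auto
 moreover have "ALL i<Suc n. (a(n := x)) i : F" using a x by auto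
 ultimately have "~ (ALL c::nat=>rat. (\<Sum>i<Suc n. of_rat (c i) * (a(n := x)) i) = 0 --> (ALL i<Suc n. c i = 0))"
 unfolding P_def by blast
 then obtain c :: "nat => rat" and i where c: "(\<Sum>i<Suc n. of_rat (c i) * (a(n := x)) i) = 0"
 "i < Suc n" "c i ~= 0" by blast
 have eq: "(\<Sum>i<n. of_rat (c i) * a i) + of_rat (c n) * x = 0" using c(1) by simp
 have "c n ~= 0"
 proof
 assume "c n = 0"
 with eq a(2) have "ALL i<n. c i = 0" by auto
 with c(2,3) \<open>c n = 0\<close> show False by (auto simp: less_Suc_eq)
 qed
 have "x = (\<Sum>i<n. of_rat (- c i / c n) * a i)"
 proof -
 have "of_rat (c n) * (\<Sum>i<n. of_rat (- c i / c n) * a i) = - (\<Sum>i<n. of_rat (c i) * a i)"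
 using \<open>c n ~= 0\<close> by (simp add: sum_distrib_left of_rat_divide of_rat_minus flip: sum_negf)
 also have "... = of_rat (c n) * x" using eq by (simp add: eq_neg_iff_add_eq_0 add.commute neg_eq_iff_add_eq_0)
 finally show ?thesis using \<open>c n ~= 0\<close> by simp
 qed
 thus "EX c::nat=>rat. x = (\<Sum>i<n. of_rat (c i) * a i)" by (intro exI[of _ "%i. - c i / c n"])
 qed (use a in auto)
 thus ?thesis using number_fieldI F by blast
qed

lemma fam_basis_pos:
 assumes "is_subfield K" "fam_basis \<rat> K n b" shows "n > 0"
proof (rule ccontr)
 assume "~ n > 0"
 thus False using assms subfield_1[OF assms(1)] unfolding fam_basis_rat by auto
qed

lemma fam_basis_nonzero:
 assumes "fam_basis \<rat> K n b" "i < n" shows "b i ~= 0"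
proof
 assume b0: "b i = 0"
 have "(\<Sum>j<n. of_rat (if j = i then 1 else 0) * b j) = 0"
 by (rule sum.neutral) (use b0 in auto)
 from fam_basis_rat_indep[OF assms(1) this assms(2)] show False by simp
qed

text \<open>Multiplication by x has a rational matrix in a basis, and x is an eigenvalue of this
  matrix.\<close>

lemma number_field_algebraic:
 assumes K: "number_field K" and x: "x : K"
 shows "algebraic x"
proof -
 note sf = number_field_subfield[OF K]
 obtain n b where b: "fam_basis \<rat> K n b" using number_field_basis[OF K] by blast
 have n: "0 < n" using fam_basis_pos[OF sf b] .
 have "ALL i. EX c::nat=>rat. i < n --> x * b i = (\<Sum>j<n. of_rat (c j) * b j)"
 proof (intro allI)
 fix i
 have "x * b i : K" if "i < n" using b x subfield_mult[OF sf] that unfolding fam_basis_rat by blast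
 thus "EX c::nat=>rat. i < n --> x * b i = (\<Sum>j<n. of_rat (c j) * b j)"
 using b unfolding fam_basis_rat by blast
 qed
 then obtain A :: "nat => nat => rat" where "!!i. i < n ==> x * b i = (\<Sum>j<n. of_rat (A i j) * b j)"
 by metis
 from rat_poly_eigenE[OF n fam_basis_nonzero[OF b n] this] obtain p :: "rat poly" where
 "p ~= 0" "poly (map_poly of_rat p) x = 0" by blast
 thus ?thesis unfolding algebraic_altdef
 by (intro exI[of _ "map_poly of_rat p"]) (auto simp: coeff_map_poly)
qed

lemma adjoin_subfield':
 assumes K: "number_field K" and F: "is_subfield F" "F <= K" and "bt : K"
 shows "is_subfield (adjoin F bt)" "adjoin F bt <= K"
proof -
 show sub: "adjoin F bt <= K" using adjoin_minimal[OF number_field_subfield[OF K] F(2) assms(4)] .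
 show "is_subfield (adjoin F bt)"
 by (rule adjoin_subfield[OF F(1)]) (use sub number_field_algebraic[OF K] in auto)
qed

section \<open>The tower law and the number of embeddings\<close>

lemma sum_div_mod:
 fixes f :: "nat => nat => 'b::comm_monoid_add"
 assumes "n > 0"
 shows "(\<Sum>k<n * e. f (k div n) (k mod n)) = (\<Sum>i<e. \<Sum>j<n. f i j)"
proof -
 have lt: "i * n + j < n * e" if "i < e" "j < n" for i j
 proof -
 have "i * n + j < (i + 1) * n" using that by simp
 also have "... <= e * n" using that by (intro mult_right_mono) auto
 finally show ?thesis by (simp add: mult.commute)
 qed
 have "(\<Sum>i<e. \<Sum>j<n. f i j) = (\<Sum>(i, j)\<in>{..<e} \<times> {..<n}. f i j)"
 by (simp add: sum.cartesian_product)
 also have "... = (\<Sum>k<n * e. f (k div n) (k mod n))"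
 by (rule sum.reindex_bij_witness[of _ "%k. (k div n, k mod n)" "%(i, j). i * n + j"])
 (use assms lt in "auto simp: less_mult_imp_div_less mult.commute")
 finally show ?thesis by simp
qed

text \<open>An element of F(bt) is a polynomial in bt of degree below that of m, whose coefficients
  are expanded in the basis of F. The index k stands for the exponent k div n and the basis index k
  mod n.\<close>

lemma adjoin_basis:
 assumes F: "is_subfield F" and b: "fam_basis \<rat> F n b" and m: "minpoly_over F bt m"
 shows "fam_basis \<rat> (adjoin F bt) (n * degree m) (%k. b (k mod n) * bt ^ (k div n))"
proof -
 define e where "e = degree m"
 have n: "n > 0" by (rule fam_basis_pos[OF F b])
 have e: "e > 0" using minpoly_degree_pos[OF F m] e_def by simp
 have resum: "(\<Sum>k<n * e. of_rat (c k) * (b (k mod n) * bt ^ (k div n))) =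
 (\<Sum>i<e. (\<Sum>j<n. of_rat (c (i * n + j)) * b j) * bt ^ i)" for c :: "nat => rat"
 using sum_div_mod[OF n, of "%i j. of_rat (c (i * n + j)) * (b j * bt ^ i)" e]
 by (simp add: sum_distrib_right mult.assoc)
 show ?thesis unfolding fam_basis_rat e_def[symmetric]
 proof (intro conjI allI impI ballI)
 fix k assume "k < n * e"
 have "b (k mod n) : F" using b n unfolding fam_basis_rat by simp
 hence "b (k mod n) : adjoin F bt" using subsetD[OF adjoin_base[OF F]] by blast
 moreover have "bt ^ i : adjoin F bt" for i
 using adjoin_gen[OF F] adjoin_closed(3)[OF F] subsetD[OF adjoin_base[OF F] subfield_1[OF F]]
 by (induction i) simp_all
 ultimately show "b (k mod n) * bt ^ (k div n) : adjoin F bt" using adjoin_closed[OF F] by blast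
 next
 fix x assume "x : adjoin F bt"
 then obtain g where g: "poly_over F g" "degree g < e" "x = poly g bt"
 using adjoin_reduced[OF F m] e_def by metis
 have "EX c::nat=>rat. coeff g i = (\<Sum>j<n. of_rat (c j) * b j)" for i
 using g(1) b unfolding fam_basis_rat poly_over_def by blast
 then obtain C :: "nat => nat => rat" where C: "!!i. coeff g i = (\<Sum>j<n. of_rat (C i j) * b j)" by metis
 have "x = (\<Sum>i<e. coeff g i * bt ^ i)" unfolding g(3) poly_altdef
 by (rule sum.mono_neutral_left) (use g(2) in "auto simp: coeff_eq_0")
 also have "... = (\<Sum>k<n * e. of_rat (C (k div n) (k mod n)) * (b (k mod n) * bt ^ (k div n)))"
 unfolding resum by (intro sum.cong) (auto simp: C)
 finally show "EX c::nat=>rat. x = (\<Sum>k<n * e. of_rat (c k) * (b (k mod n) * bt ^ (k div n)))"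
 by (intro exI[of _ "%k. C (k div n) (k mod n)"])
 next
 fix c :: "nat => rat" and k
 assume z: "(\<Sum>k<n * e. of_rat (c k) * (b (k mod n) * bt ^ (k div n))) = 0" and k: "k < n * e"
 define f where "f = (%i. \<Sum>j<n. of_rat (c (i * n + j)) * b j)"
 define g where "g = (\<Sum>i<e. monom (f i) i)"
 have fF: "f i : F" for i unfolding f_def
 using b by (auto intro!: subfield_sum[OF F] subfield_mult[OF F] subfield_of_rat[OF F] simp: fam_basis_rat)
 have cg: "coeff g i = (if i < e then f i else 0)" for i
 by (simp add: g_def coeff_sum)
 have "poly_over F g" using fF subfield_0[OF F] by (simp add: poly_over_def cg)
 moreover have "degree g < degree m"
 proof (cases "g = 0")
 case False
 hence "coeff g (degree g) ~= 0" by simp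
 thus ?thesis using cg[of "degree g"] e_def by (auto split: if_splits)
 qed (use e e_def in simp)
 moreover have "poly g bt = 0" using z unfolding resum by (simp add: g_def poly_sum poly_monom f_def)
 ultimately have "g = 0" using minpoly_min[OF F m] by blast
 hence f0: "f i = 0" if "i < e" for i using cg[of i] that by simp
 have kd: "k div n < e" "k mod n < n" using k n by (auto simp: less_mult_imp_div_less mult.commute)
 have "(\<Sum>j<n. of_rat (c (k div n * n + j)) * b j) = 0" using f0[OF kd(1)] unfolding f_def .
 from fam_basis_rat_indep[OF b this kd(2)] show "c k = 0" by simp
 qed
qed

text \<open>K arises from F0 by adjoining the members of a basis one at a time, so a property that
  survives simple extensions passes from F0 to K.\<close>

lemma subfield_tower_induct:
 assumes K: "number_field K" and F0: "is_subfield F0" "F0 <= K" "P F0"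
 and step: "!!F bt. is_subfield F ==> F0 <= F ==> F <= K ==> bt : K ==> P F ==> P (adjoin F bt)"
 shows "P K"
proof -
 obtain n b where b: "fam_basis \<rat> K n b" using number_field_basis[OF K] by blast
 have "j <= n ==> EX F. is_subfield F & F0 <= F & F <= K & (ALL i<j. b i : F) & P F" for j
 proof (induction j)
 case 0 thus ?case using F0 by auto
 next
 case (Suc j)
 then obtain F where F: "is_subfield F" "F0 <= F" "F <= K" "ALL i<j. b i : F" "P F" by auto
 have bj: "b j : K" using b Suc.prems unfolding fam_basis_rat by auto
 have "F <= adjoin F (b j)" "b j : adjoin F (b j)" using adjoin_base[OF F(1)] adjoin_gen[OF F(1)] by auto
 hence "F0 <= adjoin F (b j)" "ALL i<Suc j. b i : adjoin F (b j)" using F(2,4) by (auto simp: less_Suc_eq)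
 thus ?case
 using adjoin_subfield'[OF K F(1,3) bj] step[OF F(1,2,3) bj F(5)] by blast
 qed
 from this[of n] obtain F where F: "is_subfield F" "F <= K" "ALL i<n. b i : F" "P F" by auto
 have "K <= F"
 proof
 fix x assume "x : K"
 then obtain c :: "nat => rat" where "x = (\<Sum>i<n. of_rat (c i) * b i)" using b unfolding fam_basis_rat by blast
 thus "x : F" using F by (auto intro!: subfield_sum subfield_mult subfield_of_rat)
 qed
 hence "F = K" using F by auto
 thus ?thesis using F by simp
qed

lemma restrict_embedding:
 assumes "tu : Emb K" "F <= K" "is_subfield F"
 shows "restrict tu F : Emb F"
 using assms(1) subsetD[OF assms(2)] subfield_add[OF assms(3)] subfield_mult[OF assms(3)] subfield_1[OF assms(3)]
 unfolding embeddings_def by simp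

lemma embeddings_Rats: "EX sg. Emb (\<rat> :: 'a::field_char_0 set) = {sg}"
proof -
 define h where "h = (%x::'a. THE q. x = of_rat q)"
 have h: "h (of_rat q) = q" for q unfolding h_def by (rule the_equality) auto
 define sg where "sg = restrict (%x. complex_of_real (of_rat (h x))) (\<rat> :: 'a set)"
 have s: "sg (of_rat q) = of_real (of_rat q)" for q by (simp add: sg_def h)
 have mem: "sg : embeddings \<rat>" unfolding embeddings_def
 proof (intro CollectI conjI ballI)
 show "sg : extensional \<rat>" by (simp add: sg_def)
 show "sg 1 = 1" using s[of 1] by simp
 fix x y :: 'a assume "x : \<rat>" "y : \<rat>"
 then obtain p q where "x = of_rat p" "y = of_rat q" by (auto elim!: Rats_cases)
 thus "sg (x + y) = sg x + sg y" "sg (x * y) = sg x * sg y"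
 using s[of "p + q"] s[of "p * q"] by (simp_all add: s of_rat_add of_rat_mult)
 qed
 have uniq: "tu = sg" if t: "tu : embeddings \<rat>" for tu
 proof
 fix x show "tu x = sg x"
 proof (cases "x : \<rat>")
 case True
 then obtain q where "x = of_rat q" by (auto elim!: Rats_cases)
 thus ?thesis using emb_of_rat[OF is_subfield_Rats t, of q]
 emb_of_rat[OF is_subfield_Rats mem, of q] by simp
 next
 case False
 have "tu : extensional \<rat>" "sg : extensional \<rat>" using t mem by (auto dest: embeddingsD(4))
 thus ?thesis using False by (simp add: extensional_def)
 qed
 qed
 have "embeddings \<rat> = {sg}" using mem uniq by blast
 thus ?thesis by blast
qed

lemma fam_basis_Rats_Rats: "fam_basis \<rat> \<rat> 1 (%_. 1)"
 unfolding fam_basis_rat by (auto elim!: Rats_cases)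

lemma card_fibres:
 assumes "finite B" "!!x. x : A ==> f x : B" "!!y. y : B ==> finite {x : A. f x = y} & card {x : A. f x = y} = e"
 shows "finite A" "card A = e * card B"
proof -
 have A: "A = (\<Union>y\<in>B. {x : A. f x = y})" using assms(2) by auto
 show "finite A" by (subst A) (use assms in auto)
 have "card A = (SUM y:B. card {x : A. f x = y})"
 by (subst A, rule card_UN_disjoint) (use assms in auto)
 thus "card A = e * card B" using assms(3) by simp
qed

lemma embeddings_adjoin_fibre:
 assumes F: "is_subfield F" and E: "is_subfield (adjoin F bt)" and m: "minpoly_over F bt m" and sg: "sg : Emb F"
 shows "finite {tu : Emb (adjoin F bt). restrict tu F = sg}"
 "card {tu : Emb (adjoin F bt). restrict tu F = sg} = degree m"
 using emb_adjoin_bij[OF F m sg E] emb_minpoly_split(2,3)[OF F m sg]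
 by (auto simp: bij_betw_finite bij_betw_same_card)

text \<open>Adjoining \<open>bt\<close> multiplies the degree and the number of embeddings by the
  same factor, the degree of the minimal polynomial. Both numbers are 1 for the rationals.\<close>

theorem embeddings_card:
 assumes K: "number_field K" and b: "fam_basis \<rat> K n b"
 shows "finite (Emb K)" "card (Emb K) = n"
proof -
 note sf = number_field_subfield[OF K]
 have "finite (Emb K) & (EX b. fam_basis \<rat> K (card (Emb K)) b)"
 proof (rule subfield_tower_induct[OF K is_subfield_Rats subfield_Rats[OF sf]])
 obtain sg :: "'a => complex" where "embeddings \<rat> = {sg}" using embeddings_Rats by blast
 thus "finite (Emb (\<rat>::'a set)) & (EX b. fam_basis \<rat> (\<rat>::'a set) (card (Emb (\<rat>::'a set))) b)"
 using fam_basis_Rats_Rats by auto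
 fix F bt assume F: "is_subfield F" "F <= K" "bt : K"
 and IH: "finite (Emb F) & (EX b. fam_basis \<rat> F (card (Emb F)) b)"
 note E = adjoin_subfield'[OF K F]
 obtain m where m: "minpoly_over F bt m" using minpoly_over_exists[OF F(1) number_field_algebraic[OF K F(3)]] by blast
 have "finite (Emb (adjoin F bt))" "card (Emb (adjoin F bt)) = degree m * card (Emb F)"
 using card_fibres[of "Emb F" "Emb (adjoin F bt)" "%tu. restrict tu F" "degree m"]
 IH restrict_embedding[OF _ adjoin_base[OF F(1)] F(1)] embeddings_adjoin_fibre[OF F(1) E(1) m] by auto
 thus "finite (Emb (adjoin F bt)) & (EX b. fam_basis \<rat> (adjoin F bt) (card (Emb (adjoin F bt))) b)"
 using adjoin_basis[OF F(1) _ m] IH by (metis mult.commute)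
 qed
 thus "finite (Emb K)" "card (Emb K) = n" using fam_basis_unique[OF _ b] by auto
qed

lemma embeddings_finite: "number_field K ==> finite (Emb K)"
 using embeddings_card number_field_basis by metis

lemma embeddings_card_pos: "number_field K ==> card (Emb K) > 0"
 using embeddings_card number_field_basis fam_basis_pos number_field_subfield by metis

lemma embeddings_card_degree: "number_field K ==> card (Emb K) = ext_degree \<rat> K"
 using embeddings_card number_field_basis ext_degree_eq number_field_subfield by metis

text \<open>The induction of \<open>embeddings_card\<close>, started at F instead of \<rat>.\<close>

theorem embeddings_fibre:
 assumes K: "number_field K" and F: "is_subfield F" "F <= K"
 obtains e where "e > 0" "!!sg. sg : Emb F ==> card {tu : Emb K. restrict tu F = sg} = e"
 "card (Emb K) = e * card (Emb F)"
proof -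
 have "EX e>0. ALL sg:Emb F. finite {tu : Emb K. restrict tu F = sg} & card {tu : Emb K. restrict tu F = sg} = e"
 proof (rule subfield_tower_induct[OF K F])
 have "{tu : Emb F. restrict tu F = sg} = {sg}" if "sg : Emb F" for sg
 proof -
 have "restrict tu F = tu" if "tu : Emb F" for tu
 using embeddingsD(4)[OF that] by (simp add: extensional_restrict)
 thus ?thesis using \<open>sg : Emb F\<close> by auto
 qed
 thus "EX e>0. ALL sg:Emb F. finite {tu : Emb F. restrict tu F = sg} & card {tu : Emb F. restrict tu F = sg} = e"
 by (intro exI[of _ 1]) auto
 fix G bt assume G: "is_subfield G" "F <= G" "G <= K" "bt : K"
 and IH: "EX e>0. ALL sg:Emb F. finite {tu : Emb G. restrict tu F = sg} & card {tu : Emb G. restrict tu F = sg} = e"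
 note E = adjoin_subfield'[OF K G(1,3,4)]
 obtain m where m: "minpoly_over G bt m" using minpoly_over_exists[OF G(1) number_field_algebraic[OF K G(4)]] by blast
 obtain e where e: "e > 0" "ALL sg:Emb F. finite {tu : Emb G. restrict tu F = sg} & card {tu : Emb G. restrict tu F = sg} = e"
 using IH by blast
 have rr: "restrict (restrict tu G) F = restrict tu F" for tu :: "'a => complex"
 using G(2) by (auto simp: restrict_def fun_eq_iff)
 show "EX e>0. ALL sg:Emb F. finite {tu : Emb (adjoin G bt). restrict tu F = sg} & card {tu : Emb (adjoin G bt). restrict tu F = sg} = e"
 proof (intro exI[of _ "degree m * e"] conjI ballI)
 show "0 < degree m * e" using e minpoly_degree_pos[OF G(1) m] by simp
 fix sg assume s: "sg : Emb F"
 let ?A = "{tu : Emb (adjoin G bt). restrict tu F = sg}" and ?B = "{tu : Emb G. restrict tu F = sg}"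
 have B: "finite ?B" "card ?B = e" using e s by auto
 have fib: "{tu : ?A. restrict tu G = \<theta>} = {tu : Emb (adjoin G bt). restrict tu G = \<theta>}" if "\<theta> : ?B" for \<theta>
 using that rr by auto
 have "tu : ?A ==> restrict tu G : ?B" for tu
 using restrict_embedding[OF _ adjoin_base[OF G(1)] G(1)] rr by auto
 moreover have "finite {tu : ?A. restrict tu G = \<theta>} & card {tu : ?A. restrict tu G = \<theta>} = degree m" if "\<theta> : ?B" for \<theta>
 unfolding fib[OF that] using embeddings_adjoin_fibre[OF G(1) E(1) m, of \<theta>] that by simp
 ultimately have "finite ?A" "card ?A = degree m * card ?B"
 using card_fibres[of ?B ?A "%tu. restrict tu G" "degree m"] B(1) by blast+
 thus "finite ?A" "card ?A = degree m * e" using B by auto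
 qed
 qed
 then obtain e where e: "e > 0" "!!sg. sg : Emb F ==> finite {tu : Emb K. restrict tu F = sg} & card {tu : Emb K. restrict tu F = sg} = e"
 by blast
 have "card (Emb K) = e * card (Emb F)"
 by (rule card_fibres(2)[of _ _ "%tu. restrict tu F"])
 (use e embeddings_finite[OF subfield_number_field[OF K F]] restrict_embedding[OF _ F(2,1)] in auto)
 with e show ?thesis using that by blast
qed

section \<open>Norms, integral bases and the discriminant\<close>

lemma fam_basis_rat_span:
 "fam_basis \<rat> M n b ==> x : M ==> EX c::nat=>rat. x = (\<Sum>i<n. of_rat (c i) * b i)"
 unfolding fam_basis_rat by blast

lemma fam_basis_mem: "fam_basis R M n b ==> i < n ==> b i : M"
 unfolding fam_basis_def by blast

text \<open>Subtracting \<open>s y\<close> times the relation at x from the relation at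
  \<open>y * x\<close> removes the embedding s. With y chosen to separate t from s, the shorter
  relation forces \<open>c t = 0\<close>.\<close>

lemma dedekind_independence:
 assumes K: "is_subfield K" and S: "finite S" "S <= Emb K"
 and z: "!!x. x : K ==> (SUM sg:S. c sg * sg x) = 0" and tu: "tu : S"
 shows "c tu = 0"
 using S z tu
proof (induction S arbitrary: c tu rule: finite_induct)
 case empty thus ?case by simp
next
 case (insert s S)
 have emb: "s : Emb K" "S <= Emb K" using insert.prems(1) by auto
 have zero: "c t = 0" if t: "t : S" for t
 proof -
 have "t ~= s" using t insert.hyps by auto
 have te: "t : Emb K" using t emb by auto
 obtain y where y: "y : K" "t y ~= s y"
 proof (rule ccontr)
 assume "~ thesis"
 hence eq: "!!y. y : K ==> t y = s y" using that by blast
 have "t = s"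
 using extensionalityI[OF embeddingsD(4)[OF te] embeddingsD(4)[OF emb(1)] eq] by simp
 with \<open>t ~= s\<close> show False by simp
 qed
 have "(SUM sg:S. (c sg * (sg y - s y)) * sg x) = 0" if x: "x : K" for x
 proof -
 have yx: "y * x : K" using subfield_mult[OF K y(1) x] .
 have "0 = (SUM sg:insert s S. c sg * sg (y * x)) - s y * (SUM sg:insert s S. c sg * sg x)"
 using insert.prems(2)[OF yx] insert.prems(2)[OF x] by simp
 also have "... = (SUM sg:insert s S. c sg * (sg y * sg x) - s y * (c sg * sg x))"
 unfolding sum_distrib_left sum_subtractf[symmetric]
 using insert.prems(1) embeddingsD(3)[of _ K y x] y(1) x by (intro sum.cong) auto
 also have "... = (SUM sg:S. c sg * (sg y * sg x) - s y * (c sg * sg x))"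
 using insert.hyps by simp
 also have "... = (SUM sg:S. (c sg * (sg y - s y)) * sg x)"
 by (intro sum.cong) (auto simp: algebra_simps)
 finally show ?thesis by simp
 qed
 from insert.IH[of "%sg. c sg * (sg y - s y)", OF emb(2) this t] y show ?thesis by simp
 qed
 have "(SUM sg:S. c sg * sg 1) = 0" by (rule sum.neutral) (simp add: zero)
 hence "c s * s 1 = 0" using insert.prems(2)[OF subfield_1[OF K]] insert.hyps by simp
 hence "c s = 0" using embeddingsD(1)[OF emb(1)] by simp
 with zero insert.prems(3) show ?case by blast
qed

definition emb_mat :: "nat => (nat => 'a => complex) => (nat => 'a) => complex mat" where
 "emb_mat n e b = mat n n (%(i, j). e i (b j))"

lemma emb_mat_carrier [simp]: "emb_mat n e b : carrier_mat n n"
 by (simp add: emb_mat_def)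

lemma mat_inverse_ex:
 fixes A :: "'f::field mat"
 assumes A: "A : carrier_mat n n" and d: "det A ~= 0"
 obtains B where "B : carrier_mat n n" "A * B = 1\<^sub>m n" "B * A = 1\<^sub>m n"
proof -
 note adj = adj_mat[OF A]
 define B where "B = (1 / det A) \<cdot>\<^sub>m adj_mat A"
 have "B : carrier_mat n n" using adj(1) by (simp add: B_def)
 moreover have "A * B = 1\<^sub>m n"
 unfolding B_def mult_smult_distrib[OF A adj(1)] adj(2) using d by (intro eq_matI) auto
 moreover have "B * A = 1\<^sub>m n"
 unfolding B_def mult_smult_assoc_mat[OF adj(1) A] adj(3) using d by (intro eq_matI) auto
 ultimately show ?thesis using that by blast
qed

lemma mat_mult_sum:
 assumes "i < n" "j < m"
 shows "(mat n k f * mat k m g) $$ (i, j) = (\<Sum>l<k. f (i, l) * g (l, j))"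
 using assms by (auto simp: scalar_prod_def lessThan_atLeast0)

lemma coeff_prod_linear_factors:
 fixes f :: "'b => 'c::comm_ring_1"
 assumes "finite S"
 shows "coeff (PROD i:S. [:- f i, 1:]) (card S) = 1 &
 (ALL m. card S = Suc m --> coeff (PROD i:S. [:- f i, 1:]) m = - (SUM i:S. f i)) &
 (ALL m>card S. coeff (PROD i:S. [:- f i, 1:]) m = 0)"
 using assms
proof (induction S rule: finite_induct)
 case empty thus ?case by (auto simp: coeff_1)
next
 case (insert s S)
 let ?P = "PROD i:S. [:- f i, 1:]"
 have c: "coeff (PROD i:insert s S. [:- f i, 1:]) (Suc m) = coeff ?P m - f s * coeff ?P (Suc m)" for m
 using insert.hyps by simp
 have c0: "coeff (PROD i:insert s S. [:- f i, 1:]) 0 = - f s * coeff ?P 0"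
 using insert.hyps by simp
 show ?case
 proof (intro conjI allI impI)
 show "coeff (PROD i:insert s S. [:- f i, 1:]) (card (insert s S)) = 1"
 using insert.IH unfolding card_insert_disjoint[OF insert.hyps] c by simp
 fix m assume m: "card (insert s S) = Suc m"
 hence mS: "m = card S" using insert.hyps by simp
 show "coeff (PROD i:insert s S. [:- f i, 1:]) m = - sum f (insert s S)"
 proof (cases m)
 case 0
 hence "S = {}" using mS insert.hyps by simp
 thus ?thesis using 0 by (simp add: c0)
 next
 case (Suc k)
 hence "coeff ?P k = - sum f S" using insert.IH mS by auto
 moreover have "coeff ?P (Suc k) = 1" using insert.IH mS Suc by auto
 ultimately show ?thesis unfolding Suc c using insert.hyps by simp
 qed
 next
 fix m assume "card (insert s S) < m"
 hence "card S < m - 1" "m = Suc (m - 1)" using insert.hyps by auto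
 thus "coeff (PROD i:insert s S. [:- f i, 1:]) m = 0"
 using insert.IH c[of "m - 1"] by auto
 qed
qed

lemma common_denominator:
 fixes c :: "nat => rat"
 obtains N :: int and k :: "nat => int" where "N > 0" "!!i. i < n ==> of_int N * c i = of_int (k i)"
proof -
 have "EX N::int. N > 0 & (EX k::nat => int. ALL i<n. of_int N * c i = of_int (k i))"
 proof (induction n)
 case 0 thus ?case by (auto intro: exI[of _ 1])
 next
 case (Suc n)
 then obtain N k where N: "N > 0" "ALL i<n. of_int N * c i = of_int (k i)" by blast
 obtain p q where pq: "quotient_of (c n) = (p, q)" by (cases "quotient_of (c n)")
 have q: "q > 0" "c n = of_int p / of_int q"
 using quotient_of_denom_pos[OF pq] quotient_of_div[OF pq] by auto
 show ?case
 proof (intro exI conjI allI impI)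
 show "N * q > 0" using N q by simp
 fix i assume i: "i < Suc n"
 show "of_int (N * q) * c i = of_int ((%i. if i = n then N * p else q * k i) i)"
 proof (cases "i = n")
 case True thus ?thesis using q by simp
 next
 case False
 hence "of_int N * c i = of_int (k i)" using i N by simp
 hence "of_int q * (of_int N * c i) = of_int q * of_int (k i)" by simp
 thus ?thesis using False by (simp add: mult_ac)
 qed
 qed
 qed
 thus ?thesis using that by blast
qed

text \<open>Multiplying an integer equation of degree n for x by the (n - 1)-th power of its leading
  coefficient c makes it monic in c x.\<close>

lemma algebraic_int_multiple:
 fixes x :: "'a::field_char_0"
 assumes "algebraic x"
 obtains N :: int where "N > 0" "algebraic_int (of_int N * x)"
proof -
 obtain p :: "'a poly" where p: "!!i. coeff p i : \<int>" "p ~= 0" "poly p x = 0"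
 using assms unfolding algebraic_def by blast
 have "EX c. coeff p i = of_int c" for i using p(1)[of i] by (auto elim: Ints_cases)
 then obtain c :: "nat => int" where c: "!!i. coeff p i = of_int (c i)" by metis
 define n where "n = degree p"
 have cn: "c n ~= 0" using p(2) c[of n] n_def by auto
 have n: "n > 0"
 proof (rule ccontr)
 assume "~ n > 0"
 then obtain a where "p = [:a:]" using n_def by (auto elim: degree_eq_zeroE)
 with p show False by auto
 qed
 define y where "y = of_int (c n) * x"
 have rel: "of_int (c n) * x ^ n = - (\<Sum>i<n. of_int (c i) * x ^ i)"
 proof -
 have "0 = (\<Sum>i\<le>n. of_int (c i) * x ^ i)" using p(3) unfolding poly_altdef n_def c by simp
 also have "... = (\<Sum>i<n. of_int (c i) * x ^ i) + of_int (c n) * x ^ n"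
 by (simp flip: lessThan_Suc_atMost)
 finally show ?thesis by (simp add: eq_neg_iff_add_eq_0 add.commute)
 qed
 have yn: "y ^ n = (\<Sum>i<n. of_int (- c i * c n ^ (n - 1 - i)) * y ^ i)"
 proof -
 have "of_int (c n) ^ n = of_int (c n) ^ (n - 1) * (of_int (c n) :: 'a)"
 using power_minus_mult[OF n, of "of_int (c n) :: 'a"] by simp
 hence "y ^ n = of_int (c n ^ (n - 1)) * (of_int (c n) * x ^ n)"
 by (simp only: y_def power_mult_distrib of_int_power mult.assoc)
 also have "... = (\<Sum>i<n. of_int (c n ^ (n - 1)) * (- of_int (c i) * x ^ i))"
 unfolding rel by (simp add: sum_distrib_left sum_negf)
 also have "... = (\<Sum>i<n. of_int (- c i * c n ^ (n - 1 - i)) * y ^ i)"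
 proof (rule sum.cong)
 fix i assume "i : {..<n}"
 hence "n - 1 = (n - 1 - i) + i" by simp
 hence "c n ^ (n - 1) = c n ^ (n - 1 - i) * c n ^ i" using power_add[of "c n" "n - 1 - i" i] by simp
 thus "of_int (c n ^ (n - 1)) * (- of_int (c i) * x ^ i) = of_int (- c i * c n ^ (n - 1 - i)) * y ^ i"
 by (simp add: y_def power_mult_distrib mult_ac)
 qed simp
 finally show ?thesis .
 qed
 have "algebraic_int y"
 proof (rule algebraic_int_combsI[of 0 n "%i. y ^ i"])
 fix i assume i: "i < n"
 show "y * y ^ i : int_combs n (%i. y ^ i)"
 proof (cases "Suc i < n")
 case True thus ?thesis using int_combs_gen[of "Suc i" n "%i. y ^ i"] by simp
 next
 case False
 hence "n = Suc i" using i by simp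
 hence "y * y ^ i = y ^ n" by simp
 moreover have "(\<Sum>i<n. of_int (- c i * c n ^ (n - 1 - i)) * y ^ i) : int_combs n (%i. y ^ i)"
 unfolding int_combs_def
 by (rule CollectI, rule exI[of _ "%i. - c i * c n ^ (n - 1 - i)"], rule conjI[OF refl TrueI])
 ultimately show ?thesis by (simp only: yn)
 qed
 qed (use n in auto)
 show ?thesis
 proof (cases "c n > 0")
 case True thus ?thesis using that[of "c n"] \<open>algebraic_int y\<close> y_def by simp
 next
 case False
 thus ?thesis using that[of "- c n"] cn algebraic_int_minus[OF \<open>algebraic_int y\<close>] by (simp add: y_def)
 qed
qed

locale numfield =
 fixes K :: "'a::field_char_0 set" and n :: nat and e :: "nat => 'a => complex"
 assumes nf: "number_field K" and e: "bij_betw e {..<n} (Emb K)"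
begin

abbreviation "OK \<equiv> ring_of_integers K"

lemma sf: "is_subfield K" using nf by (rule number_field_subfield)

lemma e_emb: "i < n ==> e i : Emb K"
 using e by (auto simp: bij_betw_def)

lemma n_card: "card (Emb K) = n"
 using bij_betw_same_card[OF e] by simp

lemma n_basis: "fam_basis \<rat> K m b ==> m = n"
 using embeddings_card(2)[OF nf] n_card by auto

lemma n_pos: "n > 0"
 using embeddings_card_pos[OF nf] n_card by simp

lemma basis_ex: obtains b where "fam_basis \<rat> K n b"
proof -
 obtain m b where b: "fam_basis \<rat> K m b" using number_field_basis[OF nf] by blast
 thus ?thesis using that[of b] n_basis[OF b] by simp
qed

lemma prod_emb: "(PROD sg:Emb K. f sg) = (\<Prod>i<n. f (e i))"
 using prod.reindex_bij_betw[OF e, of f] by simp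

lemma sum_emb: "(SUM sg:Emb K. f sg) = (\<Sum>i<n. f (e i))"
 using sum.reindex_bij_betw[OF e, of f] by simp

lemma e_rat_comb:
 assumes "i < n" "!!j. j < m ==> b j : K"
 shows "e i (\<Sum>j<m. of_rat (q j) * b j) = (\<Sum>j<m. of_rat (q j) * e i (b j))"
 using assms emb_sum[OF sf e_emb[OF assms(1)], of "{..<m}" "%j. of_rat (q j) * b j"]
 subfield_mult[OF sf subfield_of_rat[OF sf]]
 by (simp add: emb_mult[OF sf e_emb] subfield_of_rat[OF sf] emb_of_rat[OF sf e_emb])

lemma OK_closed:
 "x : OK ==> y : OK ==> x + y : OK" "x : OK ==> y : OK ==> x - y : OK"
 "x : OK ==> y : OK ==> x * y : OK" "of_int k : OK" "x : OK ==> - x : OK" "x : OK ==> x ^ m : OK"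
 unfolding ring_of_integers_def
 by (auto intro: algebraic_int_add_mult algebraic_int_diff algebraic_int_power int_imp_algebraic_int
 subfield_add[OF sf] subfield_diff[OF sf] subfield_mult[OF sf] subfield_of_int[OF sf] subfield_uminus[OF sf]
 subfield_power[OF sf])

lemma OK_sum: "(!!i. i : I ==> f i : OK) ==> sum f I : OK"
 using OK_closed(4)[of 0] by (induction I rule: infinite_finite_induct) (auto intro: OK_closed)

lemma OK_K: "x : OK ==> x : K" by (simp add: ring_of_integers_def)

lemma OK_poly: "x : OK ==> poly (map_poly of_int p) x : OK"
 unfolding poly_altdef coeff_map_poly[of of_int, OF of_int_0] by (intro OK_sum OK_closed) auto

text \<open>A kernel vector of the transposed matrix is a linear relation between the embeddings
  that holds on a basis, hence on K; Dedekind's lemma excludes it.\<close>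

lemma det_emb_mat_nonzero:
 assumes b: "fam_basis \<rat> K n b"
 shows "det (emb_mat n e b) ~= 0"
proof
 let ?V = "emb_mat n e b"
 assume "det ?V = 0"
 hence "det (transpose_mat ?V) = 0" using det_transpose[OF emb_mat_carrier] by metis
 then obtain v where v: "v : carrier_vec n" "v ~= 0\<^sub>v n" "transpose_mat ?V *\<^sub>v v = 0\<^sub>v n"
 using det_0_iff_vec_prod_zero[of "transpose_mat ?V" n] by auto
 have rel: "(\<Sum>i<n. v $ i * e i (b j)) = 0" if "j < n" for j
 proof -
 have "0 = (transpose_mat ?V *\<^sub>v v) $ j" using v(3) that by simp
 also have "... = (\<Sum>i<n. v $ i * e i (b j))" using v(1) that
 by (auto simp: emb_mat_def scalar_prod_def lessThan_atLeast0 mult.commute intro!: sum.cong)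
 finally show ?thesis by simp
 qed
 define c where "c = (%sg. v $ (inv_into {..<n} e sg))"
 have ce: "c (e i) = v $ i" if "i < n" for i using e that by (simp add: c_def bij_betw_def)
 have "(SUM sg:Emb K. c sg * sg x) = 0" if xK: "x : K" for x
 proof -
 obtain q :: "nat => rat" where q: "x = (\<Sum>j<n. of_rat (q j) * b j)" using fam_basis_rat_span[OF b xK] by blast
 have bK: "!!j. j < n ==> b j : K" using fam_basis_mem[OF b] .
 have "(SUM sg:Emb K. c sg * sg x) = (\<Sum>i<n. v $ i * e i x)"
 unfolding sum_emb by (simp add: ce)
 also have "... = (\<Sum>i<n. v $ i * (\<Sum>j<n. of_rat (q j) * e i (b j)))"
 unfolding q by (intro sum.cong refl) (simp add: e_rat_comb bK)
 also have "... = (\<Sum>i<n. \<Sum>j<n. of_rat (q j) * (v $ i * e i (b j)))"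
 by (simp add: sum_distrib_left mult.left_commute)
 also have "... = (\<Sum>j<n. of_rat (q j) * (\<Sum>i<n. v $ i * e i (b j)))"
 by (subst sum.swap) (simp add: sum_distrib_left)
 also have "... = 0" by (simp add: rel)
 finally show ?thesis .
 qed
 from dedekind_independence[OF sf embeddings_finite[OF nf] order.refl this] have "c (e i) = 0" if "i < n" for i
 using e_emb[OF that] by blast
 hence "v = 0\<^sub>v n" using v(1) ce by (intro eq_vecI) auto
 thus False using v(2) by simp
qed

lemma mult_matrix_exists:
 assumes b: "fam_basis \<rat> K n b" and x: "x : K"
 obtains A :: "nat => nat => rat" where "!!j. j < n ==> x * b j = (\<Sum>i<n. of_rat (A i j) * b i)"
proof -
 have "EX c::nat=>rat. j < n --> x * b j = (\<Sum>i<n. of_rat (c i) * b i)" for j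
 using fam_basis_rat_span[OF b subfield_mult[OF sf x fam_basis_mem[OF b]]] by blast
 then obtain A :: "nat => nat => rat" where "!!j. j < n ==> x * b j = (\<Sum>i<n. of_rat (A j i) * b i)" by metis
 thus ?thesis using that[of "%i j. A j i"] by blast
qed

text \<open>The matrix of embeddings diagonalises multiplication by x: V C = D V, where C is
  rational and D carries the conjugates of x. So C and D have the same characteristic
  polynomial.\<close>

lemma char_poly_rat:
 assumes x: "x : K"
 obtains p :: "rat poly" where "map_poly of_rat p = (PROD sg:Emb K. [:- sg x, 1:])"
proof -
 obtain b where b: "fam_basis \<rat> K n b" using basis_ex by blast
 have bK: "!!j. j < n ==> b j : K" using fam_basis_mem[OF b] .
 obtain A :: "nat => nat => rat" where A: "!!j. j < n ==> x * b j = (\<Sum>i<n. of_rat (A i j) * b i)"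
 using mult_matrix_exists[OF b x] by blast
 define M where "M = mat n n (%(i, j). A i j)"
 define C where "C = mat n n (%(i, j). complex_of_rat (A i j))"
 define D where "D = mat n n (%(i, j). if i = j then e i x else 0)"
 let ?V = "emb_mat n e b"
 have car: "M : carrier_mat n n" "C : carrier_mat n n" "D : carrier_mat n n"
 by (auto simp: M_def C_def D_def)
 have CM: "C = map_mat of_rat M" by (intro eq_matI) (auto simp: C_def M_def)
 have VC: "?V * C = D * ?V"
 proof (intro eq_matI)
 fix i j assume "i < dim_row (D * ?V)" "j < dim_col (D * ?V)"
 hence ij: "i < n" "j < n" by (auto simp: D_def emb_mat_def)
 have "(?V * C) $$ (i, j) = (\<Sum>l<n. of_rat (A l j) * e i (b l))"
 unfolding emb_mat_def C_def mat_mult_sum[OF ij] by (simp add: mult.commute)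
 also have "... = e i (x * b j)" using e_rat_comb[OF ij(1), of n b "%l. A l j"] bK A[OF ij(2)] by simp
 also have "... = e i x * e i (b j)" using emb_mult[OF sf e_emb[OF ij(1)] x bK[OF ij(2)]] .
 also have "... = (\<Sum>l<n. if l = i then e i x * e l (b j) else 0)" using ij by simp
 also have "... = (\<Sum>l<n. (if i = l then e i x else 0) * e l (b j))" by (intro sum.cong) auto
 also have "... = (D * ?V) $$ (i, j)" unfolding emb_mat_def D_def mat_mult_sum[OF ij] by simp
 finally show "(?V * C) $$ (i, j) = (D * ?V) $$ (i, j)" .
 qed (use car in "auto simp: emb_mat_def")
 obtain W where W: "W : carrier_mat n n" "?V * W = 1\<^sub>m n" "W * ?V = 1\<^sub>m n"
 using mat_inverse_ex[OF emb_mat_carrier det_emb_mat_nonzero[OF b]] by blast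
 have "C = W * ?V * C" using W car by simp
 also have "... = W * (?V * C)" using assoc_mult_mat[OF W(1) emb_mat_carrier car(2)] .
 also have "... = W * D * ?V" unfolding VC using assoc_mult_mat[OF W(1) car(3) emb_mat_carrier, symmetric] .
 finally have CW: "C = W * D * ?V" .
 have "similar_mat C D" unfolding similar_mat_def similar_mat_wit_def
 by (rule exI[of _ W], rule exI[of _ ?V]) (use W car CW in "auto simp: Let_def")
 hence "char_poly C = char_poly D" by (rule char_poly_similar)
 also have "... = (\<Prod>a\<leftarrow>diag_mat D. [:- a, 1:])"
 by (rule char_poly_upper_triangular[OF car(3)]) (auto simp: D_def)
 also have "... = (\<Prod>i<n. [:- e i x, 1:])"
 proof -
 have "diag_mat D = map (%i. e i x) [0..<n]" by (auto simp: diag_mat_def D_def)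
 hence "(\<Prod>a\<leftarrow>diag_mat D. [:- a, 1:]) = prod_list (map (%i. [:- e i x, 1:]) [0..<n])"
 by (simp add: comp_def)
 thus ?thesis by (simp add: prod.distinct_set_conv_list[symmetric] lessThan_atLeast0)
 qed
 also have "... = (PROD sg:Emb K. [:- sg x, 1:])" by (simp add: prod_emb)
 finally have "char_poly C = (PROD sg:Emb K. [:- sg x, 1:])" .
 moreover have "char_poly C = map_poly of_rat (char_poly M)" unfolding CM by (rule of_rat_hom.char_poly_hom[OF car(1)])
 ultimately show ?thesis using that[of "char_poly M"] by simp
qed

lemma trace_rat:
 assumes x: "x : K" shows "(SUM sg:Emb K. sg x) : \<rat>"
proof -
 obtain p :: "rat poly" where p: "map_poly of_rat p = (PROD sg:Emb K. [:- sg x, 1:])"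
 using char_poly_rat[OF x] by blast
 have "coeff (map_poly of_rat p) (n - 1) = - (SUM sg:Emb K. sg x)"
 unfolding p using coeff_prod_linear_factors[OF embeddings_finite[OF nf], of "%sg. sg x"] n_card n_pos by auto
 hence "(SUM sg:Emb K. sg x) = of_rat (- coeff p (n - 1))"
 by (simp add: coeff_map_poly of_rat_minus)
 thus ?thesis by simp
qed

lemma char_poly_int:
 assumes x: "x : OK"
 obtains f :: "int poly" where "map_poly of_int f = (PROD sg:Emb K. [:- sg x, 1:])"
 "poly (map_poly of_int f) x = 0"
proof -
 obtain p :: "rat poly" where p: "map_poly of_rat p = (PROD sg:Emb K. [:- sg x, 1:])"
 using char_poly_rat[OF OK_K[OF x]] by blast
 \<comment> \<open>The coefficients turn out to be integers, so \<open>floor\<close> merely changes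
   their type.\<close>
 define f where "f = map_poly floor p"
 have "complex_of_rat (coeff p i) = of_int (coeff f i)" for i
 proof -
 have "algebraic_int (coeff (PROD sg:Emb K. [:- sg x, 1:]) i)"
 by (rule algebraic_int_coeff_prod[OF embeddings_finite[OF nf]])
 (use x algebraic_int_emb_iff[OF sf] in "auto simp: ring_of_integers_def")
 hence "algebraic_int (complex_of_rat (coeff p i))" unfolding p[symmetric] by (simp add: coeff_map_poly)
 hence "complex_of_rat (coeff p i) : \<int>" by (rule rational_algebraic_int_is_int) simp
 then obtain k where "complex_of_rat (coeff p i) = of_int k" by (auto elim: Ints_cases)
 hence "complex_of_rat (coeff p i) = complex_of_rat (of_int k)" by simp
 hence "coeff p i = of_int k" by (simp only: of_rat_eq_iff)
 thus ?thesis by (simp add: f_def coeff_map_poly)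
 qed
 hence f: "map_poly of_int f = (PROD sg:Emb K. [:- sg x, 1:])"
 unfolding p[symmetric] by (intro poly_eqI) (simp add: coeff_map_poly)
 have "e 0 (poly (map_poly of_int f) x) = poly (map_poly of_int f) (e 0 x)"
 by (rule emb_poly_int[OF sf e_emb[OF n_pos] OK_K[OF x]])
 also have "... = 0" unfolding f poly_prod using embeddings_finite[OF nf] e_emb[OF n_pos]
 by (auto intro!: prod_zero)
 finally have "poly (map_poly of_int f) x = 0"
 using emb_eq_0_iff[OF sf e_emb[OF n_pos]] poly_over_eval[OF sf poly_over_of_int[OF sf e_emb[OF n_pos]] OK_K[OF x]] by blast
 with f show ?thesis using that by blast
qed

text \<open>Up to sign the norm is the constant term of the characteristic polynomial f, so the
  equation f(x) = 0 itself exhibits it as a multiple of x. The integral cofactor y is used later to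
  construct units.\<close>

lemma norm_int:
 assumes x: "x : OK"
 obtains N :: int and y where "(PROD sg:Emb K. sg x) = of_int N" "y : OK" "x * y = of_int N"
 "N = 0 \<longleftrightarrow> x = 0"
proof -
 obtain f :: "int poly" where f: "map_poly of_int f = (PROD sg:Emb K. [:- sg x, 1:])"
 "poly (map_poly of_int f) x = 0" using char_poly_int[OF x] by blast
 obtain c g where fg: "f = pCons c g" by (cases f)
 have "complex_of_int c = poly (map_poly of_int f) 0" by (simp add: fg map_poly_pCons)
 also have "... = (PROD sg:Emb K. - sg x)" unfolding f(1) by (simp add: poly_prod)
 also have "... = (- 1) ^ n * (PROD sg:Emb K. sg x)"
 using prod.distrib[of "%_. - 1" "%sg. sg x" "Emb K"] n_card by simp
 finally have c: "complex_of_int c = (- 1) ^ n * (PROD sg:Emb K. sg x)" .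
 define N where "N = (- 1) ^ n * c"
 define y where "y = of_int (- ((- 1) ^ n)) * poly (map_poly of_int g) x"
 have N: "(PROD sg:Emb K. sg x) = of_int N"
 by (simp add: N_def c mult.assoc[symmetric] flip: power_add mult_2)
 have "map_poly of_int f = pCons (of_int c) (map_poly of_int g :: 'a poly)"
 by (intro poly_eqI) (simp add: fg coeff_map_poly coeff_pCons split: nat.split)
 hence "of_int c + x * poly (map_poly of_int g) x = 0" using f(2) by simp
 hence "x * poly (map_poly of_int g) x = - of_int c" by (simp add: eq_neg_iff_add_eq_0 add.commute)
 moreover have "x * y = of_int (- ((- 1) ^ n)) * (x * poly (map_poly of_int g) x)"
 unfolding y_def by (rule mult.left_commute)
 ultimately have "x * y = of_int N" by (simp add: N_def)
 moreover have "y : OK" unfolding y_def by (intro OK_closed OK_poly x)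
 moreover have "N = 0 \<longleftrightarrow> x = 0"
 proof -
 have "N = 0 \<longleftrightarrow> (PROD sg:Emb K. sg x) = 0" using N by simp
 also have "... \<longleftrightarrow> (EX sg:Emb K. sg x = 0)" using embeddings_finite[OF nf] by simp
 also have "... \<longleftrightarrow> x = 0" using emb_eq_0_iff[OF sf _ OK_K[OF x]] e_emb[OF n_pos] by blast
 finally show ?thesis .
 qed
 ultimately show ?thesis using that N by blast
qed

text \<open>The square is the determinant of the matrix of traces of \<open>b j * b k\<close>, hence
  rational; by the Leibniz formula it is also an algebraic integer.\<close>

lemma disc_int:
 assumes b: "!!j. j < n ==> b j : OK"
 obtains De :: int where "of_int De = (det (emb_mat n e b))\<^sup>2"
proof -
 let ?V = "emb_mat n e b"
 have "EX q. j < n --> k < n --> (SUM sg:Emb K. sg (b j * b k)) = of_rat q" for j k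
 using trace_rat[OF subfield_mult[OF sf OK_K[OF b] OK_K[OF b]], of j k]
 by (auto elim: Rats_cases)
 then obtain T where T: "!!j k. j < n ==> k < n ==> (SUM sg:Emb K. sg (b j * b k)) = of_rat (T j k)"
 by metis
 have VV: "transpose_mat ?V * ?V = map_mat of_rat (mat n n (%(j, k). T j k))"
 proof (intro eq_matI)
 fix j k assume "j < dim_row (map_mat complex_of_rat (mat n n (%(j, k). T j k)))"
 "k < dim_col (map_mat complex_of_rat (mat n n (%(j, k). T j k)))"
 hence jk: "j < n" "k < n" by auto
 have "(transpose_mat ?V * ?V) $$ (j, k) = (\<Sum>i<n. e i (b j) * e i (b k))"
 using jk by (auto simp: emb_mat_def scalar_prod_def lessThan_atLeast0)
 also have "... = (\<Sum>i<n. e i (b j * b k))"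
 using emb_mult[OF sf e_emb] OK_K[OF b] jk by simp
 also have "... = of_rat (T j k)" using T[OF jk] unfolding sum_emb .
 finally show "(transpose_mat ?V * ?V) $$ (j, k) = map_mat of_rat (mat n n (%(j, k). T j k)) $$ (j, k)"
 using jk by simp
 qed (auto simp: emb_mat_def)
 have "(det ?V)\<^sup>2 = det (transpose_mat ?V * ?V)"
 using det_mult[of "transpose_mat ?V" n ?V] det_transpose[OF emb_mat_carrier[of n e b]]
 by (simp add: power2_eq_square)
 also have "... = of_rat (det (mat n n (%(j, k). T j k)))" unfolding VV by (rule of_rat_hom.hom_det)
 finally have "(det ?V)\<^sup>2 : \<rat>" by simp
 moreover have "algebraic_int (det ?V)"
 proof -
 have alg: "algebraic_int (signof p * (\<Prod>i = 0..<n. ?V $$ (i, p i)))" if p: "p permutes {0..<n}" for p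
 proof (rule algebraic_int_add_mult(2))
 show "algebraic_int (signof p :: complex)" by (simp add: sign_def)
 show "algebraic_int (\<Prod>i = 0..<n. ?V $$ (i, p i))"
 proof (rule algebraic_int_prod)
 fix i assume i: "i : {0..<n}"
 hence pi: "p i < n" using permutes_in_image[OF p] by auto
 have "algebraic_int (e i (b (p i)))"
 using b[OF pi] i algebraic_int_emb_iff[OF sf e_emb] by (auto simp: ring_of_integers_def)
 thus "algebraic_int (?V $$ (i, p i))" using i pi by (simp add: emb_mat_def)
 qed
 qed
 show ?thesis unfolding det_def'[OF emb_mat_carrier] by (rule algebraic_int_sum) (use alg in simp)
 qed
 hence "algebraic_int ((det ?V)\<^sup>2)" by (rule algebraic_int_power)
 ultimately have "(det ?V)\<^sup>2 : \<int>" by (rule rational_algebraic_int_is_int[rotated])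
 then obtain De where "(det ?V)\<^sup>2 = of_int De" by (auto elim: Ints_cases)
 thus ?thesis using that[of De] by simp
qed

lemma det_nonzero_imp_basis:
 assumes bK: "!!j. j < n ==> b j : K" and d: "det (emb_mat n e b) ~= 0"
 shows "fam_basis \<rat> K n b"
proof -
 have indep: "ALL i<n. q i = 0" if q: "(\<Sum>j<n. of_rat (q j) * b j) = 0" for q :: "nat => rat"
 proof (rule ccontr)
 assume "~ (ALL i<n. q i = 0)"
 then obtain k where k: "k < n" "q k ~= 0" by blast
 let ?v = "vec n (%j. complex_of_rat (q j))"
 have "emb_mat n e b *\<^sub>v ?v = 0\<^sub>v n"
 proof (intro eq_vecI)
 fix i assume "i < dim_vec (0\<^sub>v n :: complex vec)"
 hence i: "i < n" by simp
 have "(emb_mat n e b *\<^sub>v ?v) $ i = (\<Sum>j<n. of_rat (q j) * e i (b j))"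
 using i by (auto simp: emb_mat_def scalar_prod_def lessThan_atLeast0 mult.commute intro!: sum.cong)
 also have "... = e i 0" using e_rat_comb[OF i, of n b q] bK q by simp
 finally show "(emb_mat n e b *\<^sub>v ?v) $ i = 0\<^sub>v n $ i" using i emb_0[OF sf e_emb[OF i]] by simp
 qed (auto simp: emb_mat_def)
 moreover have "?v ~= 0\<^sub>v n"
 proof
 assume "?v = 0\<^sub>v n"
 hence "?v $ k = 0" using k by simp
 thus False using k by simp
 qed
 ultimately show False using d det_0_iff_vec_prod_zero[OF emb_mat_carrier, of n e b] vec_carrier by blast
 qed
 obtain a where a: "fam_basis \<rat> K n a" using basis_ex by blast
 show ?thesis unfolding fam_basis_rat
 proof (intro conjI ballI)
 fix x assume x: "x : K"
 have ex: "!!i. i < Suc n ==> EX c::nat=>rat. (b(n := x)) i = (\<Sum>j<n. of_rat (c j) * a j)"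
 proof -
 fix i assume "i < Suc n"
 hence "(b(n := x)) i : K" using x bK by auto
 thus "EX c::nat=>rat. (b(n := x)) i = (\<Sum>j<n. of_rat (c j) * a j)" using fam_basis_rat_span[OF a] by blast
 qed
 obtain c :: "nat => rat" where c: "EX i<Suc n. c i ~= 0" "(\<Sum>i<Suc n. of_rat (c i) * (b(n := x)) i) = 0"
 using rat_dependent[of n "Suc n" "b(n := x)" a, OF _ ex] by auto
 have eq: "(\<Sum>i<n. of_rat (c i) * b i) + of_rat (c n) * x = 0" using c(2) by simp
 have cn: "c n ~= 0"
 proof
 assume "c n = 0"
 with eq indep have "ALL i<n. c i = 0" by auto
 with c(1) \<open>c n = 0\<close> show False by (auto simp: less_Suc_eq)
 qed
 have "of_rat (c n) * (\<Sum>i<n. of_rat (- c i / c n) * b i) = - (\<Sum>i<n. of_rat (c i) * b i)"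
 using cn by (simp add: sum_distrib_left of_rat_divide of_rat_minus flip: sum_negf)
 also have "... = of_rat (c n) * x" using eq by (simp add: eq_neg_iff_add_eq_0 add.commute neg_eq_iff_add_eq_0)
 finally have "x = (\<Sum>i<n. of_rat (- c i / c n) * b i)" using cn by simp
 thus "EX c::nat=>rat. x = (\<Sum>i<n. of_rat (c i) * b i)" by (intro exI[of _ "%i. - c i / c n"])
 qed (use bK indep in auto)
qed

lemma integral_multiple:
 assumes "x : K" obtains N :: int where "N > 0" "of_int N * x : OK"
 using algebraic_int_multiple[OF number_field_algebraic[OF nf assms]] subfield_mult[OF sf subfield_of_int[OF sf] assms]
 unfolding ring_of_integers_def by blast

lemma integral_Q_basis_ex:
 obtains b where "fam_basis \<rat> K n b" "!!j. j < n ==> b j : OK"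
proof -
 obtain a where a: "fam_basis \<rat> K n a" using basis_ex by blast
 have aK: "!!j. j < n ==> a j : K" using fam_basis_mem[OF a] .
 have "EX N::int. j < n --> N > 0 & of_int N * a j : OK" for j
 using integral_multiple[OF aK, of j] by blast
 then obtain N :: "nat => int" where N: "!!j. j < n ==> N j > 0 & of_int (N j) * a j : OK" by metis
 define b where "b = (%j. of_int (N j) * a j)"
 have bO: "!!j. j < n ==> b j : OK" using N by (simp add: b_def)
 have "fam_basis \<rat> K n b" unfolding fam_basis_rat
 proof (intro conjI allI impI ballI)
 show "!!i. i < n ==> b i : K" using bO OK_K by blast
 fix x assume "x : K"
 then obtain c :: "nat => rat" where c: "x = (\<Sum>i<n. of_rat (c i) * a i)" using fam_basis_rat_span[OF a] by blast
 have "x = (\<Sum>i<n. of_rat (c i / of_int (N i)) * b i)" unfolding c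
 proof (rule sum.cong)
 fix i assume "i : {..<n}"
 hence "N i ~= 0" using N[of i] by auto
 thus "of_rat (c i) * a i = of_rat (c i / of_int (N i)) * b i" by (simp add: b_def of_rat_divide)
 qed simp
 thus "EX c::nat=>rat. x = (\<Sum>i<n. of_rat (c i) * b i)" by (intro exI[of _ "%i. c i / of_int (N i)"])
 next
 fix c :: "nat => rat" and i assume z: "(\<Sum>i<n. of_rat (c i) * b i) = 0" and i: "i < n"
 have "(\<Sum>i<n. of_rat (c i * of_int (N i)) * a i) = 0" using z by (simp add: b_def of_rat_mult mult.assoc)
 from fam_basis_rat_indep[OF a this i] show "c i = 0" using N[OF i] by auto
 qed
 thus ?thesis using that bO by blast
qed

end

lemma fam_basis_int_span:
 "fam_basis \<int> M n b ==> x : M ==> EX c::nat=>int. x = (\<Sum>i<n. of_int (c i) * b i)"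
 unfolding fam_basis_int by blast

lemma fam_basis_int_indep:
 "fam_basis \<int> M n b ==> (\<Sum>i<n. of_int (c i) * b i) = 0 ==> i < n ==> c i = 0"
 unfolding fam_basis_int by blast

context numfield
begin

lemma fam_basis_int_to_rat:
 assumes w: "fam_basis \<int> OK m w"
 shows "fam_basis \<rat> K m w"
 unfolding fam_basis_rat
proof (intro conjI allI impI ballI)
 fix i assume "i < m" thus "w i : K" using OK_K fam_basis_mem[OF w] by blast
next
 fix x assume x: "x : K"
 obtain N :: int where N: "N > 0" "of_int N * x : OK" using integral_multiple[OF x] by blast
 obtain c :: "nat => int" where c: "of_int N * x = (\<Sum>i<m. of_int (c i) * w i)"
 using fam_basis_int_span[OF w N(2)] by blast
 have "of_int N * (\<Sum>i<m. of_rat (of_int (c i) / of_int N) * w i) = of_int N * x"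
 unfolding c sum_distrib_left
 proof (rule sum.cong)
 fix i show "of_int N * (of_rat (of_int (c i) / of_int N) * w i) = of_int (c i) * w i"
 using N by (simp add: of_rat_divide)
 qed simp
 hence "x = (\<Sum>i<m. of_rat (of_int (c i) / of_int N) * w i)" using N by simp
 thus "EX c::nat=>rat. x = (\<Sum>i<m. of_rat (c i) * w i)" by (intro exI[of _ "%i. of_int (c i) / of_int N"])
next
 fix c :: "nat => rat" and i assume z: "(\<Sum>i<m. of_rat (c i) * w i) = 0" and i: "i < m"
 obtain N :: int and k :: "nat => int" where N: "N > 0" "!!i. i < m ==> of_int N * c i = of_int (k i)"
 using common_denominator[of m c] by blast
 have "(\<Sum>i<m. of_int (k i) * w i) = of_int N * (\<Sum>i<m. of_rat (c i) * w i)"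
 unfolding sum_distrib_left
 proof (rule sum.cong)
 fix i assume "i : {..<m}"
 hence "(of_rat (of_int N * c i) :: 'a) = of_rat (of_int (k i))" using N(2)[of i] by simp
 thus "of_int (k i) * w i = of_int N * (of_rat (c i) * w i)" by (simp add: of_rat_mult)
 qed simp
 hence "(\<Sum>i<m. of_int (k i) * w i) = 0" using z by simp
 hence "k i = 0" by (rule fam_basis_int_indep[OF w _ i])
 thus "c i = 0" using N(1) N(2)[OF i] by simp
qed

lemma det_emb_mat_perm:
 assumes e': "bij_betw e' {..<n} (Emb K)"
 shows "(det (emb_mat n e' b))\<^sup>2 = (det (emb_mat n e b))\<^sup>2"
proof -
 define p where "p = (%i. if i < n then inv_into {..<n} e (e' i) else i)"
 have "bij_betw (%i. inv_into {..<n} e (e' i)) {..<n} {..<n}"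
 using bij_betw_trans[OF e' bij_betw_inv_into[OF e]] by (simp add: comp_def)
 hence "bij_betw p {..<n} {..<n}" by (rule bij_betw_cong[THEN iffD1, rotated]) (simp add: p_def)
 hence p: "p permutes {0..<n}" by (intro bij_imp_permutes) (auto simp: lessThan_atLeast0 p_def)
 have ep: "e (p i) = e' i" if i: "i < n" for i
 proof -
 have "e' i : e ` {..<n}" using e e' i by (auto simp: bij_betw_def)
 thus ?thesis using i by (simp add: p_def f_inv_into_f)
 qed
 have pn: "p i < n" if "i < n" for i using permutes_in_image[OF p, of i] that by simp
 have "emb_mat n e' b = mat n n (%(i, j). emb_mat n e b $$ (p i, j))"
 by (intro eq_matI) (auto simp: emb_mat_def ep pn)
 hence "det (emb_mat n e' b) = of_int (sign p) * det (emb_mat n e b)"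
 using det_permute_rows[OF emb_mat_carrier p] by simp
 thus ?thesis by (simp add: power_mult_distrib sign_def)
qed

text \<open>The candidate for an integral basis: among independent integers of K, those whose
  discriminant is least in absolute value.\<close>

lemma minimal_disc_ex:
 obtains b De where "ALL j<n. b j : OK" "det (emb_mat n e b) ~= 0" "of_int De = (det (emb_mat n e b))\<^sup>2"
 "ALL c De'. (ALL j<n. c j : OK) --> det (emb_mat n e c) ~= 0 --> of_int De' = (det (emb_mat n e c))\<^sup>2 --> \<bar>De\<bar> <= \<bar>De'\<bar>"
proof -
 define Q where "Q = (%(b, De::int). (ALL j<n. b j : OK) & det (emb_mat n e b) ~= 0 & of_int De = (det (emb_mat n e b))\<^sup>2)"
 obtain b0 where b0: "fam_basis \<rat> K n b0" "!!j. j < n ==> b0 j : OK" using integral_Q_basis_ex by blast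
 obtain De0 :: int where "of_int De0 = (det (emb_mat n e b0))\<^sup>2" using disc_int[of b0] b0(2) by blast
 hence "Q (b0, De0)" using b0 det_emb_mat_nonzero[OF b0(1)] unfolding Q_def by simp
 then obtain x where x: "Q x" "ALL y. Q y --> nat \<bar>snd x\<bar> <= nat \<bar>snd y\<bar>"
 using ex_has_least_nat[of Q "(b0, De0)" "%y. nat \<bar>snd y\<bar>"] by blast
 obtain b De where xb: "x = (b, De)" by (cases x)
 show ?thesis
 proof (rule that[of b De]; (intro allI impI)?)
 fix c and De' :: int assume "ALL j<n. c j : OK" "det (emb_mat n e c) ~= 0" "of_int De' = (det (emb_mat n e c))\<^sup>2"
 hence "Q (c, De')" unfolding Q_def by simp
 with x(2) show "\<bar>De\<bar> <= \<bar>De'\<bar>" unfolding xb by fastforce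
 qed (use x(1) in "auto simp: xb Q_def")
qed

lemma emb_mat_mult:
 assumes "!!j. j < n ==> c j = (\<Sum>k<n. of_rat (P k j) * b k)" "!!k. k < n ==> b k : K"
 shows "emb_mat n e c = emb_mat n e b * mat n n (%(k, j). of_rat (P k j))"
proof (intro eq_matI)
 fix i j assume "i < dim_row (emb_mat n e b * mat n n (%(k, j). complex_of_rat (P k j)))"
 "j < dim_col (emb_mat n e b * mat n n (%(k, j). complex_of_rat (P k j)))"
 hence ij: "i < n" "j < n" by (auto simp: emb_mat_def)
 have "emb_mat n e c $$ (i, j) = (\<Sum>k<n. of_rat (P k j) * e i (b k))"
 using ij e_rat_comb[OF ij(1), of n b "%k. P k j"] assms by (simp add: emb_mat_def)
 thus "emb_mat n e c $$ (i, j) = (emb_mat n e b * mat n n (%(k, j). of_rat (P k j))) $$ (i, j)"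
 unfolding emb_mat_def mat_mult_sum[OF ij] by (simp add: mult.commute)
qed (auto simp: emb_mat_def)

text \<open>The last conclusion carries the minimality out of the proof. The height argument plays
  it against Hadamard's inequality.\<close>

theorem discriminant_basis:
 obtains b where "fam_basis \<int> OK n b" "fam_basis \<rat> K n b"
 "of_int (discriminant K) = (det (emb_mat n e b))\<^sup>2" "discriminant K ~= 0"
 "ALL c. (ALL j<n. c j : OK) --> det (emb_mat n e c) ~= 0 --> \<bar>real_of_int (discriminant K)\<bar> <= (cmod (det (emb_mat n e c)))\<^sup>2"
proof -
 obtain b De where bO': "ALL j<n. b j : OK" and d: "det (emb_mat n e b) ~= 0"
 and De: "of_int De = (det (emb_mat n e b))\<^sup>2"
 and min': "ALL c De'. (ALL j<n. c j : OK) --> det (emb_mat n e c) ~= 0 --> of_int De' = (det (emb_mat n e c))\<^sup>2 --> \<bar>De\<bar> <= \<bar>De'\<bar>"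
 using minimal_disc_ex by blast
 have bO: "!!j. j < n ==> b j : OK" using bO' by blast
 have min: "!!c De'. (!!j. j < n ==> c j : OK) ==> det (emb_mat n e c) ~= 0 ==> of_int De' = (det (emb_mat n e c))\<^sup>2 ==> \<bar>De\<bar> <= \<bar>De'\<bar>"
 using min' by blast
 have bK: "!!j. j < n ==> b j : K" using bO OK_K by blast
 have De0: "De ~= 0" using De d by auto
 have bQ: "fam_basis \<rat> K n b" using det_nonzero_imp_basis[of b] bK d by blast
 have bZ: "fam_basis \<int> OK n b" unfolding fam_basis_int
 proof (intro conjI allI impI ballI)
 fix x assume x: "x : OK"
 obtain q :: "nat => rat" where q: "x = (\<Sum>i<n. of_rat (q i) * b i)"
 using fam_basis_rat_span[OF bQ OK_K[OF x]] by blast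
 have int: "q j = of_int \<lfloor>q j\<rfloor>" if j: "j < n" for j
 proof (rule ccontr)
 assume ne: "q j ~= of_int \<lfloor>q j\<rfloor>"
 define t where "t = q j - of_int \<lfloor>q j\<rfloor>"
 have t: "t ~= 0" "0 < t" "t < 1"
 using ne floor_correct[of "q j"] by (auto simp: t_def less_le)
 \<comment> \<open>Subtracting the integral part of the j-th coordinate keeps an integer of K. By
   Cramer's rule the determinant is multiplied by the fractional part t, so the discriminant shrinks
   by t^2 < 1, against minimality.\<close>
 define b' where "b' = b(j := x - of_int \<lfloor>q j\<rfloor> * b j)"
 define y where "y = vec n (%i. complex_of_rat (if i = j then t else q i))"
 have b'O: "b' k : OK" if "k < n" for k
 using that bO x OK_closed(2)[OF x OK_closed(3)[OF OK_closed(4) bO[OF j]]] by (auto simp: b'_def)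
 have xj: "x - of_int \<lfloor>q j\<rfloor> * b j = (\<Sum>i<n. of_rat (if i = j then t else q i) * b i)"
 proof -
 have "(\<Sum>i<n. of_rat (if i = j then t else q i) * b i) = (\<Sum>i<n. of_rat (q i) * b i - (if i = j then of_int \<lfloor>q j\<rfloor> * b i else 0))"
 by (intro sum.cong) (auto simp: t_def of_rat_diff algebra_simps)
 also have "... = x - of_int \<lfloor>q j\<rfloor> * b j" using j by (simp add: sum_subtractf q)
 finally show ?thesis by simp
 qed
 have Vy: "(emb_mat n e b *\<^sub>v y) $ i = e i (b' j)" if i: "i < n" for i
 proof -
 have "(emb_mat n e b *\<^sub>v y) $ i = (\<Sum>k<n. of_rat (if k = j then t else q k) * e i (b k))"
 using i by (auto simp: emb_mat_def y_def scalar_prod_def lessThan_atLeast0 mult.commute intro!: sum.cong)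
 also have "... = e i (x - of_int \<lfloor>q j\<rfloor> * b j)" unfolding xj
 using e_rat_comb[OF i, of n b "%k. if k = j then t else q k"] bK by simp
 finally show ?thesis by (simp add: b'_def)
 qed
 have "emb_mat n e b' = replace_col (emb_mat n e b) (emb_mat n e b *\<^sub>v y) j"
 proof (intro eq_matI)
 fix i k assume "i < dim_row (replace_col (emb_mat n e b) (emb_mat n e b *\<^sub>v y) j)"
 "k < dim_col (replace_col (emb_mat n e b) (emb_mat n e b *\<^sub>v y) j)"
 hence ik: "i < n" "k < n" by (auto simp: replace_col_def emb_mat_def)
 show "emb_mat n e b' $$ (i, k) = replace_col (emb_mat n e b) (emb_mat n e b *\<^sub>v y) j $$ (i, k)"
 proof (cases "k = j")
 case True
 have "replace_col (emb_mat n e b) (emb_mat n e b *\<^sub>v y) j $$ (i, k) = (emb_mat n e b *\<^sub>v y) $ i"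
 using ik True by (simp add: replace_col_def carrier_matD[OF emb_mat_carrier])
 thus ?thesis using Vy[OF ik(1)] True ik by (simp add: emb_mat_def)
 next
 case False
 thus ?thesis using ik by (simp add: replace_col_def emb_mat_def b'_def)
 qed
 qed (auto simp: replace_col_def emb_mat_def)
 hence det': "det (emb_mat n e b') = of_rat t * det (emb_mat n e b)"
 using cramer_lemma_mat[OF emb_mat_carrier, of y n j e b] j by (simp add: y_def)
 obtain De' :: int where De': "of_int De' = (det (emb_mat n e b'))\<^sup>2" using disc_int[of b'] b'O by blast
 have "det (emb_mat n e b') ~= 0" using det' d t by simp
 hence le: "\<bar>De\<bar> <= \<bar>De'\<bar>" by (intro min[of b' De'] b'O De')
 have "complex_of_int De' = of_rat (t\<^sup>2 * of_int De)"
 unfolding De' det' by (simp add: power_mult_distrib De of_rat_mult of_rat_power)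
 hence "complex_of_rat (of_int De') = of_rat (t\<^sup>2 * of_int De)" by simp
 hence "(of_int De' :: rat) = t\<^sup>2 * of_int De" by (simp only: of_rat_eq_iff)
 hence "(of_int \<bar>De'\<bar> :: rat) = t\<^sup>2 * of_int \<bar>De\<bar>" by (simp add: abs_mult)
 also have "... < 1 * of_int \<bar>De\<bar>"
 using t De0 by (intro mult_strict_right_mono) (auto simp: abs_square_less_1)
 finally have "(of_int \<bar>De'\<bar> :: rat) < of_int \<bar>De\<bar>" by simp
 hence "\<bar>De'\<bar> < \<bar>De\<bar>" by (simp only: of_int_less_iff)
 thus False using le by simp
 qed
 have "x = (\<Sum>i<n. of_int \<lfloor>q i\<rfloor> * b i)" unfolding q
 proof (rule sum.cong)
 fix i assume "i : {..<n}"
 hence "q i = of_int \<lfloor>q i\<rfloor>" by (intro int) simp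
 hence "(of_rat (q i) :: 'a) = of_rat (of_int \<lfloor>q i\<rfloor>)" by (rule arg_cong)
 thus "of_rat (q i) * b i = of_int \<lfloor>q i\<rfloor> * b i" by simp
 qed simp
 thus "EX c::nat=>int. x = (\<Sum>i<n. of_int (c i) * b i)" by (intro exI[of _ "%i. \<lfloor>q i\<rfloor>"])
 next
 fix c :: "nat => int" and i assume z: "(\<Sum>i<n. of_int (c i) * b i) = 0" and i: "i < n"
 have "(\<Sum>i<n. of_rat (of_int (c i)) * b i) = 0" using z by simp
 from fam_basis_rat_indep[OF bQ this i] show "c i = 0" by simp
 qed (use bO in auto)
 have disc: "discriminant K = De" unfolding discriminant_def
 proof (rule the_equality)
 define sg where "sg = map e [0..<n]"
 define om where "om = map b [0..<n]"
 have inj: "inj_on b {..<n}" "is_basis \<int> OK (b ` {..<n})"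
 using family_imp_is_basis[OF bZ] by (auto intro: Ints_diff)
 have "inj_on e {..<n}" "e ` {..<n} = Emb K" using e by (auto simp: bij_betw_def)
 hence "distinct sg" "set sg = Emb K" by (auto simp: sg_def distinct_map lessThan_atLeast0)
 moreover have "distinct om" "set om = b ` {..<n}" using inj(1)
 by (auto simp: om_def distinct_map lessThan_atLeast0)
 moreover have "mat (length om) (length om) (%(i, j). (sg ! i) (om ! j)) = emb_mat n e b"
 by (intro eq_matI) (auto simp: sg_def om_def emb_mat_def)
 ultimately show "EX om sg. distinct om & is_basis \<int> (ring_of_integers K) (set om) & distinct sg & set sg = Emb K &
 of_int De = (det (mat (length om) (length om) (%(i, j). (sg ! i) (om ! j))))\<^sup>2"
 using inj(2) De by (intro exI[of _ om] exI[of _ sg]) simp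
 next
 fix De' assume "EX om sg. distinct om & is_basis \<int> (ring_of_integers K) (set om) & distinct sg & set sg = Emb K &
 of_int De' = (det (mat (length om) (length om) (%(i, j). (sg ! i) (om ! j))))\<^sup>2"
 then obtain om sg where w: "distinct om" "is_basis \<int> OK (set om)" and s: "distinct sg" "set sg = Emb K"
 and D': "of_int De' = (det (mat (length om) (length om) (%(i, j). (sg ! i) (om ! j))))\<^sup>2" by blast
 have "0 : OK" using OK_closed(4)[of 0] by simp
 have wZ: "fam_basis \<int> OK (length om) ((!) om)"
 by (rule is_basis_imp_family[OF w(2) bij_betw_nth[OF w(1) refl refl]]) (use \<open>0 : OK\<close> in auto)
 have wn: "length om = n" using n_basis[OF fam_basis_int_to_rat[OF wZ]] .
 have sn: "length sg = n" using s n_card distinct_card[OF s(1)] by simp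
 have bij: "bij_betw ((!) sg) {..<n} (Emb K)"
 using bij_betw_nth[OF s(1) _ s(2)[symmetric], of "{..<n}"] sn by simp
 have wQ: "fam_basis \<rat> K n ((!) om)" using fam_basis_int_to_rat[OF wZ] wn by simp
 have "mat (length om) (length om) (%(i, j). (sg ! i) (om ! j)) = emb_mat n ((!) sg) ((!) om)"
 by (simp add: emb_mat_def wn)
 hence D2: "of_int De' = (det (emb_mat n e ((!) om)))\<^sup>2" using D' det_emb_mat_perm[OF bij] by simp
 have le: "\<bar>De\<bar> <= \<bar>De'\<bar>"
 by (rule min[OF _ det_emb_mat_nonzero[OF wQ] D2]) (use fam_basis_mem[OF wZ] wn in auto)
 have "EX c::nat=>int. j < n --> b j = (\<Sum>k<n. of_int (c k) * om ! k)" for j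
 using fam_basis_int_span[OF wZ, of "b j"] bO[of j] wn by auto
 then obtain P :: "nat => nat => int" where P: "!!j. j < n ==> b j = (\<Sum>k<n. of_int (P j k) * om ! k)" by metis
 define A where "A = mat n n (%(k, j). P j k)"
 have "emb_mat n e b = emb_mat n e ((!) om) * mat n n (%(k, j). of_rat (of_int (P j k)))"
 by (rule emb_mat_mult) (use P fam_basis_mem[OF wQ] in auto)
 also have "mat n n (%(k, j). of_rat (of_int (P j k))) = (map_mat of_int A :: complex mat)"
 by (intro eq_matI) (auto simp: A_def)
 finally have "det (emb_mat n e b) = det (emb_mat n e ((!) om)) * det (map_mat of_int A :: complex mat)"
 using det_mult[OF emb_mat_carrier, of "map_mat of_int A" n e "(!) om"] by (simp add: A_def)
 also have "det (map_mat of_int A :: complex mat) = of_int (det A)" by (rule of_int_hom.hom_det)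
 finally have "complex_of_int De = of_int (De' * (det A)\<^sup>2)" by (simp add: De D2 power_mult_distrib)
 \<comment> \<open>The base change between two integral bases has an integer determinant, and
   minimality of De leaves only the square 1.\<close>
 hence eq: "De = De' * (det A)\<^sup>2" by (simp only: of_int_eq_iff)
 have "(det A)\<^sup>2 ~= 0" using eq De0 by auto
 hence "(det A)\<^sup>2 > 0" by simp
 hence pos: "(det A)\<^sup>2 >= 1" by linarith
 have "\<bar>De'\<bar> * (det A)\<^sup>2 <= \<bar>De'\<bar>" using le eq by (simp add: abs_mult)
 moreover have "\<bar>De'\<bar> > 0" using eq De0 by auto
 ultimately have "(det A)\<^sup>2 <= 1" using mult_le_cancel_left_pos[of "\<bar>De'\<bar>" "(det A)\<^sup>2" 1] by simp
 hence "(det A)\<^sup>2 = 1" using pos by simp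
 thus "De' = De" using eq by simp
 qed
 show ?thesis
 proof (rule that[OF bZ bQ])
 show "of_int (discriminant K) = (det (emb_mat n e b))\<^sup>2" "discriminant K ~= 0" using disc De De0 by auto
 show "ALL c. (ALL j<n. c j : OK) --> det (emb_mat n e c) ~= 0 --> \<bar>real_of_int (discriminant K)\<bar> <= (cmod (det (emb_mat n e c)))\<^sup>2"
 proof (intro allI impI)
 fix c assume c': "ALL j<n. c j : OK" and c2: "det (emb_mat n e c) ~= 0"
 have c: "!!j. j < n ==> c j : OK" using c' by blast
 obtain De' :: int where De': "of_int De' = (det (emb_mat n e c))\<^sup>2" using disc_int[of c] c by blast
 have "\<bar>De\<bar> <= \<bar>De'\<bar>" by (intro min[of c De'] c c2 De')
 hence "real_of_int \<bar>De\<bar> <= real_of_int \<bar>De'\<bar>" by (simp only: of_int_le_iff)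
 also have "... = cmod (of_int De')" by simp
 also have "... = (cmod (det (emb_mat n e c)))\<^sup>2" unfolding De' by (simp add: norm_power)
 finally show "\<bar>real_of_int (discriminant K)\<bar> <= (cmod (det (emb_mat n e c)))\<^sup>2" using disc by simp
 qed
 qed
qed

end

section \<open>Hadamard's inequality\<close>

definition cip :: "nat => (nat => complex) => (nat => complex) => complex" where
 "cip n u v = (\<Sum>k<n. u k * cnj (v k))"

lemma cip_self: "cip n u u = of_real (\<Sum>k<n. (cmod (u k))\<^sup>2)"
 unfolding cip_def of_real_sum by (intro sum.cong) (simp_all only: complex_norm_square)

lemma cip_cnj: "cip n v u = cnj (cip n u v)"
 unfolding cip_def by (simp add: mult.commute)

lemma cip_self_0: "cip n u u = 0 ==> cip n v u = 0"
proof -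
 assume "cip n u u = 0"
 hence "(\<Sum>k<n. (cmod (u k))\<^sup>2) = 0" unfolding cip_self by (simp only: of_real_eq_0_iff)
 hence "ALL k:{..<n}. (cmod (u k))\<^sup>2 = 0" by (subst (asm) sum_nonneg_eq_0_iff) auto
 hence "ALL k<n. u k = 0" by simp
 thus ?thesis unfolding cip_def by (intro sum.neutral) auto
qed

text \<open>Gram-Schmidt without normalisation: L is unitriangular, so determinants are kept, and by
  Pythagoras each row only gets shorter.\<close>

lemma orthogonalise_rows:
 fixes A :: "nat => nat => complex"
 shows "EX B L. (ALL i<m. ALL k. A i k = (\<Sum>j<m. L i j * B j k)) & (ALL i<m. L i i = (1::complex)) & (ALL i j. i < j --> j < m --> L i j = 0) &
 (ALL i<m. ALL j<m. i ~= j --> cip n (B i) (B j) = 0) & (ALL i<m. (\<Sum>k<n. (cmod (B i k))\<^sup>2) <= (\<Sum>k<n. (cmod (A i k))\<^sup>2))"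
proof (induction m)
 case 0 show ?case by simp
 next
 case (Suc m)
 then obtain B L where H: "(ALL i<m. ALL k. A i k = (\<Sum>j<m. L i j * B j k)) & (ALL i<m. L i i = (1::complex)) & (ALL i j. i < j --> j < m --> L i j = 0) &
 (ALL i<m. ALL j<m. i ~= j --> cip n (B i) (B j) = 0) & (ALL i<m. (\<Sum>k<n. (cmod (B i k))\<^sup>2) <= (\<Sum>k<n. (cmod (A i k))\<^sup>2))" by (elim exE)
 have B: "!!i k. i < m ==> A i k = (\<Sum>j<m. L i j * B j k)" "!!i. i < m ==> L i i = 1"
 "!!i j. i < j ==> j < m ==> L i j = 0" "!!i j. i < m ==> j < m ==> i ~= j ==> cip n (B i) (B j) = 0"
 "!!i. i < m ==> (\<Sum>k<n. (cmod (B i k))\<^sup>2) <= (\<Sum>k<n. (cmod (A i k))\<^sup>2)"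
 using H by blast+
 define c where "c = (%j. cip n (A m) (B j) / cip n (B j) (B j))"
 define S where "S = (%k. \<Sum>j<m. c j * B j k)"
 define b where "b = (%k. A m k - S k)"
 define B' where "B' = B(m := b)"
 define L' where "L' = (%i j. if i = m then (if j < m then c j else if j = m then 1 else 0) else if j = m then 0 else L i j)"
 \<comment> \<open>If \<open>B j\<close> is zero, the quotient \<open>c j\<close> is 0 by the
   convention for division and the right side vanishes by \<open>cip_self_0\<close>. Dependent rows
   therefore fit in.\<close>
 have cB: "c j * cip n (B j) (B j) = cip n (A m) (B j)" for j
 using cip_self_0[of n "B j" "A m"] by (cases "cip n (B j) (B j) = 0") (auto simp: c_def)
 have SB: "cip n S (B j) = cip n (A m) (B j)" if j: "j < m" for j
 proof -
 have "cip n S (B j) = (\<Sum>k<n. \<Sum>i<m. c i * (B i k * cnj (B j k)))"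
 unfolding cip_def S_def by (simp add: sum_distrib_right mult.assoc)
 also have "... = (\<Sum>i<m. c i * cip n (B i) (B j))"
 by (subst sum.swap) (simp add: cip_def sum_distrib_left)
 also have "... = (\<Sum>i<m. if i = j then c j * cip n (B j) (B j) else 0)"
 by (intro sum.cong) (use B(4) j in auto)
 also have "... = cip n (A m) (B j)" using j cB by simp
 finally show ?thesis .
 qed
 have bB: "cip n b (B j) = 0" if "j < m" for j
 using SB[OF that] unfolding cip_def b_def by (simp add: left_diff_distrib sum_subtractf)
 have bS: "cip n b S = 0"
 proof -
 have "cip n b S = (\<Sum>k<n. \<Sum>j<m. cnj (c j) * (b k * cnj (B j k)))"
 unfolding cip_def S_def by (simp add: sum_distrib_left mult_ac)
 also have "... = (\<Sum>j<m. cnj (c j) * cip n b (B j))"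
 by (subst sum.swap) (simp add: cip_def sum_distrib_left)
 also have "... = 0" by (simp add: bB)
 finally show ?thesis .
 qed
 have "cip n (A m) (A m) = cip n b b + cip n S S + cip n b S + cip n S b"
 unfolding cip_def by (simp add: b_def algebra_simps flip: sum.distrib)
 also have "... = cip n b b + cip n S S" using bS cip_cnj[of n S b] by simp
 finally have "(\<Sum>k<n. (cmod (A m k))\<^sup>2) = (\<Sum>k<n. (cmod (b k))\<^sup>2) + (\<Sum>k<n. (cmod (S k))\<^sup>2)"
 unfolding cip_self of_real_add[symmetric] of_real_eq_iff .
 moreover have "(\<Sum>k<n. (cmod (S k))\<^sup>2) >= 0" by (intro sum_nonneg) auto
 ultimately have nb: "(\<Sum>k<n. (cmod (b k))\<^sup>2) <= (\<Sum>k<n. (cmod (A m k))\<^sup>2)" by linarith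
 show ?case
 proof (rule exI[of _ B'], rule exI[of _ L'], intro conjI allI impI)
 fix i k assume i: "i < Suc m"
 show "A i k = (\<Sum>j<Suc m. L' i j * B' j k)"
 proof (cases "i = m")
 case True
 have "(\<Sum>j<Suc m. L' i j * B' j k) = (\<Sum>j<m. c j * B j k) + b k"
 using True by (simp add: L'_def B'_def)
 thus ?thesis using True by (simp add: b_def S_def)
 next
 case False
 have "(\<Sum>j<Suc m. L' i j * B' j k) = (\<Sum>j<m. L i j * B j k)"
 using False by (simp add: L'_def B'_def)
 thus ?thesis using B(1) i False by simp
 qed
 next
 fix i j assume ij: "i < Suc m" "j < Suc m" "i ~= j"
 show "cip n (B' i) (B' j) = 0"
 using ij B(4)[of i j] bB[of j] bB[of i] cip_cnj[of n "B i" b] by (auto simp: B'_def less_Suc_eq)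
 next
 fix i assume "i < Suc m"
 thus "(\<Sum>k<n. (cmod (B' i k))\<^sup>2) <= (\<Sum>k<n. (cmod (A i k))\<^sup>2)" using B(5)[of i] nb by (auto simp: B'_def less_Suc_eq)
 qed (use B(2,3) in "auto simp: L'_def less_Suc_eq")
qed

text \<open>In A = L B the factor L has determinant 1, and B times its conjugate transpose is
  diagonal with the squared row lengths of B as entries.\<close>

theorem hadamard:
 fixes A :: "nat => nat => complex"
 shows "(cmod (det (mat n n (%(i, j). A i j))))\<^sup>2 <= (\<Prod>i<n. \<Sum>j<n. (cmod (A i j))\<^sup>2)"
proof -
 obtain B L where H: "(ALL i<n. ALL k. A i k = (\<Sum>j<n. L i j * B j k)) & (ALL i<n. L i i = (1::complex)) & (ALL i j. i < j --> j < n --> L i j = 0) &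
 (ALL i<n. ALL j<n. i ~= j --> cip n (B i) (B j) = 0) & (ALL i<n. (\<Sum>k<n. (cmod (B i k))\<^sup>2) <= (\<Sum>k<n. (cmod (A i k))\<^sup>2))"
 using orthogonalise_rows[of n A n] by (elim exE)
 have B: "!!i k. i < n ==> A i k = (\<Sum>j<n. L i j * B j k)" "!!i. i < n ==> L i i = 1"
 "!!i j. i < j ==> j < n ==> L i j = 0" "!!i j. i < n ==> j < n ==> i ~= j ==> cip n (B i) (B j) = 0"
 "!!i. i < n ==> (\<Sum>k<n. (cmod (B i k))\<^sup>2) <= (\<Sum>k<n. (cmod (A i k))\<^sup>2)"
 using H by blast+
 define MB where "MB = mat n n (%(i, j). B i j)"
 define LM where "LM = mat n n (%(i, j). L i j)"
 define MC where "MC = mat n n (%(i, j). cnj (B j i))"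
 have car: "MB : carrier_mat n n" "LM : carrier_mat n n" "MC : carrier_mat n n" by (auto simp: MB_def LM_def MC_def)
 have "mat n n (%(i, j). A i j) = LM * MB"
 by (intro eq_matI) (auto simp: MB_def LM_def B(1) scalar_prod_def lessThan_atLeast0)
 hence "det (mat n n (%(i, j). A i j)) = det LM * det MB" using det_mult[OF car(2,1)] by simp
 also have "det LM = 1"
 proof -
 have "det LM = prod_list (diag_mat LM)" by (rule det_lower_triangular[OF _ car(2)]) (auto simp: LM_def B(3))
 moreover have "diag_mat LM = map (%_. 1) [0..<n]" by (auto simp: diag_mat_def LM_def B(2))
 moreover have "prod_list (map (%_. 1) xs) = (1::complex)" for xs :: "nat list" by (induction xs) auto
 ultimately show ?thesis by simp
 qed
 finally have dA: "det (mat n n (%(i, j). A i j)) = det MB" by simp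
 have "det MC = cnj (det MB)"
 proof -
 have "MC = transpose_mat (map_mat cnj MB)" by (intro eq_matI) (auto simp: MC_def MB_def)
 hence "det MC = det (map_mat cnj MB)" using det_transpose[of "map_mat cnj MB" n] car by simp
 also have "... = cnj (det MB)"
 proof -
 have "comm_ring_hom cnj" by unfold_locales auto
 thus ?thesis by (rule comm_ring_hom.hom_det)
 qed
 finally show ?thesis .
 qed
 hence "of_real ((cmod (det MB))\<^sup>2) = det (MB * MC)"
 using det_mult[OF car(1,3)] complex_norm_square[of "det MB"] by simp
 also have "... = prod_list (diag_mat (MB * MC))"
 proof (rule det_upper_triangular)
 show "MB * MC : carrier_mat n n" using car by simp
 show "upper_triangular (MB * MC)"
 proof (rule upper_triangularI)
 fix i j assume ij: "j < i" "i < dim_row (MB * MC)"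
 hence ij': "i < n" "j < n" using car by auto
 have "(MB * MC) $$ (i, j) = cip n (B i) (B j)"
 unfolding MB_def MC_def mat_mult_sum[OF ij'] cip_def by simp
 thus "(MB * MC) $$ (i, j) = 0" using B(4)[OF ij'] ij by simp
 qed
 qed
 also have "diag_mat (MB * MC) = map (%i. of_real (\<Sum>k<n. (cmod (B i k))\<^sup>2)) [0..<n]"
 proof -
 have "(MB * MC) $$ (i, i) = of_real (\<Sum>k<n. (cmod (B i k))\<^sup>2)" if "i < n" for i
 unfolding MB_def MC_def mat_mult_sum[OF that that] cip_self[symmetric] cip_def by simp
 thus ?thesis using car by (auto simp: diag_mat_def)
 qed
 also have "prod_list (map (%i. of_real (\<Sum>k<n. (cmod (B i k))\<^sup>2)) [0..<n]) = (complex_of_real (\<Prod>i<n. \<Sum>k<n. (cmod (B i k))\<^sup>2))"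
 by (simp add: prod.distinct_set_conv_list[symmetric] lessThan_atLeast0)
 finally have "(cmod (det MB))\<^sup>2 = (\<Prod>i<n. \<Sum>k<n. (cmod (B i k))\<^sup>2)" by (simp only: of_real_eq_iff)
 also have "... <= (\<Prod>i<n. \<Sum>j<n. (cmod (A i j))\<^sup>2)"
 by (intro prod_mono) (auto intro!: B(5) sum_nonneg)
 finally show ?thesis unfolding dA .
qed

section \<open>Elements of small height lie in a proper subfield\<close>

text \<open>The logarithmic Mahler measure of the characteristic polynomial of x over K; for an
  algebraic integer, the degree of K times the absolute logarithmic height. It depends on K and not
  only on x.\<close>

definition log_mahler :: "'a::field_char_0 set => 'a => real" where
 "log_mahler K x = (SUM sg:Emb K. ln (max 1 (cmod (sg x))))"

lemma log_mahler_nonneg: "log_mahler K x >= 0"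
 unfolding log_mahler_def by (intro sum_nonneg) auto

text \<open>F has maximal degree m among the subfields with a basis of integers whose conjugates
  under sg are bounded by h(sg), the product of all h(sg) being at most exp ((m - 1) \<mu>).
  Adjoining an element of S keeps this property, so it lies in F already. If F were K, Hadamard's
  inequality would bound the discriminant by d^d exp (2 (d - 1) \<mu>).\<close>

theorem small_height_subfield:
 assumes nf: "number_field K" and S: "S <= ring_of_integers K" "!!u. u : S ==> log_mahler K u <= \<mu>" and \<mu>: "\<mu> >= 0"
 and disc: "real d * ln (real d) + 2 * (real d - 1) * \<mu> < ln \<bar>real_of_int (discriminant K)\<bar>" "d = card (Emb K)"
 obtains F where "is_subfield F" "F \<subset> K" "S <= F"
proof -
 obtain e0 where e0: "bij_betw e0 {0..<d} (Emb K)"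
 using ex_bij_betw_nat_finite[OF embeddings_finite[OF nf]] disc(2) by blast
 interpret numfield K d e0 by unfold_locales (use nf e0 in "auto simp: lessThan_atLeast0")
 define P where "P = (%F m. is_subfield F & F <= K & (EX b h. fam_basis \<rat> F m b & (ALL i<m. b i : OK) &
 (ALL sg:Emb K. h sg >= (1::real) & (ALL i<m. cmod (sg (b i)) <= h sg)) &
 (SUM sg:Emb K. ln (h sg)) <= (real m - 1) * \<mu>))"
 have P0: "P \<rat> 1"
 proof -
 have "1 : OK" using OK_closed(4)[of 1] by simp
 thus ?thesis unfolding P_def using is_subfield_Rats subfield_Rats[OF sf] fam_basis_Rats_Rats
 by (auto intro!: exI[of _ "%_. 1"] simp: embeddingsD(1))
 qed
 have bound: "m <= d" if PF: "P F m" for F m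
 proof -
 obtain b where b: "fam_basis \<rat> F m b" "F <= K" using PF unfolding P_def by blast
 obtain a where a: "fam_basis \<rat> K d a" using basis_ex by blast
 show ?thesis
 by (rule fam_basis_card_le[OF a, of m b]) (use b fam_basis_mem[OF b(1)] fam_basis_rat_indep[OF b(1)] in auto)
 qed
 define m where "m = (GREATEST m. EX F. P F m)"
 have "EX F. P F m" unfolding m_def by (rule GreatestI_nat[of _ 1 d]) (use P0 bound in auto)
 then obtain F where F: "P F m" by blast
 have mmax: "k <= m" if "P E k" for E k
 unfolding m_def by (rule Greatest_le_nat[of _ k d]) (use that bound in auto)
 obtain b h where Fs: "is_subfield F" "F <= K" and b: "fam_basis \<rat> F m b" "!!i. i < m ==> b i : OK"
 and h: "!!sg. sg : Emb K ==> h sg >= 1" "!!sg i. sg : Emb K ==> i < m ==> cmod (sg (b i)) <= h sg"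
 "(SUM sg:Emb K. ln (h sg)) <= (real m - 1) * \<mu>"
 using F unfolding P_def by blast
 have m0: "m > 0" by (rule fam_basis_pos[OF Fs(1) b(1)])
 have SF: "u : F" if u: "u : S" for u
 proof -
 have uO: "u : OK" "u : K" using u S OK_K by auto
 obtain p where p: "minpoly_over F u p" using minpoly_over_exists[OF Fs(1) number_field_algebraic[OF nf uO(2)]] by blast
 define l where "l = degree p"
 have l0: "l > 0" using minpoly_degree_pos[OF Fs(1) p] l_def by simp
 define b' where "b' = (%k. b (k mod m) * u ^ (k div m))"
 define h' where "h' = (%sg. h sg * max 1 (cmod (sg u)) ^ (l - 1))"
 have "P (adjoin F u) (m * l)" unfolding P_def
 proof -
 have a1: "is_subfield (adjoin F u)" "adjoin F u <= K" using adjoin_subfield'[OF nf Fs uO(2)] by auto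
 have a2: "fam_basis \<rat> (adjoin F u) (m * l) b'" unfolding b'_def l_def by (rule adjoin_basis[OF Fs(1) b(1) p])
 have a3: "ALL i<m * l. b' i : OK" unfolding b'_def using b(2) m0 OK_closed(3,6) uO(1) by simp
 have a4: "ALL sg:Emb K. h' sg >= 1 & (ALL i<m * l. cmod (sg (b' i)) <= h' sg)"
 proof (intro ballI conjI allI impI)
 fix sg assume s: "sg : Emb K"
 show "h' sg >= 1" unfolding h'_def using h(1)[OF s] mult_mono[of 1 "h sg" 1 "max 1 (cmod (sg u)) ^ (l - 1)"] by simp
 fix i assume i: "i < m * l"
 have "i div m < l" using i by (simp add: less_mult_imp_div_less mult.commute)
 hence im: "i mod m < m" "i div m <= l - 1" using m0 by auto
 have bK: "b (i mod m) : K" using b(2)[OF im(1)] OK_K by blast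
 have "cmod (sg (b' i)) = cmod (sg (b (i mod m))) * cmod (sg u) ^ (i div m)"
 unfolding b'_def by (simp add: emb_mult[OF sf s bK subfield_power[OF sf uO(2)]] emb_power[OF sf s uO(2)] norm_mult norm_power)
 also have "... <= h sg * max 1 (cmod (sg u)) ^ (i div m)"
 using h(2)[OF s im(1)] h(1)[OF s] by (intro mult_mono power_mono) auto
 also have "... <= h' sg" unfolding h'_def
 using h(1)[OF s] im(2) by (intro mult_left_mono power_increasing) auto
 finally show "cmod (sg (b' i)) <= h' sg" .
 qed
 have "(SUM sg:Emb K. ln (h' sg)) = (SUM sg:Emb K. ln (h sg) + real (l - 1) * ln (max 1 (cmod (sg u))))"
 proof (rule sum.cong)
 fix sg assume "sg : Emb K"
 hence "h sg > 0" using h(1) by force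
 thus "ln (h' sg) = ln (h sg) + real (l - 1) * ln (max 1 (cmod (sg u)))"
 unfolding h'_def by (simp add: ln_mult ln_realpow)
 qed simp
 also have "... = (SUM sg:Emb K. ln (h sg)) + real (l - 1) * log_mahler K u"
 unfolding log_mahler_def by (simp add: sum.distrib sum_distrib_left)
 also have "... <= (real m - 1) * \<mu> + real (l - 1) * \<mu>" using h(3) S(2)[OF u] by (intro add_mono mult_left_mono) auto
 also have "... = (real m - 1 + (real l - 1)) * \<mu>" using l0 by (simp add: of_nat_diff algebra_simps)
 \<comment> \<open>The exponents add while the degrees multiply: (m - 1) + (l - 1) is at most m l -
   1.\<close>
 also have "... <= (real (m * l) - 1) * \<mu>"
 proof (intro mult_right_mono \<mu>)
 have "0 <= (real m - 1) * (real l - 1)" using m0 l0 by (intro mult_nonneg_nonneg) auto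
 thus "real m - 1 + (real l - 1) <= real (m * l) - 1" by (simp add: algebra_simps)
 qed
 finally have a5: "(SUM sg:Emb K. ln (h' sg)) <= (real (m * l) - 1) * \<mu>" .
 show "is_subfield (adjoin F u) & adjoin F u <= K & (EX b h. fam_basis \<rat> (adjoin F u) (m * l) b & (ALL i<m * l. b i : OK) &
 (ALL sg:Emb K. h sg >= (1::real) & (ALL i<m * l. cmod (sg (b i)) <= h sg)) &
 (SUM sg:Emb K. ln (h sg)) <= (real (m * l) - 1) * \<mu>)"
 by (rule conjI[OF a1(1)], rule conjI[OF a1(2)], rule exI[of _ b'], rule exI[of _ h'], rule conjI[OF a2],
 rule conjI[OF a3], rule conjI[OF a4 a5])
 qed
 hence "m * l <= m" by (rule mmax)
 hence l1: "l = 1" using m0 l0 by simp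
 obtain c q where pc: "p = pCons c q" by (cases p)
 have "degree q = 0" "q ~= 0" using l1 unfolding l_def pc by (auto simp: degree_pCons_eq_if split: if_splits)
 then obtain a where q: "q = [:a:]" by (auto elim: degree_eq_zeroE)
 have "lead_coeff p = 1" "poly p u = 0" "poly_over F p" using minpoly_props[OF Fs(1) p] by auto
 hence "a = 1" "c + u * a = 0" "c : F" using l1 unfolding pc q l_def poly_over_def
 by (auto simp: degree_pCons_eq_if coeff_pCons split: if_splits nat.splits)
 hence "u = - c" by (simp add: eq_neg_iff_add_eq_0 add.commute)
 thus "u : F" using \<open>c : F\<close> subfield_uminus[OF Fs(1)] by simp
 qed
 have "F ~= K"
 proof
 assume FK: "F = K"
 have md: "m = d" using n_basis b(1) FK by simp
 have det: "det (emb_mat d e0 b) ~= 0" using det_emb_mat_nonzero b(1) FK md by simp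
 obtain w where "fam_basis \<int> OK d w" "fam_basis \<rat> K d w"
 "of_int (discriminant K) = (det (emb_mat d e0 w))\<^sup>2" and D: "discriminant K ~= 0"
 and Dle: "ALL c. (ALL j<d. c j : OK) --> det (emb_mat d e0 c) ~= 0 --> \<bar>real_of_int (discriminant K)\<bar> <= (cmod (det (emb_mat d e0 c)))\<^sup>2"
 using discriminant_basis by blast
 have "\<bar>real_of_int (discriminant K)\<bar> <= (cmod (det (emb_mat d e0 b)))\<^sup>2"
 using Dle b(2) md det by blast
 also have "(cmod (det (emb_mat d e0 b)))\<^sup>2 <= (\<Prod>i<d. \<Sum>j<d. (cmod (e0 i (b j)))\<^sup>2)"
 unfolding emb_mat_def by (rule hadamard)
 also have "... <= (\<Prod>i<d. real d * (h (e0 i))\<^sup>2)"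
 proof (intro prod_mono conjI sum_nonneg)
 fix i assume "i : {..<d}"
 hence s: "e0 i : Emb K" using e_emb by simp
 have "(\<Sum>j<d. (cmod (e0 i (b j)))\<^sup>2) <= (\<Sum>j<d. (h (e0 i))\<^sup>2)"
 by (intro sum_mono power_mono) (use h(2)[OF s] md in auto)
 thus "(\<Sum>j<d. (cmod (e0 i (b j)))\<^sup>2) <= real d * (h (e0 i))\<^sup>2" by simp
 qed auto
 finally have le: "\<bar>real_of_int (discriminant K)\<bar> <= (\<Prod>i<d. real d * (h (e0 i))\<^sup>2)" .
 have hp: "h (e0 i) > 0" if "i < d" for i using h(1)[OF e_emb[OF that]] by linarith
 have hn: "h (e0 i) ~= 0" if "i < d" for i using hp[OF that] by simp
 have "ln \<bar>real_of_int (discriminant K)\<bar> <= ln (\<Prod>i<d. real d * (h (e0 i))\<^sup>2)"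
 using le D by (subst ln_le_cancel_iff) (auto intro!: prod_pos mult_pos_pos simp: hp hn n_pos)
 also have "... = (\<Sum>i<d. ln (real d * (h (e0 i))\<^sup>2))"
 by (rule ln_prod) (auto intro!: mult_pos_pos simp: hn n_pos)
 also have "... = (\<Sum>i<d. ln (real d) + 2 * ln (h (e0 i)))"
 proof (rule sum.cong)
 fix i assume "i : {..<d}"
 hence "h (e0 i) > 0" using hp by simp
 thus "ln (real d * (h (e0 i))\<^sup>2) = ln (real d) + 2 * ln (h (e0 i))"
 using n_pos by (simp add: ln_mult ln_realpow)
 qed simp
 also have "... = real d * ln (real d) + 2 * (SUM sg:Emb K. ln (h sg))"
 unfolding sum_emb by (simp add: sum.distrib sum_distrib_left)
 also have "... <= real d * ln (real d) + 2 * ((real d - 1) * \<mu>)" using h(3) md by simp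
 finally show False using disc(1) by simp
 qed
 thus ?thesis using that[of F] Fs SF by blast
qed

section \<open>Confluent Vandermonde determinants\<close>

text \<open>For nodes with repetitions, the order of the derivative that belongs to position
  i.\<close>

definition prev_count :: "(nat => 'b) => nat => nat" where
 "prev_count y i = card {l. l < i & y l = y i}"

text \<open>Row i lists the derivatives of order m of 1, X, X^2, ... at \<open>y i\<close>, divided
  by m!, where m is \<open>prev_count y i\<close>. For j < m the binomial coefficient is 0, so the
  truncated subtraction is harmless.\<close>

definition confluent :: "nat => (nat => complex) => complex mat" where
 "confluent n y = mat n n (%(i, j). of_nat (j choose prev_count y i) * y i ^ (j - prev_count y i))"

lemma pcompose_power': "pcompose (p ^ k) q = pcompose p q ^ k" for p q :: "'b::comm_ring_1 poly"
 by (induction k) (auto simp: pcompose_mult)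

lemma coeff_shift_power: "coeff ([:y, 1:] ^ k) m = of_nat (k choose m) * y ^ (k - m)" for y :: complex
 using coeff_linear_poly_power[of m k y 1]
 by (cases "m <= k") (auto simp: coeff_eq_0 degree_linear_power)

text \<open>Taylor coefficients at y: the right side is a row of \<open>confluent\<close> for the
  node y and the order m, applied to the coefficients of p.\<close>

lemma coeff_pcompose_shift:
 fixes p :: "complex poly"
 assumes "degree p < n"
 shows "coeff (pcompose p [:y, 1:]) m = (\<Sum>k<n. coeff p k * (of_nat (k choose m) * y ^ (k - m)))"
proof -
 have "pcompose p [:y, 1:] = pcompose (\<Sum>k\<le>degree p. monom (coeff p k) k) [:y, 1:]"
 by (simp add: poly_as_sum_of_monoms)
 also have "... = (\<Sum>k\<le>degree p. Polynomial.smult (coeff p k) ([:y, 1:] ^ k))"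
 unfolding pcompose_sum
 proof (rule sum.cong)
 fix k
 have "monom (coeff p k) k = Polynomial.smult (coeff p k) ([:0, 1:] ^ k)"
 by (simp add: monom_altdef)
 thus "pcompose (monom (coeff p k) k) [:y, 1:] = Polynomial.smult (coeff p k) ([:y, 1:] ^ k)"
 by (simp add: pcompose_smult pcompose_power' pcompose_pCons)
 qed simp
 finally have "coeff (pcompose p [:y, 1:]) m = (\<Sum>k\<le>degree p. coeff p k * coeff ([:y, 1:] ^ k) m)"
 by (simp add: coeff_sum)
 also have "... = (\<Sum>k\<le>degree p. coeff p k * (of_nat (k choose m) * y ^ (k - m)))"
 by (simp add: coeff_shift_power)
 also have "... = (\<Sum>k<n. coeff p k * (of_nat (k choose m) * y ^ (k - m)))"
 by (rule sum.mono_neutral_left) (use assms in "auto simp: coeff_eq_0")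
 finally show ?thesis .
qed

lemma prod_linear_zeros:
 fixes c :: "nat => complex"
 assumes "finite I"
 shows "(PROD l:I. [:c l, 1:]) = monom 1 (card {l : I. c l = 0}) * (PROD l:{l : I. c l ~= 0}. [:c l, 1:])"
proof -
 have "(PROD l:I. [:c l, 1:]) = (PROD l:{l : I. c l = 0}. [:c l, 1:]) * (PROD l:{l : I. c l ~= 0}. [:c l, 1:])"
 using assms by (subst prod.union_disjoint[symmetric]) (auto intro!: prod.cong)
 also have "(PROD l:{l : I. c l = 0}. [:c l, 1:]) = (PROD l:{l : I. c l = 0}. [:0, 1:])"
 by (intro prod.cong) auto
 also have "... = monom 1 (card {l : I. c l = 0})" by (simp add: monom_altdef)
 finally show ?thesis .
qed

text \<open>\<open>g j\<close> is the Newton polynomial of the first j nodes. Shifted to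
  \<open>y i\<close> it is divisible by X^c, with c the number of these nodes equal to
  \<open>y i\<close>. For j > i this c exceeds \<open>prev_count y i\<close>, for j = i it equals
  it.\<close>

lemma confluent_newton:
 fixes y :: "nat => complex"
 assumes "i < n" "j < n"
 defines "g \<equiv> %j. \<Prod>l<j. [:- y l, 1:]"
 shows "i < j ==> coeff (pcompose (g j) [:y i, 1:]) (prev_count y i) = 0"
 and "coeff (pcompose (g i) [:y i, 1:]) (prev_count y i) = (PROD l:{l. l < i & y l ~= y i}. y i - y l)"
proof -
 have pc: "pcompose (g j) [:y i, 1:] = monom 1 (card {l. l < j & y l = y i}) * (PROD l:{l. l < j & y l ~= y i}. [:y i - y l, 1:])" for j
 proof -
 have "pcompose (g j) [:y i, 1:] = (\<Prod>l<j. [:y i - y l, 1:])"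
 unfolding g_def pcompose_prod by (intro prod.cong) (auto simp: pcompose_pCons)
 also have "... = monom 1 (card {l : {..<j}. y i - y l = 0}) * (PROD l:{l : {..<j}. y i - y l ~= 0}. [:y i - y l, 1:])"
 by (rule prod_linear_zeros) simp
 also have "{l : {..<j}. y i - y l = 0} = {l. l < j & y l = y i}" by auto
 also have "{l : {..<j}. y i - y l ~= 0} = {l. l < j & y l ~= y i}" by auto
 finally show ?thesis .
 qed
 {
 assume ij: "i < j"
 have "prev_count y i < card {l. l < j & y l = y i}" unfolding prev_count_def
 by (rule psubset_card_mono) (use ij in auto)
 thus "coeff (pcompose (g j) [:y i, 1:]) (prev_count y i) = 0"
 unfolding pc coeff_monom_mult by simp
 }
 have "coeff (pcompose (g i) [:y i, 1:]) (prev_count y i) = coeff (PROD l:{l. l < i & y l ~= y i}. [:y i - y l, 1:]) 0"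
 unfolding pc coeff_monom_mult by (simp add: prev_count_def)
 also have "... = (PROD l:{l. l < i & y l ~= y i}. y i - y l)"
 unfolding poly_0_coeff_0[symmetric] poly_prod by simp
 finally show "coeff (pcompose (g i) [:y i, 1:]) (prev_count y i) = (PROD l:{l. l < i & y l ~= y i}. y i - y l)" .
qed

text \<open>Multiplication by the unitriangular coefficient matrix of the Newton polynomials makes
  the confluent matrix lower triangular.\<close>

lemma det_confluent:
 "det (confluent n y) = (\<Prod>i<n. PROD l:{l. l < i & y l ~= y i}. y i - y l)"
proof -
 define g where "g = (%j. \<Prod>l<j. [:- y l, 1:])"
 define G where "G = mat n n (%(k, j). coeff (g j) k)"
 have deg: "degree (g j) = j" for j unfolding g_def by (subst degree_prod_eq_sum_degree) auto
 have lc: "coeff (g j) j = 1" for j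
 using coeff_prod_linear_factors[of "{..<j}" y] unfolding g_def by simp
 have G: "G : carrier_mat n n" by (simp add: G_def)
 have V: "confluent n y : carrier_mat n n" by (simp add: confluent_def)
 have "det G = prod_list (diag_mat G)"
 by (rule det_upper_triangular[OF _ G]) (auto simp: G_def coeff_eq_0 deg)
 also have "diag_mat G = map (%_. 1) [0..<n]" by (auto simp: diag_mat_def G_def lc)
 also have "prod_list (map (%_. 1) [0..<n]) = (1::complex)"
 proof -
 have "prod_list (map (%_. 1) xs) = (1::complex)" for xs :: "nat list" by (induction xs) auto
 thus ?thesis .
 qed
 finally have dG: "det G = 1" .
 have VG: "(confluent n y * G) $$ (i, j) = coeff (pcompose (g j) [:y i, 1:]) (prev_count y i)" if "i < n" "j < n" for i j
 unfolding confluent_def G_def mat_mult_sum[OF that]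
 using coeff_pcompose_shift[of "g j" n "y i" "prev_count y i"] that deg by (simp add: mult.commute)
 have "det (confluent n y) = det (confluent n y * G)" using det_mult[OF V G] dG by simp
 also have "... = prod_list (diag_mat (confluent n y * G))"
 proof (rule det_lower_triangular)
 show "confluent n y * G : carrier_mat n n" using V G by simp
 fix i j assume ij: "i < j" "j < n"
 thus "(confluent n y * G) $$ (i, j) = 0"
 using VG[of i j] confluent_newton(1)[of i n j y] unfolding g_def by simp
 qed
 also have "diag_mat (confluent n y * G) = map (%i. PROD l:{l. l < i & y l ~= y i}. y i - y l) [0..<n]"
 using V G VG confluent_newton(2)[of _ n _ y] unfolding diag_mat_def g_def by auto
 finally show ?thesis by (simp add: prod.distinct_set_conv_list[symmetric] lessThan_atLeast0)
qed

text \<open>The value 1 on the diagonal lets products run over all pairs of nodes, repetitions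
  included.\<close>

definition sep :: "complex => complex => real" where
 "sep z w = (if z = w then 1 else cmod (z - w))"

lemma sep_commute: "sep z w = sep w z" by (simp add: sep_def norm_minus_commute)
lemma sep_self [simp]: "sep z z = 1" by (simp add: sep_def)
lemma sep_pos: "sep z w > 0" by (simp add: sep_def)

lemma norm_det_confluent: "(cmod (det (confluent n y)))\<^sup>2 = (\<Prod>i<n. \<Prod>l<n. sep (y i) (y l))"
proof -
 have "cmod (det (confluent n y)) = (\<Prod>i<n. \<Prod>l<i. sep (y i) (y l))"
 unfolding det_confluent prod_norm[symmetric]
 proof (rule prod.cong)
 fix i
 have "(\<Prod>l<i. sep (y i) (y l)) = (PROD l:{l. l < i & y l ~= y i}. sep (y i) (y l))"
 by (rule prod.mono_neutral_right) (auto simp: sep_def)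
 thus "(PROD l:{l. l < i & y l ~= y i}. cmod (y i - y l)) = (\<Prod>l<i. sep (y i) (y l))"
 by (auto simp: sep_def intro!: prod.cong)
 qed simp
 moreover have "(\<Prod>i<n. \<Prod>l<i. sep (y i) (y l))\<^sup>2 = (\<Prod>i<n. \<Prod>l<n. sep (y i) (y l))"
 proof (induction n)
 case (Suc n)
 have "(\<Prod>i<Suc n. \<Prod>l<Suc n. sep (y i) (y l)) = (\<Prod>i<n. (\<Prod>l<n. sep (y i) (y l)) * sep (y i) (y n)) * (\<Prod>l<n. sep (y n) (y l))"
 by simp
 also have "... = (\<Prod>i<n. \<Prod>l<n. sep (y i) (y l)) * (\<Prod>i<n. sep (y n) (y i)) * (\<Prod>l<n. sep (y n) (y l))"
 by (simp add: prod.distrib sep_commute[of _ "y n"])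
 finally have E: "(\<Prod>i<Suc n. \<Prod>l<Suc n. sep (y i) (y l)) =
 (\<Prod>i<n. \<Prod>l<n. sep (y i) (y l)) * (\<Prod>i<n. sep (y n) (y i)) * (\<Prod>l<n. sep (y n) (y l))" .
 have "(\<Prod>i<Suc n. \<Prod>l<i. sep (y i) (y l))\<^sup>2 = (\<Prod>i<n. \<Prod>l<i. sep (y i) (y l))\<^sup>2 * ((\<Prod>i<n. sep (y n) (y i)) * (\<Prod>l<n. sep (y n) (y l)))"
 by (simp add: power2_eq_square mult_ac)
 thus ?case by (simp only: Suc E mult.assoc)
 qed simp
 ultimately show ?thesis by simp
qed

text \<open>The occurrences of a value z in the list have \<open>prev_count\<close> 0, 1, 2, ..., so
  a product over positions can be regrouped by values and orders.\<close>

lemma prod_prev_count: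
 fixes R :: "'b => nat => 'c::comm_monoid_mult"
 shows "(\<Prod>i<length ys. R (ys ! i) (prev_count ((!) ys) i)) = (PROD z:set ys. \<Prod>m<count_list ys z. R z m)"
proof (induction ys rule: rev_induct)
 case Nil show ?case by simp
next
 case (snoc x ys)
 have pc: "prev_count ((!) (ys @ [x])) i = prev_count ((!) ys) i" if "i < length ys" for i
 unfolding prev_count_def using that by (intro arg_cong[of _ _ card]) (auto simp: nth_append)
 have last: "prev_count ((!) (ys @ [x])) (length ys) = count_list ys x"
 proof -
 have "{l. l < length ys & (ys @ [x]) ! l = (ys @ [x]) ! length ys} = {l. l < length ys & x = ys ! l}"
 by (auto simp: nth_append)
 thus ?thesis unfolding prev_count_def count_list_eq_length_filter length_filter_conv_card by simp
 qed
 have "(\<Prod>i<length (ys @ [x]). R ((ys @ [x]) ! i) (prev_count ((!) (ys @ [x])) i)) =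
 (\<Prod>i<length ys. R (ys ! i) (prev_count ((!) ys) i)) * R x (count_list ys x)"
 by (simp add: pc last nth_append)
 also have "... = (PROD z:set ys. \<Prod>m<count_list ys z. R z m) * R x (count_list ys x)" using snoc by simp
 also have "... = (PROD z:insert x (set ys). \<Prod>m<count_list (ys @ [x]) z. R z m)"
 proof (cases "x : set ys")
 case True
 hence "(PROD z:insert x (set ys). \<Prod>m<count_list (ys @ [x]) z. R z m) = (PROD z:insert x (set ys - {x}). \<Prod>m<count_list (ys @ [x]) z. R z m)"
 by (simp add: insert_absorb)
 also have "... = (\<Prod>m<count_list ys x. R x m) * R x (count_list ys x) * (PROD z:set ys - {x}. \<Prod>m<count_list ys z. R z m)"
 proof -
 have "(PROD z:set ys - {x}. \<Prod>m<count_list (ys @ [x]) z. R z m) = (PROD z:set ys - {x}. \<Prod>m<count_list ys z. R z m)"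
 by (intro prod.cong) auto
 moreover have "(\<Prod>m<count_list (ys @ [x]) x. R x m) = (\<Prod>m<count_list ys x. R x m) * R x (count_list ys x)" by simp
 ultimately show ?thesis by (subst prod.insert) (simp_all only: finite_set finite_Diff Diff_iff singletonI not_True_eq_False simp_thms)
 qed
 also have "... = (PROD z:set ys. \<Prod>m<count_list ys z. R z m) * R x (count_list ys x)"
 using prod.remove[of "set ys" x "%z. \<Prod>m<count_list ys z. R z m"] True by (simp add: mult_ac)
 finally show ?thesis by simp
 next
 case False
 hence c: "count_list ys x = 0" by (simp add: count_list_0_iff)
 have "(PROD z:insert x (set ys). \<Prod>m<count_list (ys @ [x]) z. R z m) = (\<Prod>m<count_list (ys @ [x]) x. R x m) * (PROD z:set ys. \<Prod>m<count_list (ys @ [x]) z. R z m)"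
 using False by simp
 also have "(PROD z:set ys. \<Prod>m<count_list (ys @ [x]) z. R z m) = (PROD z:set ys. \<Prod>m<count_list ys z. R z m)"
 using False by (intro prod.cong) auto
 finally show ?thesis using c by (simp add: mult_ac)
 qed
 finally show ?case by simp
qed

lemma list_with_counts:
 assumes "finite Z"
 shows "EX ys. ALL z. count_list ys z = (if z : Z then M z else 0)"
 using assms
proof (induction Z rule: finite_induct)
 case empty show ?case by (auto intro: exI[of _ "[]"])
next
 case (insert x Z)
 then obtain ys where ys: "ALL z. count_list ys z = (if z : Z then M z else 0)" by blast
 have rep: "count_list (replicate k x) z = (if z = x then k else 0)" for k z by (induction k) auto
 show ?case using ys insert.hyps by (intro exI[of _ "ys @ replicate (M x) x"]) (auto simp: rep)
qed

text \<open>A sum compared with the integral of x^(2m) over [0, N]; the induction step is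
  Bernoulli's inequality.\<close>

lemma sum_powers_le: "(2 * m + 1) * (\<Sum>j<N. j ^ (2 * m)) <= N ^ (2 * m + 1)" for N m :: nat
proof (induction N)
 case (Suc N)
 have bern: "N ^ (a + 1) + (a + 1) * N ^ a <= (N + 1) ^ (a + 1)" for a
 proof (induction a)
 case (Suc a)
 have "N ^ (Suc a + 1) + (Suc a + 1) * N ^ Suc a <= (N + 1) * (N ^ (a + 1) + (a + 1) * N ^ a)"
 by (simp add: algebra_simps)
 also have "... <= (N + 1) * (N + 1) ^ (a + 1)" by (rule mult_left_mono[OF Suc]) simp
 finally show ?case by simp
 qed simp
 have "(2 * m + 1) * (\<Sum>j<Suc N. j ^ (2 * m)) <= N ^ (2 * m + 1) + (2 * m + 1) * N ^ (2 * m)"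
 using Suc by (simp add: algebra_simps)
 also have "... <= Suc N ^ (2 * m + 1)" using bern[of "2 * m"] by simp
 finally show ?case .
qed simp

text \<open>The integral of (x^m / m!)^2 over [0, N]. It bounds the squared length of a confluent
  row of order m at a node in the unit disc.\<close>

definition row_const :: "nat => nat => real" where
 "row_const N m = real N ^ (2 * m + 1) / ((fact m)\<^sup>2 * real (2 * m + 1))"

lemma confluent_row_bound:
 fixes y :: complex
 shows "(\<Sum>j<N. (cmod (of_nat (j choose m) * y ^ (j - m)))\<^sup>2) <= max 1 (cmod y) ^ (2 * N) * row_const N m"
proof -
 have tm: "(cmod (of_nat (j choose m) * y ^ (j - m)))\<^sup>2 <= max 1 (cmod y) ^ (2 * N) * (real j ^ (2 * m) / (fact m)\<^sup>2)" if j: "j < N" for j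
 proof -
 have "real ((j choose m) * fact m) <= real (j ^ m)" using binomial_fact_pow[of j m] by (simp only: of_nat_le_iff)
 hence "real (j choose m) <= real j ^ m / fact m" by (simp add: field_simps)
 hence b: "(real (j choose m))\<^sup>2 <= real j ^ (2 * m) / (fact m)\<^sup>2"
 using power_mono[of "real (j choose m)" "real j ^ m / fact m" 2] by (simp add: power_divide power_mult mult.commute flip: power_mult)
 have "cmod y ^ (j - m) <= max 1 (cmod y) ^ (j - m)" by (intro power_mono) auto
 also have "... <= max 1 (cmod y) ^ N" using j by (intro power_increasing) auto
 finally have "(cmod y ^ (j - m))\<^sup>2 <= (max 1 (cmod y) ^ N)\<^sup>2" by (intro power_mono) auto
 also have "... = max 1 (cmod y) ^ (2 * N)" by (simp add: power_mult mult.commute flip: power_mult)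
 finally have "(cmod y ^ (j - m))\<^sup>2 <= max 1 (cmod y) ^ (2 * N)" .
 with b have "(real (j choose m))\<^sup>2 * (cmod y ^ (j - m))\<^sup>2 <= (real j ^ (2 * m) / (fact m)\<^sup>2) * max 1 (cmod y) ^ (2 * N)"
 by (intro mult_mono) auto
 thus ?thesis by (simp add: norm_mult norm_power power_mult_distrib mult.commute)
 qed
 have "(\<Sum>j<N. (cmod (of_nat (j choose m) * y ^ (j - m)))\<^sup>2) <= (\<Sum>j<N. max 1 (cmod y) ^ (2 * N) * (real j ^ (2 * m) / (fact m)\<^sup>2))"
 by (intro sum_mono tm) auto
 also have "... = max 1 (cmod y) ^ (2 * N) * ((\<Sum>j<N. real j ^ (2 * m)) / (fact m)\<^sup>2)"
 by (simp add: sum_distrib_left sum_divide_distrib)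
 also have "... <= max 1 (cmod y) ^ (2 * N) * row_const N m"
 proof (rule mult_left_mono)
 have "real ((2 * m + 1) * (\<Sum>j<N. j ^ (2 * m))) <= real (N ^ (2 * m + 1))"
 using sum_powers_le[of m N] by (simp only: of_nat_le_iff)
 hence "(\<Sum>j<N. real j ^ (2 * m)) <= real N ^ (2 * m + 1) / real (2 * m + 1)"
 by (simp add: field_simps)
 hence "(\<Sum>j<N. real j ^ (2 * m)) / (fact m)\<^sup>2 <= real N ^ (2 * m + 1) / real (2 * m + 1) / (fact m)\<^sup>2"
 by (intro divide_right_mono) auto
 thus "(\<Sum>j<N. real j ^ (2 * m)) / (fact m)\<^sup>2 <= row_const N m" by (simp add: row_const_def mult.commute)
 qed auto
 finally show ?thesis .
qed

lemma row_const_pos: "N > 0 ==> row_const N m > 0"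
 unfolding row_const_def by (auto intro!: divide_pos_pos mult_pos_pos)

text \<open>Each node z in Z is repeated \<open>M z\<close> times. The left side is then the squared
  confluent determinant, and the right side collects the bounds for the squared row lengths.\<close>

theorem confluent_hadamard:
 fixes Z :: "complex set"
 assumes Z: "finite Z" and N: "N = (SUM z:Z. M z)"
 shows "(PROD z:Z. PROD w:Z. sep z w ^ (M z * M w)) <= (PROD z:Z. \<Prod>m<M z. max 1 (cmod z) ^ (2 * N) * row_const N m)"
proof -
 obtain ys where ys: "ALL z. count_list ys z = (if z : Z then M z else 0)" using list_with_counts[OF Z] by blast
 have sub: "set ys <= Z"
 proof
 fix z assume "z : set ys"
 hence "count_list ys z ~= 0" by (simp add: count_list_0_iff)
 thus "z : Z" using ys by (auto split: if_splits)
 qed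
 have zero: "M z = 0" if "z : Z - set ys" for z
 using ys that count_list_0_iff[of ys z] by auto
 have len: "length ys = N" unfolding N using sum_count_set[OF sub Z] ys by (simp cong: sum.cong)
 have conv: "(PROD z:set ys. \<Prod>m<count_list ys z. R z m) = (PROD z:Z. \<Prod>m<M z. R z m)" for R :: "complex => nat => real"
 proof -
 have "(PROD z:set ys. \<Prod>m<count_list ys z. R z m) = (PROD z:set ys. \<Prod>m<M z. R z m)"
 using ys sub by (intro prod.cong) auto
 also have "... = (PROD z:Z. \<Prod>m<M z. R z m)" by (rule prod.mono_neutral_left[OF Z sub]) (use zero in auto)
 finally show ?thesis .
 qed
 have single: "(\<Prod>i<length ys. h (ys ! i)) = (PROD z:Z. h z ^ M z)" for h :: "complex => real"
 using prod_prev_count[of "%z m. h z" ys] conv[of "%z m. h z"] by simp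
 have "(PROD z:Z. PROD w:Z. sep z w ^ (M z * M w)) = (PROD z:Z. (PROD w:Z. sep z w ^ M w) ^ M z)"
 by (simp add: prod_power_distrib mult.commute flip: power_mult)
 also have "... = (\<Prod>i<length ys. \<Prod>l<length ys. sep (ys ! i) (ys ! l))"
 unfolding single[symmetric] by simp
 also have "... = (cmod (det (confluent N ((!) ys))))\<^sup>2" unfolding norm_det_confluent len by simp
 also have "... <= (\<Prod>i<N. \<Sum>j<N. (cmod (of_nat (j choose prev_count ((!) ys) i) * (ys ! i) ^ (j - prev_count ((!) ys) i)))\<^sup>2)"
 unfolding confluent_def by (rule hadamard)
 also have "... <= (\<Prod>i<length ys. max 1 (cmod (ys ! i)) ^ (2 * N) * row_const N (prev_count ((!) ys) i))"
 unfolding len by (intro prod_mono conjI confluent_row_bound sum_nonneg) auto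
 also have "... = (PROD z:Z. \<Prod>m<M z. max 1 (cmod z) ^ (2 * N) * row_const N m)"
 using prod_prev_count[of "%z m. max 1 (cmod z) ^ (2 * N) * row_const N m" ys] conv by simp
 finally show ?thesis .
qed

lemma sep_nz: "sep z w ~= 0"
 using sep_pos[of z w] by simp

section \<open>The Frobenius congruence\<close>

lemma prime_dvd_binomial:
 assumes p: "prime (p::nat)" and k: "0 < k" "k < p" shows "p dvd (p choose k)"
proof -
 have "k * (p choose k) = p * ((p - 1) choose (k - 1))" using times_binomial_minus1_eq[OF k(1)] by simp
 hence "p dvd k * (p choose k)" by simp
 thus ?thesis using p k by (auto simp: prime_dvd_mult_iff dest: dvd_imp_le)
qed

lemma freshman_dream:
 fixes x y :: "'b::comm_ring_1"
 assumes p: "prime p" shows "of_nat p dvd (x + y) ^ p - x ^ p - y ^ p"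
proof -
 let ?f = "%k. of_nat (p choose k) * x ^ k * y ^ (p - k)"
 have p0: "p > 0" using p prime_gt_0_nat by blast
 have "{..p} = insert 0 (insert p {0<..<p})" using p0 by auto
 hence "(x + y) ^ p = ?f 0 + (?f p + sum ?f {0<..<p})" using p0 by (simp add: binomial_ring)
 hence "(x + y) ^ p - x ^ p - y ^ p = sum ?f {0<..<p}" by simp
 also have "of_nat p dvd ..."
 proof (rule dvd_sum)
 fix k assume "k : {0<..<p}"
 hence "p dvd (p choose k)" using prime_dvd_binomial[OF p] by auto
 hence "of_nat p dvd (of_nat (p choose k) :: 'b)" by (auto simp: dvd_def)
 thus "of_nat p dvd ?f k" by (simp add: mult.assoc)
 qed
 finally show ?thesis .
qed

lemma fermat_int: assumes p: "prime p" shows "int p dvd a ^ p - a"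
proof (induction a rule: int_induct[of _ 0])
 case base show ?case using prime_gt_0_nat[OF p] by (simp add: zero_power)
next
 case (step1 i)
 have "int p dvd ((i + 1) ^ p - i ^ p - 1 ^ p) + (i ^ p - i)"
 using freshman_dream[OF p, of i 1] step1 by (intro dvd_add) auto
 moreover have "((i + 1) ^ p - i ^ p - 1 ^ p) + (i ^ p - i) = (i + 1) ^ p - (i + 1)" by simp
 ultimately show ?case by (simp only:)
next
 case (step2 i)
 have "int p dvd ((i - 1) + 1) ^ p - (i - 1) ^ p - 1 ^ p" using freshman_dream[OF p, of "i - 1" 1] by simp
 hence "int p dvd (i ^ p - i) - (((i - 1) + 1) ^ p - (i - 1) ^ p - 1 ^ p)"
 by (rule dvd_diff[OF step2(2)])
 moreover have "(i ^ p - i) - (((i - 1) + 1) ^ p - (i - 1) ^ p - 1 ^ p) = (i - 1) ^ p - (i - 1)" by simp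
 ultimately show ?case by (simp only:)
qed

text \<open>At a root x of f it says that f(x^p) is p times the value of an integer polynomial at x.
  This is where primes enter Dobrowolski's argument.\<close>

lemma frobenius_poly:
 fixes f :: "int poly" assumes p: "prime p"
 shows "of_nat p dvd (pcompose f (monom 1 p) - f ^ p)"
proof (induction f)
 case 0 show ?case using prime_gt_0_nat[OF p] by (simp add: zero_power)
next
 case (pCons a f)
 let ?X = "[:0, 1:] :: int poly"
 have eq: "pCons a f = [:a:] + ?X * f" by simp
 have "pcompose (pCons a f) (monom 1 p) = [:a:] + ?X ^ p * pcompose f (monom 1 p)"
 by (simp add: pcompose_pCons monom_altdef)
 hence "pcompose (pCons a f) (monom 1 p) - pCons a f ^ p =
 - ([:a:] ^ p - [:a:]) + ?X ^ p * (pcompose f (monom 1 p) - f ^ p) - (([:a:] + ?X * f) ^ p - [:a:] ^ p - (?X * f) ^ p)"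
 unfolding eq by (simp only: power_mult_distrib) (simp add: algebra_simps)
 moreover have "of_nat p dvd [:a:] ^ p - [:a:]"
 proof -
 obtain c where "a ^ p - a = int p * c" using fermat_int[OF p, of a] by (auto simp: dvd_def)
 hence "[:a ^ p - a:] = of_nat p * [:c:]" by (simp add: of_nat_poly)
 moreover have "[:a:] ^ p - [:a:] = [:a ^ p - a:]" by (simp add: poly_const_pow)
 ultimately have "[:a:] ^ p - [:a:] = of_nat p * [:c:]" by (simp only:)
 thus ?thesis by (rule dvdI)
 qed
 moreover have "of_nat p dvd (([:a:] + ?X * f) ^ p - [:a:] ^ p - (?X * f) ^ p)" by (rule freshman_dream[OF p])
 ultimately show ?case using dvd_diff[OF dvd_add[OF _ dvd_mult[OF pCons.IH]]] by (simp only: dvd_minus_iff)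
qed

lemma ln_max_power: "ln (max 1 (r ^ q)) = real q * ln (max 1 r)" if "r >= 0" for r :: real
proof (cases "r >= 1")
 case True thus ?thesis by (simp add: max_def ln_realpow)
next
 case False
 hence "r ^ q <= 1" using that by (simp add: power_le_one)
 thus ?thesis using False by (simp add: max_def)
qed

section \<open>Cantor and Straus' determinant inequality\<close>

context numfield
begin

lemma norm_ge_1: assumes x: "x : OK" "x ~= 0" shows "(PROD sg:Emb K. cmod (sg x)) >= 1"
proof -
 obtain N :: int and y where N: "(PROD sg:Emb K. sg x) = of_int N" "y : OK" "x * y = of_int N" "N = 0 \<longleftrightarrow> x = 0"
 using norm_int[OF x(1)] by blast
 have "(PROD sg:Emb K. cmod (sg x)) = cmod (of_int N)" unfolding N(1)[symmetric] by (simp add: prod_norm)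
 also have "... >= 1" using N(4) x(2) by simp
 finally show ?thesis .
qed

lemma resultant_norm:
 assumes x: "x : OK" and z: "z : OK"
 obtains f :: "int poly" where "poly (map_poly of_int f) z = 0"
 "(PROD sg:Emb K. PROD tu:Emb K. cmod (sg x - tu z)) = (PROD sg:Emb K. cmod (sg (poly (map_poly of_int f) x)))"
proof -
 obtain f :: "int poly" where f: "map_poly of_int f = (PROD tu:Emb K. [:- tu z, 1:])" "poly (map_poly of_int f) z = 0"
 using char_poly_int[OF z] by blast
 have "(PROD tu:Emb K. cmod (sg x - tu z)) = cmod (sg (poly (map_poly of_int f) x))" if "sg : Emb K" for sg
 unfolding emb_poly_int[OF sf that OK_K[OF x]] f(1) poly_prod by (simp add: prod_norm)
 thus ?thesis using that[OF f(2)] by simp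
qed

lemma disjoint_resultant_ge_1:
 assumes x: "x : OK" and z: "z : OK" and ne: "ALL sg:Emb K. ALL tu:Emb K. sg x ~= tu z"
 shows "(PROD sg:Emb K. PROD tu:Emb K. sep (sg x) (tu z)) >= 1"
proof -
 obtain f :: "int poly" where f: "poly (map_poly of_int f) z = 0"
 "(PROD sg:Emb K. PROD tu:Emb K. cmod (sg x - tu z)) = (PROD sg:Emb K. cmod (sg (poly (map_poly of_int f) x)))"
 using resultant_norm[OF x z] by blast
 have eq: "(PROD sg:Emb K. PROD tu:Emb K. sep (sg x) (tu z)) = (PROD sg:Emb K. PROD tu:Emb K. cmod (sg x - tu z))"
 using ne by (intro prod.cong refl) (auto simp: sep_def)
 have "(PROD sg:Emb K. PROD tu:Emb K. sep (sg x) (tu z)) > 0" by (intro prod_pos) (auto simp: sep_pos sep_nz)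
 hence nz: "(PROD sg:Emb K. cmod (sg (poly (map_poly of_int f) x))) ~= 0" using eq f(2) by simp
 have "poly (map_poly of_int f) x ~= 0"
 proof
 assume "poly (map_poly of_int f) x = 0"
 hence "cmod (e 0 (poly (map_poly of_int f) x)) = 0" using emb_0[OF sf e_emb[OF n_pos]] by simp
 hence "(PROD sg:Emb K. cmod (sg (poly (map_poly of_int f) x))) = 0"
 using e_emb[OF n_pos] embeddings_finite[OF nf] by (intro prod_zero) auto
 thus False using nz by simp
 qed
 thus ?thesis unfolding eq f(2) by (intro norm_ge_1 OK_poly x)
qed

text \<open>With f the characteristic polynomial of x, f(x^p) is p y for an integer y of K by the
  Frobenius congruence. As the product of the \<open>sep\<close> values is positive, y is nonzero,
  so the norm of p y is at least p^n in absolute value.\<close>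

lemma prime_resultant_ge:
 assumes x: "x : OK" and p: "prime p" and ne: "ALL sg:Emb K. ALL tu:Emb K. sg (x ^ p) ~= tu x"
 shows "(PROD sg:Emb K. PROD tu:Emb K. sep (sg (x ^ p)) (tu x)) >= real p ^ n"
proof -
 have xp: "x ^ p : OK" using OK_closed(6)[OF x] .
 obtain f :: "int poly" where f: "poly (map_poly of_int f) x = 0"
 "(PROD sg:Emb K. PROD tu:Emb K. cmod (sg (x ^ p) - tu x)) = (PROD sg:Emb K. cmod (sg (poly (map_poly of_int f) (x ^ p))))"
 using resultant_norm[OF xp x] by blast
 obtain h :: "int poly" where h: "pcompose f (monom 1 p) - f ^ p = of_nat p * h"
 using frobenius_poly[OF p, of f] by (auto simp: dvd_def)
 have "poly (map_poly of_int (pcompose f (monom 1 p))) x = poly (map_poly of_int f) (x ^ p)"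
 by (simp add: of_int_hom.map_poly_pcompose poly_pcompose map_poly_monom poly_monom)
 moreover have "poly (map_poly of_int (f ^ p)) x = 0"
 using f(1) prime_gt_0_nat[OF p] by (simp add: of_int_poly_hom.hom_power)
 moreover have "poly (map_poly of_int (pcompose f (monom 1 p) - f ^ p)) x =
 poly (map_poly of_int (pcompose f (monom 1 p))) x - poly (map_poly of_int (f ^ p)) x"
 by (simp add: of_int_poly_hom.hom_minus)
 moreover have "poly (map_poly of_int (of_nat p * h)) x = of_nat p * poly (map_poly of_int h) x"
 proof -
 have "map_poly of_int (of_nat p * h) = Polynomial.smult (of_nat p) (map_poly of_int h :: 'a poly)"
 by (intro poly_eqI) (simp add: coeff_map_poly of_nat_poly)
 thus ?thesis by simp
 qed
 ultimately have fx: "poly (map_poly of_int f) (x ^ p) = of_nat p * poly (map_poly of_int h) x" using h by simp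
 let ?y = "poly (map_poly of_int h) x"
 have yO: "?y : OK" by (rule OK_poly[OF x])
 have eq: "(PROD sg:Emb K. PROD tu:Emb K. sep (sg (x ^ p)) (tu x)) = (PROD sg:Emb K. PROD tu:Emb K. cmod (sg (x ^ p) - tu x))"
 using ne by (intro prod.cong refl) (auto simp: sep_def)
 have "(PROD sg:Emb K. cmod (sg (of_nat p * ?y))) = (PROD sg:Emb K. real p * cmod (sg ?y))"
 proof (intro prod.cong refl)
 fix sg assume s: "sg : Emb K"
 show "cmod (sg (of_nat p * ?y)) = real p * cmod (sg ?y)"
 by (simp add: emb_mult[OF sf s subfield_of_nat[OF sf] OK_K[OF yO]] emb_of_nat[OF sf s] norm_mult)
 qed
 also have "... = real p ^ n * (PROD sg:Emb K. cmod (sg ?y))" by (simp add: prod.distrib n_card)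
 finally have val: "(PROD sg:Emb K. PROD tu:Emb K. sep (sg (x ^ p)) (tu x)) = real p ^ n * (PROD sg:Emb K. cmod (sg ?y))"
 unfolding eq f(2) fx .
 have "(PROD sg:Emb K. PROD tu:Emb K. sep (sg (x ^ p)) (tu x)) > 0" by (intro prod_pos) (auto simp: sep_pos sep_nz)
 hence nz: "(PROD sg:Emb K. cmod (sg ?y)) ~= 0" unfolding val by auto
 have "?y ~= 0"
 proof
 assume "?y = 0"
 hence "cmod (e 0 ?y) = 0" using emb_0[OF sf e_emb[OF n_pos]] by simp
 hence "(PROD sg:Emb K. cmod (sg ?y)) = 0"
 using e_emb[OF n_pos] embeddings_finite[OF nf] by (intro prod_zero) auto
 thus False using nz by simp
 qed
 from norm_ge_1[OF yO this] show ?thesis unfolding val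
 using mult_left_mono[of 1 "PROD sg:Emb K. cmod (sg ?y)" "real p ^ n"] by simp
qed

text \<open>For distinct conjugates the confluent matrix has no derivative rows; its squared
  determinant is the discriminant of 1, x, x^2, ..., a nonzero integer.\<close>

lemma self_resultant_ge_1:
 assumes x: "x : OK" and inj: "inj_on (%sg. sg x) (Emb K)"
 shows "(PROD sg:Emb K. PROD tu:Emb K. sep (sg x) (tu x)) >= 1"
proof -
 define y where "y = (%i. e i x)"
 have "prev_count y i = 0" if i: "i < n" for i
 proof -
 have "y l ~= y i" if "l < i" for l
 proof
 assume "y l = y i"
 hence "e l = e i" using inj e_emb i that unfolding y_def inj_on_def by (meson less_trans)
 thus False using e i that unfolding bij_betw_def inj_on_def by (metis lessThan_iff less_trans nat_neq_iff)
 qed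
 hence "{l. l < i & y l = y i} = {}" by auto
 thus ?thesis unfolding prev_count_def by simp
 qed
 hence conf: "confluent n y = emb_mat n e (%j. x ^ j)"
 unfolding confluent_def emb_mat_def by (intro eq_matI) (auto simp: y_def emb_power[OF sf e_emb OK_K[OF x]])
 have eq: "(PROD sg:Emb K. PROD tu:Emb K. sep (sg x) (tu x)) = (cmod (det (emb_mat n e (%j. x ^ j))))\<^sup>2"
 unfolding conf[symmetric] norm_det_confluent prod_emb y_def by simp
 obtain De :: int where De: "of_int De = (det (emb_mat n e (%j. x ^ j)))\<^sup>2"
 using disc_int[of "%j. x ^ j"] OK_closed(6)[OF x] by blast
 have "(cmod (det (emb_mat n e (%j. x ^ j))))\<^sup>2 = cmod (of_int De)" unfolding De by (simp add: norm_power)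
 also have "... = real_of_int \<bar>De\<bar>" by simp
 finally have v: "(PROD sg:Emb K. PROD tu:Emb K. sep (sg x) (tu x)) = real_of_int \<bar>De\<bar>" unfolding eq .
 moreover have "(PROD sg:Emb K. PROD tu:Emb K. sep (sg x) (tu x)) > 0" by (intro prod_pos) (auto simp: sep_pos sep_nz)
 ultimately have "\<bar>De\<bar> >= 1" by simp
 thus ?thesis unfolding v by simp
qed

lemma log_mahler_power:
 assumes "x : K" shows "log_mahler K (x ^ q) = real q * log_mahler K x"
 unfolding log_mahler_def sum_distrib_left
 by (intro sum.cong refl) (simp add: emb_power[OF sf _ assms] norm_power ln_max_power)

text \<open>If one conjugate is shared, the characteristic polynomial of x^j vanishes at x^i, so all
  conjugates are shared. Then both powers have the same measure, although the measure of x is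
  multiplied by i and by j.\<close>

lemma power_conjugates_distinct:
 assumes x: "x : OK" and L: "log_mahler K x > 0" and ij: "i ~= j"
 and inj: "inj_on (%sg. sg (x ^ i)) (Emb K)" "inj_on (%sg. sg (x ^ j)) (Emb K)"
 and st: "sg : Emb K" "tu : Emb K"
 shows "sg (x ^ i) ~= tu (x ^ j)"
proof
 assume eq: "sg (x ^ i) = tu (x ^ j)"
 have xi: "x ^ i : OK" "x ^ j : OK" using OK_closed(6)[OF x] by auto
 obtain f :: "int poly" where f: "map_poly of_int f = (PROD tu:Emb K. [:- tu (x ^ j), 1:])"
 using char_poly_int[OF xi(2)] by blast
 have root: "poly (map_poly of_int f) z = 0 \<longleftrightarrow> z : (%tu. tu (x ^ j)) ` Emb K" for z :: complex
 unfolding f poly_prod using embeddings_finite[OF nf] by auto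
 have "sg (poly (map_poly of_int f) (x ^ i)) = poly (map_poly of_int f) (sg (x ^ i))"
 by (rule emb_poly_int[OF sf st(1) OK_K[OF xi(1)]])
 also have "... = 0" unfolding root using eq st by auto
 finally have z: "poly (map_poly of_int f) (x ^ i) = 0"
 using emb_eq_0_iff[OF sf st(1) OK_K[OF OK_poly[OF xi(1)]]] by blast
 have "(%tu. tu (x ^ i)) ` Emb K <= (%tu. tu (x ^ j)) ` Emb K"
 proof
 fix w assume "w : (%tu. tu (x ^ i)) ` Emb K"
 then obtain \<rho> where r: "\<rho> : Emb K" "w = \<rho> (x ^ i)" by blast
 have "poly (map_poly of_int f) w = \<rho> (poly (map_poly of_int f) (x ^ i))"
 unfolding r(2) by (rule emb_poly_int[OF sf r(1) OK_K[OF xi(1)], symmetric])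
 also have "... = 0" unfolding z by (rule emb_0[OF sf r(1)])
 finally show "w : (%tu. tu (x ^ j)) ` Emb K" using root by blast
 qed
 hence img: "(%tu. tu (x ^ i)) ` Emb K = (%tu. tu (x ^ j)) ` Emb K"
 using embeddings_finite[OF nf] by (intro card_subset_eq) (auto simp: card_image[OF inj(1)] card_image[OF inj(2)])
 have "log_mahler K (x ^ i) = (SUM w:(%tu. tu (x ^ i)) ` Emb K. ln (max 1 (cmod w)))"
 unfolding log_mahler_def sum.reindex[OF inj(1)] by simp
 also have "... = log_mahler K (x ^ j)"
 unfolding log_mahler_def img sum.reindex[OF inj(2)] by simp
 finally have "real i * log_mahler K x = real j * log_mahler K x" by (simp add: log_mahler_power[OF OK_K[OF x]])
 thus False using L ij by simp
qed

text \<open>The nodes are the conjugates of x with multiplicity k and those of x^p, p in P, with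
  multiplicity 1. In the squared Vandermonde product the pairs formed from x and x^p contribute at
  least p^n to the power 2 k, all others at least 1. Hadamard's inequality bounds it from above, and
  a common factor n cancels after taking logarithms.\<close>

theorem cantor_straus:
 assumes x: "x : OK" and L: "log_mahler K x > 0" and P: "finite P" "!!p. p : P ==> prime p"
 and inj: "!!q. q : insert 1 P ==> inj_on (%sg. sg (x ^ q)) (Emb K)" and k: "k > 0"
 and N: "N = n * (k + card P)"
 shows "2 * real k * (SUM p:P. ln (real p)) \<le>
 2 * real (k + card P) * real (k + \<Sum>P) * log_mahler K x + (\<Sum>m<k. ln (row_const N m)) + real (card P) * ln (real N)"
proof -
 let ?E = "Emb K"
 define Q where "Q = insert 1 P"
 define I where "I = Q \<times> ?E"
 define \<nu> where "\<nu> = (%(q, sg). (sg (x ^ q) :: complex))"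
 define w where "w = (%q::nat. if q = 1 then k else 1)"
 have P1: "1 \<notin> P" using P(2)[of 1] by auto
 have Q: "finite Q" and I: "finite I" using P embeddings_finite[OF nf] by (auto simp: Q_def I_def)
 have ne: "sg (x ^ q) ~= tu (x ^ q')" if "q : Q" "q' : Q" "q ~= q'" "sg : ?E" "tu : ?E" for q q' sg tu
 using power_conjugates_distinct[OF x L that(3) inj inj that(4,5)] that unfolding Q_def by blast
 have inj\<nu>: "inj_on \<nu> I"
 proof (rule inj_onI)
 fix a b assume ab: "a : I" "b : I" "\<nu> a = \<nu> b"
 obtain q sg q' tu where "a = (q, sg)" "b = (q', tu)" by (cases a, cases b)
 note ab = ab this
 have "q = q'" using ne[of q q' sg tu] ab by (auto simp: I_def \<nu>_def)
 moreover have "sg = tu" using inj[of q] ab calculation unfolding inj_on_def by (auto simp: I_def \<nu>_def Q_def)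
 ultimately show "a = b" using ab by simp
 qed
 have sumI: "(SUM i:I. F i) = (SUM q:Q. SUM sg:?E. F (q, sg))" for F :: "nat \<times> ('a => complex) => real"
 unfolding I_def by (simp only: sum.cartesian_product split_def prod.collapse)
 define Z where "Z = \<nu> ` I"
 \<comment> \<open>The multiplicity of a node is read off from its origin (q, sg), which is unique
   by \<open>inj\<nu>\<close>.\<close>
 define M where "M = (%z. w (fst (inv_into I \<nu> z)))"
 have M: "M (\<nu> i) = w (fst i)" if "i : I" for i using that inj\<nu> by (simp add: M_def)
 have Z: "finite Z" using I by (simp add: Z_def)
 have wsum: "(SUM q:Q. w q) = k + card P"
 proof -
 have "(SUM q:Q. w q) = k + (SUM q:P. w q)" using P P1 by (simp add: Q_def w_def)
 also have "(SUM q:P. w q) = (SUM q:P. 1)" using P1 by (intro sum.cong) (auto simp: w_def)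
 also have "... = card P" by simp
 finally show ?thesis .
 qed
 have NZ: "N = (SUM z:Z. M z)"
 proof -
 have "(SUM z:Z. M z) = (SUM i:I. w (fst i))" unfolding Z_def sum.reindex[OF inj\<nu>] by (simp add: M)
 also have "... = (SUM q:Q. SUM sg:?E. w q)" unfolding I_def by (simp only: sum.cartesian_product split_def)
 also have "... = N" by (simp add: n_card N wsum flip: sum_distrib_left)
 finally show ?thesis by simp
 qed
 have N0: "N > 0" using N n_pos k by simp
 have rn: "row_const N m ~= 0" for m using row_const_pos[OF N0, of m] by simp
 define S where "S = (%q q'. SUM sg:?E. SUM tu:?E. ln (sep (sg (x ^ q)) (tu (x ^ q'))))"
 have Sln: "S q q' = ln (PROD sg:?E. PROD tu:?E. sep (sg (x ^ q)) (tu (x ^ q')))" for q q'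
 proof -
 have "ln (PROD tu:?E. sep (sg (x ^ q)) (tu (x ^ q'))) = (SUM tu:?E. ln (sep (sg (x ^ q)) (tu (x ^ q'))))" for sg
 by (rule ln_prod) (auto intro: sep_pos embeddings_finite[OF nf] simp: sep_nz)
 moreover have "ln (PROD sg:?E. PROD tu:?E. sep (sg (x ^ q)) (tu (x ^ q'))) = (SUM sg:?E. ln (PROD tu:?E. sep (sg (x ^ q)) (tu (x ^ q'))))"
 by (rule ln_prod) (auto intro!: embeddings_finite[OF nf] simp: sep_nz prod_zero_iff[OF embeddings_finite[OF nf]])
 ultimately show ?thesis unfolding S_def by simp
 qed
 have xq: "x ^ q : OK" for q using OK_closed(6)[OF x] .
 have S0: "S q q' >= 0" if "q : Q" "q' : Q" for q q'
 proof (cases "q = q'")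
 case True
 show ?thesis unfolding Sln using self_resultant_ge_1[OF xq inj, of q] that True by (simp add: Q_def)
 next
 case False
 show ?thesis unfolding Sln using disjoint_resultant_ge_1[OF xq xq, of q q'] ne[OF that False] by simp
 qed
 have Sp: "S p 1 >= real n * ln (real p)" if p: "p : P" for p
 proof -
 have pr: "prime p" using P(2)[OF p] .
 have "p ~= 1" using p P1 by auto
 hence "(PROD sg:?E. PROD tu:?E. sep (sg (x ^ p)) (tu (x ^ 1))) >= real p ^ n"
 using prime_resultant_ge[OF x pr] ne[of p 1] p by (simp add: Q_def)
 hence "ln (real p ^ n) <= S p 1" unfolding Sln using prime_gt_0_nat[OF pr]
 by (subst ln_le_cancel_iff) (auto intro!: prod_pos simp: sep_pos sep_nz)
 thus ?thesis using prime_gt_0_nat[OF pr] by (simp add: ln_realpow)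
 qed
 have Ssym: "S q q' = S q' q" for q q'
 unfolding S_def by (subst sum.swap) (simp add: sep_commute)
 have low: "2 * real k * real n * (SUM p:P. ln (real p)) <= (SUM q:Q. SUM q':Q. real (w q) * real (w q') * S q q')"
 proof -
 have wp: "w p = 1" if "p : P" for p using that P1 by (auto simp: w_def)
 have w1: "w 1 = k" by (simp add: w_def)
 have "(SUM q:Q. SUM q':Q. real (w q) * real (w q') * S q q') =
 real k * real k * S 1 1 + (SUM p:P. real k * S 1 p) + (SUM p:P. real k * S p 1 + (SUM p':P. S p p'))"
 unfolding Q_def using P P1 by (simp add: wp w1 sum.distrib del: One_nat_def)
 also have "... >= (SUM p:P. real k * (real n * ln (real p))) + (SUM p:P. real k * (real n * ln (real p)))"
 proof -
 have 1: "(SUM p:P. real k * (real n * ln (real p))) <= (SUM p:P. real k * S 1 p)"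
 using Sp Ssym[of 1] by (intro sum_mono mult_left_mono) auto
 have 2: "(SUM p:P. real k * (real n * ln (real p))) <= (SUM p:P. real k * S p 1 + (SUM p':P. S p p'))"
 proof (intro sum_mono)
 fix p assume p: "p : P"
 have "(SUM p':P. S p p') >= 0" using S0 p by (intro sum_nonneg) (auto simp: Q_def)
 moreover have "real k * (real n * ln (real p)) <= real k * S p 1" using Sp[OF p] by (intro mult_left_mono) auto
 ultimately show "real k * (real n * ln (real p)) <= real k * S p 1 + (SUM p':P. S p p')" by linarith
 qed
 have 3: "real k * real k * S 1 1 >= 0" using S0[of 1 1] by (simp add: Q_def)
 show ?thesis using 1 2 3 by linarith
 qed
 finally show ?thesis by (simp add: sum_distrib_left mult_ac)
 qed
 have lhs: "ln (PROD z:Z. PROD z':Z. sep z z' ^ (M z * M z')) = (SUM q:Q. SUM q':Q. real (w q) * real (w q') * S q q')"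
 proof -
 have "ln (PROD z:Z. PROD z':Z. sep z z' ^ (M z * M z')) = (SUM z:Z. SUM z':Z. real (M z * M z') * ln (sep z z'))"
 proof (subst ln_prod)
 show "(SUM z:Z. ln (PROD z':Z. sep z z' ^ (M z * M z'))) = (SUM z:Z. SUM z':Z. real (M z * M z') * ln (sep z z'))"
 using Z by (intro sum.cong refl) (subst ln_prod, auto simp: ln_realpow sep_pos sep_nz)
 qed (use Z in "auto intro!: prod_pos simp: sep_pos sep_nz")
 also have "... = (SUM i:I. SUM j:I. real (w (fst i) * w (fst j)) * ln (sep (\<nu> i) (\<nu> j)))"
 unfolding Z_def sum.reindex[OF inj\<nu>] by (simp add: M)
 also have "... = (SUM q:Q. SUM sg:?E. SUM q':Q. SUM tu:?E. real (w q * w q') * ln (sep (sg (x ^ q)) (tu (x ^ q'))))"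
 unfolding sumI by (simp add: \<nu>_def)
 also have "... = (SUM q:Q. SUM q':Q. SUM sg:?E. SUM tu:?E. real (w q * w q') * ln (sep (sg (x ^ q)) (tu (x ^ q'))))"
 by (intro sum.cong refl sum.swap)
 also have "... = (SUM q:Q. SUM q':Q. real (w q) * real (w q') * S q q')"
 unfolding S_def by (simp add: sum_distrib_left)
 finally show ?thesis .
 qed
 have rhs: "ln (PROD z:Z. \<Prod>m<M z. max 1 (cmod z) ^ (2 * N) * row_const N m) =
 real n * (2 * real (k + card P) * real (k + \<Sum>P) * log_mahler K x + (\<Sum>m<k. ln (row_const N m)) + real (card P) * ln (real N))"
 proof -
 have tm: "ln (max 1 (cmod z) ^ (2 * N) * row_const N m) = 2 * real N * ln (max 1 (cmod z)) + ln (row_const N m)" for z m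
 using row_const_pos[OF N0, of m] by (simp add: ln_mult ln_realpow)
 have "ln (PROD z:Z. \<Prod>m<M z. max 1 (cmod z) ^ (2 * N) * row_const N m) =
 (SUM z:Z. \<Sum>m<M z. 2 * real N * ln (max 1 (cmod z)) + ln (row_const N m))"
 proof (subst ln_prod)
 show "(SUM z:Z. ln (\<Prod>m<M z. max 1 (cmod z) ^ (2 * N) * row_const N m)) =
 (SUM z:Z. \<Sum>m<M z. 2 * real N * ln (max 1 (cmod z)) + ln (row_const N m))"
 by (intro sum.cong refl) (subst ln_prod, auto simp: tm rn row_const_pos[OF N0])
 qed (use Z in "auto intro!: prod_pos mult_pos_pos row_const_pos[OF N0] simp: rn")
 also have "... = (SUM z:Z. 2 * real N * (real (M z) * ln (max 1 (cmod z))) + (\<Sum>m<M z. ln (row_const N m)))"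
 by (simp add: sum.distrib mult_ac)
 also have "... = (SUM i:I. 2 * real N * (real (w (fst i)) * ln (max 1 (cmod (\<nu> i)))) + (\<Sum>m<w (fst i). ln (row_const N m)))"
 unfolding Z_def sum.reindex[OF inj\<nu>] by (simp add: M)
 also have "... = (SUM q:Q. SUM sg:?E. 2 * real N * (real (w q) * ln (max 1 (cmod (sg (x ^ q))))) + (\<Sum>m<w q. ln (row_const N m)))"
 unfolding sumI by (simp add: \<nu>_def)
 also have "... = (SUM q:Q. 2 * real N * (real (w q) * log_mahler K (x ^ q)) + real n * (\<Sum>m<w q. ln (row_const N m)))"
 by (simp add: sum.distrib log_mahler_def sum_distrib_left n_card)
 also have "... = 2 * real N * (SUM q:Q. real (w q) * real q) * log_mahler K x + real n * (SUM q:Q. \<Sum>m<w q. ln (row_const N m))"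
 by (simp add: log_mahler_power[OF OK_K[OF x]] sum.distrib sum_distrib_left sum_distrib_right mult_ac)
 also have "(SUM q:Q. real (w q) * real q) = real (k + \<Sum>P)"
 proof -
 have "(SUM q:P. real (w q) * real q) = (SUM q:P. real q)" using P1 by (intro sum.cong) (auto simp: w_def)
 thus ?thesis using P P1 by (simp add: Q_def w_def)
 qed
 also have "(SUM q:Q. \<Sum>m<w q. ln (row_const N m)) = (\<Sum>m<k. ln (row_const N m)) + real (card P) * ln (real N)"
 proof -
 \<comment> \<open>A node of multiplicity 1 has only the row of order 0, and
   \<open>row_const N 0\<close> is N.\<close>
 have "(SUM q:P. \<Sum>m<w q. ln (row_const N m)) = (SUM q:P. ln (real N))"
 using P1 by (intro sum.cong) (auto simp: w_def row_const_def)
 thus ?thesis using P P1 by (simp add: Q_def w_def)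
 qed
 finally show ?thesis by (simp add: N algebra_simps)
 qed
 have "(PROD z:Z. PROD z':Z. sep z z' ^ (M z * M z')) <= (PROD z:Z. \<Prod>m<M z. max 1 (cmod z) ^ (2 * N) * row_const N m)"
 by (rule confluent_hadamard[OF Z NZ])
 hence "ln (PROD z:Z. PROD z':Z. sep z z' ^ (M z * M z')) <= ln (PROD z:Z. \<Prod>m<M z. max 1 (cmod z) ^ (2 * N) * row_const N m)"
 by (subst ln_le_cancel_iff) (auto intro!: prod_pos mult_pos_pos zero_less_power row_const_pos[OF N0] simp: sep_pos sep_nz rn)
 with low have "real n * (2 * real k * (SUM p:P. ln (real p))) \<le>
 real n * (2 * real (k + card P) * real (k + \<Sum>P) * log_mahler K x + (\<Sum>m<k. ln (row_const N m)) + real (card P) * ln (real N))"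
 unfolding lhs rhs by (simp add: mult_ac)
 thus ?thesis using n_pos by simp
qed

end

section \<open>Descent to fields generated by all powers\<close>

lemma minpoly_degree_1:
 assumes F: "is_subfield F" and p: "minpoly_over F u p" and d: "degree p = 1"
 shows "u : F"
proof -
 obtain c q where pc: "p = pCons c q" by (cases p)
 have "degree q = 0" using d unfolding pc by (auto simp: degree_pCons_eq_if split: if_splits)
 then obtain a where q: "q = [:a:]" by (auto elim: degree_eq_zeroE)
 have "lead_coeff p = 1" "poly p u = 0" "poly_over F p" using minpoly_props[OF F p] by auto
 hence "a = 1" "c + u * a = 0" "c : F" using d unfolding pc q poly_over_def
 by (auto simp: degree_pCons_eq_if coeff_pCons split: if_splits nat.splits)
 hence "u = - c" by (simp add: eq_neg_iff_add_eq_0 add.commute)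
 thus ?thesis using \<open>c : F\<close> subfield_uminus[OF F] by simp
qed

lemma embeddings_fibre_ex:
 assumes K: "number_field K" and F: "is_subfield F" "F <= K"
 shows "EX e>0. (ALL sg:Emb F. card {tu : Emb K. restrict tu F = sg} = e) &
 card (Emb K) = e * card (Emb F)"
proof (rule embeddings_fibre[OF K F])
 fix e assume "e > 0" "!!sg. sg : Emb F ==> card {tu : Emb K. restrict tu F = sg} = e"
 "card (Emb K) = e * card (Emb F)"
 thus ?thesis by (intro exI[of _ e]) simp
qed

lemma subfield_card_eq:
 assumes K: "number_field K" and E: "is_subfield E" "E <= K" and c: "card (Emb K) <= card (Emb E)"
 shows "E = K"
proof
 show "K <= E"
 proof
 fix x assume x: "x : K"
 obtain p where p: "minpoly_over E x p" using minpoly_over_exists[OF E(1) number_field_algebraic[OF K x]] by blast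
 have nE: "number_field E" by (rule subfield_number_field[OF K E])
 note A = adjoin_subfield'[OF K E x]
 have nA: "number_field (adjoin E x)" by (rule subfield_number_field[OF K A])
 obtain m b where b: "fam_basis \<rat> E m b" using number_field_basis[OF nE] by blast
 have cE: "card (Emb E) = m" by (rule embeddings_card(2)[OF nE b])
 have cA: "card (Emb (adjoin E x)) = m * degree p"
 by (rule embeddings_card(2)[OF nA adjoin_basis[OF E(1) b p]])
 obtain e where e: "e > 0" "card (Emb K) = e * card (Emb (adjoin E x))"
 using embeddings_fibre_ex[OF K A] by blast
 have m0: "m > 0" by (rule fam_basis_pos[OF E(1) b])
 have "m * degree p <= e * (m * degree p)" using e(1) by simp
 also have "... <= m * 1" using c e(2) cE cA by simp
 finally have "degree p <= 1" using m0 by (simp only: mult_le_cancel1)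
 moreover have "degree p > 0" by (rule minpoly_degree_pos[OF E(1) p])
 ultimately show "x : E" using minpoly_degree_1[OF E(1) p] by simp
 qed
qed (rule E(2))

lemma sum_embeddings_fibres:
 assumes K: "number_field K" and E: "is_subfield E" "E <= K"
 shows "(SUM sg:Emb E. SUM tu:{tu : Emb K. restrict tu E = sg}. h tu) = (SUM tu:Emb K. (h tu :: real))"
 by (rule sum.group[OF embeddings_finite[OF K] embeddings_finite[OF subfield_number_field[OF K E]]])
 (use restrict_embedding[OF _ E(2,1)] in auto)

lemma log_mahler_subfield:
 assumes K: "number_field K" and E: "is_subfield E" "E <= K" and x: "x : E"
 obtains e :: nat where "e > 0" "log_mahler K x = real e * log_mahler E x"
proof -
 obtain e where e: "e > 0" "!!sg. sg : Emb E ==> card {tu : Emb K. restrict tu E = sg} = e"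
 using embeddings_fibre_ex[OF K E] by blast
 have "log_mahler K x = (SUM sg:Emb E. SUM tu:{tu : Emb K. restrict tu E = sg}. ln (max 1 (cmod (tu x))))"
 unfolding log_mahler_def sum_embeddings_fibres[OF K E] ..
 also have "... = (SUM sg:Emb E. SUM tu:{tu : Emb K. restrict tu E = sg}. ln (max 1 (cmod (sg x))))"
 using x by (intro sum.cong refl) auto
 also have "... = real e * log_mahler E x"
 using e(2) by (simp add: log_mahler_def sum_distrib_left)
 finally show ?thesis using that e(1) by blast
qed

lemma integer_units_iff:
 assumes K: "is_subfield K"
 shows "u : integer_units K \<longleftrightarrow> u : K & u ~= 0 & algebraic_int u & algebraic_int (inverse u)"
proof
 assume "u : integer_units K"
 then obtain v where v: "u : K" "algebraic_int u" "v : K" "algebraic_int v" "u * v = 1"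
 unfolding integer_units_def ring_of_integers_def by blast
 have "u ~= 0" using v by auto
 moreover have "inverse u = v" using inverse_unique[OF v(5)] .
 ultimately show "u : K & u ~= 0 & algebraic_int u & algebraic_int (inverse u)" using v by simp
next
 assume "u : K & u ~= 0 & algebraic_int u & algebraic_int (inverse u)"
 thus "u : integer_units K" unfolding integer_units_def ring_of_integers_def
 using subfield_inverse[OF K, of u] by (auto intro!: bexI[of _ "inverse u"])
qed

lemma embedding_eq_on_adjoin_Rats:
 assumes K: "is_subfield K" and b: "b : K" and s: "sg : Emb K" "tu : Emb K" "sg b = tu b"
 shows "restrict sg (adjoin \<rat> b) = restrict tu (adjoin \<rat> b)"
proof
 fix x show "restrict sg (adjoin \<rat> b) x = restrict tu (adjoin \<rat> b) x"
 proof (cases "x : adjoin \<rat> b")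
 case True
 then obtain g where g: "poly_over \<rat> g" "x = poly g b" unfolding adjoin_def by blast
 have gK: "poly_over K g" using g(1) subfield_Rats[OF K] unfolding poly_over_def by blast
 have "map_poly sg g = map_poly tu g"
 proof (intro poly_eqI)
 fix i
 obtain q where "coeff g i = of_rat q" using g(1) unfolding poly_over_def by (auto elim: Rats_cases)
 thus "coeff (map_poly sg g) i = coeff (map_poly tu g) i"
 by (simp add: coeff_map_emb[OF K s(1)] coeff_map_emb[OF K s(2)] emb_of_rat[OF K s(1)] emb_of_rat[OF K s(2)])
 qed
 thus ?thesis using True g(2) s(3) emb_poly[OF K s(1) gK b] emb_poly[OF K s(2) gK b] by simp
 qed simp
qed

text \<open>With F = \<rat>(al^q) and E = F(al): if E is smaller than K, al itself is used in E,
  where its measure is divided by [K:E]. If E = K, the norm of al to F has the same measure as al,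
  because the conjugates of al over one embedding of F differ by q-th roots of unity.\<close>

lemma norm_descent:
 fixes K :: "'a::field_char_0 set"
 assumes K: "number_field K" and a: "al : integer_units K" and q: "q > 0"
 and s: "sg : Emb K" "tu : Emb K" "sg ~= tu" "sg (al ^ q) = tu (al ^ q)"
 obtains F :: "'a set" and \<gamma> where "number_field F" "card (Emb F) < card (Emb K)" "\<gamma> : integer_units F"
 "log_mahler F \<gamma> > 0 \<longleftrightarrow> log_mahler K al > 0" "log_mahler F \<gamma> <= log_mahler K al"
proof -
 note sf = number_field_subfield[OF K]
 have aK: "al : K" "al ~= 0" "algebraic_int al" "algebraic_int (inverse al)"
 using a integer_units_iff[OF sf] by auto
 have aq: "al ^ q : K" using subfield_power[OF sf aK(1)] .
 define F where "F = adjoin \<rat> (al ^ q)"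
 have F: "is_subfield F" "F <= K" unfolding F_def using adjoin_subfield'[OF K is_subfield_Rats subfield_Rats[OF sf] aq] by auto
 define E where "E = adjoin F al"
 have E: "is_subfield E" "E <= K" unfolding E_def using adjoin_subfield'[OF K F aK(1)] by auto
 have FE: "F <= E" unfolding E_def by (rule adjoin_base[OF F(1)])
 have aE: "al : E" unfolding E_def by (rule adjoin_gen[OF F(1)])
 have nE: "number_field E" by (rule subfield_number_field[OF K E])
 have nF: "number_field F" by (rule subfield_number_field[OF K F])
 show ?thesis
 proof (cases "E = K")
 case False
 have "card (Emb E) < card (Emb K)" using subfield_card_eq[OF K E] False by force
 moreover have "al : integer_units E" using integer_units_iff[OF E(1)] aK aE by auto
 moreover obtain e :: nat where e: "e > 0" "log_mahler K al = real e * log_mahler E al"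
 using log_mahler_subfield[OF K E aE] by blast
 moreover have "log_mahler E al > 0 \<longleftrightarrow> log_mahler K al > 0" using e by (simp add: zero_less_mult_iff)
 moreover have "log_mahler E al <= log_mahler K al"
 using e mult_right_mono[of 1 "real e" "log_mahler E al"] log_mahler_nonneg[of E al] by simp
 ultimately show ?thesis using nE by (intro that[of E al])
 next
 case True
 obtain m where m: "minpoly_over F al m" using minpoly_over_exists[OF F(1) number_field_algebraic[OF K aK(1)]] by blast
 \<comment> \<open>The norm of al from K to F, from the constant term of the minimal
   polynomial.\<close>
 define \<gamma> where "\<gamma> = (- 1) ^ degree m * coeff m 0"
 have mF: "poly_over F m" using minpoly_props[OF F(1) m] by auto
 have gF: "\<gamma> : F" unfolding \<gamma>_def using mF
 by (intro subfield_mult[OF F(1)] subfield_power[OF F(1)] subfield_uminus[OF F(1)] subfield_1[OF F(1)]) (auto simp: poly_over_def)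
 define fib where "fib = (%\<rho>. {tu : Emb K. restrict tu F = \<rho>})"
 have fin: "finite (fib \<rho>)" for \<rho> unfolding fib_def using embeddings_finite[OF K] by simp
 have val: "\<rho> \<gamma> = (PROD tu:fib \<rho>. tu al)" if r: "\<rho> : Emb F" for \<rho>
 proof -
 let ?R = "{z. poly (map_poly \<rho> m) z = 0}"
 have "\<rho> (coeff m 0) = coeff (map_poly \<rho> m) 0" by (simp add: coeff_map_emb[OF F(1) r])
 also have "... = poly (PROD z:?R. [:- z, 1:]) 0"
 using emb_minpoly_split(1)[OF F(1) m r] by (metis poly_0_coeff_0)
 also have "... = (PROD z:?R. - z)" by (simp add: poly_prod)
 also have "... = (- 1) ^ degree m * (PROD z:?R. z)"
 using prod.distrib[of "%_. - 1" "%z. z" ?R] emb_minpoly_split(2)[OF F(1) m r] by simp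
 also have "(PROD z:?R. z) = (PROD tu:fib \<rho>. tu al)"
 using prod.reindex_bij_betw[OF emb_adjoin_bij[OF F(1) m r], of "%z. z"] E True unfolding E_def fib_def by simp
 finally have c0: "\<rho> (coeff m 0) = (- 1) ^ degree m * (PROD tu:fib \<rho>. tu al)" .
 have c0F: "coeff m 0 : F" using mF by (simp add: poly_over_def)
 have "\<rho> \<gamma> = \<rho> ((- 1) ^ degree m) * \<rho> (coeff m 0)" unfolding \<gamma>_def
 by (intro emb_mult[OF F(1) r] c0F subfield_power[OF F(1)] subfield_uminus[OF F(1)] subfield_1[OF F(1)])
 also have "\<rho> ((- 1) ^ degree m) = (- 1) ^ degree m"
 using emb_of_int[OF F(1) r, of "(- 1) ^ degree m"] by simp
 finally show ?thesis unfolding c0 by (simp add: mult.assoc[symmetric] flip: power_add mult_2)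
 qed
 obtain \<rho>0 where r0: "\<rho>0 : Emb F" using restrict_embedding[OF s(1) F(2,1)] by blast
 have ga: "algebraic_int \<gamma>"
 proof -
 have "algebraic_int (\<rho>0 \<gamma>)" unfolding val[OF r0]
 proof (rule algebraic_int_prod)
 fix tu assume "tu : fib \<rho>0"
 hence "tu : Emb K" by (simp add: fib_def)
 thus "algebraic_int (tu al)" using algebraic_int_emb_iff[OF sf _ aK(1)] aK(3) by blast
 qed
 thus ?thesis using algebraic_int_emb_iff[OF F(1) r0 gF] by simp
 qed
 have g0: "\<gamma> ~= 0"
 proof -
 have "\<rho>0 \<gamma> ~= 0" unfolding val[OF r0] prod_zero_iff[OF fin]
 using emb_eq_0_iff[OF sf _ aK(1)] aK(2) unfolding fib_def by auto
 thus ?thesis using emb_0[OF F(1) r0] by auto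
 qed
 have gia: "algebraic_int (inverse \<gamma>)"
 proof -
 have "\<rho>0 (inverse \<gamma>) = (PROD tu:fib \<rho>0. tu (inverse al))"
 unfolding emb_inverse[OF F(1) r0 gF] val[OF r0] prod_inversef[symmetric] comp_def
 using emb_inverse[OF sf _ aK(1)] unfolding fib_def by (intro prod.cong) auto
 moreover have "algebraic_int (PROD tu:fib \<rho>0. tu (inverse al))"
 proof (rule algebraic_int_prod)
 fix tu assume "tu : fib \<rho>0"
 hence "tu : Emb K" by (simp add: fib_def)
 thus "algebraic_int (tu (inverse al))"
 using algebraic_int_emb_iff[OF sf _ subfield_inverse[OF sf aK(1)]] aK(4) by blast
 qed
 ultimately show ?thesis using algebraic_int_emb_iff[OF F(1) r0 subfield_inverse[OF F(1) gF]] by simp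
 qed
 have gU: "\<gamma> : integer_units F" using integer_units_iff[OF F(1)] gF g0 ga gia by blast
 have lm: "ln (max 1 (cmod (\<rho> \<gamma>))) = (SUM tu:fib \<rho>. ln (max 1 (cmod (tu al))))" if r: "\<rho> : Emb F" for \<rho>
 proof (cases "fib \<rho> = {}")
 case True thus ?thesis by (simp add: val[OF r])
 next
 case False
 then obtain t0 where t0: "t0 : fib \<rho>" by blast
 have aqF: "al ^ q : F" unfolding F_def by (rule adjoin_gen[OF is_subfield_Rats])
 \<comment> \<open>The power al^q lies in F, so the conjugates of al in one fibre have equal
   absolute value. Hence truncation at 1 commutes with the product over the fibre.\<close>
 have pw: "cmod (t al) ^ q = cmod (\<rho> (al ^ q))" if t: "t : fib \<rho>" for t
 proof -
 have te: "t : Emb K" "restrict t F = \<rho>" using t by (auto simp: fib_def)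
 have "\<rho> (al ^ q) = t (al ^ q)" using te(2) aqF by auto
 thus ?thesis using emb_power[OF sf te(1) aK(1), of q] by (simp add: norm_power)
 qed
 have eq: "cmod (t al) = cmod (t0 al)" if "t : fib \<rho>" for t
 using power_eq_imp_eq_base[of "cmod (t al)" q "cmod (t0 al)"] pw[OF that] pw[OF t0] q by simp
 have "cmod (\<rho> \<gamma>) = cmod (t0 al) ^ card (fib \<rho>)"
 unfolding val[OF r] prod_norm[symmetric] using eq by simp
 hence "ln (max 1 (cmod (\<rho> \<gamma>))) = real (card (fib \<rho>)) * ln (max 1 (cmod (t0 al)))"
 by (simp add: ln_max_power)
 also have "... = (SUM tu:fib \<rho>. ln (max 1 (cmod (tu al))))" using eq by simp
 finally show ?thesis .
 qed
 have lmeq: "log_mahler F \<gamma> = log_mahler K al"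
 unfolding log_mahler_def using lm sum_embeddings_fibres[OF K F, of "%tu. ln (max 1 (cmod (tu al)))"]
 unfolding fib_def by simp
 have "card (Emb F) < card (Emb K)"
 proof -
 obtain e where e: "e > 0" "!!\<rho>. \<rho> : Emb F ==> card {tu : Emb K. restrict tu F = \<rho>} = e"
 "card (Emb K) = e * card (Emb F)" using embeddings_fibre_ex[OF K F] by blast
 let ?\<rho> = "restrict sg F"
 \<comment> \<open>The two colliding embeddings agree on F, so fibres have at least two elements and
   the degree drops.\<close>
 have "restrict tu F = ?\<rho>" unfolding F_def using embedding_eq_on_adjoin_Rats[OF sf aq s(2,1) s(4)[symmetric]] .
 hence "{sg, tu} <= fib ?\<rho>" using s by (auto simp: fib_def)
 hence "card {sg, tu} <= card (fib ?\<rho>)" by (intro card_mono fin)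
 hence "2 <= e" using s(3) e(2)[OF restrict_embedding[OF s(1) F(2,1)]] by (simp add: fib_def)
 thus ?thesis using e(3) embeddings_card_pos[OF nF] by simp
 qed
 thus ?thesis by (intro that[of F \<gamma>] nF gU) (simp_all add: lmeq)
 qed
qed

lemma row_const_mono: "N <= N' ==> row_const N m <= row_const N' m"
 unfolding row_const_def by (intro divide_right_mono power_mono) auto

text \<open>Induction on the degree: either all conjugates needed for the determinant inequality are
  distinct, or \<open>norm_descent\<close> applies. Stating the bound with d in place of the degree
  of K makes it the same for all fields met in the descent, since \<open>row_const\<close> grows
  with N.\<close>

theorem dobrowolski_bound:
 fixes K :: "'a::field_char_0 set"
 assumes P: "finite P" "!!p. p : P ==> prime p" and k: "k > 0" and d: "d > 0"
 and K: "number_field K" "card (Emb K) <= d" and a: "al : integer_units K" "log_mahler K al > 0"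
 shows "2 * real k * (SUM p:P. ln (real p)) <= 2 * real (k + card P) * real (k + \<Sum>P) * log_mahler K al +
 (\<Sum>m<k. ln (row_const (d * (k + card P)) m)) + real (card P) * ln (real (d * (k + card P)))"
 using K a
proof (induction "card (Emb K)" arbitrary: K al rule: less_induct)
 case less
 note nf = less.prems(1)
 note sf = number_field_subfield[OF nf]
 define n where "n = card (Emb K)"
 show ?case
 proof (cases "ALL q:insert 1 P. inj_on (%sg. sg (al ^ q)) (Emb K)")
 case True
 obtain e where e: "bij_betw e {0..<n} (Emb K)"
 using ex_bij_betw_nat_finite[OF embeddings_finite[OF nf]] n_def by blast
 interpret numfield K n e by unfold_locales (use nf e in "auto simp: lessThan_atLeast0")
 define N N' where "N = n * (k + card P)" and "N' = d * (k + card P)"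
 have NN: "N <= N'" "N > 0" using less.prems(2) n_pos k by (auto simp: N_def N'_def n_def)
 have aO: "al : OK" using less.prems(3) by (simp add: integer_units_def)
 have "2 * real k * (SUM p:P. ln (real p)) \<le>
 2 * real (k + card P) * real (k + \<Sum>P) * log_mahler K al + (\<Sum>m<k. ln (row_const N m)) + real (card P) * ln (real N)"
 by (rule cantor_straus[OF aO less.prems(4) P(1) _ _ k N_def]) (use P True in auto)
 moreover have "(\<Sum>m<k. ln (row_const N m)) <= (\<Sum>m<k. ln (row_const N' m))"
 proof (intro sum_mono)
 fix m
 have "0 < row_const N m" "row_const N m <= row_const N' m" using row_const_pos[OF NN(2)] row_const_mono[OF NN(1)] by auto
 thus "ln (row_const N m) <= ln (row_const N' m)" by simp
 qed
 moreover have "real (card P) * ln (real N) <= real (card P) * ln (real N')" using NN by (intro mult_left_mono) auto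
 ultimately show ?thesis unfolding N'_def by linarith
 next
 case False
 then obtain q sg tu where q: "q : insert 1 P" and s: "sg : Emb K" "tu : Emb K" "sg ~= tu" "sg (al ^ q) = tu (al ^ q)"
 unfolding inj_on_def by blast
 have q0: "q > 0" using q P(2) prime_gt_0_nat by auto
 obtain F :: "'a set" and \<gamma> where F: "number_field F" "card (Emb F) < card (Emb K)" "\<gamma> : integer_units F"
 "log_mahler F \<gamma> > 0 \<longleftrightarrow> log_mahler K al > 0" "log_mahler F \<gamma> <= log_mahler K al"
 using norm_descent[OF nf less.prems(3) q0 s] by blast
 have "2 * real k * (SUM p:P. ln (real p)) <= 2 * real (k + card P) * real (k + \<Sum>P) * log_mahler F \<gamma> +
 (\<Sum>m<k. ln (row_const (d * (k + card P)) m)) + real (card P) * ln (real (d * (k + card P)))"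
 using less.hyps[OF F(2,1) _ F(3)] F(2,4) less.prems by simp
 moreover have "2 * real (k + card P) * real (k + \<Sum>P) * log_mahler F \<gamma> <= 2 * real (k + card P) * real (k + \<Sum>P) * log_mahler K al"
 using F(5) by (intro mult_left_mono) (auto intro!: mult_nonneg_nonneg add_nonneg_nonneg sum_nonneg)
 ultimately show ?thesis by linarith
 qed
qed

section \<open>Numerical evaluation for degrees of moderate size\<close>

lemma ln2_bounds: "69314 / 100000 <= ln (2::real)" "ln (2::real) <= 69315 / 100000"
 using ln_approx_bounds[of 2 5] by (simp_all add: eval_nat_numeral)

text \<open>The primes below 67; trial division by them decides primality below 67^2 = 4489.\<close>

definition small_primes :: "nat list" where
 "small_primes = [2, 3, 5, 7, 11, 13, 17, 19, 23, 29, 31, 37, 41, 43, 47, 53, 59, 61]"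

lemma not_prime_composite:
 fixes n :: nat
 assumes "1 < n" "~ prime n" obtains a b where "n = a * b" "1 < a" "1 < b"
proof -
 obtain a where a: "a dvd n" "a ~= 1" "a ~= n" using assms unfolding prime_nat_iff by blast
 then obtain b where b: "n = a * b" by (auto simp: dvd_def)
 have "a ~= 0" using b assms(1) by (cases a) auto
 moreover have "b ~= 0" using b assms(1) by (cases b) auto
 moreover have "b ~= 1" using a b by auto
 ultimately show ?thesis using that[of a b] a b by simp
qed

lemma prime_sieve:
 fixes n :: nat
 assumes n: "1 < n" "n < 4489" and nd: "list_all (%q. n mod q ~= 0) small_primes"
 shows "prime n"
proof (rule ccontr)
 assume "~ prime n"
 then obtain a b where ab: "n = a * b" "1 < a" "1 < b"
 using not_prime_composite[OF n(1)] by blast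
 have "EX c. c dvd n & 1 < c & c < 67"
 proof (cases "a < 67")
 case False
 have "b < 67"
 proof (rule ccontr)
 assume "~ b < 67"
 hence "67 * 67 <= a * b" using False by (intro mult_mono) auto
 thus False using n ab by simp
 qed
 thus ?thesis using ab by (intro exI[of _ b]) auto
 next
 case True thus ?thesis using ab by (intro exI[of _ a]) auto
 qed
 then obtain c where c: "c dvd n" "1 < c" "c < 67" by blast
 have "list_all (%c. list_ex (%q. c mod q = 0) small_primes) [2..<67]"
 by (simp add: small_primes_def upt_rec_numeral)
 hence "ALL c:set [2..<67]. list_ex (%q. c mod q = 0) small_primes" unfolding list_all_iff .
 moreover have "c : set [2..<67]" unfolding set_upt using c by simp
 ultimately have "list_ex (%q. c mod q = 0) small_primes" by (rule bspec)
 then obtain q where "q : set small_primes" "q dvd c" by (auto simp: list_ex_iff)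
 hence "q : set small_primes" "n mod q = 0" using c(1) dvd_trans by auto
 thus False using nd by (auto simp: list_all_iff)
qed

text \<open>t counts quarters of a bit: the logarithms of the primes add up to at least (t / 4) ln
  2, so the table stays integral. The bound X lets the next block start above it.\<close>

definition prime_block :: "nat => nat => nat => nat => bool" where
 "prime_block s S t X \<longleftrightarrow> (EX P. finite P & (ALL p:P. prime p & p <= X) & card P = s & \<Sum>P = S & 2 ^ t <= (\<Prod>P) ^ 4)"

text \<open>The bound 11 makes the first block start at 13, which leaves out the primes with the
  smallest logarithms.\<close>

lemma prime_block_0: "prime_block 0 0 0 11"
 unfolding prime_block_def by (intro exI[of _ "{}"]) simp

text \<open>All conditions on ps are decided by evaluation. The alternative \<open>p = q\<close>
  admits members of \<open>small_primes\<close>, which the sieve itself would reject.\<close>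

lemma prime_block_extend:
 assumes b: "prime_block s S t X" and ps: "sorted_wrt (<) (X # ps)"
 and sv: "list_all (%p. 1 < p & p < 4489 & list_all (%q. p mod q ~= 0 \<or> p = q) small_primes) ps"
 and u: "2 ^ u <= prod_list ps ^ 4" and eq: "s' = s + length ps" "S' = S + sum_list ps" "t' = t + u" "X' = last (X # ps)"
 shows "prime_block s' S' t' X'"
proof -
 obtain P where P: "finite P" "ALL p:P. prime p & p <= X" "card P = s" "\<Sum>P = S" "2 ^ t <= (\<Prod>P) ^ 4"
 using b unfolding prime_block_def by blast
 have "sorted_wrt (<) ps" using ps by simp
 hence dist: "distinct ps" using strict_sorted_iff by blast
 have gt: "X < p" if p: "p : set ps" for p using ps p by simp
 have disj: "P \<inter> set ps = {}"
 proof -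
 have "p \<notin> set ps" if "p : P" for p using P(2) that gt[of p] by auto
 thus ?thesis by blast
 qed
 have pr: "prime p" if p: "p : set ps" for p
 proof (cases "p : set small_primes")
 case True
 thus ?thesis by (auto simp: small_primes_def)
 next
 case False
 have "1 < p" "p < 4489" "list_all (%q. p mod q ~= 0) small_primes"
 using sv p False unfolding list_all_iff by auto
 thus ?thesis by (rule prime_sieve)
 qed
 have le: "p <= last (X # ps)" if "p : set (X # ps)" for p
 proof -
 have srt: "sorted (X # ps)" using ps strict_sorted_imp_sorted by blast
 have "sorted ys ==> ALL q:set ys. q <= last ys" for ys :: "nat list"
 proof (induction ys)
 case (Cons y ys)
 thus ?case by (cases "ys = []") (auto dest: last_in_set)
 qed simp
 from this[OF srt] that show ?thesis by blast
 qed
 show ?thesis unfolding prime_block_def eq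
 proof (intro exI[of _ "P \<union> set ps"] conjI)
 show "ALL p:P \<union> set ps. prime p & p <= last (X # ps)"
 proof
 fix p assume "p : P \<union> set ps"
 thus "prime p & p <= last (X # ps)"
 proof
 assume "p : P"
 hence "prime p" "p <= X" using P(2) by auto
 moreover have "X <= last (X # ps)" by (rule le) simp
 ultimately show ?thesis by (meson order_trans)
 next
 assume "p : set ps"
 thus ?thesis using pr le[of p] by (meson list.set_intros(2))
 qed
 qed
 show "card (P \<union> set ps) = s + length ps" using P disj dist by (simp add: card_Un_disjoint distinct_card)
 show "\<Sum>(P \<union> set ps) = S + sum_list ps" using P disj dist by (simp add: sum.union_disjoint sum_list_distinct_conv_sum_set[of ps "%x. x", simplified])
 have "\<Prod>(P \<union> set ps) = \<Prod>P * prod_list ps"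
 using P disj dist prod.distinct_set_conv_list[of ps "%x. x"] by (simp add: prod.union_disjoint)
 thus "2 ^ (t + u) <= (\<Prod>(P \<union> set ps)) ^ 4" using mult_mono[OF P(5) u] by (simp add: power_add power_mult_distrib)
 qed (use P in auto)
qed

declare small_primes_def [simp]

lemma prime_block_4: "prime_block 4 72 66 23"
 by (rule prime_block_extend[OF prime_block_0, of "[13, 17, 19, 23]" 66]) simp_all

lemma prime_block_8: "prime_block 8 210 147 41"
 by (rule prime_block_extend[OF prime_block_4, of "[29, 31, 37, 41]" 81]) simp_all

lemma prime_block_12: "prime_block 12 412 237 59"
 by (rule prime_block_extend[OF prime_block_8, of "[43, 47, 53, 59]" 90]) simp_all

lemma prime_block_16: "prime_block 16 684 334 73"
 by (rule prime_block_extend[OF prime_block_12, of "[61, 67, 71, 73]" 97]) simp_all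

lemma prime_block_20: "prime_block 20 1032 437 97"
 by (rule prime_block_extend[OF prime_block_16, of "[79, 83, 89, 97]" 103]) simp_all

lemma prime_block_24: "prime_block 24 1452 544 109"
 by (rule prime_block_extend[OF prime_block_20, of "[101, 103, 107, 109]" 107]) simp_all

lemma prime_block_28: "prime_block 28 1960 655 137"
 by (rule prime_block_extend[OF prime_block_24, of "[113, 127, 131, 137]" 111]) simp_all

lemma prime_block_32: "prime_block 32 2556 770 157"
 by (rule prime_block_extend[OF prime_block_28, of "[139, 149, 151, 157]" 115]) simp_all

lemma prime_block_40: "prime_block 40 4000 1009 197"
 by (rule prime_block_extend[OF prime_block_32, of "[163, 167, 173, 179, 181, 191, 193, 197]" 239]) simp_all

lemma prime_block_48: "prime_block 48 5802 1259 241"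
 by (rule prime_block_extend[OF prime_block_40, of "[199, 211, 223, 227, 229, 233, 239, 241]" 250]) simp_all

lemma prime_block_56: "prime_block 56 7954 1517 283"
 by (rule prime_block_extend[OF prime_block_48, of "[251, 257, 263, 269, 271, 277, 281, 283]" 258]) simp_all

lemma prime_block_72: "prime_block 72 13462 2056 389"
 by (rule prime_block_extend[OF prime_block_56, of "[293, 307, 311, 313, 317, 331, 337, 347, 349, 353, 359, 367, 373, 379, 383, 389]" 539]) simp_all

lemma prime_block_88: "prime_block 88 20518 2618 487"
 by (rule prime_block_extend[OF prime_block_72, of "[397, 401, 409, 419, 421, 431, 433, 439, 443, 449, 457, 461, 463, 467, 479, 487]" 562]) simp_all

lemma prime_block_104: "prime_block 104 29268 3199 599"
 by (rule prime_block_extend[OF prime_block_88, of "[491, 499, 503, 509, 521, 523, 541, 547, 557, 563, 569, 571, 577, 587, 593, 599]" 581]) simp_all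

lemma prime_block_120: "prime_block 120 39584 3796 691"
 by (rule prime_block_extend[OF prime_block_104, of "[601, 607, 613, 617, 619, 631, 641, 643, 647, 653, 659, 661, 673, 677, 683, 691]" 597]) simp_all

lemma prime_block_136: "prime_block 136 51670 4407 811"
 by (rule prime_block_extend[OF prime_block_120, of "[701, 709, 719, 727, 733, 739, 743, 751, 757, 761, 769, 773, 787, 797, 809, 811]" 611]) simp_all

lemma prime_block_152: "prime_block 152 65506 5031 919"
 by (rule prime_block_extend[OF prime_block_136, of "[821, 823, 827, 829, 839, 853, 857, 859, 863, 877, 881, 883, 887, 907, 911, 919]" 624]) simp_all

lemma prime_block_168: "prime_block 168 81192 5666 1031"
 by (rule prime_block_extend[OF prime_block_152, of "[929, 937, 941, 947, 953, 967, 971, 977, 983, 991, 997, 1009, 1013, 1019, 1021, 1031]" 635]) simp_all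

lemma prime_block_184: "prime_block 184 98506 6311 1129"
 by (rule prime_block_extend[OF prime_block_168, of "[1033, 1039, 1049, 1051, 1061, 1063, 1069, 1087, 1091, 1093, 1097, 1103, 1109, 1117, 1123, 1129]" 645]) simp_all

lemma prime_block_200: "prime_block 200 117764 6965 1259"
 by (rule prime_block_extend[OF prime_block_184, of "[1151, 1153, 1163, 1171, 1181, 1187, 1193, 1201, 1213, 1217, 1223, 1229, 1231, 1237, 1249, 1259]" 654]) simp_all

lemma prime_block_216: "prime_block 216 138840 7628 1381"
 by (rule prime_block_extend[OF prime_block_200, of "[1277, 1279, 1283, 1289, 1291, 1297, 1301, 1303, 1307, 1319, 1321, 1327, 1361, 1367, 1373, 1381]" 663]) simp_all

lemma prime_block_232: "prime_block 232 162020 8300 1489"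
 by (rule prime_block_extend[OF prime_block_216, of "[1399, 1409, 1423, 1427, 1429, 1433, 1439, 1447, 1451, 1453, 1459, 1471, 1481, 1483, 1487, 1489]" 672]) simp_all

lemma prime_block_248: "prime_block 248 186886 8978 1607"
 by (rule prime_block_extend[OF prime_block_232, of "[1493, 1499, 1511, 1523, 1531, 1543, 1549, 1553, 1559, 1567, 1571, 1579, 1583, 1597, 1601, 1607]" 678]) simp_all

lemma prime_block_264: "prime_block 264 213510 9662 1723"
 by (rule prime_block_extend[OF prime_block_248, of "[1609, 1613, 1619, 1621, 1627, 1637, 1657, 1663, 1667, 1669, 1693, 1697, 1699, 1709, 1721, 1723]" 684]) simp_all

lemma prime_block_280: "prime_block 280 242220 10353 1867"
 by (rule prime_block_extend[OF prime_block_264, of "[1733, 1741, 1747, 1753, 1759, 1777, 1783, 1787, 1789, 1801, 1811, 1823, 1831, 1847, 1861, 1867]" 691]) simp_all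

lemma prime_block_296: "prime_block 296 273026 11051 1993"
 by (rule prime_block_extend[OF prime_block_280, of "[1871, 1873, 1877, 1879, 1889, 1901, 1907, 1913, 1931, 1933, 1949, 1951, 1973, 1979, 1987, 1993]" 698]) simp_all

lemma prime_block_312: "prime_block 312 305772 11754 2099"
 by (rule prime_block_extend[OF prime_block_296, of "[1997, 1999, 2003, 2011, 2017, 2027, 2029, 2039, 2053, 2063, 2069, 2081, 2083, 2087, 2089, 2099]" 703]) simp_all

lemma prime_block_328: "prime_block 328 340490 12463 2239"
 by (rule prime_block_extend[OF prime_block_312, of "[2111, 2113, 2129, 2131, 2137, 2141, 2143, 2153, 2161, 2179, 2203, 2207, 2213, 2221, 2237, 2239]" 709]) simp_all

lemma prime_block_344: "prime_block 344 377282 13177 2351"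
 by (rule prime_block_extend[OF prime_block_328, of "[2243, 2251, 2267, 2269, 2273, 2281, 2287, 2293, 2297, 2309, 2311, 2333, 2339, 2341, 2347, 2351]" 714]) simp_all

lemma prime_block_360: "prime_block 360 415834 13896 2467"
 by (rule prime_block_extend[OF prime_block_344, of "[2357, 2371, 2377, 2381, 2383, 2389, 2393, 2399, 2411, 2417, 2423, 2437, 2441, 2447, 2459, 2467]" 719]) simp_all

lemma prime_block_376: "prime_block 376 456688 14620 2621"
 by (rule prime_block_extend[OF prime_block_360, of "[2473, 2477, 2503, 2521, 2531, 2539, 2543, 2549, 2551, 2557, 2579, 2591, 2593, 2609, 2617, 2621]" 724]) simp_all

lemma prime_block_392: "prime_block 392 499596 15348 2719"
 by (rule prime_block_extend[OF prime_block_376, of "[2633, 2647, 2657, 2659, 2663, 2671, 2677, 2683, 2687, 2689, 2693, 2699, 2707, 2711, 2713, 2719]" 728]) simp_all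

lemma prime_block_408: "prime_block 408 544156 16080 2843"
 by (rule prime_block_extend[OF prime_block_392, of "[2729, 2731, 2741, 2749, 2753, 2767, 2777, 2789, 2791, 2797, 2801, 2803, 2819, 2833, 2837, 2843]" 732]) simp_all

lemma prime_block_424: "prime_block 424 590796 16816 2971"
 by (rule prime_block_extend[OF prime_block_408, of "[2851, 2857, 2861, 2879, 2887, 2897, 2903, 2909, 2917, 2927, 2939, 2953, 2957, 2963, 2969, 2971]" 736]) simp_all

lemma prime_block_440: "prime_block 440 639704 17556 3121"
 by (rule prime_block_extend[OF prime_block_424, of "[2999, 3001, 3011, 3019, 3023, 3037, 3041, 3049, 3061, 3067, 3079, 3083, 3089, 3109, 3119, 3121]" 740]) simp_all

lemma prime_block_456: "prime_block 456 690998 18301 3259"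
 by (rule prime_block_extend[OF prime_block_440, of "[3137, 3163, 3167, 3169, 3181, 3187, 3191, 3203, 3209, 3217, 3221, 3229, 3251, 3253, 3257, 3259]" 745]) simp_all

lemma prime_block_472: "prime_block 472 744334 19049 3389"
 by (rule prime_block_extend[OF prime_block_456, of "[3271, 3299, 3301, 3307, 3313, 3319, 3323, 3329, 3331, 3343, 3347, 3359, 3361, 3371, 3373, 3389]" 748]) simp_all

lemma prime_block_488: "prime_block 488 799818 19801 3529"
 by (rule prime_block_extend[OF prime_block_472, of "[3391, 3407, 3413, 3433, 3449, 3457, 3461, 3463, 3467, 3469, 3491, 3499, 3511, 3517, 3527, 3529]" 752]) simp_all

lemma prime_block_504: "prime_block 504 857150 20556 3637"
 by (rule prime_block_extend[OF prime_block_488, of "[3533, 3539, 3541, 3547, 3557, 3559, 3571, 3581, 3583, 3593, 3607, 3613, 3617, 3623, 3631, 3637]" 755]) simp_all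

lemma prime_block_520: "prime_block 520 916486 21314 3769"
 by (rule prime_block_extend[OF prime_block_504, of "[3643, 3659, 3671, 3673, 3677, 3691, 3697, 3701, 3709, 3719, 3727, 3733, 3739, 3761, 3767, 3769]" 758]) simp_all

lemma prime_block_536: "prime_block 536 978014 22076 3911"
 by (rule prime_block_extend[OF prime_block_520, of "[3779, 3793, 3797, 3803, 3821, 3823, 3833, 3847, 3851, 3853, 3863, 3877, 3881, 3889, 3907, 3911]" 762]) simp_all

lemma prime_block_552: "prime_block 552 1041570 22841 4027"
 by (rule prime_block_extend[OF prime_block_536, of "[3917, 3919, 3923, 3929, 3931, 3943, 3947, 3967, 3989, 4001, 4003, 4007, 4013, 4019, 4021, 4027]" 765]) simp_all

lemma prime_block_568: "prime_block 568 1107270 23609 4159"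
 by (rule prime_block_extend[OF prime_block_552, of "[4049, 4051, 4057, 4073, 4079, 4091, 4093, 4099, 4111, 4127, 4129, 4133, 4139, 4153, 4157, 4159]" 768]) simp_all

declare small_primes_def [simp del]

text \<open>A lower bound, in units of ln 2, for the logarithms of the denominators of
  \<open>row_const\<close> over the orders below k.\<close>

definition fact_bits :: "nat => nat => bool" where
 "fact_bits k c \<longleftrightarrow> real c * ln 2 <= (\<Sum>m<k. ln ((fact m)\<^sup>2 * real (2 * m + 1)))"

lemma fact_bits_step:
 assumes c: "fact_bits k c" and a: "(2::nat) ^ a <= (fact k)\<^sup>2 * (2 * k + 1)" and eq: "k' = k + 1" "c' = c + a"
 shows "fact_bits k' c'"
proof -
 have "real ((2::nat) ^ a) <= real ((fact k)\<^sup>2 * (2 * k + 1))" using a by (simp only: of_nat_le_iff)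
 hence "(2::real) ^ a <= (fact k)\<^sup>2 * real (2 * k + 1)"
 by (simp only: of_nat_mult of_nat_power of_nat_fact of_nat_numeral)
 hence "ln ((2::real) ^ a) <= ln ((fact k)\<^sup>2 * real (2 * k + 1))" by (subst ln_le_cancel_iff) auto
 hence "real a * ln 2 <= ln ((fact k)\<^sup>2 * real (2 * k + 1))" by (simp add: ln_realpow)
 thus ?thesis using c unfolding fact_bits_def eq by (simp add: algebra_simps)
qed

lemma fact_bits_1: "fact_bits 1 0" unfolding fact_bits_def by simp

lemma fact_bits_2: "fact_bits 2 1"
 by (rule fact_bits_step[OF fact_bits_1, of 1]) (simp_all add: fact_numeral)

lemma fact_bits_3: "fact_bits 3 5"
 by (rule fact_bits_step[OF fact_bits_2, of 4]) (simp_all add: fact_numeral)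

lemma fact_bits_4: "fact_bits 4 12"
 by (rule fact_bits_step[OF fact_bits_3, of 7]) (simp_all add: fact_numeral)

lemma fact_bits_5: "fact_bits 5 24"
 by (rule fact_bits_step[OF fact_bits_4, of 12]) (simp_all add: fact_numeral)

lemma fact_bits_6: "fact_bits 6 41"
 by (rule fact_bits_step[OF fact_bits_5, of 17]) (simp_all add: fact_numeral)

lemma fact_bits_7: "fact_bits 7 63"
 by (rule fact_bits_step[OF fact_bits_6, of 22]) (simp_all add: fact_numeral)

lemma fact_bits_8: "fact_bits 8 91"
 by (rule fact_bits_step[OF fact_bits_7, of 28]) (simp_all add: fact_numeral)

lemma fact_bits_9: "fact_bits 9 125"
 by (rule fact_bits_step[OF fact_bits_8, of 34]) (simp_all add: fact_numeral)

lemma fact_bits_10: "fact_bits 10 166"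
 by (rule fact_bits_step[OF fact_bits_9, of 41]) (simp_all add: fact_numeral)

lemma fact_bits_11: "fact_bits 11 213"
 by (rule fact_bits_step[OF fact_bits_10, of 47]) (simp_all add: fact_numeral)

lemma fact_bits_12: "fact_bits 12 268"
 by (rule fact_bits_step[OF fact_bits_11, of 55]) (simp_all add: fact_numeral)

lemma fact_bits_13: "fact_bits 13 330"
 by (rule fact_bits_step[OF fact_bits_12, of 62]) (simp_all add: fact_numeral)

lemma fact_bits_14: "fact_bits 14 399"
 by (rule fact_bits_step[OF fact_bits_13, of 69]) (simp_all add: fact_numeral)

lemma fact_bits_15: "fact_bits 15 476"
 by (rule fact_bits_step[OF fact_bits_14, of 77]) (simp_all add: fact_numeral)

lemma fact_bits_16: "fact_bits 16 561"
 by (rule fact_bits_step[OF fact_bits_15, of 85]) (simp_all add: fact_numeral)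

lemma fact_bits_17: "fact_bits 17 654"
 by (rule fact_bits_step[OF fact_bits_16, of 93]) (simp_all add: fact_numeral)

lemma fact_bits_18: "fact_bits 18 755"
 by (rule fact_bits_step[OF fact_bits_17, of 101]) (simp_all add: fact_numeral)

lemma fact_bits_19: "fact_bits 19 865"
 by (rule fact_bits_step[OF fact_bits_18, of 110]) (simp_all add: fact_numeral)

lemma fact_bits_20: "fact_bits 20 983"
 by (rule fact_bits_step[OF fact_bits_19, of 118]) (simp_all add: fact_numeral)

lemma fact_bits_21: "fact_bits 21 1110"
 by (rule fact_bits_step[OF fact_bits_20, of 127]) (simp_all add: fact_numeral)

lemma fact_bits_22: "fact_bits 22 1246"
 by (rule fact_bits_step[OF fact_bits_21, of 136]) (simp_all add: fact_numeral)

lemma fact_bits_23: "fact_bits 23 1391"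
 by (rule fact_bits_step[OF fact_bits_22, of 145]) (simp_all add: fact_numeral)

lemma fact_bits_24: "fact_bits 24 1545"
 by (rule fact_bits_step[OF fact_bits_23, of 154]) (simp_all add: fact_numeral)

lemma fact_bits_25: "fact_bits 25 1708"
 by (rule fact_bits_step[OF fact_bits_24, of 163]) (simp_all add: fact_numeral)

lemma fact_bits_26: "fact_bits 26 1881"
 by (rule fact_bits_step[OF fact_bits_25, of 173]) (simp_all add: fact_numeral)

section \<open>From the tables to Dobrowolski's bound for ln d <= 155\<close>

lemma ln_row_const: "N > 0 ==> ln (row_const N m) = real (2 * m + 1) * ln (real N) - ln ((fact m)\<^sup>2 * real (2 * m + 1))"
 unfolding row_const_def by (subst ln_div) (auto simp: ln_realpow simp del: power_Suc power_Suc2 of_nat_add of_nat_mult)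

lemma sum_odd_real: "(\<Sum>m<k. real (2 * m + 1)) = (real k)\<^sup>2"
 by (induction k) (auto simp: power2_eq_square algebra_simps)

text \<open>The rows of order m < k contribute the powers N^(2m + 1), and the exponents 1 + 3 + ...
  + (2k - 1) add up to k^2.\<close>

lemma dobrowolski_explicit:
 fixes K :: "'a::field_char_0 set"
 assumes P: "finite P" "!!p. p : P ==> prime p" and k: "k > 0" and d: "d > 0"
 and K: "number_field K" "card (Emb K) <= d" and a: "al : integer_units K" "log_mahler K al > 0"
 shows "2 * real k * (SUM p:P. ln (real p)) + (\<Sum>m<k. ln ((fact m)\<^sup>2 * real (2 * m + 1)))
 - ((real k)\<^sup>2 + real (card P)) * (ln (real d) + ln (real (k + card P)))
 <= 2 * real (k + card P) * real (k + \<Sum>P) * log_mahler K al"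
proof -
 define N where "N = d * (k + card P)"
 have N: "N > 0" using d k by (simp add: N_def)
 have lnN: "ln (real N) = ln (real d) + ln (real (k + card P))"
 unfolding N_def of_nat_mult using d k by (subst ln_mult) auto
 have "(\<Sum>m<k. ln (row_const N m)) = (real k)\<^sup>2 * ln (real N) - (\<Sum>m<k. ln ((fact m)\<^sup>2 * real (2 * m + 1)))"
 by (simp only: ln_row_const[OF N] sum_subtractf sum_distrib_right[symmetric] sum_odd_real)
 with dobrowolski_bound[OF P k d K a] show ?thesis
 unfolding N_def[symmetric] lnN by (simp add: algebra_simps)
qed

text \<open>Reduces a range of degrees to one inequality between rationals: \<open>Lb\<close> bounds
  ln d, the numbers t / 4, j / 16 and c are logarithms in bits, and 69314 / 100000 stands for ln 2.
  D is meant as a bound for ln (ln d) / ln d.\<close>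

lemma table_entry:
 fixes K :: "'a::field_char_0 set"
 assumes blk: "prime_block s S t X" and cb: "fact_bits k c" and k: "k > 0" and d: "d > 0"
 and K: "number_field K" "card (Emb K) <= d" and a: "al : integer_units K" "log_mahler K al > 0"
 and L: "ln (real d) <= Lb" "Lb >= 0" and D: "D >= 0" and kap: "(k + s) ^ 16 <= (2::nat) ^ j"
 and ineq: "((real k)\<^sup>2 + real s) * Lb + 1 / 2 * real (k + s) * real (k + S) * D ^ 3 \<le>
 (2 * real k * (real t / 4) - ((real k)\<^sup>2 + real s) * (real j / 16) + real c) * (69314 / 100000)"
 shows "D ^ 3 / 4 <= log_mahler K al"
proof -
 obtain P where P: "finite P" "ALL p:P. prime p & p <= X" "card P = s" "\<Sum>P = S" "2 ^ t <= (\<Prod>P) ^ 4"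
 using blk unfolding prime_block_def by blast
 have p0: "p > 0" if "p : P" for p using P(2) that prime_gt_0_nat by blast
 have T: "real t / 4 * ln 2 <= (SUM p:P. ln (real p))"
 proof -
 have pos: "0 < (PROD p:P. real p)" using p0 by (intro prod_pos) auto
 have "real (2 ^ t) <= real ((\<Prod>P) ^ 4)" using P(5) by (simp only: of_nat_le_iff)
 hence "(2::real) ^ t <= (PROD p:P. real p) ^ 4" by simp
 hence "ln ((2::real) ^ t) <= ln ((PROD p:P. real p) ^ 4)" using pos by (subst ln_le_cancel_iff) auto
 hence "real t * ln 2 <= 4 * ln (PROD p:P. real p)" using pos by (simp add: ln_realpow)
 also have "ln (PROD p:P. real p) = (SUM p:P. ln (real p))" using P(1) p0 by (subst ln_prod) auto
 finally show ?thesis by simp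
 qed
 have J: "ln (real (k + s)) <= real j / 16 * ln 2"
 proof -
 have "real ((k + s) ^ 16) <= real ((2::nat) ^ j)" using kap by (simp only: of_nat_le_iff)
 hence "ln (real (k + s) ^ 16) <= ln ((2::real) ^ j)" using k by (subst ln_le_cancel_iff) auto
 moreover have "ln (real (k + s) ^ 16) = 16 * ln (real (k + s))" using ln_realpow[of "real (k + s)" 16] k by simp
 ultimately show ?thesis by (simp add: ln_realpow)
 qed
 have main: "2 * real k * (SUM p:P. ln (real p)) + (\<Sum>m<k. ln ((fact m)\<^sup>2 * real (2 * m + 1)))
 - ((real k)\<^sup>2 + real s) * (ln (real d) + ln (real (k + s))) <= 2 * real (k + s) * real (k + S) * log_mahler K al"
 using dobrowolski_explicit[OF P(1) _ k d K a] P by blast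
 define Q where "Q = 2 * real k * (real t / 4) - ((real k)\<^sup>2 + real s) * (real j / 16) + real c"
 define W where "W = (real k)\<^sup>2 + real s"
 have W: "W >= 0" by (simp add: W_def)
 have ineq': "W * Lb + 1 / 2 * real (k + s) * real (k + S) * D ^ 3 <= Q * (69314 / 100000)"
 unfolding Q_def W_def by (rule ineq)
 \<comment> \<open>The collected number of bits must be nonnegative before ln 2 may replace its
   lower bound.\<close>
 have Q0: "Q >= 0"
 proof -
 have "0 <= W * Lb + 1 / 2 * real (k + s) * real (k + S) * D ^ 3"
 using W L(2) D by (intro add_nonneg_nonneg mult_nonneg_nonneg) auto
 thus ?thesis using ineq' by linarith
 qed
 have 1: "2 * real k * (real t / 4 * ln 2) <= 2 * real k * (SUM p:P. ln (real p))" using T by (intro mult_left_mono) auto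
 have 2: "W * (ln (real d) + ln (real (k + s))) <= W * (Lb + real j / 16 * ln 2)" using L J W by (intro mult_left_mono) auto
 have 3: "real c * ln 2 <= (\<Sum>m<k. ln ((fact m)\<^sup>2 * real (2 * m + 1)))" using cb by (simp add: fact_bits_def)
 have 4: "Q * (69314 / 100000) <= Q * ln 2" using Q0 ln2_bounds(1) by (intro mult_left_mono) auto
 have 5: "Q * ln 2 = 2 * real k * (real t / 4 * ln 2) - W * (real j / 16 * ln 2) + real c * ln 2"
 unfolding Q_def W_def by (simp add: algebra_simps)
 have "1 / 2 * real (k + s) * real (k + S) * D ^ 3 <= 2 * real (k + s) * real (k + S) * log_mahler K al"
 using main[folded W_def] ineq' 1 2 3 4 5 by (simp add: distrib_left)
 hence "(real (k + s) * real (k + S)) * (D ^ 3 / 4) <= (real (k + s) * real (k + S)) * log_mahler K al"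
 by (simp add: algebra_simps)
 moreover have "real (k + s) * real (k + S) > 0" using k by simp
 ultimately show ?thesis by (simp only: mult_le_cancel_left_pos)
qed

text \<open>The tangent line of \<open>ln\<close> at \<open>1 / r\<close>, where \<open>r\<close> is slightly above \<open>2 powr (- h / 2)\<close>.\<close>

lemma ln_over_self_le:
 fixes L :: real
 assumes r: "r > 0" "1 <= r\<^sup>2 * 2 ^ h" and L: "0 < La" "La <= L" and h: "1 <= real h * (69315 / 200000)"
 and D: "r + (real h * (69315 / 200000) - 1) / La <= D"
 shows "ln L / L <= D"
proof -
 have L0: "L > 0" using L by simp
 have "0 <= ln (r\<^sup>2 * 2 ^ h)" using r by (intro ln_ge_zero) auto
 hence "0 <= 2 * ln r + real h * ln 2" using r by (simp add: ln_mult ln_realpow)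
 moreover have "real h * ln 2 <= real h * (69315 / 100000)" using ln2_bounds(2) by (intro mult_left_mono) auto
 ultimately have lr: "- ln r <= real h * (69315 / 200000)" by simp
 have "ln (r * L) <= r * L - 1" using r L0 by (intro ln_le_minus_one) auto
 hence "ln L <= r * L - 1 - ln r" using r L0 by (simp add: ln_mult)
 also have "... <= r * L + (real h * (69315 / 200000) - 1)" using lr by simp
 finally have "ln L / L <= (r * L + (real h * (69315 / 200000) - 1)) / L" using L0 by (intro divide_right_mono) auto
 also have "... = r + (real h * (69315 / 200000) - 1) / L" using L0 by (simp add: add_divide_distrib)
 also have "... <= r + (real h * (69315 / 200000) - 1) / La" using L h by (intro add_left_mono divide_left_mono) auto
 finally show ?thesis using D by simp
qed

text \<open>The range of L = ln d is cut into intervals. On each the left end gives a bound for ln L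
  / L and the right end serves as \<open>Lb\<close>, so one block of primes and one k settle the
  whole interval. The facts e2, e3, ... treat single intervals; g1, g2, ... collect them.\<close>

lemma dobrowolski_medium:
 fixes K :: "'a::field_char_0 set"
 assumes K: "number_field K" "card (Emb K) <= d" and a: "al : integer_units K" "log_mahler K al > 0"
 and d: "d >= 3" "ln (real d) <= 155"
 shows "(ln (ln (real d)) / ln (real d)) ^ 3 / 4 <= log_mahler K al"
proof -
 define L where "L = ln (real d)"
 let ?G = "(ln L / L) ^ 3 / 4 <= log_mahler K al"
 \<comment> \<open>3^12 = 531441 is just above 2^19 = 524288, which makes (19 / 12) ln 2 a sharp
   lower bound for ln 3.\<close>
 have "ln ((2::real) ^ 19) <= ln (3 ^ 12)" by (subst ln_le_cancel_iff) auto
 hence "19 * ln 2 <= 12 * ln (3::real)"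
 unfolding ln_realpow[of "2::real" 19] ln_realpow[of "3::real" 12] by simp
 hence "ln (3::real) >= 1.097" using ln2_bounds(1) by simp
 moreover have "ln (3::real) <= L" unfolding L_def using d by simp
 ultimately have L3: "L >= 1.097" by simp
 have d0: "d > 0" using d by simp
 have goal: ?G if "ln L / L <= D" "D ^ 3 / 4 <= log_mahler K al" for D
 proof -
 have "0 <= ln L / L" using L3 by simp
 hence "(ln L / L) ^ 3 <= D ^ 3" using that(1) by (intro power_mono) auto
 thus ?thesis using that(2) by simp
 qed

 have g1: ?G if "L <= (831 / 250)"
 proof (rule goal)
 show "ln L / L <= (39001 / 100000)"
 by (rule ln_over_self_le[of "(8839 / 25000)" 3 "(1097 / 1000)"]) (use L3 that in "simp_all add: power_divide")
 show "(39001 / 100000) ^ 3 / 4 <= log_mahler K al"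
 by (rule table_entry[OF prime_block_12 fact_bits_7 _ d0 K a, of "(831 / 250)" _ 68]) (use that L_def in "simp_all add: power_divide")
 qed
 have e2: ?G if "L >= (831 / 250)" "L <= (4129 / 1000)"
 proof (rule goal)
 show "ln L / L <= (4569 / 12500)"
 by (rule ln_over_self_le[of "(8839 / 25000)" 3 "(831 / 250)"]) (use L3 that in "simp_all add: power_divide")
 show "(4569 / 12500) ^ 3 / 4 <= log_mahler K al"
 by (rule table_entry[OF prime_block_12 fact_bits_6 _ d0 K a, of "(4129 / 1000)" _ 67]) (use that L_def in "simp_all add: power_divide")
 qed
 have g2: ?G if "L <= (4129 / 1000)"
 using g1 e2 that by (cases "L <= (831 / 250)") auto
 have e3: ?G if "L >= (4129 / 1000)" "L <= (5017 / 1000)"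
 proof (rule goal)
 show "ln L / L <= (8589 / 25000)"
 by (rule ln_over_self_le[of "(1 / 4)" 4 "(4129 / 1000)"]) (use L3 that in "simp_all add: power_divide")
 show "(8589 / 25000) ^ 3 / 4 <= log_mahler K al"
 by (rule table_entry[OF prime_block_16 fact_bits_7 _ d0 K a, of "(5017 / 1000)" _ 73]) (use that L_def in "simp_all add: power_divide")
 qed
 have g3: ?G if "L <= (5017 / 1000)"
 using g2 e3 that by (cases "L <= (4129 / 1000)") auto
 have e4: ?G if "L >= (5017 / 1000)" "L <= (1201 / 200)"
 proof (rule goal)
 show "ln L / L <= (16143 / 50000)"
 by (rule ln_over_self_le[of "(8839 / 50000)" 5 "(5017 / 1000)"]) (use L3 that in "simp_all add: power_divide")
 show "(16143 / 50000) ^ 3 / 4 <= log_mahler K al"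
 by (rule table_entry[OF prime_block_20 fact_bits_8 _ d0 K a, of "(1201 / 200)" _ 77]) (use that L_def in "simp_all add: power_divide")
 qed
 have g4: ?G if "L <= (1201 / 200)"
 using g3 e4 that by (cases "L <= (5017 / 1000)") auto
 have e5: ?G if "L >= (1201 / 200)" "L <= (7349 / 1000)"
 proof (rule goal)
 show "ln L / L <= (29883 / 100000)"
 by (rule ln_over_self_le[of "(8839 / 50000)" 5 "(1201 / 200)"]) (use L3 that in "simp_all add: power_divide")
 show "(29883 / 100000) ^ 3 / 4 <= log_mahler K al"
 by (rule table_entry[OF prime_block_24 fact_bits_9 _ d0 K a, of "(7349 / 1000)" _ 81]) (use that L_def in "simp_all add: power_divide")
 qed
 have g5: ?G if "L <= (7349 / 1000)"
 using g4 e5 that by (cases "L <= (1201 / 200)") auto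
 have e6: ?G if "L >= (7349 / 1000)" "L <= (4591 / 500)"
 proof (rule goal)
 show "ln L / L <= (27189 / 100000)"
 by (rule ln_over_self_le[of "(1 / 8)" 6 "(7349 / 1000)"]) (use L3 that in "simp_all add: power_divide")
 show "(27189 / 100000) ^ 3 / 4 <= log_mahler K al"
 by (rule table_entry[OF prime_block_28 fact_bits_9 _ d0 K a, of "(4591 / 500)" _ 84]) (use that L_def in "simp_all add: power_divide")
 qed
 have g6: ?G if "L <= (4591 / 500)"
 using g5 e6 that by (cases "L <= (7349 / 1000)") auto
 have e7: ?G if "L >= (4591 / 500)" "L <= (11799 / 1000)"
 proof (rule goal)
 show "ln L / L <= (24257 / 100000)"
 by (rule ln_over_self_le[of "(1 / 8)" 6 "(4591 / 500)"]) (use L3 that in "simp_all add: power_divide")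
 show "(24257 / 100000) ^ 3 / 4 <= log_mahler K al"
 by (rule table_entry[OF prime_block_40 fact_bits_11 _ d0 K a, of "(11799 / 1000)" _ 91]) (use that L_def in "simp_all add: power_divide")
 qed
 have g7: ?G if "L <= (11799 / 1000)"
 using g6 e7 that by (cases "L <= (4591 / 500)") auto
 have e8: ?G if "L >= (11799 / 1000)" "L <= (3191 / 200)"
 proof (rule goal)
 show "ln L / L <= (837 / 4000)"
 by (rule ln_over_self_le[of "(8839 / 100000)" 7 "(11799 / 1000)"]) (use L3 that in "simp_all add: power_divide")
 show "(837 / 4000) ^ 3 / 4 <= log_mahler K al"
 by (rule table_entry[OF prime_block_56 fact_bits_13 _ d0 K a, of "(3191 / 200)" _ 98]) (use that L_def in "simp_all add: power_divide")
 qed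
 have g8: ?G if "L <= (3191 / 200)"
 using g7 e8 that by (cases "L <= (11799 / 1000)") auto
 have e9: ?G if "L >= (3191 / 200)" "L <= (2249 / 100)"
 proof (rule goal)
 show "ln L / L <= (217 / 1250)"
 by (rule ln_over_self_le[of "(1 / 16)" 8 "(3191 / 200)"]) (use L3 that in "simp_all add: power_divide")
 show "(217 / 1250) ^ 3 / 4 <= log_mahler K al"
 by (rule table_entry[OF prime_block_72 fact_bits_13 _ d0 K a, of "(2249 / 100)" _ 103]) (use that L_def in "simp_all add: power_divide")
 qed
 have g9: ?G if "L <= (2249 / 100)"
 using g8 e9 that by (cases "L <= (3191 / 200)") auto
 have e10: ?G if "L >= (2249 / 100)" "L <= (33257 / 1000)"
 proof (rule goal)
 show "ln L / L <= (13843 / 100000)"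
 by (rule ln_over_self_le[of "(221 / 5000)" 9 "(2249 / 100)"]) (use L3 that in "simp_all add: power_divide")
 show "(13843 / 100000) ^ 3 / 4 <= log_mahler K al"
 by (rule table_entry[OF prime_block_120 fact_bits_17 _ d0 K a, of "(33257 / 1000)" _ 114]) (use that L_def in "simp_all add: power_divide")
 qed
 have g10: ?G if "L <= (33257 / 1000)"
 using g9 e10 that by (cases "L <= (2249 / 100)") auto
 have e11: ?G if "L >= (33257 / 1000)" "L <= (51327 / 1000)"
 proof (rule goal)
 show "ln L / L <= (527 / 5000)"
 by (rule ln_over_self_le[of "(1 / 32)" 10 "(33257 / 1000)"]) (use L3 that in "simp_all add: power_divide")
 show "(527 / 5000) ^ 3 / 4 <= log_mahler K al"
 by (rule table_entry[OF prime_block_216 fact_bits_23 _ d0 K a, of "(51327 / 1000)" _ 127]) (use that L_def in "simp_all add: power_divide")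
 qed
 have g11: ?G if "L <= (51327 / 1000)"
 using g10 e11 that by (cases "L <= (33257 / 1000)") auto
 have e12: ?G if "L >= (51327 / 1000)" "L <= (10114 / 125)"
 proof (rule goal)
 show "ln L / L <= (769 / 10000)"
 by (rule ln_over_self_le[of "(221 / 10000)" 11 "(51327 / 1000)"]) (use L3 that in "simp_all add: power_divide")
 show "(769 / 10000) ^ 3 / 4 <= log_mahler K al"
 by (rule table_entry[OF prime_block_360 fact_bits_26 _ d0 K a, of "(10114 / 125)" _ 138]) (use that L_def in "simp_all add: power_divide")
 qed
 have g12: ?G if "L <= (10114 / 125)"
 using g11 e12 that by (cases "L <= (51327 / 1000)") auto
 have e13: ?G if "L >= (10114 / 125)" "L <= (123133 / 1000)"
 proof (rule goal)
 show "ln L / L <= (2719 / 50000)"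
 by (rule ln_over_self_le[of "(221 / 20000)" 13 "(10114 / 125)"]) (use L3 that in "simp_all add: power_divide")
 show "(2719 / 50000) ^ 3 / 4 <= log_mahler K al"
 by (rule table_entry[OF prime_block_568 fact_bits_26 _ d0 K a, of "(123133 / 1000)" _ 148]) (use that L_def in "simp_all add: power_divide")
 qed
 have g13: ?G if "L <= (123133 / 1000)"
 using g12 e13 that by (cases "L <= (10114 / 125)") auto
 have e14: ?G if "L >= (123133 / 1000)" "L <= (149831 / 1000)"
 proof (rule goal)
 show "ln L / L <= (3911 / 100000)"
 by (rule ln_over_self_le[of "(391 / 50000)" 14 "(123133 / 1000)"]) (use L3 that in "simp_all add: power_divide")
 show "(3911 / 100000) ^ 3 / 4 <= log_mahler K al"
 by (rule table_entry[OF prime_block_568 fact_bits_26 _ d0 K a, of "(149831 / 1000)" _ 148]) (use that L_def in "simp_all add: power_divide")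
 qed
 have g14: ?G if "L <= (149831 / 1000)"
 using g13 e14 that by (cases "L <= (123133 / 1000)") auto
 have e15: ?G if "L >= (149831 / 1000)" "L <= (3892 / 25)"
 proof (rule goal)
 show "ln L / L <= (3353 / 100000)"
 by (rule ln_over_self_le[of "(391 / 50000)" 14 "(149831 / 1000)"]) (use L3 that in "simp_all add: power_divide")
 show "(3353 / 100000) ^ 3 / 4 <= log_mahler K al"
 by (rule table_entry[OF prime_block_568 fact_bits_26 _ d0 K a, of "(3892 / 25)" _ 148]) (use that L_def in "simp_all add: power_divide")
 qed
 have g15: ?G if "L <= (3892 / 25)"
 using g14 e15 that by (cases "L <= (149831 / 1000)") auto
 show ?thesis using g15 d(2) unfolding L_def by simp
qed

section \<open>Elementary estimates for primes\<close>

definition prime_count :: "nat => nat" where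
 "prime_count x = card {p. prime p & p <= x}"

lemma finite_primes_le: "finite {p::nat. prime p & p <= x}"
 by (rule finite_subset[of _ "{..x}"]) auto

text \<open>Leibniz's harmonic triangle: 1 / (m (n choose m)) is the difference of the entries for
  (n - 1, m) and (n, m + 1). Both are closer to the edge m = n, where the entry is 1 / n.\<close>

lemma nair_divisibility:
 "1 <= m ==> m <= n ==> real (Lcm {1..n}) / (real m * real (n choose m)) : \<int>"
proof (induction "n - m" arbitrary: m n)
 case 0
 hence mn: "m = n" by simp
 have "n dvd Lcm {1..n}" using 0 mn by (intro dvd_Lcm) auto
 then obtain t where t: "Lcm {1..n} = n * t" by (auto simp: dvd_def)
 show ?case unfolding mn t using 0 mn by simp
next
 case (Suc j)
 hence mn: "m < n" by simp
 define l where "l = real (Lcm {1..n})"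
 have "Lcm {1..n - 1} dvd Lcm {1..n}" by (rule Lcm_subset) auto
 then obtain t where t: "Lcm {1..n} = Lcm {1..n - 1} * t" by (auto simp: dvd_def)
 have "real (Lcm {1..n - 1}) / (real m * real ((n - 1) choose m)) : \<int>"
 using Suc.hyps(2) Suc.prems mn by (intro Suc.hyps(1)) auto
 from Ints_mult[OF Ints_of_nat[of t] this] have 1: "l / (real m * real ((n - 1) choose m)) : \<int>"
 unfolding l_def t of_nat_mult by (simp only: times_divide_eq_right mult.commute)
 have 2: "l / (real (m + 1) * real (n choose (m + 1))) : \<int>"
 unfolding l_def using Suc.hyps(2) Suc.prems mn by (intro Suc.hyps(1)) auto
 define C where "C = real (n choose m)"
 have C: "C > 0" using mn by (simp add: C_def)
 have "n * ((n - 1) choose m) = (n - m) * (n choose m)" by (rule binomial_absorb_comp[symmetric])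
 hence "real (n * ((n - 1) choose m)) = real ((n - m) * (n choose m))" by (rule arg_cong)
 hence a: "real n * real ((n - 1) choose m) = (real n - real m) * C" using mn by (simp add: C_def of_nat_diff)
 have "(m + 1) * (n choose (m + 1)) = n * ((n - 1) choose m)" using times_binomial_minus1_eq[of "m + 1" n] by simp
 hence "real ((m + 1) * (n choose (m + 1))) = real (n * ((n - 1) choose m))" by (rule arg_cong)
 hence b: "real (m + 1) * real (n choose (m + 1)) = (real n - real m) * C" using a by (simp only: of_nat_mult)
 have nm: "real n - real m > 0" "real m > 0" "real n > 0" using mn Suc.prems by auto
 have a': "real ((n - 1) choose m) = (real n - real m) * C / real n" using a nm by (simp add: field_simps)
 have "l / (real m * C) = l / (real m * ((real n - real m) * C / real n)) - l / ((real n - real m) * C)"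
 proof -
 define D where "D = real n - real m"
 have D: "D > 0" "real n = real m + D" using nm by (simp_all add: D_def)
 show ?thesis unfolding D_def[symmetric] using C D nm(2) by (simp add: D(2) field_simps)
 qed
 hence "l / (real m * C) = l / (real m * real ((n - 1) choose m)) - l / (real (m + 1) * real (n choose (m + 1)))"
 unfolding a' b .
 thus ?case using Ints_diff[OF 1 2] unfolding l_def C_def by simp
qed

text \<open>The Lcm divides the product of the largest powers of primes not exceeding n, and each of
  these \<open>prime_count n\<close> factors is at most n.\<close>

lemma Lcm_le_prime_count:
 assumes n: "n >= 1" shows "Lcm {1..n} <= n ^ prime_count n"
proof -
 let ?P = "{p. prime p & p <= n}"
 define ex where "ex = (%p. GREATEST e. p ^ e <= n)"
 have bd: "e <= n" if "prime p" "p ^ e <= n" for p e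
 proof -
 have "e < 2 ^ e" by (rule less_exp)
 also have "(2::nat) ^ e <= p ^ e" using prime_ge_2_nat[OF that(1)] by (intro power_mono) auto
 finally show ?thesis using that(2) by simp
 qed
 have ex1: "p ^ ex p <= n" if "prime p" for p unfolding ex_def
 by (rule GreatestI_nat[of "%e. p ^ e <= n" 0 n]) (use n bd[OF that] in auto)
 have ex2: "e <= ex p" if "prime p" "p ^ e <= n" for p e unfolding ex_def
 by (rule Greatest_le_nat[of "%e. p ^ e <= n" e n]) (use that bd[OF that(1)] in auto)
 define R where "R = (PROD p:?P. p ^ ex p)"
 have "Lcm {1..n} dvd R"
 proof (rule Lcm_least)
 fix k assume k: "k : {1..n}"
 have "k = (PROD p:prime_factors k. p ^ multiplicity p k)" using k prod_prime_factors[of k] by simp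
 also have "... dvd R" unfolding R_def
 proof (rule prod_dvd_prod_subset2)
 show "finite ?P" by (rule finite_primes_le)
 show "prime_factors k <= ?P" using k by (auto simp: prime_factors_dvd dest: dvd_imp_le)
 fix p assume p: "p : prime_factors k"
 hence pr: "prime p" by (rule in_prime_factors_imp_prime)
 have "p ^ multiplicity p k <= k" using k by (intro dvd_imp_le multiplicity_dvd) auto
 hence "multiplicity p k <= ex p" using k by (intro ex2[OF pr]) auto
 thus "p ^ multiplicity p k dvd p ^ ex p" by (rule le_imp_power_dvd)
 qed
 finally show "k dvd R" .
 qed
 moreover have "R > 0" unfolding R_def by (intro prod_pos) (auto simp: prime_gt_0_nat)
 ultimately have "Lcm {1..n} <= R" by (rule dvd_imp_le)
 also have "R <= (PROD p:?P. n)" unfolding R_def by (intro prod_mono) (auto intro: ex1)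
 also have "... = n ^ prime_count n" by (simp add: prime_count_def)
 finally show ?thesis .
qed

text \<open>Nair's proof of Chebyshev's bound: m (2m choose m) divides Lcm {1..2m} and is at least
  4^m / 2. Writing 2^l for an upper bound of 2m keeps the result integral.\<close>

lemma prime_count_lower:
 assumes m: "m >= 1" and l: "2 * m <= 2 ^ l"
 shows "2 * m <= l * prime_count (2 * m) + 1"
proof -
 let ?n = "2 * m"
 have "real (Lcm {1..?n}) / (real m * real (?n choose m)) : \<int>" using m by (intro nair_divisibility) auto
 then obtain t where t: "real (Lcm {1..?n}) / (real m * real (?n choose m)) = of_int t" by (auto elim: Ints_cases)
 have Lpos: "Lcm {1..?n} > 0" by (rule gr0I) (auto simp: Lcm_0_iff_nat)
 have den: "real m * real (?n choose m) > 0" using m by simp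
 have "real_of_int t > 0" unfolding t[symmetric] using Lpos den by simp
 hence "real_of_int t >= 1" by simp
 hence "real m * real (?n choose m) <= real (Lcm {1..?n})" unfolding t[symmetric] using den by (simp add: le_divide_eq)
 moreover have "4 ^ m / (2 * real m) <= real (?n choose m)" using m by (intro central_binomial_lower_bound) simp
 hence "4 ^ m <= 2 * (real m * real (?n choose m))" using m by (simp add: field_simps)
 ultimately have "4 ^ m <= 2 * real (Lcm {1..?n})" by linarith
 also have "real (Lcm {1..?n}) <= real (?n ^ prime_count ?n)"
 using Lcm_le_prime_count[of ?n] m by (simp only: of_nat_le_iff)
 also have "real (?n ^ prime_count ?n) <= real ((2 ^ l) ^ prime_count ?n)"
 using power_mono[OF l, of "prime_count ?n"] by (simp only: of_nat_le_iff)
 finally have "(4::real) ^ m <= 2 * real ((2 ^ l) ^ prime_count ?n)" by simp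
 hence "(2::real) ^ (2 * m) <= 2 ^ (l * prime_count ?n + 1)" by (simp add: power_mult)
 thus ?thesis by (simp only: power_increasing_iff)
qed

text \<open>Greedy choice: the lower bound for \<open>prime_count\<close> gives more than s primes
  up to l s + 3, hence a new one of this size. Summing l i + 3 over i < s gives the quadratic
  bound.\<close>

lemma many_small_primes:
 assumes l: "l >= 1" and s: "l * s + 3 <= 2 ^ l"
 shows "EX P. finite P & (ALL p:P. prime p) & card P = s & 2 * \<Sum>P + l * s <= l * s * s + 6 * s"
 using s
proof (induction s)
 case 0 show ?case by (intro exI[of _ "{}"]) simp
next
 case (Suc s)
 have "l * s + 3 <= 2 ^ l" using Suc.prems by simp
 then obtain P where P: "finite P" "ALL p:P. prime p" "card P = s" "2 * \<Sum>P + l * s <= l * s * s + 6 * s"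
 using Suc.IH by blast
 \<comment> \<open>2 m is the even one of l s + 2 and l s + 3.\<close>
 define m where "m = (l * s + 3) div 2"
 have m: "l * s + 2 <= 2 * m" "2 * m <= l * s + 3" "m >= 1" by (auto simp: m_def)
 have "2 * m <= 2 ^ l" using m(2) \<open>l * s + 3 <= 2 ^ l\<close> by simp
 from prime_count_lower[OF m(3) this] have "l * s + 1 <= l * prime_count (2 * m)" using m(1) by simp
 hence "l * s < l * prime_count (2 * m)" by linarith
 hence "card P < card {p. prime p & p <= 2 * m}" using P(3) by (simp add: prime_count_def)
 hence "~ {p. prime p & p <= 2 * m} <= P" using card_mono[OF P(1)] by (meson not_less)
 then obtain p where p: "prime p" "p <= 2 * m" "p \<notin> P" by blast
 show ?case
 proof (intro exI[of _ "insert p P"] conjI)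
 show "finite (insert p P)" "ALL q:insert p P. prime q" "card (insert p P) = Suc s" using P p by auto
 have "2 * \<Sum>(insert p P) = 2 * p + 2 * \<Sum>P" using P(1) p(3) by simp
 moreover have "2 * p <= 2 * (l * s) + 6" using p(2) m(2) by simp
 ultimately have "2 * \<Sum>(insert p P) + l * s <= 2 * (l * s) + 6 + (l * s * s + 6 * s)" using P(4) by linarith
 thus "2 * \<Sum>(insert p P) + l * Suc s <= l * Suc s * Suc s + 6 * Suc s" by (simp add: algebra_simps)
 qed
qed

lemma coprime_30_residues:
 fixes b :: nat
 assumes "b < 30" "b mod 2 ~= 0" "b mod 3 ~= 0" "b mod 5 ~= 0"
 shows "b : {1, 7, 11, 13, 17, 19, 23, 29}"
proof -
 have "ALL b:set [0..<30::nat]. b mod 2 ~= 0 --> b mod 3 ~= 0 --> b mod 5 ~= 0 --> b : {1, 7, 11, 13, 17, 19, 23, 29}"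
 by code_simp
 thus ?thesis using assms by simp
qed

text \<open>Apart from 2, 3 and 5 the primes lie in 8 of the 30 classes modulo 30. This gives the
  slope 8 / 30 = 4 / 15 and the constant 165 = 15 (3 + 8).\<close>

lemma prime_count_upper: "15 * prime_count x <= 4 * x + 165"
proof -
 let ?R = "{1, 7, 11, 13, 17, 19, 23, 29} :: nat set"
 let ?f = "%(a, b). 30 * a + b :: nat"
 have "{p. prime p & p <= x} <= {2, 3, 5} \<union> ?f ` ({..x div 30} \<times> ?R)"
 proof
 fix p assume "p : {p. prime p & p <= x}"
 hence p: "prime p" "p <= x" by auto
 show "p : {2, 3, 5} \<union> ?f ` ({..x div 30} \<times> ?R)"
 proof (cases "p : {2, 3, 5}")
 case False
 have nd: "p mod q ~= 0" if "q : {2, 3, 5}" for q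
 proof
 assume "p mod q = 0"
 hence "q dvd p" by auto
 hence "q = 1 \<or> q = p" using p(1) prime_nat_iff by blast
 thus False using that False by auto
 qed
 have "p mod 30 : ?R"
 by (rule coprime_30_residues) (use nd[of 2] nd[of 3] nd[of 5] in "simp_all add: mod_mod_cancel")
 moreover have "p = ?f (p div 30, p mod 30)" by simp
 moreover have "p div 30 <= x div 30" using p(2) by (rule div_le_mono)
 ultimately show ?thesis by blast
 qed (erule UnI1)
 qed
 hence "prime_count x <= card ({2, 3, 5} \<union> ?f ` ({..x div 30} \<times> ?R))"
 unfolding prime_count_def by (intro card_mono) auto
 also have "... <= card {2, 3, 5::nat} + card (?f ` ({..x div 30} \<times> ?R))" by (rule card_Un_le)
 also have "card (?f ` ({..x div 30} \<times> ?R)) <= card ({..x div 30} \<times> ?R)" by (rule card_image_le) simp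
 also have "card ({..x div 30} \<times> ?R) = 8 * (x div 30) + 8" by (simp add: card_cartesian_product)
 finally have "prime_count x <= 11 + 8 * (x div 30)" by simp
 moreover have "30 * (x div 30) <= x" by simp
 ultimately show ?thesis by linarith
qed

text \<open>P lies below its largest element x, so \<open>prime_count_upper\<close> gives x >= (15 /
  4) (card P - 11). Removing x leads down to 11 elements, whose logarithms are discarded.\<close>

lemma sum_ln_primes_lower:
 assumes "finite P" "ALL p:P. prime (p::nat)"
 shows "(\<Sum>i<card P - 11. ln (15 / 4 * real (i + 1))) <= (SUM p:P. ln (real p))"
 using assms
proof (induction "card P" arbitrary: P)
 case 0 thus ?case by simp
next
 case (Suc s)
 have ne: "P ~= {}" using Suc.hyps(2) by auto
 define x where "x = Max P"
 have x: "x : P" "!!p. p : P ==> p <= x" using ne Suc.prems by (auto simp: x_def)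
 have c: "card (P - {x}) = s" using Suc.hyps(2) x(1) Suc.prems by simp
 have IH: "(\<Sum>i<s - 11. ln (15 / 4 * real (i + 1))) <= (SUM p:P - {x}. ln (real p))"
 using Suc.hyps(1)[of "P - {x}"] c Suc.prems by simp
 have split: "(SUM p:P. ln (real p)) = ln (real x) + (SUM p:P - {x}. ln (real p))"
 using Suc.prems x(1) by (simp add: sum.remove)
 have x1: "x >= 1" using x(1) Suc.prems prime_ge_1_nat by blast
 show ?case
 proof (cases "s >= 11")
 case True
 have "P <= {p. prime p & p <= x}" using x(2) Suc.prems by auto
 hence "card P <= prime_count x" unfolding prime_count_def by (intro card_mono finite_primes_le)
 hence "15 * card P <= 15 * prime_count x" by (rule mult_le_mono2)
 hence "15 * Suc s <= 4 * x + 165" unfolding Suc.hyps(2) using prime_count_upper[of x] by (rule order.trans)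
 hence "15 * (s - 10) <= 4 * x" using True by simp
 hence "15 * real (s - 10) <= 4 * real x" by (metis of_nat_le_iff of_nat_mult of_nat_numeral)
 hence "ln (15 / 4 * real (s - 11 + 1)) <= ln (real x)" using True by (subst ln_le_cancel_iff) auto
 moreover have "card P - 11 = Suc (s - 11)" using Suc.hyps(2) True by simp
 ultimately show ?thesis unfolding split using IH by simp
 next
 case False
 hence "card P - 11 = 0" using Suc.hyps(2) by simp
 moreover have "(SUM p:P. ln (real p)) >= 0"
 using Suc.prems prime_ge_1_nat by (intro sum_nonneg ln_ge_zero) auto
 ultimately show ?thesis by simp
 qed
qed

text \<open>Stirling's bound ln (j!) >= j ln j - j, with the factor c carried along.\<close>

lemma sum_ln_linear_lower:
 fixes c :: real assumes c: "c > 0"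
 shows "real j * (ln (real j) + ln c - 1) <= (\<Sum>i<j. ln (c * real (i + 1)))"
proof (induction j)
 case (Suc j)
 have "real j * (ln (real (j + 1)) - ln (real j)) <= 1"
 proof (cases "j = 0")
 case False
 have "ln (real (j + 1)) - ln (real j) = ln (real (j + 1) / real j)" using False by (simp add: ln_div)
 also have "... <= real (j + 1) / real j - 1" using False by (intro ln_le_minus_one) auto
 also have "... = 1 / real j" using False by (simp add: field_simps)
 finally have "real j * (ln (real (j + 1)) - ln (real j)) <= real j * (1 / real j)" by (intro mult_left_mono) auto
 thus ?thesis using False by simp
 qed simp
 moreover have "ln (c * real (j + 1)) = ln c + ln (real (j + 1))" using c by (simp add: ln_mult)
 ultimately show ?case using Suc by (simp add: algebra_simps)
qed simp

section \<open>Large degrees\<close>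

lemma ln_ge_by_power_of_2:
 fixes x :: real assumes "x > 0" "2 ^ m <= x ^ n" "n > 0" shows "real m / real n * (69314 / 100000) <= ln x"
proof -
 have "ln ((2::real) ^ m) <= ln (x ^ n)" using assms by (subst ln_le_cancel_iff) auto
 hence "real m * ln 2 <= real n * ln x" using assms by (simp add: ln_realpow)
 moreover have "real m * (69314 / 100000) <= real m * ln 2" using ln2_bounds(1) by (intro mult_left_mono) auto
 ultimately have "real m * (69314 / 100000) <= real n * ln x" by linarith
 thus ?thesis using assms(3) by (simp add: field_simps)
qed

text \<open>With y = L / z and z = ln L the claim is that the measure is at least 1 / (4 y^3). All
  quantities are estimated by powers of y times a linear expression in z, with constants that absorb
  the rounding for y >= 29.6 and z >= 5.\<close>

theorem dobrowolski_large:
 fixes K :: "'a::field_char_0 set"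
 assumes K: "number_field K" "card (Emb K) <= d" and a: "al : integer_units K" "log_mahler K al > 0"
 and d: "ln (real d) >= 150"
 shows "(ln (ln (real d)) / ln (real d)) ^ 3 / 4 <= log_mahler K al"
proof -
 define L where "L = ln (real d)"
 define z where "z = ln L"
 define y where "y = L / z"
 have L: "L >= 150" using d by (simp add: L_def)
 have d0: "d > 0"
 proof (rule gr0I)
 assume "d = 0" thus False using d by simp
 qed
 have "real 65 / real 9 * (69314 / 100000) <= ln (150::real)" by (rule ln_ge_by_power_of_2) auto
 moreover have "ln 150 <= z" unfolding z_def using L by simp
 ultimately have z5: "z >= 5" by simp
 \<comment> \<open>The tangent of ln at 5, with ln 5 bounded through 5^3 <= 2^7. It trades the
   lower-order term ln z for a fifth of z.\<close>
 have lz: "ln z <= z / 5 + (6174 / 10000)"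
 proof -
 have "ln (z / 5) <= z / 5 - 1" using z5 by (intro ln_le_minus_one) auto
 moreover have "ln (z / 5) = ln z - ln 5" using z5 by (simp add: ln_div)
 moreover have "ln (5::real) <= (16174 / 10000)"
 proof -
 have "ln ((5::real) ^ 3) <= ln (2 ^ 7)" by (subst ln_le_cancel_iff) auto
 hence "3 * ln (5::real) <= 7 * ln 2"
 unfolding ln_realpow[of "2::real" 7] ln_realpow[of "5::real" 3] by simp
 thus ?thesis using ln2_bounds(2) by simp
 qed
 ultimately show ?thesis by simp
 qed
 have lz2: "ln z >= (16 / 10)"
 proof -
 have "real 37 / real 16 * (69314 / 100000) <= ln (5::real)" by (rule ln_ge_by_power_of_2) auto
 moreover have "ln 5 <= ln z" using z5 by simp
 ultimately show ?thesis by simp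
 qed
 have y: "y >= (296 / 10)"
 proof -
 have "ln L / L <= (336 / 10000)" by (rule ln_over_self_le[of "(782 / 100000)" 14 150]) (use L in "simp_all add: power_divide")
 hence "z <= (336 / 10000) * L" unfolding z_def using L by (simp add: field_simps)
 hence "(296 / 10) * z <= L" using L by simp
 thus ?thesis unfolding y_def using z5 by (simp add: le_divide_eq)
 qed
 have Lyz: "L = y * z" using z5 by (simp add: y_def)
 have ly: "ln y = z - ln z" unfolding y_def using L z5 by (simp add: ln_div z_def)
 have yy: "y\<^sup>2 >= (87616 / 100)" using power_mono[OF y, of 2] by (simp add: power2_eq_square)
 \<comment> \<open>For k = a y and s = b y^2 the gain 2 k T is about 4 a b y^3 z and the loss (k^2 +
   s) L is (a^2 + b) y^3 z, up to terms in ln z, while (k + s) (k + S) is of order b^3 y^6 z. The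
   choice a = 17 / 10, b = 13 / 10 keeps the resulting constant at least 1 / 4 after all
   rounding.\<close>
 define k where "k = nat \<lceil>(17 / 10) * y\<rceil>"
 define s where "s = nat \<lceil>(13 / 10) * y\<^sup>2\<rceil>"
 \<comment> \<open>Makes 2^l at least L^2 = y^2 z^2, which exceeds l s + 3 as
   \<open>many_small_primes\<close> demands; since l is of order z, the sum of the primes is of
   order y^4 z.\<close>
 define l where "l = nat \<lceil>2 * z / ln 2\<rceil>"
 have k: "(17 / 10) * y <= real k" "real k <= (1734 / 1000) * y"
 proof -
 have "real k <= (17 / 10) * y + 1" "(17 / 10) * y <= real k" unfolding k_def using y by linarith+
 thus "(17 / 10) * y <= real k" "real k <= (1734 / 1000) * y" using y by linarith+
 qed
 have s: "(13 / 10) * y\<^sup>2 <= real s" "real s <= (13012 / 10000) * y\<^sup>2"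
 proof -
 have "real s <= (13 / 10) * y\<^sup>2 + 1" "(13 / 10) * y\<^sup>2 <= real s" unfolding s_def using yy by linarith+
 thus "(13 / 10) * y\<^sup>2 <= real s" "real s <= (13012 / 10000) * y\<^sup>2" using yy by linarith+
 qed
 have ln2p: "ln (2::real) > 0" by simp
 have l: "2 * z <= real l * ln 2" "real l <= (28855 / 10000) * z + 1"
 proof -
 have q: "0 <= 2 * z / ln 2" using z5 by simp
 have 1: "2 * z / ln 2 <= real l" "real l <= 2 * z / ln 2 + 1" unfolding l_def using q by linarith+
 show "2 * z <= real l * ln 2" using 1(1) ln2p by (simp add: divide_le_eq)
 have "2 * z / ln 2 <= 2 * z / (69314 / 100000)" using z5 ln2_bounds(1) by (intro divide_left_mono) auto
 also have "... <= (28855 / 10000) * z" using z5 by simp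
 finally show "real l <= (28855 / 10000) * z + 1" using 1(2) by linarith
 qed
 have kpos: "k > 0" using k(1) y by (intro gr0I) auto
 have lpos: "l >= 1"
 proof (rule ccontr)
 assume "~ l >= 1"
 hence "l = 0" by simp
 thus False using l(1) z5 by simp
 qed
 have pow: "L\<^sup>2 <= 2 ^ l"
 proof -
 have "ln (L\<^sup>2) = 2 * z" unfolding z_def using L by (simp add: ln_realpow)
 also have "... <= ln ((2::real) ^ l)" using l(1) by (simp add: ln_realpow)
 finally show ?thesis using L by (subst (asm) ln_le_cancel_iff) auto
 qed
 have cond: "l * s + 3 <= 2 ^ l"
 proof -
 have "real l * real s <= ((28855 / 10000) * z + 1) * ((13012 / 10000) * y\<^sup>2)" using l(2) s(2) z5 by (intro mult_mono) auto
 also have "... + 3 <= z\<^sup>2 * y\<^sup>2"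
 proof -
 have "((28855 / 10000) * z + 1) * (13012 / 10000) + (1 / 100) <= 5 * z" using z5 by ((simp; fail) | linarith | (simp add: field_simps))
 also have "... <= z\<^sup>2" using z5 by (simp add: power2_eq_square)
 finally have "(((28855 / 10000) * z + 1) * (13012 / 10000) + (1 / 100)) * y\<^sup>2 <= z\<^sup>2 * y\<^sup>2" by (intro mult_right_mono) auto
 moreover have "3 <= (1 / 100) * y\<^sup>2" using yy by ((simp; fail) | linarith | (simp add: field_simps))
 moreover have "(((28855 / 10000) * z + 1) * (13012 / 10000) + (1 / 100)) * y\<^sup>2
 = ((28855 / 10000) * z + 1) * ((13012 / 10000) * y\<^sup>2) + (1 / 100) * y\<^sup>2"
 by (simp only: distrib_right[of "((28855 / 10000) * z + 1) * (13012 / 10000)"] mult.assoc)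
 ultimately show ?thesis by linarith
 qed
 finally have "real l * real s + 3 <= z\<^sup>2 * y\<^sup>2" by ((simp; fail) | linarith | (simp add: field_simps))
 also have "... = L\<^sup>2" by (simp add: Lyz power_mult_distrib)
 finally have "real (l * s + 3) <= real (2 ^ l)" using pow by ((simp; fail) | linarith | (simp add: field_simps))
 thus ?thesis by (simp only: of_nat_le_iff)
 qed
 obtain P where P: "finite P" "ALL p:P. prime p" "card P = s" "2 * \<Sum>P + l * s <= l * s * s + 6 * s"
 using many_small_primes[OF lpos cond] by blast
 define S where "S = real (\<Sum>P)"
 have S: "S <= real l * (real s)\<^sup>2 / 2 + 3 * real s"
 proof -
 have "real (2 * \<Sum>P + l * s) <= real (l * s * s + 6 * s)" using P(4) by (simp only: of_nat_le_iff)
 hence "2 * S + real l * real s <= real l * real s * real s + 6 * real s" unfolding S_def by ((simp; fail) | linarith | (simp add: field_simps))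
 moreover have "real l * real s >= 0" by ((simp; fail) | linarith | (simp add: field_simps))
 ultimately have "2 * S <= real l * real s * real s + 6 * real s" by linarith
 thus ?thesis by (simp add: power2_eq_square)
 qed
 have S0: "S >= 0" by (simp add: S_def sum_nonneg)
 define T where "T = (SUM p:P. ln (real p))"
 \<comment> \<open>Bounds ln j + ln (15 / 4) - 1 from below for the j = s - 11 primes that count: ln
   y = z - ln z, and 0.5722 is below ln 1.2874 + ln (15 / 4) - 1.\<close>
 define B where "B = 2 * z - 2 * ln z + (5722 / 10000)"
 have B0: "B >= (16 / 10) * z - (6626 / 10000)" "B >= 0" unfolding B_def using lz z5 by auto
 have T: "(12874 / 10000) * y\<^sup>2 * B <= T"
 proof -
 define j where "j = s - 11"
 have "real s >= 11" using s(1) yy by ((simp; fail) | linarith | (simp add: field_simps))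
 hence j: "real j = real s - 11" by (simp add: j_def of_nat_diff)
 \<comment> \<open>As y^2 >= 876, the 11 discarded primes cost at most 0.0126 y^2.\<close>
 have jy: "real j >= (12874 / 10000) * y\<^sup>2" using j s(1) yy by ((simp; fail) | linarith | (simp add: field_simps))
 have j0: "real j > 0" using jy yy by ((simp; fail) | linarith | (simp add: field_simps))
 have c: "real 40 / real 21 * (69314 / 100000) <= ln (15 / 4 :: real)" by (rule ln_ge_by_power_of_2) (auto simp: power_divide)
 have c2: "real 4 / real 11 * (69314 / 100000) <= ln ((12874 / 10000) :: real)" by (rule ln_ge_by_power_of_2) (auto simp: power_divide)
 have "ln ((12874 / 10000) * y\<^sup>2) <= ln (real j)" using jy yy by (subst ln_le_cancel_iff) auto
 moreover have "ln ((12874 / 10000) * y\<^sup>2) = ln (12874 / 10000) + 2 * ln y" using y by (subst ln_mult) (auto simp: ln_realpow)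
 ultimately have lj: "ln (real j) >= (252 / 1000) + 2 * (z - ln z)" using c2 ly by ((simp; fail) | linarith | (simp add: field_simps))
 have "B <= ln (real j) + ln (15 / 4) - 1" using lj c unfolding B_def by ((simp; fail) | linarith | (simp add: field_simps))
 hence "(12874 / 10000) * y\<^sup>2 * B <= real j * (ln (real j) + ln (15 / 4) - 1)"
 using jy B0(2) j0 by (intro mult_mono) auto
 also have "... <= (\<Sum>i<j. ln (15 / 4 * real (i + 1)))" by (rule sum_ln_linear_lower) simp
 also have "... <= T" unfolding T_def j_def using sum_ln_primes_lower[OF P(1,2)] P(3) by ((simp; fail) | linarith | (simp add: field_simps))
 finally show ?thesis .
 qed
 have kT: "(437716 / 100000) * y ^ 3 * B <= 2 * real k * T"
 proof -
 have "(2 * ((17 / 10) * y)) * ((12874 / 10000) * y\<^sup>2 * B) <= (2 * real k) * T"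
 using k(1) T B0 y by (intro mult_mono) auto
 thus ?thesis by (simp add: power3_eq_cube power2_eq_square mult_ac)
 qed
 have ks: "real (k + s) <= (136 / 100) * y\<^sup>2"
 proof -
 have "(1734 / 1000) * y <= (586 / 10000) * y\<^sup>2" using y mult_right_mono[of "296 / 10" y y] by (simp add: power2_eq_square)
 thus ?thesis using k(2) s(2) by ((simp; fail) | linarith | (simp add: field_simps))
 qed
 have lks: "ln (real (k + s)) <= 2 * z - (284 / 100)"
 proof -
 have "ln (real (k + s)) <= ln ((136 / 100) * y\<^sup>2)" using ks kpos by (subst ln_le_cancel_iff) (use yy in auto)
 also have "... = ln (136 / 100) + 2 * ln y" using y by (subst ln_mult) (auto simp: ln_realpow)
 also have "ln ((136 / 100)::real) <= (36 / 100)" using ln_le_minus_one[of "(136 / 100)::real"] by ((simp; fail) | linarith | (simp add: field_simps))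
 finally show ?thesis using ly lz2 by ((simp; fail) | linarith | (simp add: field_simps))
 qed
 have Lk: "L + ln (real (k + s)) <= y * ((10676 / 10000) * z - (959 / 10000))"
 proof -
 have "(296 / 10) * (2 * z - (284 / 100)) <= y * (2 * z - (284 / 100))" using y z5 by (intro mult_right_mono) auto
 moreover have "y * z * (296 / 10) >= 0" using y z5 by ((simp; fail) | linarith | (simp add: field_simps))
 ultimately have "(296 / 10) * (L + (2 * z - (284 / 100))) <= (296 / 10) * (y * z) + y * (2 * z - (284 / 100))" by (simp add: Lyz)
 also have "... = y * ((316 / 10) * z - (284 / 100))" by (simp add: algebra_simps)
 also have "... <= y * ((296 / 10) * ((10676 / 10000) * z - (959 / 10000)))" using y z5 by (intro mult_left_mono) auto
 finally have "L + (2 * z - (284 / 100)) <= y * ((10676 / 10000) * z - (959 / 10000))" by ((simp; fail) | linarith | (simp add: field_simps))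
 thus ?thesis using lks by ((simp; fail) | linarith | (simp add: field_simps))
 qed
 have kks: "(real k)\<^sup>2 + real s <= (4308 / 1000) * y\<^sup>2"
 proof -
 have "(real k)\<^sup>2 <= ((1734 / 1000) * y)\<^sup>2" using k(2) by (intro power_mono) auto
 hence "(real k)\<^sup>2 <= (3006756 / 1000000) * y\<^sup>2" by (simp add: power_mult_distrib power2_eq_square)
 thus ?thesis using s(2) by ((simp; fail) | linarith | (simp add: field_simps))
 qed
 have sub: "((real k)\<^sup>2 + real s) * (L + ln (real (k + s))) <= (4308 / 1000) * y ^ 3 * ((10676 / 10000) * z - (959 / 10000))"
 proof -
 have "0 <= L + ln (real (k + s))" using L kpos by (intro add_nonneg_nonneg ln_ge_zero) auto
 hence "((real k)\<^sup>2 + real s) * (L + ln (real (k + s))) <= ((4308 / 1000) * y\<^sup>2) * (y * ((10676 / 10000) * z - (959 / 10000)))"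
 using kks Lk by (intro mult_mono) auto
 thus ?thesis by (simp add: power3_eq_cube power2_eq_square mult_ac)
 qed
 have main: "2 * real k * T + (\<Sum>m<k. ln ((fact m)\<^sup>2 * real (2 * m + 1)))
 - ((real k)\<^sup>2 + real s) * (L + ln (real (k + s))) <= 2 * real (k + s) * (real k + S) * log_mahler K al"
 using dobrowolski_explicit[OF P(1) _ kpos d0 K a] P(2,3) unfolding T_def L_def S_def by ((simp; fail) | linarith | (simp add: field_simps))
 have fb: "(\<Sum>m<k. ln ((fact m)\<^sup>2 * real (2 * m + 1))) >= 0"
 proof (intro sum_nonneg ln_ge_zero)
 fix m
 have "(1::real) * 1 <= (fact m)\<^sup>2 * real (2 * m + 1)" by (intro mult_mono one_le_power) (auto simp: fact_ge_1)
 thus "1 <= (fact m)\<^sup>2 * real (2 * m + 1)" by ((simp; fail) | linarith | (simp add: field_simps))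
 qed
 have y3: "y ^ 3 > 0" using y by ((simp; fail) | linarith | (simp add: field_simps))
 have num: "y ^ 3 * ((16612 / 10000) * z + (5788 / 10000)) <= 2 * real k * T - ((real k)\<^sup>2 + real s) * (L + ln (real (k + s)))"
 proof -
 have "(16612 / 10000) * z + (5788 / 10000) <= (437716 / 100000) * ((16 / 10) * z - (6626 / 10000)) - (4308 / 1000) * ((10676 / 10000) * z - (959 / 10000))" using z5 by ((simp; fail) | linarith | (simp add: field_simps))
 also have "... <= (437716 / 100000) * B - (4308 / 1000) * ((10676 / 10000) * z - (959 / 10000))" using B0 by ((simp; fail) | linarith | (simp add: field_simps))
 finally have "y ^ 3 * ((16612 / 10000) * z + (5788 / 10000)) <= y ^ 3 * ((437716 / 100000) * B - (4308 / 1000) * ((10676 / 10000) * z - (959 / 10000)))"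
 using y3 by (intro mult_left_mono) auto
 also have "... = (437716 / 100000) * y ^ 3 * B - (4308 / 1000) * y ^ 3 * ((10676 / 10000) * z - (959 / 10000))" by (simp add: algebra_simps)
 finally show ?thesis using kT sub by linarith
 qed
 have den: "real (k + s) * (real k + S) <= 2 * (y ^ 3 * y ^ 3) * ((16612 / 10000) * z + (5788 / 10000))"
 proof -
 have "(real s)\<^sup>2 <= ((13012 / 10000) * y\<^sup>2)\<^sup>2" using s(2) by (intro power_mono) auto
 hence "(real s)\<^sup>2 <= (169312144 / 100000000) * (y\<^sup>2 * y\<^sup>2)" by (simp add: power2_eq_square)
 hence "real l * (real s)\<^sup>2 <= ((28855 / 10000) * z + 1) * ((169312144 / 100000000) * (y\<^sup>2 * y\<^sup>2))"
 using l(2) z5 by (intro mult_mono) auto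
 moreover have "3 * real s + real k <= (453 / 100000) * (y\<^sup>2 * y\<^sup>2)"
 proof -
 have 1: "(87616 / 100) * y\<^sup>2 <= y\<^sup>2 * y\<^sup>2" using yy by (intro mult_right_mono) auto
 have 2: "(296 / 10) * y <= y\<^sup>2" using y mult_right_mono[of "296 / 10" y y] by (simp add: power2_eq_square)
 show ?thesis using 1 2 s(2) k(2) by linarith
 qed
 ultimately have "real k + S <= ((28855 / 10000) * z + 1) * ((84656072 / 100000000) * (y\<^sup>2 * y\<^sup>2)) + (453 / 100000) * (y\<^sup>2 * y\<^sup>2)" using S by linarith
 also have "... = (((28855 / 10000) * z + 1) * (84656072 / 100000000) + (453 / 100000)) * (y\<^sup>2 * y\<^sup>2)" by (simp add: algebra_simps)
 also have "... <= ((24428 / 10000) * z + (85110 / 100000)) * (y\<^sup>2 * y\<^sup>2)" using z5 by (intro mult_right_mono) ((auto; fail) | linarith | (simp add: field_simps; fail))+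
 finally have kS: "real k + S <= ((24428 / 10000) * z + (85110 / 100000)) * (y\<^sup>2 * y\<^sup>2)" .
 have "real (k + s) * (real k + S) <= ((136 / 100) * y\<^sup>2) * (((24428 / 10000) * z + (85110 / 100000)) * (y\<^sup>2 * y\<^sup>2))"
 using ks kS S0 by (intro mult_mono) auto
 also have "... = ((136 / 100) * ((24428 / 10000) * z + (85110 / 100000))) * (y ^ 3 * y ^ 3)" by (simp add: power2_eq_square power3_eq_cube algebra_simps)
 also have "... <= (2 * ((16612 / 10000) * z + (5788 / 10000))) * (y ^ 3 * y ^ 3)" using z5 y3 by (intro mult_right_mono) ((auto; fail) | linarith | (simp add: field_simps; fail))+
 finally show ?thesis by (simp only: mult_ac)
 qed
 have pos: "real (k + s) * (real k + S) > 0" using kpos S0 by (intro mult_pos_pos add_pos_nonneg) auto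
 have "y ^ 3 * (real (k + s) * (real k + S)) <= y ^ 3 * (2 * (y ^ 3 * y ^ 3) * ((16612 / 10000) * z + (5788 / 10000)))"
 using den y3 by (intro mult_left_mono) auto
 also have "... = 2 * (y ^ 3 * y ^ 3) * (y ^ 3 * ((16612 / 10000) * z + (5788 / 10000)))" by ((simp; fail) | linarith | (simp add: field_simps))
 also have "... <= 2 * (y ^ 3 * y ^ 3) * (2 * (real (k + s) * (real k + S)) * log_mahler K al)"
 proof (rule mult_left_mono)
 show "y ^ 3 * ((16612 / 10000) * z + (5788 / 10000)) <= 2 * (real (k + s) * (real k + S)) * log_mahler K al"
 using num main fb unfolding mult.assoc by linarith
 show "0 <= 2 * (y ^ 3 * y ^ 3)" using y3 by simp
 qed
 finally have "(real (k + s) * (real k + S) * y ^ 3) * 1 <= (real (k + s) * (real k + S) * y ^ 3) * (4 * y ^ 3 * log_mahler K al)"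
 by (simp add: mult_ac)
 moreover have "real (k + s) * (real k + S) * y ^ 3 > 0" using pos y3 by ((simp; fail) | linarith | (simp add: field_simps))
 ultimately have "1 <= 4 * y ^ 3 * log_mahler K al" by (simp only: mult_le_cancel_left_pos)
 hence "1 / y ^ 3 / 4 <= log_mahler K al" using y3 by (simp add: field_simps)
 moreover have "(z / L) ^ 3 = 1 / y ^ 3" unfolding y_def by (simp add: power_divide)
 ultimately show ?thesis unfolding z_def L_def by ((simp; fail) | linarith | (simp add: field_simps))
qed

corollary dobrowolski:
 fixes K :: "'a::field_char_0 set"
 assumes "number_field K" "card (Emb K) <= d" "al : integer_units K" "log_mahler K al > 0" "d >= 3"
 shows "(ln (ln (real d)) / ln (real d)) ^ 3 / 4 <= log_mahler K al"
 using dobrowolski_medium[OF assms] dobrowolski_large[OF assms(1-4)] by linarith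

section \<open>Volumes and lattices\<close>

text \<open>The dimension is a variable, so \<real>^n is modelled by the functions extensional on
  {..<n}.\<close>

definition lebn :: "nat => (nat => real) measure" where
 "lebn n = PiM {..<n} (%_. lborel)"

lemma space_lebn: "space (lebn n) = {..<n} \<rightarrow>\<^sub>E UNIV"
 by (simp add: lebn_def space_PiM)

lemma lebn_component [measurable]: "i < n ==> (%x. x i) : borel_measurable (lebn n)"
 unfolding lebn_def using measurable_component_singleton[of i "{..<n}" "%_. lborel :: real measure"] by simp

lemma lebn_restrict:
 assumes "!!i. i < n ==> (%x. h x i) : borel_measurable M"
 shows "(%x. \<lambda>i\<in>{..<n}. h x i) : measurable M (lebn n)"
 unfolding lebn_def using assms by (intro measurable_restrict) auto

lemma lebn_upd:
 assumes "k < n" "h : borel_measurable (lebn n)"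
 shows "(%x. x(k := h x)) : measurable (lebn n) (lebn n)"
 unfolding lebn_def
proof (rule measurable_fun_upd[where J = "{..<n}"])
 show "{..<n} = {..<n} \<union> {k}" using assms by auto
 show "h : measurable (PiM {..<n} (%_. lborel)) lborel" using assms(2) by (simp add: lebn_def)
qed simp

lemma nn_integral_lebn_insert:
 assumes k: "k < n" and f: "f : borel_measurable (lebn n)"
 shows "(\<integral>\<^sup>+x. f x \<partial>lebn n) = (\<integral>\<^sup>+x. \<integral>\<^sup>+y. f (x(k := y)) \<partial>lborel \<partial>PiM ({..<n} - {k}) (%_. lborel))"
proof -
 interpret product_sigma_finite "%_::nat. lborel :: real measure" by standard
 have I: "insert k ({..<n} - {k}) = {..<n}" using k by auto
 show ?thesis using product_nn_integral_insert[of "{..<n} - {k}" k f] f unfolding I lebn_def by simp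
qed

text \<open>By Tonelli the integral over coordinate k can be taken first. There \<open>h x\<close>
  is constant, and an affine substitution on the line remains.\<close>

lemma nn_integral_lebn_coord:
 assumes k: "k < n" and f: "f : borel_measurable (lebn n)" and s: "s ~= 0"
 and h: "h : borel_measurable (lebn n)" "!!x y. h (x(k := y)) = h x"
 shows "ennreal \<bar>s\<bar> * (\<integral>\<^sup>+x. f (x(k := h x + s * x k)) \<partial>lebn n) = (\<integral>\<^sup>+x. f x \<partial>lebn n)"
proof -
 have I: "insert k ({..<n} - {k}) = {..<n}" using k by auto
 have m: "(%x. x(k := h x + s * x k)) : measurable (lebn n) (lebn n)"
 by (rule lebn_upd[OF k]) (use k h(1) in measurable)
 have f': "(%x. f (x(k := h x + s * x k))) : borel_measurable (lebn n)"
 by (rule measurable_compose[OF m f])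
 have upd: "(%v. x(k := v)) : measurable lborel (lebn n)" if "x : space (PiM ({..<n} - {k}) (%_. lborel :: real measure))" for x
 using measurable_component_update[OF that, of k] unfolding I lebn_def by simp
 have m2: "(%x. \<integral>\<^sup>+y. g (x(k := y)) \<partial>lborel) : borel_measurable (PiM ({..<n} - {k}) (%_. lborel))"
 if g: "g : borel_measurable (lebn n)" for g :: "(nat => real) => ennreal"
 proof -
 have "(%p. (fst p)(k := snd p)) : measurable (PiM ({..<n} - {k}) (%_. lborel) \<Otimes>\<^sub>M lborel) (lebn n)"
 unfolding lebn_def by (rule measurable_fun_upd[where J = "{..<n} - {k}"]) (use I in auto)
 from measurable_compose[OF this g]
 have "(%(x, y). g (x(k := y))) : borel_measurable (PiM ({..<n} - {k}) (%_. lborel) \<Otimes>\<^sub>M lborel)"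
 by (simp add: case_prod_beta')
 thus ?thesis by (rule lborel.borel_measurable_nn_integral)
 qed
 have "ennreal \<bar>s\<bar> * (\<integral>\<^sup>+x. f (x(k := h x + s * x k)) \<partial>lebn n)
 = ennreal \<bar>s\<bar> * (\<integral>\<^sup>+x. \<integral>\<^sup>+y. f (x(k := h x + s * y)) \<partial>lborel \<partial>PiM ({..<n} - {k}) (%_. lborel))"
 by (subst nn_integral_lebn_insert[OF k f']) (simp add: h(2))
 also have "... = (\<integral>\<^sup>+x. ennreal \<bar>s\<bar> * (\<integral>\<^sup>+y. f (x(k := h x + s * y)) \<partial>lborel) \<partial>PiM ({..<n} - {k}) (%_. lborel))"
 by (rule nn_integral_cmult[symmetric]) (use m2[OF f'] in "simp add: h(2)")
 also have "... = (\<integral>\<^sup>+x. \<integral>\<^sup>+y. f (x(k := y)) \<partial>lborel \<partial>PiM ({..<n} - {k}) (%_. lborel))"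
 proof (rule nn_integral_cong)
 fix x assume x: "x : space (PiM ({..<n} - {k}) (%_. lborel :: real measure))"
 have "(%v. f (x(k := v))) : borel_measurable borel"
 using measurable_compose[OF upd[OF x] f] by simp
 from nn_integral_real_affine[OF this s, of "h x"]
 show "ennreal \<bar>s\<bar> * (\<integral>\<^sup>+y. f (x(k := h x + s * y)) \<partial>lborel) = (\<integral>\<^sup>+y. f (x(k := y)) \<partial>lborel)" by simp
 qed
 also have "... = (\<integral>\<^sup>+x. f x \<partial>lebn n)" by (rule nn_integral_lebn_insert[OF k f, symmetric])
 finally show ?thesis .
qed

text \<open>One coordinate at a time: \<open>T j\<close> has transformed the first j of
  them.\<close>

lemma nn_integral_lebn_affine:
 assumes f: "f : borel_measurable (lebn n)" and s: "!!i. i < n ==> s i ~= 0"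
 shows "ennreal (\<Prod>i<n. \<bar>s i\<bar>) * (\<integral>\<^sup>+x. f (\<lambda>i\<in>{..<n}. v i + s i * x i) \<partial>lebn n) = (\<integral>\<^sup>+x. f x \<partial>lebn n)"
proof -
 define T where "T = (%j (x::nat => real). \<lambda>i\<in>{..<n}. if i < j then v i + s i * x i else x i)"
 have Tm: "T j : measurable (lebn n) (lebn n)" for j
 unfolding T_def by (rule lebn_restrict) (auto intro!: borel_measurable_add borel_measurable_times)
 have "j <= n ==> ennreal (\<Prod>i<j. \<bar>s i\<bar>) * (\<integral>\<^sup>+x. f (T j x) \<partial>lebn n) = (\<integral>\<^sup>+x. f x \<partial>lebn n)"
 if "f : borel_measurable (lebn n)" for j f using that
 proof (induction j arbitrary: f)
 case 0
 have "(\<integral>\<^sup>+x. f (T 0 x) \<partial>lebn n) = (\<integral>\<^sup>+x. f x \<partial>lebn n)"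
 by (rule nn_integral_cong) (auto simp: T_def space_lebn PiE_restrict)
 thus ?case by simp
 next
 case (Suc j)
 have j: "j < n" using Suc.prems by simp
 define g where "g = (%x. f (x(j := v j + s j * x j)))"
 have "(%x. x(j := v j + s j * x j)) : measurable (lebn n) (lebn n)"
 by (rule lebn_upd[OF j]) (use j in measurable)
 hence g: "g : borel_measurable (lebn n)" unfolding g_def by (rule measurable_compose[OF _ Suc.prems(2)])
 have T: "f (T (Suc j) x) = g (T j x)" for x
 unfolding g_def T_def using j by (intro arg_cong[where f = f]) (auto simp: fun_eq_iff)
 have 1: "ennreal (\<Prod>i<j. \<bar>s i\<bar>) * (\<integral>\<^sup>+x. g (T j x) \<partial>lebn n) = (\<integral>\<^sup>+x. g x \<partial>lebn n)"
 using Suc.IH[OF _ g] j by simp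
 have 2: "ennreal \<bar>s j\<bar> * (\<integral>\<^sup>+x. g x \<partial>lebn n) = (\<integral>\<^sup>+x. f x \<partial>lebn n)"
 unfolding g_def by (rule nn_integral_lebn_coord[OF j Suc.prems(2) s[OF j]]) auto
 have "ennreal (\<Prod>i<Suc j. \<bar>s i\<bar>) = ennreal \<bar>s j\<bar> * ennreal (\<Prod>i<j. \<bar>s i\<bar>)"
 by (simp add: ennreal_mult[symmetric] prod_nonneg mult.commute)
 thus ?case unfolding T using 1 2 by (simp add: mult.assoc)
 qed
 from this[OF f, of n] show ?thesis unfolding T_def by (simp add: restrict_def cong: if_cong)
qed

section \<open>Linear maps and volume\<close>

definition mat_act :: "nat => real mat => (nat => real) => nat => real" where
 "mat_act n A x = (\<lambda>i\<in>{..<n}. \<Sum>j<n. A $$ (i, j) * x j)"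

lemma mat_act_measurable: "mat_act n A : measurable (lebn n) (lebn n)"
 unfolding mat_act_def by (rule lebn_restrict) (auto intro!: borel_measurable_sum borel_measurable_times)

lemma mat_act_mult:
 assumes A: "A : carrier_mat n n" and B: "B : carrier_mat n n"
 shows "mat_act n (A * B) x = mat_act n A (mat_act n B x)"
proof
 fix i show "mat_act n (A * B) x i = mat_act n A (mat_act n B x) i"
 proof (cases "i < n")
 case True
 have e: "(A * B) $$ (i, j) = (\<Sum>l<n. A $$ (i, l) * B $$ (l, j))" if "j < n" for j
 using A B True that by (auto simp: scalar_prod_def atLeast0LessThan)
 have "(\<Sum>j<n. (A * B) $$ (i, j) * x j) = (\<Sum>j<n. \<Sum>l<n. A $$ (i, l) * (B $$ (l, j) * x j))"
 by (intro sum.cong refl) (simp add: e sum_distrib_right mult.assoc)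
 also have "... = (\<Sum>l<n. \<Sum>j<n. A $$ (i, l) * (B $$ (l, j) * x j))" by (rule sum.swap)
 also have "... = (\<Sum>l<n. A $$ (i, l) * (\<Sum>j<n. B $$ (l, j) * x j))"
 by (simp add: sum_distrib_left)
 finally show ?thesis using True by (simp add: mat_act_def)
 qed (simp add: mat_act_def)
qed

text \<open>The matrix of the change of one coordinate in \<open>nn_integral_lebn_coord\<close>.
  These matrices take the place of elementary matrices.\<close>

definition row_mat :: "nat => nat => (nat => real) => real mat" where
 "row_mat n k w = mat n n (%(i, j). if i = k then w j else if i = j then 1 else 0)"

lemma row_mat_carrier [simp]: "row_mat n k w : carrier_mat n n" "dim_row (row_mat n k w) = n" "dim_col (row_mat n k w) = n"
 by (simp_all add: row_mat_def)

lemma det_row_mat: assumes k: "k < n" shows "det (row_mat n k w) = w k"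
proof -
 have "row_mat n k w = transpose_mat (replace_col (1\<^sub>m n) (1\<^sub>m n *\<^sub>v vec n w) k)"
 using k by (intro eq_matI) (auto simp: row_mat_def replace_col_def)
 also have "det ... = det (replace_col (1\<^sub>m n) (1\<^sub>m n *\<^sub>v vec n w) k)"
 by (rule det_transpose[of _ n]) (simp add: replace_col_def)
 also have "... = vec n w $ k * det (1\<^sub>m n)" by (rule cramer_lemma_mat) (use k in auto)
 finally show ?thesis using k by simp
qed

lemma mult_row_mat:
 assumes A: "A : carrier_mat n n" and k: "k < n" and ij: "i < n" "j < n"
 shows "(A * row_mat n k w) $$ (i, j) = A $$ (i, k) * w j + (if j = k then 0 else A $$ (i, j))"
proof -
 have "(A * row_mat n k w) $$ (i, j) = (\<Sum>l<n. A $$ (i, l) * (if l = k then w j else if l = j then 1 else 0))"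
 using A ij by (auto simp: scalar_prod_def row_mat_def atLeast0LessThan)
 also have "... = (\<Sum>l<n. (if l = k then A $$ (i, k) * w j else 0) + (if l = j then if j = k then 0 else A $$ (i, j) else 0))"
 by (intro sum.cong) auto
 finally show ?thesis using k ij by (simp add: sum.distrib)
qed

lemma row_mat_inverse:
 assumes k: "k < n" and w: "w k ~= 0"
 shows "row_mat n k (%j. if j = k then 1 / w k else - w j / w k) * row_mat n k w = 1\<^sub>m n"
 "row_mat n k w * row_mat n k (%j. if j = k then 1 / w k else - w j / w k) = 1\<^sub>m n"
 using assms by (auto intro!: eq_matI simp: mult_row_mat simp del: index_mult_mat(1))
 (auto simp: row_mat_def field_simps)

definition scales_volume :: "nat => real mat => bool" where
 "scales_volume n A \<longleftrightarrow> A : carrier_mat n n &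
 (ALL f:borel_measurable (lebn n). ennreal \<bar>det A\<bar> * (\<integral>\<^sup>+x. f (mat_act n A x) \<partial>lebn n) = (\<integral>\<^sup>+x. f x \<partial>lebn n))"

lemma scales_volume_mult:
 assumes "scales_volume n A" "scales_volume n B" shows "scales_volume n (A * B)"
 unfolding scales_volume_def
proof (intro conjI ballI)
 have AB: "A : carrier_mat n n" "B : carrier_mat n n" using assms by (auto simp: scales_volume_def)
 show "A * B : carrier_mat n n" using AB by simp
 fix f :: "(nat => real) => ennreal" assume f: "f : borel_measurable (lebn n)"
 have g: "(%x. f (mat_act n A x)) : borel_measurable (lebn n)"
 by (rule measurable_compose[OF mat_act_measurable f])
 have 1: "ennreal \<bar>det B\<bar> * (\<integral>\<^sup>+x. f (mat_act n A (mat_act n B x)) \<partial>lebn n) = (\<integral>\<^sup>+x. f (mat_act n A x) \<partial>lebn n)"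
 using bspec[OF conjunct2[OF assms(2)[unfolded scales_volume_def]] g] .
 have 2: "ennreal \<bar>det A\<bar> * (\<integral>\<^sup>+x. f (mat_act n A x) \<partial>lebn n) = (\<integral>\<^sup>+x. f x \<partial>lebn n)"
 using assms(1) f unfolding scales_volume_def by blast
 have "ennreal \<bar>det (A * B)\<bar> = ennreal \<bar>det A\<bar> * ennreal \<bar>det B\<bar>"
 by (simp add: det_mult[OF AB] abs_mult ennreal_mult)
 thus "ennreal \<bar>det (A * B)\<bar> * (\<integral>\<^sup>+x. f (mat_act n (A * B) x) \<partial>lebn n) = (\<integral>\<^sup>+x. f x \<partial>lebn n)"
 unfolding mat_act_mult[OF AB] using 1 2 by (simp add: mult.assoc)
qed

lemma scales_volume_row_mat:
 assumes k: "k < n" and w: "w k ~= 0" shows "scales_volume n (row_mat n k w)"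
 unfolding scales_volume_def
proof (intro conjI ballI)
 fix f :: "(nat => real) => ennreal" assume f: "f : borel_measurable (lebn n)"
 define h where "h = (%x. SUM j:{..<n} - {k}. w j * x j)"
 have h: "h : borel_measurable (lebn n)" "!!x y. h (x(k := y)) = h x"
 unfolding h_def by (auto intro!: borel_measurable_sum borel_measurable_times sum.cong)
 have eq: "mat_act n (row_mat n k w) x = x(k := h x + w k * x k)" if x: "x : space (lebn n)" for x
 proof
 fix i show "mat_act n (row_mat n k w) x i = (x(k := h x + w k * x k)) i"
 proof (cases "i < n")
 case True
 have "(\<Sum>j<n. row_mat n k w $$ (i, j) * x j) = (if i = k then h x + w k * x k else x i)"
 proof (cases "i = k")
 case True
 have "(\<Sum>j<n. row_mat n k w $$ (i, j) * x j) = (\<Sum>j<n. w j * x j)"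
 using True k by (intro sum.cong) (auto simp: row_mat_def)
 also have "... = w k * x k + h x" unfolding h_def using k by (subst sum.remove[of _ k]) auto
 finally show ?thesis using True by simp
 next
 case False
 have "(\<Sum>j<n. row_mat n k w $$ (i, j) * x j) = (\<Sum>j<n. if j = i then x j else 0)"
 using False \<open>i < n\<close> by (intro sum.cong) (auto simp: row_mat_def)
 thus ?thesis using False \<open>i < n\<close> by simp
 qed
 thus ?thesis using True by (simp add: mat_act_def)
 next
 case False
 thus ?thesis using x k by (auto simp: mat_act_def space_lebn PiE_def extensional_def)
 qed
 qed
 have "(\<integral>\<^sup>+x. f (mat_act n (row_mat n k w) x) \<partial>lebn n) = (\<integral>\<^sup>+x. f (x(k := h x + w k * x k)) \<partial>lebn n)"
 by (rule nn_integral_cong) (simp add: eq)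
 thus "ennreal \<bar>det (row_mat n k w)\<bar> * (\<integral>\<^sup>+x. f (mat_act n (row_mat n k w) x) \<partial>lebn n) = (\<integral>\<^sup>+x. f x \<partial>lebn n)"
 using nn_integral_lebn_coord[OF k f w h] by (simp add: det_row_mat[OF k])
qed simp

text \<open>Gaussian elimination into factors \<open>row_mat\<close>, from the bottom row upwards:
  the rows from m on already agree with the identity.\<close>

lemma scales_volume_invertible:
 assumes "A : carrier_mat n n" "B : carrier_mat n n" "A * B = 1\<^sub>m n" "m <= n"
 "!!i j. m <= i ==> i < n ==> j < n ==> A $$ (i, j) = (if i = j then 1 else 0)"
 shows "scales_volume n A"
 using assms
proof (induction m arbitrary: A B)
 case 0
 have A: "A = 1\<^sub>m n" using 0 by (intro eq_matI) auto
 have "mat_act n A x = x" if "x : space (lebn n)" for x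
 proof
 fix i show "mat_act n A x i = x i"
 proof (cases "i < n")
 case True
 have "(\<Sum>j<n. A $$ (i, j) * x j) = (\<Sum>j<n. if j = i then x j else 0)"
 using True by (intro sum.cong) (auto simp: A)
 thus ?thesis using True by (simp add: mat_act_def)
 next
 case False thus ?thesis using that by (auto simp: mat_act_def space_lebn PiE_def extensional_def)
 qed
 qed
 hence "(\<integral>\<^sup>+x. f (mat_act n A x) \<partial>lebn n) = (\<integral>\<^sup>+x. f x \<partial>lebn n)" for f
 by (intro nn_integral_cong) simp
 thus ?case by (simp add: scales_volume_def A)
next
 case (Suc m)
 have m: "m < n" using Suc.prems by simp
 have main: "scales_volume n A" if A: "A : carrier_mat n n" and B: "B : carrier_mat n n" and AB: "A * B = 1\<^sub>m n"
 and rows: "!!i j. m < i ==> i < n ==> j < n ==> A $$ (i, j) = (if i = j then 1 else 0)"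
 and mm: "A $$ (m, m) ~= 0" for A B
 proof -
 define w where "w = (%j. A $$ (m, j))"
 define w' where "w' = (%j. if j = m then 1 / w m else - w j / w m)"
 have w: "w m ~= 0" using mm by (simp add: w_def)
 note inv = row_mat_inverse[of m n w, OF m w, folded w'_def]
 define A' where "A' = A * row_mat n m w'"
 have A': "A' : carrier_mat n n" using A by (simp add: A'_def)
 have eq: "A = A' * row_mat n m w" unfolding A'_def using A inv(1)
 by (subst assoc_mult_mat[of _ n n _ n _ n]) auto
 have "A' * (row_mat n m w * B) = 1\<^sub>m n"
 using A A' B AB by (subst assoc_mult_mat[symmetric, of _ n n _ n _ n]) (auto simp: eq[symmetric])
 moreover have "A' $$ (i, j) = (if i = j then 1 else 0)" if "m <= i" "i < n" "j < n" for i j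
 using that m mm rows[of i j] rows[of i m] unfolding A'_def
 by (cases "i = m") (auto simp: mult_row_mat[OF A m] w'_def w_def simp del: index_mult_mat(1))
 ultimately have "scales_volume n A'" using Suc.IH[of A' "row_mat n m w * B"] A' B m mult_carrier_mat[of "row_mat n m w" n n B n] by simp
 thus ?thesis using eq scales_volume_mult scales_volume_row_mat[of m n w, OF m w] by metis
 qed
 show ?case
 proof (cases "A $$ (m, m) = 0")
 case False
 show ?thesis by (rule main[of A B]) (use Suc.prems False in auto)
 next
 case True
 \<comment> \<open>Otherwise row m is supported on columns beyond m, where column m of B vanishes,
   against A * B = 1.\<close>
 have "EX l<m. A $$ (m, l) ~= 0"
 proof (rule ccontr)
 assume "~ ?thesis"
 hence z: "A $$ (m, l) = 0" if "l <= m" for l using True that by (cases "l = m") auto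
 have B0: "B $$ (l, m) = 0" if "m < l" "l < n" for l
 proof -
 have "(A * B) $$ (l, m) = (\<Sum>i<n. A $$ (l, i) * B $$ (i, m))"
 using Suc.prems(1,2) that m by (auto simp: scalar_prod_def atLeast0LessThan)
 also have "... = (\<Sum>i<n. if i = l then B $$ (i, m) else 0)"
 using Suc.prems(5)[of l] that by (intro sum.cong) auto
 finally show ?thesis using that m Suc.prems(3) by simp
 qed
 have "(A * B) $$ (m, m) = (\<Sum>i<n. A $$ (m, i) * B $$ (i, m))"
 using Suc.prems(1,2) m by (auto simp: scalar_prod_def atLeast0LessThan)
 also have "... = 0"
 proof (rule sum.neutral, rule ballI)
 fix i assume "i : {..<n}"
 thus "A $$ (m, i) * B $$ (i, m) = 0" using z[of i] B0[of i] by (cases "i <= m") auto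
 qed
 finally show False using Suc.prems(3) m by simp
 qed
 then obtain l where l: "l < m" "A $$ (m, l) ~= 0" by blast
 have ln: "l < n" using l m by simp
 \<comment> \<open>This factor adds column l of A to column m and so produces a nonzero
   pivot.\<close>
 define w :: "nat => real" where "w = (%j. if j = l \<or> j = m then 1 else 0)"
 define w' where "w' = (%j. if j = l then 1 / w l else - w j / w l)"
 have w: "w l ~= 0" by (simp add: w_def)
 note inv = row_mat_inverse[of l n w, OF ln w, folded w'_def]
 define A' where "A' = A * row_mat n l w"
 have A: "A : carrier_mat n n" and B: "B : carrier_mat n n" using Suc.prems by auto
 have A': "A' : carrier_mat n n" using A by (simp add: A'_def)
 have eq: "A = A' * row_mat n l w'" unfolding A'_def using A inv(2)
 by (subst assoc_mult_mat[of _ n n _ n _ n]) auto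
 have "A' * (row_mat n l w' * B) = 1\<^sub>m n"
 using A A' B Suc.prems(3) by (subst assoc_mult_mat[symmetric, of _ n n _ n _ n]) (auto simp: eq[symmetric])
 moreover have "A' $$ (i, j) = (if i = j then 1 else 0)" if "m < i" "i < n" "j < n" for i j
 using that m l Suc.prems(5)[of i j] Suc.prems(5)[of i l] unfolding A'_def
 by (auto simp: mult_row_mat[OF A ln] simp del: index_mult_mat(1))
 moreover have "A' $$ (m, m) ~= 0"
 using True l m unfolding A'_def by (simp add: mult_row_mat[OF A ln] w_def del: index_mult_mat(1))
 ultimately have "scales_volume n A'" using main[of A' "row_mat n l w' * B"] A' B mult_carrier_mat[of "row_mat n l w'" n n B n] by simp
 moreover have "w' l ~= 0" by (simp add: w'_def w_def)
 ultimately show ?thesis using eq scales_volume_mult scales_volume_row_mat[of l n w', OF ln] by metis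
 qed
qed

lemma scales_volume_det:
 assumes A: "A : carrier_mat n n" and d: "det A ~= 0" shows "scales_volume n A"
proof -
 obtain B where "B : carrier_mat n n" "A * B = 1\<^sub>m n"
 using A d det_non_zero_imp_unit[OF A] unfolding Units_def by (auto simp: ring_mat_def)
 thus ?thesis using scales_volume_invertible[OF A _ _ order.refl] by auto
qed

section \<open>The norm on logarithm space and the volume of its unit ball\<close>

definition pos_part_norm :: "nat => (nat => real) => real" where
 "pos_part_norm n x = max (\<Sum>i<n. max 0 (x i)) (\<Sum>i<n. max 0 (- x i))"

lemma pos_part_norm_measurable: "pos_part_norm n : borel_measurable (lebn n)"
 unfolding pos_part_norm_def
 by (auto intro!: borel_measurable_max borel_measurable_sum borel_measurable_const borel_measurable_uminus)

lemma pos_part_norm_diff: "pos_part_norm n (%i. x i - y i) <= pos_part_norm n x + pos_part_norm n y"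
proof -
 have 1: "(\<Sum>i<n. max 0 (x i - y i)) <= (\<Sum>i<n. max 0 (x i)) + (\<Sum>i<n. max 0 (- y i))"
 unfolding sum.distrib[symmetric] by (intro sum_mono) auto
 have 2: "(\<Sum>i<n. max 0 (- (x i - y i))) <= (\<Sum>i<n. max 0 (- x i)) + (\<Sum>i<n. max 0 (y i))"
 unfolding sum.distrib[symmetric] by (intro sum_mono) auto
 show ?thesis unfolding pos_part_norm_def using 1 2 by linarith
qed

lemma pos_part_norm_scale: "pos_part_norm n (%i. c * x i) = \<bar>c\<bar> * pos_part_norm n x"
proof -
 have p: "pos_part_norm n (%i. c * x i) = c * pos_part_norm n x" if c: "c >= 0" for c x
 proof -
 have m: "max 0 (c * t) = c * max 0 t" for t :: real using c by (simp add: max_mult_distrib_left)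
 have "(\<Sum>i<n. max 0 (c * x i)) = c * (\<Sum>i<n. max 0 (x i))" by (simp add: m sum_distrib_left)
 moreover have "(\<Sum>i<n. max 0 (- (c * x i))) = c * (\<Sum>i<n. max 0 (- x i))"
 using m[of "- x _"] by (simp add: sum_distrib_left)
 ultimately show ?thesis unfolding pos_part_norm_def using c by (simp add: max_mult_distrib_left)
 qed
 have s: "pos_part_norm n (%i. - x i) = pos_part_norm n x" for x
 unfolding pos_part_norm_def by (simp add: max.commute)
 show ?thesis
 proof (cases "c >= 0")
 case False
 have "pos_part_norm n (%i. c * x i) = pos_part_norm n (%i. - ((- c) * x i))" by simp
 also have "... = pos_part_norm n (%i. (- c) * x i)" by (rule s)
 also have "... = (- c) * pos_part_norm n x" by (rule p) (use False in simp)
 finally show ?thesis using False by simp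
 qed (use p in simp)
qed

lemma pos_part_norm_le: "pos_part_norm n x <= (\<Sum>i<n. \<bar>x i\<bar>)"
 unfolding pos_part_norm_def by (intro max.boundedI sum_mono) auto

lemma pos_part_norm_cong: "(!!i. i < n ==> x i = y i) ==> pos_part_norm n x = pos_part_norm n y"
 unfolding pos_part_norm_def by (auto intro!: arg_cong2[where f = max] sum.cong)

text \<open>The volume of \<open>body n a b\<close>: j counts the positive coordinates, the binomial
  coefficient their positions, and the fractions are volumes of corner simplices.\<close>

definition body_poly :: "nat => real => real => real" where
 "body_poly n a b = (\<Sum>j\<le>n. real (n choose j) * (a ^ j / fact j * (b ^ (n - j) / fact (n - j))))"

lemma body_poly_has_derivative:
 "((%a. \<Sum>j\<le>n. real (n choose j) * (a ^ Suc j / fact (Suc j) * (b ^ (n - j) / fact (n - j))))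
 has_real_derivative body_poly n a b) (at a)"
proof -
 have "((%a. a ^ Suc j / fact (Suc j)) has_real_derivative a ^ j / fact j) (at a)" for j
 proof -
 have "((%a. a ^ Suc j / fact (Suc j)) has_real_derivative (real (Suc j) * a ^ j) / fact (Suc j)) (at a)"
 by (rule DERIV_cdivide) (use DERIV_pow[of "Suc j" a] in simp)
 moreover have "(real (Suc j) * a ^ j) / fact (Suc j) = a ^ j / fact j"
 by (simp only: fact_Suc of_nat_mult of_nat_Suc) simp
 ultimately show ?thesis by simp
 qed
 thus ?thesis unfolding body_poly_def by (intro DERIV_sum DERIV_cmult DERIV_cmult_right)
qed

lemma body_poly_commute: "body_poly n a b = body_poly n b a"
proof -
 have "body_poly n a b = (\<Sum>j\<le>n. real (n choose (n - j)) * (a ^ (n - j) / fact (n - j) * (b ^ (n - (n - j)) / fact (n - (n - j)))))"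
 unfolding body_poly_def by (rule sum.nat_diff_reindex[symmetric, of _ "Suc n", unfolded lessThan_Suc_atMost diff_Suc_Suc, simplified])
 also have "... = body_poly n b a" unfolding body_poly_def
 by (intro sum.cong refl) (auto simp: binomial_symmetric[symmetric] mult_ac)
 finally show ?thesis .
qed

text \<open>The integral of \<open>body_poly n x b\<close> over x in [0, a].\<close>

definition body_primitive :: "nat => real => real => real" where
 "body_primitive n a b = (\<Sum>j\<le>n. real (n choose j) * (a ^ Suc j / fact (Suc j) * (b ^ (n - j) / fact (n - j))))"

lemma body_primitive_0: "body_primitive n 0 b = 0" by (simp add: body_primitive_def)

text \<open>Pascal's rule. The two terms belong to positive and negative values of the new
  coordinate.\<close>

lemma body_poly_Suc: "body_poly (Suc n) a b = body_primitive n a b + body_primitive n b a"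
proof -
 define g where "g = (%j. a ^ j / fact j * (b ^ (Suc n - j) / fact (Suc n - j)))"
 have "body_poly (Suc n) a b = (\<Sum>j\<le>Suc n. real (Suc n choose j) * g j)" by (simp add: body_poly_def g_def)
 also have "... = g 0 + (\<Sum>j\<le>n. real (Suc n choose Suc j) * g (Suc j))" by (subst sum.atMost_Suc_shift) simp
 also have "... = (\<Sum>j\<le>n. real (n choose j) * g (Suc j)) + (g 0 + (\<Sum>j\<le>n. real (n choose Suc j) * g (Suc j)))"
 by (simp add: distrib_right sum.distrib)
 also have "g 0 + (\<Sum>j\<le>n. real (n choose Suc j) * g (Suc j)) = (\<Sum>j\<le>Suc n. real (n choose j) * g j)"
 by (subst sum.atMost_Suc_shift) simp
 also have "... = (\<Sum>j\<le>n. real (n choose j) * g j)" by simp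
 also have "(\<Sum>j\<le>n. real (n choose j) * g j) = (\<Sum>j\<le>n. real (n choose (n - j)) * g (n - j))"
 by (rule sum.nat_diff_reindex[symmetric, of _ "Suc n", unfolded lessThan_Suc_atMost diff_Suc_Suc, simplified])
 also have "... = body_primitive n b a" unfolding body_primitive_def
 proof (intro sum.cong refl)
 fix j assume "j : {..n}"
 hence j: "j <= n" by simp
 hence "Suc n - (n - j) = Suc j" by simp
 thus "real (n choose (n - j)) * g (n - j) = real (n choose j) * (b ^ Suc j / fact (Suc j) * (a ^ (n - j) / fact (n - j)))"
 using binomial_symmetric[OF j] unfolding g_def by (simp add: mult_ac)
 qed
 also have "(\<Sum>j\<le>n. real (n choose j) * g (Suc j)) = body_primitive n a b"
 unfolding body_primitive_def g_def by simp
 finally show ?thesis .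
qed

lemma body_poly_nonneg: "a >= 0 ==> b >= 0 ==> body_poly n a b >= 0"
 unfolding body_poly_def by (intro sum_nonneg) auto

text \<open>The squares of the binomial coefficients add up to (2n choose n). This is the source of
  the factor (2r)! / (r!)^3 in the regulator bound.\<close>

lemma body_poly_diag: "body_poly n a a = a ^ n * (real (2 * n choose n) / fact n)"
proof -
 have "body_poly n a a = (\<Sum>j\<le>n. a ^ n * (real ((n choose j)\<^sup>2) / fact n))" unfolding body_poly_def
 proof (intro sum.cong refl)
 fix j assume "j : {..n}"
 hence j: "j <= n" by simp
 have "real (n choose j) = fact n / (fact j * fact (n - j))" by (rule binomial_fact[OF j])
 hence "1 / (fact j * fact (n - j)) = real (n choose j) / fact n" by simp
 moreover have "a ^ j * a ^ (n - j) = a ^ n" using j by (simp add: power_add[symmetric])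
 ultimately have "a ^ j / fact j * (a ^ (n - j) / fact (n - j)) = a ^ n * (real (n choose j) / fact n)"
 by (metis (no_types, lifting) times_divide_times_eq times_divide_eq_right mult.right_neutral)
 thus "real (n choose j) * (a ^ j / fact j * (a ^ (n - j) / fact (n - j))) = a ^ n * (real ((n choose j)\<^sup>2) / fact n)"
 by (simp add: power2_eq_square)
 qed
 also have "... = a ^ n * (real (\<Sum>j\<le>n. (n choose j)\<^sup>2) / fact n)"
 by (simp add: sum_distrib_left sum_divide_distrib)
 finally show ?thesis by (simp only: choose_square_sum)
qed

definition body :: "nat => real => real => (nat => real) set" where
 "body n a b = {x. (\<Sum>i<n. max 0 (x i)) < a & (\<Sum>i<n. max 0 (- x i)) < b}"

lemma body_indicator_measurable: "(indicator (body n a b) :: _ => ennreal) : borel_measurable (lebn n)"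
proof -
 have "{x : space (lebn n). (\<Sum>i<n. max 0 (x i)) < a & (\<Sum>i<n. max 0 (- x i)) < b} : sets (lebn n)"
 by measurable
 hence "body n a b \<inter> space (lebn n) : sets (lebn n)"
 unfolding body_def by (simp add: Int_def conj_commute)
 hence "(indicator (body n a b \<inter> space (lebn n)) :: _ => ennreal) : borel_measurable (lebn n)" by (rule borel_measurable_indicator)
 thus ?thesis by (subst measurable_cong[where g = "indicator (body n a b \<inter> space (lebn n))"]) (auto simp: indicator_def)
qed

text \<open>Induction by Tonelli: fixing the last coordinate y leaves a body in which a is lowered
  by y if y > 0, and b by -y if y < 0.\<close>

lemma body_volume:
 assumes "a > 0" "b > 0"
 shows "ennreal (body_poly n a b) <= (\<integral>\<^sup>+x. indicator (body n a b) x \<partial>lebn n)"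
 using assms
proof (induction n arbitrary: a b)
 case 0
 interpret product_sigma_finite "%_::nat. lborel :: real measure" by standard
 have "emeasure (lebn 0) {%_. undefined} = 1" unfolding lebn_def by (simp add: PiM_empty)
 moreover have "(\<integral>\<^sup>+x. indicator (body 0 a b) x \<partial>lebn 0) = (\<integral>\<^sup>+x. 1 \<partial>lebn 0)"
 using 0 by (intro nn_integral_cong) (auto simp: body_def)
 ultimately show ?case by (simp add: space_lebn body_poly_def)
next
 case (Suc n)
 interpret product_sigma_finite "%_::nat. lborel :: real measure" by standard
 have I: "insert n {..<n} = {..<Suc n}" by auto
 define f where "f = (%y. body_poly n (a - y) b)"
 define g where "g = (%y. body_poly n a (b + y))"
 have cont: "continuous_on UNIV f" "continuous_on UNIV g"
 unfolding f_def g_def body_poly_def by (auto intro!: continuous_intros)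
 hence fg: "f : borel_measurable borel" "g : borel_measurable borel"
 by (auto intro: borel_measurable_continuous_onI)
 have f: "(\<integral>\<^sup>+y. ennreal (f y) * indicator {0..a} y \<partial>lborel) = ennreal (body_primitive n a b)"
 proof -
 have "(\<integral>\<^sup>+y. ennreal (f y) * indicator {0..a} y \<partial>lborel) = ennreal (- body_primitive n (a - a) b - (- body_primitive n (a - 0) b))"
 proof (rule nn_integral_FTC_Icc)
 fix y assume "y : {0..a}"
 hence y: "0 <= y" "y <= a" by auto
 show "0 <= f y" unfolding f_def using y Suc.prems by (intro body_poly_nonneg) auto
 have "((%y. body_primitive n (a - y) b) has_real_derivative body_poly n (a - y) b * (- 1)) (at y)"
 unfolding body_primitive_def
 by (rule DERIV_chain2[OF body_poly_has_derivative]) (auto intro!: derivative_eq_intros)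
 from DERIV_minus[OF this] show "((%y. - body_primitive n (a - y) b) has_real_derivative f y) (at y)"
 by (simp add: f_def)
 qed (use fg Suc.prems in auto)
 thus ?thesis by (simp add: body_primitive_0)
 qed
 have g: "(\<integral>\<^sup>+y. ennreal (g y) * indicator {-b..0} y \<partial>lborel) = ennreal (body_primitive n b a)"
 proof -
 have "(\<integral>\<^sup>+y. ennreal (g y) * indicator {-b..0} y \<partial>lborel) = ennreal (body_primitive n (b + 0) a - body_primitive n (b + - b) a)"
 proof (rule nn_integral_FTC_Icc)
 fix y assume "y : {- b..0}"
 hence y: "- b <= y" "y <= 0" by auto
 show "0 <= g y" unfolding g_def using y Suc.prems by (intro body_poly_nonneg) auto
 have "((%y. body_primitive n (b + y) a) has_real_derivative body_poly n (b + y) a * 1) (at y)"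
 unfolding body_primitive_def
 by (rule DERIV_chain2[OF body_poly_has_derivative]) (auto intro!: derivative_eq_intros)
 thus "((%y. body_primitive n (b + y) a) has_real_derivative g y) (at y)"
 by (simp add: g_def body_poly_commute[of n a])
 qed (use fg Suc.prems in auto)
 thus ?thesis by (simp add: body_primitive_0)
 qed
 have step: "indicator (body (Suc n) a b) (x(n := y)) = (indicator (body n (a - max 0 y) (b - max 0 (- y))) x :: ennreal)" for x y
 unfolding body_def indicator_def by auto
 have "body_primitive n a b >= 0" "body_primitive n b a >= 0"
 unfolding body_primitive_def using Suc.prems by (auto intro!: sum_nonneg)
 hence "ennreal (body_poly (Suc n) a b) = (\<integral>\<^sup>+y. ennreal (f y) * indicator {0..a} y + ennreal (g y) * indicator {-b..0} y \<partial>lborel)"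
 using fg by (subst nn_integral_add) (auto simp: f g body_poly_Suc)
 also have "... <= (\<integral>\<^sup>+y. (\<integral>\<^sup>+x. indicator (body n (a - max 0 y) (b - max 0 (- y))) x \<partial>lebn n) \<partial>lborel)"
 proof (rule nn_integral_mono_AE)
 \<comment> \<open>At y = 0 both integrands count, and at y = a or y = -b the remaining body
   degenerates; these points form a null set.\<close>
 have "AE y in lborel. y ~= 0 & y ~= a & y ~= - b" by (intro AE_conjI AE_lborel_singleton)
 thus "AE y in lborel. ennreal (f y) * indicator {0..a} y + ennreal (g y) * indicator {-b..0} y
 <= (\<integral>\<^sup>+x. indicator (body n (a - max 0 y) (b - max 0 (- y))) x \<partial>lebn n)"
 proof eventually_elim
 case (elim y)
 consider "0 < y" "y < a" | "- b < y" "y < 0" | "y > a \<or> y < - b" using elim by linarith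
 thus ?case
 proof cases
 case 1
 thus ?thesis using Suc.IH[of "a - y" b] Suc.prems by (simp add: f_def max_def)
 next
 case 2
 thus ?thesis using Suc.IH[of a "b + y"] Suc.prems by (simp add: g_def max_def)
 next
 case 3
 thus ?thesis using Suc.prems by auto
 qed
 qed
 qed
 also have "... = (\<integral>\<^sup>+x. indicator (body (Suc n) a b) x \<partial>lebn (Suc n))"
 using product_nn_integral_insert_rev[of "{..<n}" n "indicator (body (Suc n) a b)"] body_indicator_measurable[of "Suc n" a b]
 unfolding I lebn_def step by simp
 finally show ?case .
qed

section \<open>Minkowski's second theorem for two minima\<close>

lemma emeasure_unit_cube: "emeasure (lebn n) ({..<n} \<rightarrow>\<^sub>E {0..<1}) = 1"
proof -
 interpret product_sigma_finite "%_::nat. lborel :: real measure" by standard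
 show ?thesis unfolding lebn_def by (subst emeasure_PiM) auto
qed

text \<open>
 This is the case of two distinct successive minima of Minkowski's second theorem. The body
 \<open>B = {N < \<mu>1 / 2}\<close> is stretched by \<open>\<mu>2 / \<mu>1\<close> in the last \<open>n - m\<close> coordinates, and each of its
 fibres over these coordinates is merely translated, by \<open>(\<mu>2 / \<mu>1 - 1) q\<close> for the first rational
 point \<open>q\<close> of the fibre. The result remains disjoint from its translates under \<open>\<int>\<^sup>n\<close>.
\<close>

lemma minkowski_two_minima:
 fixes N :: "(nat => real) => real"
 assumes N: "N : borel_measurable (lebn n)" and diff: "!!x y. N (%i. x i - y i) <= N x + N y"
 and scale: "!!c x. N (%i. c * x i) = \<bar>c\<bar> * N x" and C: "!!x. N x <= C * (\<Sum>i<n. \<bar>x i\<bar>)"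
 and cong: "!!x y. (!!i. i < n ==> x i = y i) ==> N x = N y"
 and mu: "0 < \<mu>1" "\<mu>1 <= \<mu>2" and mn: "m <= n"
 and m1: "!!g::nat => int. EX j<n. g j ~= 0 ==> \<mu>1 <= N (%j. of_int (g j))"
 and m2: "!!g::nat => int. EX j<n. m <= j & g j ~= 0 ==> \<mu>2 <= N (%j. of_int (g j))"
 shows "ennreal ((\<mu>2 / \<mu>1) ^ (n - m)) * emeasure (lebn n) {x : space (lebn n). N x < \<mu>1 / 2} <= 1"
proof -
 define t where "t = \<mu>2 / \<mu>1"
 have t: "t >= 1" "t * \<mu>1 = \<mu>2" using mu by (auto simp: t_def)
 \<comment> \<open>Countably many candidates for the base point of a fibre keep its choice
   measurable. A rational one always exists because N is controlled by the coordinates through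
   C.\<close>
 define QQ where "QQ = {..<m} \<rightarrow>\<^sub>E (\<rat> :: real set)"
 have QQ: "countable QQ" "QQ ~= {}" unfolding QQ_def
 by (auto intro!: countable_PiE simp: countable_rat PiE_eq_empty_iff)
 define q where "q = from_nat_into QQ"
 have qr: "range q = QQ" unfolding q_def by (rule range_from_nat_into[OF QQ(2,1)])
 define fib where "fib = (%k (x::nat => real). \<lambda>i\<in>{..<n}. if i < m then q k i else x i)"
 have fibm: "fib k : measurable (lebn n) (lebn n)" for k
 unfolding fib_def by (rule lebn_restrict) auto
 have Nfib: "(%x. N (fib k x)) : borel_measurable (lebn n)" for k by (rule measurable_compose[OF fibm N])
 define s where "s = \<mu>1 / 2"
 have s: "s > 0" using mu by (simp add: s_def)
 \<comment> \<open>k is the index of the first rational point in the fibre through x. It depends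
   only on the coordinates from m on, so one translation serves the whole fibre.\<close>
 define first where "first = (%x k. N (fib k x) < s & (ALL l<k. ~ N (fib l x) < s))"
 define T where "T = (%k (x::nat => real) i. if i < m then x i + (t - 1) * q k i else t * x i)"
 define GG where "GG = {..<n} \<rightarrow>\<^sub>E (UNIV :: int set)"
 have GG: "countable GG" unfolding GG_def by (intro countable_PiE) auto
 define II where "II = (UNIV :: nat set) \<times> GG"
 have II: "countable II" unfolding II_def using GG by auto
 \<comment> \<open>The body is cut into countably many pieces on which the base point k and the
   integer part g of the stretched point are constant. \<open>S k g\<close> undoes stretching and
   reduction modulo \<int>^n, so \<open>W\<close> is the stretched piece moved into the unit
   cube.\<close>
 define P where "P = (%(k, g). {x : space (lebn n). N x < s & first x k & (ALL i<n. \<lfloor>T k x i\<rfloor> = g i)})"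
 define S where "S = (%k (g :: nat => int) (u::nat => real). \<lambda>i\<in>{..<n}. if i < m then u i + of_int (g i) - (t - 1) * q k i else (u i + of_int (g i)) / t)"
 define W where "W = (%(k, g). {u : space (lebn n). S k g u : P (k, g)})"
 have firstm: "{x : space (lebn n). first x k} : sets (lebn n)" for k
 unfolding first_def using Nfib by measurable
 have Tm: "(%x. T k x i) : borel_measurable (lebn n)" if "i < n" for k i
 using that unfolding T_def by (cases "i < m") auto
 have Pm: "P p : sets (lebn n)" for p
 proof -
 obtain k g where p: "p = (k, g)" by (cases p)
 have "{x : space (lebn n). ALL i:{..<n}. \<lfloor>T k x i\<rfloor> = g i} : sets (lebn n)"
 proof (rule sets.sets_Collect_finite_All)
 fix i assume "i : {..<n}"
 hence i: "i < n" by simp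
 have "{x : space (lebn n). \<lfloor>T k x i\<rfloor> = g i} = {x : space (lebn n). of_int (g i) <= T k x i & T k x i < of_int (g i) + 1}"
 by (auto simp: floor_eq_iff)
 also have "... : sets (lebn n)" using Tm[OF i] by measurable
 finally show "{x : space (lebn n). \<lfloor>T k x i\<rfloor> = g i} : sets (lebn n)" .
 qed simp
 moreover have "{x : space (lebn n). N x < s} : sets (lebn n)" using N by measurable
 moreover have "P p = {x : space (lebn n). N x < s} \<inter> ({x : space (lebn n). first x k} \<inter> {x : space (lebn n). ALL i:{..<n}. \<lfloor>T k x i\<rfloor> = g i})"
 unfolding P_def p by auto
 ultimately show ?thesis using firstm[of k] by auto
 qed
 have Sm: "S k g : measurable (lebn n) (lebn n)" for k g
 unfolding S_def by (rule lebn_restrict) (auto intro!: borel_measurable_add borel_measurable_diff borel_measurable_divide)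
 have Wm: "W p : sets (lebn n)" for p
 proof -
 obtain k g where p: "p = (k, g)" by (cases p)
 have "W p = S k g -` P p \<inter> space (lebn n)" unfolding W_def p by auto
 thus ?thesis using measurable_sets[OF Sm Pm] by simp
 qed
 have TS: "T k (S k g u) i = u i + of_int (g i)" if "i < n" for k g u i
 using that t unfolding T_def S_def by auto
 have vol: "emeasure (lebn n) (W p) = ennreal (t ^ (n - m)) * emeasure (lebn n) (P p)" if "p : II" for p
 proof -
 obtain k g where p: "p = (k, g)" by (cases p)
 define sc where "sc = (%i. if i < m then 1 else 1 / t)"
 define v where "v = (%i. if i < m then of_int (g i) - (t - 1) * q k i else of_int (g i) / t)"
 have prod: "(\<Prod>i<n. \<bar>sc i\<bar>) = 1 / t ^ (n - m)"
 proof -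
 have "{..<n} = {..<m} \<union> {m..<n}" using mn by auto
 hence "(\<Prod>i<n. \<bar>sc i\<bar>) = (\<Prod>i<m. \<bar>sc i\<bar>) * (\<Prod>i=m..<n. \<bar>sc i\<bar>)"
 by (simp add: prod.union_disjoint ivl_disj_int)
 also have "(\<Prod>i<m. \<bar>sc i\<bar>) = 1" by (simp add: sc_def)
 also have "(\<Prod>i=m..<n. \<bar>sc i\<bar>) = (\<Prod>i=m..<n. 1 / t)" using t by (intro prod.cong) (auto simp: sc_def)
 finally show ?thesis by (simp add: power_divide)
 qed
 have S: "S k g u = (\<lambda>i\<in>{..<n}. v i + sc i * u i)" for u
 unfolding S_def v_def sc_def by (auto simp: fun_eq_iff add_divide_distrib)
 have ind: "indicator (W p) u = (indicator (P p) (S k g u) :: ennreal)" if "u : space (lebn n)" for u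
 using that unfolding W_def p by (auto simp: indicator_def)
 have "ennreal (\<Prod>i<n. \<bar>sc i\<bar>) * (\<integral>\<^sup>+u. indicator (P p) (\<lambda>i\<in>{..<n}. v i + sc i * u i) \<partial>lebn n) = (\<integral>\<^sup>+x. indicator (P p) x \<partial>lebn n)"
 by (rule nn_integral_lebn_affine) (use Pm t in "auto simp: sc_def")
 moreover have "(\<integral>\<^sup>+u. indicator (P p) (\<lambda>i\<in>{..<n}. v i + sc i * u i) \<partial>lebn n) = emeasure (lebn n) (W p)"
 proof -
 have "(\<integral>\<^sup>+u. indicator (P p) (\<lambda>i\<in>{..<n}. v i + sc i * u i) \<partial>lebn n) = (\<integral>\<^sup>+u. indicator (W p) u \<partial>lebn n)"
 by (rule nn_integral_cong) (simp add: ind S)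
 thus ?thesis using Wm by simp
 qed
 ultimately have "ennreal (1 / t ^ (n - m)) * emeasure (lebn n) (W p) = emeasure (lebn n) (P p)"
 using Pm by (simp add: prod)
 hence "ennreal (t ^ (n - m)) * (ennreal (1 / t ^ (n - m)) * emeasure (lebn n) (W p)) = ennreal (t ^ (n - m)) * emeasure (lebn n) (P p)"
 by simp
 moreover have "ennreal (t ^ (n - m)) * ennreal (1 / t ^ (n - m)) = 1"
 using t by (subst ennreal_mult[symmetric]) auto
 ultimately show ?thesis by (simp add: mult.assoc[symmetric])
 qed
 have fin: "fib k x : space (lebn n)" for k x by (auto simp: fib_def space_lebn)
 have fib_eq: "fib k x = fib k y" if "!!i. m <= i ==> i < n ==> x i = y i" for k x y
 using that unfolding fib_def by (auto simp: fun_eq_iff)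
 have Bun: "{x : space (lebn n). N x < s} = (\<Union>p\<in>II. P p)"
 proof (intro equalityI subsetI)
 fix x assume x: "x : {x : space (lebn n). N x < s}"
 define C' where "C' = \<bar>C\<bar> + 1"
 \<comment> \<open>N grows by at most C' n e when the first m coordinates are moved by at most e.
   The denominator n + 1 makes the growth strictly smaller than s - N x.\<close>
 define e where "e = (s - N x) / (C' * (real n + 1))"
 have C': "C' > 0" by (simp add: C'_def)
 have e: "e > 0" using x C' unfolding e_def by (intro divide_pos_pos mult_pos_pos) auto
 have "EX r:\<rat>. \<bar>r - x i\<bar> < e" for i
 proof -
 obtain r where "r : \<rat>" "x i < r" "r < x i + e" using Rats_dense_in_real[of "x i" "x i + e"] e by auto
 thus ?thesis by (intro bexI[of _ r]) auto
 qed
 then obtain r where r: "!!i. r i : \<rat>" "!!i. \<bar>r i - x i\<bar> < e" by metis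
 have "restrict r {..<m} : QQ" unfolding QQ_def using r(1) by auto
 then obtain k where k: "q k = restrict r {..<m}" using qr by (metis imageE)
 have "N (fib k x) < s"
 proof -
 have "N (%i. x i - (x i - fib k x i)) <= N x + N (%i. x i - fib k x i)" by (rule diff)
 moreover have "N (%i. x i - (x i - fib k x i)) = N (fib k x)" by simp
 moreover have "N (%i. x i - fib k x i) <= C * (\<Sum>i<n. \<bar>x i - fib k x i\<bar>)" by (rule C)
 moreover have "C * (\<Sum>i<n. \<bar>x i - fib k x i\<bar>) <= C' * (\<Sum>i<n. \<bar>x i - fib k x i\<bar>)"
 unfolding C'_def by (intro mult_right_mono sum_nonneg) auto
 moreover have "C' * (\<Sum>i<n. \<bar>x i - fib k x i\<bar>) <= C' * (\<Sum>i<n. e)"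
 proof (intro mult_left_mono sum_mono)
 fix i assume "i : {..<n}"
 thus "\<bar>x i - fib k x i\<bar> <= e" using r(2)[of i] e unfolding fib_def k by (auto simp: abs_minus_commute)
 qed (use C' in simp)
 moreover have "C' * (\<Sum>i<n. e) < s - N x"
 proof -
 have "C' * (\<Sum>i<n. e) < C' * ((real n + 1) * e)" using C' e by simp
 also have "... = s - N x" unfolding e_def using C' by (simp add: mult.assoc[symmetric])
 finally show ?thesis .
 qed
 ultimately show ?thesis by linarith
 qed
 hence ex: "EX k. N (fib k x) < s" by blast
 define k0 where "k0 = (LEAST k. N (fib k x) < s)"
 have "first x k0" unfolding first_def k0_def using LeastI_ex[OF ex] not_less_Least by blast
 moreover have "(\<lambda>i\<in>{..<n}. \<lfloor>T k0 x i\<rfloor>) : GG" by (auto simp: GG_def)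
 ultimately show "x : (\<Union>p\<in>II. P p)" using x unfolding II_def P_def
 by (intro UN_I[of "(k0, \<lambda>i\<in>{..<n}. \<lfloor>T k0 x i\<rfloor>)"]) auto
 qed (auto simp: P_def)
 have first_uniq: "k = l" if "first x k" "first x l" for x k l
 using that unfolding first_def by (metis linorder_neqE_nat)
 have disjP: "disjoint_family_on P II"
 proof (unfold disjoint_family_on_def, intro ballI impI)
 fix p p' assume p: "p : II" "p' : II" "p ~= p'"
 obtain k g l h where kl: "p = (k, g)" "p' = (l, h)" by (metis surj_pair)
 show "P p \<inter> P p' = {}"
 proof (rule ccontr)
 assume "P p \<inter> P p' ~= {}"
 then obtain x where x: "x : P (k, g)" "x : P (l, h)" unfolding kl by blast
 hence "k = l" unfolding P_def by (auto intro: first_uniq)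
 moreover have "g = h"
 proof (rule PiE_ext[of _ "{..<n}" "%_. UNIV"])
 fix i assume "i : {..<n}"
 thus "g i = h i" using x \<open>k = l\<close> unfolding P_def by auto
 qed (use p kl in "auto simp: II_def GG_def")
 ultimately show False using p kl by simp
 qed
 qed
 have disjW: "disjoint_family_on W II"
 proof (unfold disjoint_family_on_def, intro ballI impI)
 fix p p' assume p: "p : II" "p' : II" "p ~= p'"
 obtain k g l h where kl: "p = (k, g)" "p' = (l, h)" by (metis surj_pair)
 show "W p \<inter> W p' = {}"
 proof (rule ccontr)
 assume "W p \<inter> W p' ~= {}"
 then obtain u where u: "u : W (k, g)" "u : W (l, h)" unfolding kl by blast
 define x where "x = S k g u"
 define y where "y = S l h u"
 have x: "x : P (k, g)" and y: "y : P (l, h)" using u unfolding W_def x_def y_def by auto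
 have Tx: "T k x i = u i + of_int (g i)" and Ty: "T l y i = u i + of_int (h i)" if "i < n" for i
 unfolding x_def y_def using TS[OF that] by auto
 have Nx: "N x < s" "first x k" and Ny: "N y < s" "first y l" using x y unfolding P_def by auto
 define G where "G = (%i. g i - h i)"
 have GT: "of_int (G i) = T k x i - T l y i" if "i < n" for i using Tx[OF that] Ty[OF that] by (simp add: G_def)
 show False
 proof (cases "EX j<n. m <= j & G j ~= 0")
 case True
 have "\<mu>2 <= N (%j. of_int (G j))" by (rule m2[OF True])
 \<comment> \<open>The difference of the stretched points is x - y plus (t - 1) times a difference
   of two further points of the body, so its N is below 2 s t = \<mu>2.\<close>
 also have "... = N (%i. (x i - y i) - (t - 1) * (fib l y i - fib k x i))"
 proof (rule cong)
 fix i assume i: "i < n"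
 show "of_int (G i) = (x i - y i) - (t - 1) * (fib l y i - fib k x i)"
 unfolding GT[OF i] using i by (auto simp: T_def fib_def algebra_simps)
 qed
 also have "... <= N (%i. x i - y i) + N (%i. (t - 1) * (fib l y i - fib k x i))" by (rule diff)
 also have "N (%i. (t - 1) * (fib l y i - fib k x i)) = (t - 1) * N (%i. fib l y i - fib k x i)"
 using scale[of "t - 1" "%i. fib l y i - fib k x i"] t by simp
 also have "... <= (t - 1) * (N (fib l y) + N (fib k x))" using t by (intro mult_left_mono diff) auto
 also have "... <= (t - 1) * (s + s)" using t Nx Ny unfolding first_def by (intro mult_left_mono) auto
 also have "N (%i. x i - y i) <= N x + N y" by (rule diff)
 finally have "\<mu>2 < s + s + (t - 1) * (s + s)" using Nx Ny by simp
 thus False using t by (simp add: s_def algebra_simps)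
 next
 case False
 \<comment> \<open>Equal last coordinates put x and y in the same fibre. Both are then translated
   alike, and the integer vector is x - y itself, with N below 2 s = \<mu>1.\<close>
 have xy: "x i = y i" if "m <= i" "i < n" for i
 using GT[OF that(2)] False that t unfolding T_def by auto
 have "fib j x = fib j y" for j by (rule fib_eq) (use xy in auto)
 hence "first y k" using Nx(2) unfolding first_def by simp
 hence kl': "k = l" using first_uniq Ny(2) by blast
 have "EX j<n. G j ~= 0"
 proof (rule ccontr)
 assume "~ ?thesis"
 hence "g i = h i" if "i < n" for i using that by (auto simp: G_def)
 hence "g = h" using p kl by (intro PiE_ext[of g "{..<n}" "%_. UNIV"]) (auto simp: II_def GG_def)
 thus False using p kl kl' by simp
 qed
 hence "\<mu>1 <= N (%j. of_int (G j))" by (rule m1)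
 also have "... = N (%i. x i - y i)"
 proof (rule cong)
 fix i assume i: "i < n"
 show "of_int (G i) = x i - y i" unfolding GT[OF i] using xy[OF _ i] kl' by (auto simp: T_def)
 qed
 also have "... <= N x + N y" by (rule diff)
 finally show False using Nx Ny by (simp add: s_def)
 qed
 qed
 qed
 have Wc: "W p <= {..<n} \<rightarrow>\<^sub>E {0..<1}" for p
 proof
 fix u assume u: "u : W p"
 obtain k g where p: "p = (k, g)" by (cases p)
 have "u : space (lebn n)" "ALL i<n. \<lfloor>T k (S k g u) i\<rfloor> = g i" using u unfolding W_def P_def p by auto
 hence "\<lfloor>u i + of_int (g i)\<rfloor> = g i" "u : {..<n} \<rightarrow>\<^sub>E UNIV" if "i < n" for i
 using that TS[OF that] by (auto simp: space_lebn)
 moreover have "u : {..<n} \<rightarrow>\<^sub>E UNIV" using \<open>u : space (lebn n)\<close> by (simp add: space_lebn)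
 ultimately show "u : {..<n} \<rightarrow>\<^sub>E {0..<1}" by (auto simp: PiE_def Pi_def floor_eq_iff)
 qed
 have cube: "({..<n} \<rightarrow>\<^sub>E {0..<1}) : sets (lebn n)" unfolding lebn_def by (rule sets_PiM_I_finite) auto
 have "ennreal (t ^ (n - m)) * emeasure (lebn n) {x : space (lebn n). N x < s}
 = ennreal (t ^ (n - m)) * (\<integral>\<^sup>+p. emeasure (lebn n) (P p) \<partial>count_space II)"
 unfolding Bun by (subst emeasure_UN_countable[OF Pm II disjP]) auto
 also have "... = (\<integral>\<^sup>+p. ennreal (t ^ (n - m)) * emeasure (lebn n) (P p) \<partial>count_space II)"
 by (rule nn_integral_cmult[symmetric]) simp
 also have "... = (\<integral>\<^sup>+p. emeasure (lebn n) (W p) \<partial>count_space II)"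
 by (rule nn_integral_cong) (simp add: vol)
 also have "... = emeasure (lebn n) (\<Union>p\<in>II. W p)" by (rule emeasure_UN_countable[OF Wm II disjW, symmetric])
 also have "... <= emeasure (lebn n) ({..<n} \<rightarrow>\<^sub>E {0..<1})" by (rule emeasure_mono[OF _ cube]) (use Wc in blast)
 finally show ?thesis by (simp add: emeasure_unit_cube t_def s_def)
qed

text \<open>In lattice coordinates the lattice becomes \<int>^n, and the volume of the body of
  radius \<mu>1 / 2 is divided by the absolute determinant of A.\<close>

theorem lattice_det_bound:
 assumes A: "A : carrier_mat n n" "det A ~= 0" and mu: "0 < \<mu>1" "\<mu>1 <= \<mu>2" and mn: "m <= n"
 and m1: "!!g::nat => int. EX j<n. g j ~= 0 ==> \<mu>1 <= pos_part_norm n (%i. \<Sum>j<n. A $$ (i, j) * of_int (g j))"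
 and m2: "!!g::nat => int. EX j<n. m <= j & g j ~= 0 ==> \<mu>2 <= pos_part_norm n (%i. \<Sum>j<n. A $$ (i, j) * of_int (g j))"
 shows "real (2 * n choose n) / fact n * (\<mu>1 / 2) ^ m * (\<mu>2 / 2) ^ (n - m) <= \<bar>det A\<bar>"
proof -
 define s where "s = \<mu>1 / 2"
 have s: "s > 0" using mu by (simp add: s_def)
 define N where "N = (%x. pos_part_norm n (%i. \<Sum>j<n. A $$ (i, j) * x j))"
 have Nact: "N x = pos_part_norm n (mat_act n A x)" for x
 unfolding N_def mat_act_def by (rule pos_part_norm_cong) simp
 have Nm: "N : borel_measurable (lebn n)"
 unfolding Nact by (rule measurable_compose[OF mat_act_measurable pos_part_norm_measurable])
 define C where "C = (\<Sum>i<n. \<Sum>j<n. \<bar>A $$ (i, j)\<bar>)"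
 have "ennreal ((\<mu>2 / \<mu>1) ^ (n - m)) * emeasure (lebn n) {x : space (lebn n). N x < \<mu>1 / 2} <= 1"
 proof (rule minkowski_two_minima[OF Nm _ _ _ _ mu mn])
 fix x y :: "nat => real" and c :: real
 have "(%i. \<Sum>j<n. A $$ (i, j) * (x j - y j)) = (%i. (\<Sum>j<n. A $$ (i, j) * x j) - (\<Sum>j<n. A $$ (i, j) * y j))"
 by (simp add: sum_subtractf right_diff_distrib)
 thus "N (%i. x i - y i) <= N x + N y" unfolding N_def by (simp only:) (rule pos_part_norm_diff)
 have "(%i. \<Sum>j<n. A $$ (i, j) * (c * x j)) = (%i. c * (\<Sum>j<n. A $$ (i, j) * x j))"
 by (simp add: sum_distrib_left mult_ac)
 thus "N (%i. c * x i) = \<bar>c\<bar> * N x" unfolding N_def by (simp only:) (rule pos_part_norm_scale)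
 have "N x <= (\<Sum>i<n. \<bar>\<Sum>j<n. A $$ (i, j) * x j\<bar>)" unfolding N_def by (rule pos_part_norm_le)
 also have "... <= (\<Sum>i<n. \<Sum>j<n. \<bar>A $$ (i, j)\<bar> * \<bar>x j\<bar>)"
 by (intro sum_mono order.trans[OF sum_abs]) (simp add: abs_mult)
 also have "... <= (\<Sum>i<n. \<Sum>j<n. \<bar>A $$ (i, j)\<bar> * (\<Sum>l<n. \<bar>x l\<bar>))"
 by (intro sum_mono mult_left_mono member_le_sum) auto
 also have "... = C * (\<Sum>i<n. \<bar>x i\<bar>)" by (simp add: C_def sum_distrib_right)
 finally show "N x <= C * (\<Sum>i<n. \<bar>x i\<bar>)" .
 show "N x = N y" if "!!i. i < n ==> x i = y i"
 proof -
 have "(\<Sum>j<n. A $$ (i, j) * x j) = (\<Sum>j<n. A $$ (i, j) * y j)" for i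
 by (rule sum.cong) (use that in auto)
 thus ?thesis unfolding N_def by simp
 qed
 next
 fix g :: "nat => int"
 show "EX j<n. g j ~= 0 ==> \<mu>1 <= N (%j. of_int (g j))" unfolding N_def by (rule m1)
 show "EX j<n. m <= j & g j ~= 0 ==> \<mu>2 <= N (%j. of_int (g j))" unfolding N_def by (rule m2)
 qed
 moreover have "emeasure (lebn n) {x : space (lebn n). N x < \<mu>1 / 2} = (\<integral>\<^sup>+x. indicator (body n s s) (mat_act n A x) \<partial>lebn n)"
 proof -
 have "{x : space (lebn n). N x < \<mu>1 / 2} : sets (lebn n)" using Nm by measurable
 hence "emeasure (lebn n) {x : space (lebn n). N x < \<mu>1 / 2} = (\<integral>\<^sup>+x. indicator {x : space (lebn n). N x < \<mu>1 / 2} x \<partial>lebn n)"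
 by simp
 also have "... = (\<integral>\<^sup>+x. indicator (body n s s) (mat_act n A x) \<partial>lebn n)"
 by (rule nn_integral_cong) (auto simp: Nact body_def indicator_def pos_part_norm_def s_def)
 finally show ?thesis .
 qed
 ultimately have 1: "ennreal ((\<mu>2 / \<mu>1) ^ (n - m)) * (\<integral>\<^sup>+x. indicator (body n s s) (mat_act n A x) \<partial>lebn n) <= 1" by simp
 have "ennreal \<bar>det A\<bar> * (\<integral>\<^sup>+x. indicator (body n s s) (mat_act n A x) \<partial>lebn n) = (\<integral>\<^sup>+x. indicator (body n s s) x \<partial>lebn n)"
 using scales_volume_det[OF A] body_indicator_measurable unfolding scales_volume_def by blast
 hence "ennreal (body_poly n s s) <= ennreal \<bar>det A\<bar> * (\<integral>\<^sup>+x. indicator (body n s s) (mat_act n A x) \<partial>lebn n)"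
 using body_volume[OF s s, of n] by simp
 hence "ennreal ((\<mu>2 / \<mu>1) ^ (n - m)) * ennreal (body_poly n s s) <= ennreal ((\<mu>2 / \<mu>1) ^ (n - m)) * (ennreal \<bar>det A\<bar> * (\<integral>\<^sup>+x. indicator (body n s s) (mat_act n A x) \<partial>lebn n))"
 by (rule mult_left_mono) simp
 also have "... = ennreal \<bar>det A\<bar> * (ennreal ((\<mu>2 / \<mu>1) ^ (n - m)) * (\<integral>\<^sup>+x. indicator (body n s s) (mat_act n A x) \<partial>lebn n))"
 by (simp add: mult_ac)
 also have "... <= ennreal \<bar>det A\<bar> * 1" by (rule mult_left_mono[OF 1]) simp
 finally have "ennreal ((\<mu>2 / \<mu>1) ^ (n - m) * body_poly n s s) <= ennreal \<bar>det A\<bar>"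
 using mu s body_poly_nonneg[of s s n] by (subst ennreal_mult) auto
 hence "(\<mu>2 / \<mu>1) ^ (n - m) * body_poly n s s <= \<bar>det A\<bar>" by (simp add: ennreal_le_iff)
 moreover have "(\<mu>2 / \<mu>1) ^ (n - m) * body_poly n s s = real (2 * n choose n) / fact n * (\<mu>1 / 2) ^ m * (\<mu>2 / 2) ^ (n - m)"
 proof -
 have "s ^ n = s ^ m * s ^ (n - m)" using mn by (simp add: power_add[symmetric])
 moreover have "(\<mu>2 / \<mu>1) ^ (n - m) * s ^ (n - m) = (\<mu>2 / 2) ^ (n - m)"
 unfolding power_mult_distrib[symmetric] s_def using mu by simp
 ultimately show ?thesis unfolding body_poly_diag s_def[symmetric] by (simp add: mult_ac)
 qed
 ultimately show ?thesis by simp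
qed

section \<open>Archimedean places\<close>

definition conj_emb :: "'a::field_char_0 set => ('a => complex) => 'a => complex" where
 "conj_emb K sg = restrict (%x. cnj (sg x)) K"

lemma conj_emb_in: "is_subfield K ==> sg : Emb K ==> conj_emb K sg : Emb K"
 unfolding embeddings_def conj_emb_def
 by (simp add: subfield_1 subfield_add subfield_mult)

lemma conj_emb_invol: "sg : Emb K ==> conj_emb K (conj_emb K sg) = sg"
 by (auto simp: conj_emb_def embeddings_def extensional_def fun_eq_iff)

lemma cmod_conj_emb: "x : K ==> cmod (conj_emb K sg x) = cmod (sg x)"
 by (simp add: conj_emb_def)

lemma conj_emb_real: "sg : Emb K ==> conj_emb K sg = sg \<longleftrightarrow> real_embedding K sg"
proof
 assume "conj_emb K sg = sg"
 hence "cnj (sg x) = sg x" if "x : K" for x using that by (metis conj_emb_def restrict_apply')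
 thus "real_embedding K sg" unfolding real_embedding_def using Reals_cnj_iff by blast
next
 assume s: "sg : Emb K" "real_embedding K sg"
 show "conj_emb K sg = sg"
 proof
 fix x show "conj_emb K sg x = sg x"
 proof (cases "x : K")
 case True
 hence "sg x : \<real>" using s(2) unfolding real_embedding_def by blast
 thus ?thesis using True Reals_cnj_iff by (simp add: conj_emb_def)
 next
 case False thus ?thesis using s(1) by (auto simp: conj_emb_def embeddings_def extensional_def)
 qed
 qed
qed

lemma arch_places_iff: "arch_places K vs \<longleftrightarrow> distinct vs & set vs <= Emb K &
 (ALL sg:Emb K. \<exists>!tu. tu : set vs & (tu = sg \<or> tu = conj_emb K sg))"
 unfolding arch_places_def conj_emb_def ..

lemma arch_places_ex:
 assumes nf: "number_field K" obtains vs where "arch_places K vs"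
proof -
 have sf: "is_subfield K" using nf by (rule number_field_subfield)
 \<comment> \<open>The choice is made from the unordered pair, so conjugate embeddings get the same
   representative.\<close>
 define rep where "rep = (%sg. SOME tu. tu : {sg, conj_emb K sg})"
 have rep: "rep sg : {sg, conj_emb K sg}" for sg unfolding rep_def by (rule someI[of _ sg]) simp
 have rc: "rep (conj_emb K sg) = rep sg" if "sg : Emb K" for sg
 unfolding rep_def conj_emb_invol[OF that] by (simp add: insert_commute)
 have fin: "finite (rep ` Emb K)" using embeddings_finite[OF nf] by simp
 then obtain vs where vs: "set vs = rep ` Emb K" "distinct vs" using finite_distinct_list by blast
 have sub: "rep ` Emb K <= Emb K"
 proof (rule image_subsetI)
 fix sg assume "sg : Emb K"
 thus "rep sg : Emb K" using rep[of sg] conj_emb_in[OF sf, of sg] by (elim insertE) simp_all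
 qed
 have "\<exists>!tu. tu : set vs & (tu = sg \<or> tu = conj_emb K sg)" if s: "sg : Emb K" for sg
 proof (rule ex1I[of _ "rep sg"])
 show "rep sg : set vs & (rep sg = sg \<or> rep sg = conj_emb K sg)" using s vs rep[of sg] by auto
 fix tu assume t: "tu : set vs & (tu = sg \<or> tu = conj_emb K sg)"
 then obtain sg' where s': "sg' : Emb K" "tu = rep sg'" using vs by auto
 hence "rep tu = rep sg'" using rep[of sg'] rc[OF s'(1)] by auto
 moreover have "rep tu = rep sg" using t rc[OF s] by auto
 ultimately show "tu = rep sg" using s' by simp
 qed
 hence "arch_places K vs" unfolding arch_places_iff using vs sub by simp
 thus ?thesis by (rule that)
qed

locale places = numfield K n e for K :: "'a::field_char_0 set" and n e +
 fixes vs :: "('a => complex) list"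
 assumes vs: "arch_places K vs"
begin

abbreviation UK where "UK \<equiv> integer_units K"

text \<open>The weight \<open>local_degree\<close> turns sums over places into sums over all
  embeddings, so that the logarithms of a unit add up to zero.\<close>

definition lg :: "nat => 'a => real" where
 "lg i u = real (local_degree K (vs ! i)) * ln (cmod ((vs ! i) u))"

lemma vs_distinct: "distinct vs" and vs_sub: "set vs <= Emb K"
 and vs_ex1: "sg : Emb K ==> \<exists>!tu. tu : set vs & (tu = sg \<or> tu = conj_emb K sg)"
 using vs unfolding arch_places_iff by auto

lemma vs_emb: "i < length vs ==> vs ! i : Emb K"
 using vs_sub by auto

lemma vs_nonempty: "length vs > 0"
proof -
 have "Emb K ~= {}" using n_card n_pos by auto
 thus ?thesis using vs_ex1 by fastforce
qed

lemma emb_cases: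
 assumes "sg : Emb K"
 obtains i where "i < length vs" "vs ! i = sg \<or> vs ! i = conj_emb K sg"
 using vs_ex1[OF assms] by (metis in_set_conv_nth)

lemma sum_places:
 assumes phi: "!!sg. sg : Emb K ==> fi (conj_emb K sg) = (fi sg :: real)"
 shows "(SUM sg:Emb K. fi sg) = (\<Sum>i<length vs. real (local_degree K (vs ! i)) * fi (vs ! i))"
proof -
 have un: "Emb K = (\<Union>tu\<in>set vs. {tu, conj_emb K tu})"
 proof (intro equalityI subsetI)
 fix sg assume s: "sg : Emb K"
 then obtain tu where "tu : set vs" "tu = sg \<or> tu = conj_emb K sg" using vs_ex1 by blast
 moreover from this(2) have "sg : {tu, conj_emb K tu}" using conj_emb_invol[OF s] by (elim disjE) simp_all
 ultimately show "sg : (\<Union>tu\<in>set vs. {tu, conj_emb K tu})" by (intro UN_I[of tu])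
 qed (use vs_sub conj_emb_in[OF sf] in auto)
 have disj: "{tu, conj_emb K tu} \<inter> {tu', conj_emb K tu'} = {}" if "tu : set vs" "tu' : set vs" "tu ~= tu'" for tu tu'
 proof -
 have t: "tu : Emb K" "tu' : Emb K" using that vs_sub by auto
 have "tu' ~= conj_emb K tu" using vs_ex1[OF t(1)] that by blast
 moreover have "tu ~= conj_emb K tu'" using vs_ex1[OF t(2)] that by blast
 moreover have "conj_emb K tu ~= conj_emb K tu'" using conj_emb_invol[OF t(1)] conj_emb_invol[OF t(2)] that(3) by metis
 ultimately show ?thesis using that by auto
 qed
 have "(SUM sg:Emb K. fi sg) = (SUM tu:set vs. SUM sg:{tu, conj_emb K tu}. fi sg)"
 by (subst un, rule sum.UNION_disjoint) (use disj in auto)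
 also have "... = (SUM tu:set vs. real (local_degree K tu) * fi tu)"
 proof (rule sum.cong)
 fix tu assume "tu : set vs"
 hence t: "tu : Emb K" using vs_sub by auto
 show "(SUM sg:{tu, conj_emb K tu}. fi sg) = real (local_degree K tu) * fi tu"
 proof (cases "real_embedding K tu")
 case True thus ?thesis using conj_emb_real[OF t] by (simp add: local_degree_def)
 next
 case False
 hence "tu ~= conj_emb K tu" using conj_emb_real[OF t] by metis
 thus ?thesis using False phi[OF t] by (simp add: local_degree_def)
 qed
 qed simp
 also have "... = (\<Sum>i<length vs. real (local_degree K (vs ! i)) * fi (vs ! i))"
 by (rule sum.reindex_bij_betw[symmetric]) (rule bij_betw_nth[OF vs_distinct refl refl])
 finally show ?thesis .
qed

lemma unit_iff: "u : UK \<longleftrightarrow> u : K & u ~= 0 & algebraic_int u & algebraic_int (inverse u)"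
 by (rule integer_units_iff[OF sf])

lemma unit_K: "u : UK ==> u : K" and unit_nz: "u : UK ==> u ~= 0" and unit_OK: "u : UK ==> u : OK"
 and unit_inv: "u : UK ==> inverse u : UK"
 unfolding unit_iff ring_of_integers_def using subfield_inverse[OF sf] by auto

lemma unit_1: "1 : UK" unfolding unit_iff using subfield_1[OF sf] by simp

lemma unit_mult: "u : UK ==> v : UK ==> u * v : UK"
 unfolding unit_iff using subfield_mult[OF sf] algebraic_int_add_mult(2) by (metis inverse_mult_distrib mult_eq_0_iff)

lemma emb_cmod_pos: "sg : Emb K ==> x : K ==> x ~= 0 ==> cmod (sg x) > 0"
 using emb_eq_0_iff[OF sf] by simp

text \<open>The norm of a nonzero integer is at least 1 in absolute value; this is applied to u and
  to its inverse.\<close>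

lemma unit_norm: assumes u: "u : UK" shows "(SUM sg:Emb K. ln (cmod (sg u))) = 0"
proof -
 have fin: "finite (Emb K)" by (rule embeddings_finite[OF nf])
 have ge: "(SUM sg:Emb K. ln (cmod (sg u))) >= 0" if u: "u : UK" for u
 proof -
 have "(PROD sg:Emb K. cmod (sg u)) >= 1" by (rule norm_ge_1) (use u unit_OK unit_nz in auto)
 hence "ln (PROD sg:Emb K. cmod (sg u)) >= 0" by simp
 moreover have "ln (PROD sg:Emb K. cmod (sg u)) = (SUM sg:Emb K. ln (cmod (sg u)))"
 by (rule ln_prod[OF fin]) (use emb_cmod_pos unit_K[OF u] unit_nz[OF u] in auto)
 ultimately show ?thesis by simp
 qed
 have "(SUM sg:Emb K. ln (cmod (sg (inverse u)))) = - (SUM sg:Emb K. ln (cmod (sg u)))"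
 unfolding sum_negf[symmetric]
 by (rule sum.cong) (use emb_cmod_pos unit_K[OF u] unit_nz[OF u] in "auto simp: emb_inverse[OF sf] norm_inverse ln_inverse")
 thus ?thesis using ge[OF u] ge[OF unit_inv[OF u]] by linarith
qed

lemma lg_sum: assumes u: "u : UK" shows "(\<Sum>i<length vs. lg i u) = 0"
 unfolding lg_def
 using sum_places[of "%sg. ln (cmod (sg u))"] unit_norm[OF u] cmod_conj_emb[OF unit_K[OF u]] by simp

lemma lg_mult: "i < length vs ==> u : UK ==> v : UK ==> lg i (u * v) = lg i u + lg i v"
 unfolding lg_def using emb_cmod_pos[OF vs_emb, of i u] emb_cmod_pos[OF vs_emb, of i v]
 by (simp add: emb_mult[OF sf vs_emb] unit_K unit_nz norm_mult ln_mult distrib_left)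

lemma local_degree_ge: "real (local_degree K sg) >= 1" by (simp add: local_degree_def)

lemma log_mahler_lg:
 assumes u: "u : UK" shows "log_mahler K u = (\<Sum>i<length vs. max 0 (lg i u))"
 "log_mahler K u = (\<Sum>i<length vs. max 0 (- lg i u))"
proof -
 have "log_mahler K u = (\<Sum>i<length vs. real (local_degree K (vs ! i)) * ln (max 1 (cmod ((vs ! i) u))))"
 unfolding log_mahler_def by (rule sum_places) (use cmod_conj_emb[OF unit_K[OF u]] in simp)
 also have "... = (\<Sum>i<length vs. max 0 (lg i u))"
 proof (rule sum.cong)
 fix i assume "i : {..<length vs}"
 hence "cmod ((vs ! i) u) > 0" using emb_cmod_pos[OF vs_emb, of i u] unit_K[OF u] unit_nz[OF u] by simp
 hence "ln (max 1 (cmod ((vs ! i) u))) = max 0 (ln (cmod ((vs ! i) u)))" by (auto simp: max_def)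
 thus "real (local_degree K (vs ! i)) * ln (max 1 (cmod ((vs ! i) u))) = max 0 (lg i u)"
 unfolding lg_def by (simp add: max_mult_distrib_left)
 qed simp
 finally show 1: "log_mahler K u = (\<Sum>i<length vs. max 0 (lg i u))" .
 have "(\<Sum>i<length vs. max 0 (lg i u)) - (\<Sum>i<length vs. max 0 (- lg i u)) = (\<Sum>i<length vs. lg i u)"
 unfolding sum_subtractf[symmetric] by (intro sum.cong) auto
 thus "log_mahler K u = (\<Sum>i<length vs. max 0 (- lg i u))" using 1 lg_sum[OF u] by simp
qed

section \<open>Finiteness and the existence of independent units\<close>

text \<open>The coordinates in an integral basis are the inverse of \<open>emb_mat\<close> applied
  to the conjugates, so bounded conjugates leave finitely many integer coordinates.\<close>

lemma finite_bounded_integers: "finite {x : OK. ALL sg:Emb K. cmod (sg x) <= C}"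
proof -
 obtain b where b: "fam_basis \<int> OK n b" "fam_basis \<rat> K n b" using discriminant_basis by blast
 obtain B where B: "B : carrier_mat n n" "B * emb_mat n e b = 1\<^sub>m n"
 using mat_inverse_ex[OF emb_mat_carrier det_emb_mat_nonzero[OF b(2)]] by blast
 define M where "M = (\<Sum>k<n. \<Sum>i<n. cmod (B $$ (k, i)) * \<bar>C\<bar>)"
 define g where "g = (%c::nat => int. \<Sum>k<n. of_int (c k) * b k)"
 have "{x : OK. ALL sg:Emb K. cmod (sg x) <= C} <= g ` ({..<n} \<rightarrow>\<^sub>E {- \<lceil>M\<rceil>..\<lceil>M\<rceil>})"
 proof
 fix x assume x: "x : {x : OK. ALL sg:Emb K. cmod (sg x) <= C}"
 then obtain c :: "nat => int" where c: "x = (\<Sum>k<n. of_int (c k) * b k)" using fam_basis_int_span[OF b(1)] by blast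
 have bK: "b k : K" if "k < n" for k using fam_basis_mem[OF b(2) that] .
 have ex: "e i x = (\<Sum>k<n. of_int (c k) * e i (b k))" if i: "i < n" for i
 unfolding c by (subst emb_sum[OF sf e_emb[OF i]])
 (use bK in "auto simp: emb_mult[OF sf e_emb[OF i]] emb_of_int[OF sf e_emb[OF i]] subfield_of_int[OF sf] subfield_mult[OF sf]")
 have "\<bar>of_int (c k)\<bar> <= M" if k: "k < n" for k
 proof -
 have one: "(\<Sum>i<n. B $$ (k, i) * e i (b l)) = (if k = l then 1 else 0)" if l: "l < n" for l
 proof -
 have "(B * emb_mat n e b) $$ (k, l) = (\<Sum>i<n. B $$ (k, i) * e i (b l))"
 using B(1) k l by (auto simp: scalar_prod_def emb_mat_def lessThan_atLeast0)
 thus ?thesis using B(2) k l by simp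
 qed
 have "(\<Sum>i<n. B $$ (k, i) * e i x) = (\<Sum>i<n. \<Sum>l<n. of_int (c l) * (B $$ (k, i) * e i (b l)))"
 by (intro sum.cong refl) (simp add: ex sum_distrib_left mult_ac)
 also have "... = (\<Sum>l<n. of_int (c l) * (\<Sum>i<n. B $$ (k, i) * e i (b l)))"
 by (subst sum.swap) (simp add: sum_distrib_left)
 also have "... = (\<Sum>l<n. if l = k then of_int (c k) else 0)" by (intro sum.cong) (auto simp: one)
 also have "... = of_int (c k)" using k by simp
 finally have "cmod (of_int (c k)) = cmod (\<Sum>i<n. B $$ (k, i) * e i x)" by simp
 also have "... <= (\<Sum>i<n. cmod (B $$ (k, i)) * \<bar>C\<bar>)"
 proof (rule sum_norm_le)
 fix i assume "i : {..<n}"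
 hence "cmod (e i x) <= C" using x e_emb by auto
 thus "cmod (B $$ (k, i) * e i x) <= cmod (B $$ (k, i)) * \<bar>C\<bar>" by (auto simp: norm_mult intro!: mult_left_mono)
 qed
 also have "... <= M" unfolding M_def by (rule member_le_sum[of k "{..<n}"]) (use k in "auto intro!: sum_nonneg")
 finally show ?thesis by simp
 qed
 hence bnd: "\<bar>real_of_int (c k)\<bar> <= M" if "k < n" for k using that by blast
 have "c k : {- \<lceil>M\<rceil>..\<lceil>M\<rceil>}" if "k < n" for k
 proof -
 have "real_of_int (c k) <= of_int \<lceil>M\<rceil>" "real_of_int (- \<lceil>M\<rceil>) <= of_int (c k)"
 using bnd[OF that] le_of_int_ceiling[of M] unfolding of_int_minus by linarith+
 thus ?thesis by (simp only: of_int_le_iff atLeastAtMost_iff)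
 qed
 hence "restrict c {..<n} : {..<n} \<rightarrow>\<^sub>E {- \<lceil>M\<rceil>..\<lceil>M\<rceil>}" by auto
 moreover have "x = g (restrict c {..<n})" unfolding g_def c by (intro sum.cong) auto
 ultimately show "x : g ` ({..<n} \<rightarrow>\<^sub>E {- \<lceil>M\<rceil>..\<lceil>M\<rceil>})" by blast
 qed
 thus ?thesis by (rule finite_subset) (auto intro!: finite_imageI finite_PiE)
qed

lemma finite_bounded_units: "finite {u : UK. ALL i<length vs. \<bar>lg i u\<bar> <= C}"
proof (rule finite_subset[OF _ finite_bounded_integers[of "exp \<bar>C\<bar>"]], rule subsetI)
 fix u assume "u : {u : UK. ALL i<length vs. \<bar>lg i u\<bar> <= C}"
 hence u: "u : UK" "!!i. i < length vs ==> \<bar>lg i u\<bar> <= C" by auto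
 have "cmod (sg u) <= exp \<bar>C\<bar>" if s: "sg : Emb K" for sg
 proof -
 obtain i where i: "i < length vs" "vs ! i = sg \<or> vs ! i = conj_emb K sg" using emb_cases[OF s] .
 hence eq: "cmod ((vs ! i) u) = cmod (sg u)" using cmod_conj_emb[OF unit_K[OF u(1)]] by auto
 have pos: "cmod (sg u) > 0" using emb_cmod_pos[OF s] unit_K unit_nz u by auto
 have "\<bar>ln (cmod (sg u))\<bar> <= \<bar>lg i u\<bar>" unfolding lg_def eq abs_mult
 using mult_right_mono[OF local_degree_ge[of "vs ! i"], of "\<bar>ln (cmod (sg u))\<bar>"] by simp
 hence "ln (cmod (sg u)) <= \<bar>C\<bar>" using u(2)[OF i(1)] by linarith
 thus ?thesis using pos by (metis exp_le_cancel_iff exp_ln)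
 qed
 thus "u : {x : OK. ALL sg:Emb K. cmod (sg x) <= exp \<bar>C\<bar>}" using unit_OK[OF u(1)] by simp
qed

text \<open>
 Dirichlet's box principle, applied to the real functionals \<open>Re \<circ> sg + Im \<circ> sg\<close>; those of a
 conjugate pair together control \<open>sg\<close>.
\<close>

lemma small_elements:
 assumes E: "E <= Emb K" "!!sg. sg : E ==> conj_emb K sg : E" and m: "card E = m" "1 <= m" "m < n"
 obtains N0 where "ALL ee>0. EX x:OK. x ~= 0 & (ALL sg:E. cmod (sg x) < ee) & (PROD sg:Emb K. cmod (sg x)) <= N0"
proof -
 have finK: "finite (Emb K)" by (rule embeddings_finite[OF nf])
 have finE: "finite E" using E(1) finK by (rule finite_subset)
 obtain b where b: "fam_basis \<int> OK n b" using discriminant_basis by blast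
 have bO: "b k : OK" if "k < n" for k using fam_basis_mem[OF b that] .
 hence bK: "b k : K" if "k < n" for k using that OK_K by blast
 \<comment> \<open>The factor 2 covers the passage from the modulus to \<open>ph\<close>, and the
   added 1 makes the bound by \<open>Bd\<close> strict.\<close>
 define C where "C = (SUM sg:Emb K. \<Sum>k<n. 2 * cmod (sg (b k))) + 1"
 have C1: "C >= 1" unfolding C_def by (simp add: sum_nonneg)
 define g where "g = (%c::nat => int. \<Sum>k<n. of_int (c k) * b k)"
 define ph where "ph = (%(sg :: 'a => complex) x. Re (sg x) + Im (sg x) :: real)"
 have gO: "g c : OK" for c unfolding g_def by (intro OK_sum OK_closed bO) auto
 have gs: "sg (g c) = (\<Sum>k<n. of_int (c k) * sg (b k))" if s: "sg : Emb K" for sg c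
 unfolding g_def by (subst emb_sum[OF sf s])
 (use bK in "auto simp: emb_mult[OF sf s] emb_of_int[OF sf s] subfield_of_int[OF sf] subfield_mult[OF sf]")
 have bound: "2 * cmod (sg (g c)) <= Q * (C - 1)"
 if s: "sg : Emb K" and c: "!!k. k < n ==> \<bar>of_int (c k)\<bar> <= Q" "Q >= 0" for sg c and Q :: real
 proof -
 have "cmod (sg (g c)) <= (\<Sum>k<n. Q * cmod (sg (b k)))" unfolding gs[OF s]
 by (rule sum_norm_le) (use c in "auto simp: norm_mult intro!: mult_right_mono")
 also have "(\<Sum>k<n. Q * cmod (sg (b k))) = Q * (\<Sum>k<n. 2 * cmod (sg (b k))) / 2" by (simp add: sum_distrib_left[symmetric])
 finally have "2 * cmod (sg (g c)) <= Q * (\<Sum>k<n. 2 * cmod (sg (b k)))" by simp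
 also have "... <= Q * (C - 1)" unfolding C_def using c(2) s finK
 by (intro mult_left_mono) (auto intro!: member_le_sum[where f = "%sg. \<Sum>k<n. 2 * cmod (sg (b k))"] sum_nonneg)
 finally show ?thesis .
 qed
 have step: "EX x:OK. x ~= 0 & (ALL sg:E. cmod (sg x) <= 8 * C * real t ^ m / real t ^ n) &
 (ALL sg:Emb K. cmod (sg x) <= C * real t ^ m)" if t: "t >= 2" for t :: nat
 proof -
 \<comment> \<open>There are (Q + 1)^n = t^(m n) coefficient vectors but only h^m boxes, and h = t^n
   - 1 is just small enough for the pigeonhole principle.\<close>
 define Q where "Q = t ^ m - 1"
 have tm: "t ^ m >= 2" using self_le_power[of t m] t m(2) by linarith
 have Q: "Q >= 1" "Q + 1 = t ^ m" "real Q <= real t ^ m" using tm by (auto simp: Q_def of_nat_diff)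
 define h where "h = t ^ n - 1"
 have tn: "t ^ n >= 2" using self_le_power[of t n] t m(2,3) by linarith
 have h: "h >= 1" "real t ^ n <= 2 * real h"
 proof -
 show "h >= 1" using tn by (simp add: h_def)
 have "t ^ n <= 2 * h" using tn by (simp add: h_def)
 hence "real (t ^ n) <= real (2 * h)" by (simp only: of_nat_le_iff)
 thus "real t ^ n <= 2 * real h" by simp
 qed
 define A where "A = {..<n} \<rightarrow>\<^sub>E {0..int Q}"
 define Bd where "Bd = real Q * C"
 have Bd: "Bd > 0" using Q C1 by (simp add: Bd_def)
 define box where "box = (%c. \<lambda>sg\<in>E. \<lfloor>(ph sg (g c) + Bd) * real h / (2 * Bd)\<rfloor>)"
 have phb: "\<bar>ph sg (g c)\<bar> < Bd" if c: "c : A" and s: "sg : Emb K" for c sg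
 proof -
 have "\<bar>ph sg (g c)\<bar> <= 2 * cmod (sg (g c))"
 unfolding ph_def using abs_Re_le_cmod[of "sg (g c)"] abs_Im_le_cmod[of "sg (g c)"] by linarith
 also have "... <= real Q * (C - 1)" by (rule bound[OF s]) (use c in "auto simp: A_def PiE_def Pi_def")
 also have "... < Bd" unfolding Bd_def using Q by (simp add: algebra_simps)
 finally show ?thesis .
 qed
 have "box ` A <= E \<rightarrow>\<^sub>E {0..<int h}"
 proof (rule image_subsetI)
 fix c assume c: "c : A"
 show "box c : E \<rightarrow>\<^sub>E {0..<int h}" unfolding box_def
 proof (rule restrict_PiE_iff[THEN iffD2], rule ballI)
 fix sg assume "sg : E"
 hence s: "\<bar>ph sg (g c)\<bar> < Bd" using phb[OF c] E(1) by blast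
 have "0 <= (ph sg (g c) + Bd) * real h / (2 * Bd)" using s Bd by (intro divide_nonneg_pos mult_nonneg_nonneg) auto
 moreover have "(ph sg (g c) + Bd) * real h / (2 * Bd) < real h"
 proof -
 have "(ph sg (g c) + Bd) * real h < (2 * Bd) * real h" using s h by (intro mult_strict_right_mono) auto
 thus ?thesis using Bd by (simp add: divide_less_eq mult.commute)
 qed
 ultimately show "\<lfloor>(ph sg (g c) + Bd) * real h / (2 * Bd)\<rfloor> : {0..<int h}" by (simp add: floor_less_iff)
 qed
 qed
 hence "card (box ` A) <= card (E \<rightarrow>\<^sub>E {0..<int h})" by (intro card_mono finite_PiE finE) auto
 also have "... = h ^ m" using finE m by (simp add: card_PiE)
 also have "... < (t ^ n) ^ m" using tn m(2) unfolding h_def by (intro power_strict_mono) auto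
 also have "... = (Q + 1) ^ n" unfolding Q(2) by (simp add: power_mult[symmetric] mult.commute)
 also have "... = card A" unfolding A_def by (simp add: card_PiE nat_add_distrib)
 finally have "~ inj_on box A" by (rule pigeonhole)
 then obtain c c' where c: "c : A" "c' : A" "box c = box c'" "c ~= c'" by (auto simp: inj_on_def)
 define dd where "dd = (%k. c k - c' k)"
 have gd: "g dd = g c - g c'"
 proof -
 have "g dd = (\<Sum>k<n. of_int (c k) * b k - of_int (c' k) * b k)" unfolding g_def
 by (rule sum.cong) (simp_all add: dd_def left_diff_distrib)
 thus ?thesis unfolding g_def by (simp only: sum_subtractf)
 qed
 have dQ: "\<bar>of_int (dd k)\<bar> <= real Q" if "k < n" for k
 proof -
 have k: "k : {..<n}" using that by simp
 have "c k : {0..int Q}" "c' k : {0..int Q}"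
 using PiE_mem[OF c(1)[unfolded A_def] k] PiE_mem[OF c(2)[unfolded A_def] k] by blast+
 hence "\<bar>dd k\<bar> <= int Q" by (auto simp: dd_def)
 thus ?thesis by linarith
 qed
 have nz: "g dd ~= 0"
 proof
 assume "g dd = 0"
 hence "dd k = 0" if "k < n" for k unfolding g_def using fam_basis_int_indep[OF b _ that] by blast
 hence "c k = c' k" if "k < n" for k using that by (simp add: dd_def)
 hence "c = c'" by (intro PiE_ext[OF c(1)[unfolded A_def] c(2)[unfolded A_def]]) simp
 thus False using c(4) by simp
 qed
 define et where "et = 2 * Bd / real h"
 have pd: "\<bar>ph sg (g dd)\<bar> <= et" if s: "sg : E" for sg
 proof -
 have sK: "sg : Emb K" using s E(1) by blast
 have "ph sg (g dd) = ph sg (g c) - ph sg (g c')"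
 unfolding gd ph_def emb_diff[OF sf sK OK_K[OF gO] OK_K[OF gO]] by simp
 moreover have "\<lfloor>(ph sg (g c) + Bd) * real h / (2 * Bd)\<rfloor> = \<lfloor>(ph sg (g c') + Bd) * real h / (2 * Bd)\<rfloor>"
 using fun_cong[OF c(3), of sg] s by (simp add: box_def)
 hence "\<bar>(ph sg (g c) + Bd) * real h / (2 * Bd) - (ph sg (g c') + Bd) * real h / (2 * Bd)\<bar> < 1" by linarith
 hence "\<bar>(ph sg (g c) - ph sg (g c')) * real h / (2 * Bd)\<bar> < 1"
 by (simp add: diff_divide_distrib[symmetric] left_diff_distrib[symmetric])
 hence "\<bar>ph sg (g c) - ph sg (g c')\<bar> * (real h / (2 * Bd)) < 1" using Bd by (simp add: abs_mult)
 hence "\<bar>ph sg (g c) - ph sg (g c')\<bar> < et" unfolding et_def using Bd h by (simp add: field_simps)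
 ultimately show ?thesis by simp
 qed
 have eta: "2 * et <= 8 * C * real t ^ m / real t ^ n"
 proof -
 have "2 * et = 4 * C * real Q / real h" by (simp add: et_def Bd_def)
 also have "... <= 4 * C * real t ^ m / (real t ^ n / 2)" using Q h C1 t by (intro frac_le mult_left_mono) auto
 finally show ?thesis by simp
 qed
 have small: "cmod (sg (g dd)) <= 8 * C * real t ^ m / real t ^ n" if s: "sg : E" for sg
 proof -
 have 1: "\<bar>Re (sg (g dd)) + Im (sg (g dd))\<bar> <= et" using pd[OF s] by (simp add: ph_def)
 have 2: "\<bar>Re (sg (g dd)) - Im (sg (g dd))\<bar> <= et"
 using pd[OF E(2)[OF s]] OK_K[OF gO[of dd]] by (simp add: ph_def conj_emb_def)
 have "cmod (sg (g dd)) <= \<bar>Re (sg (g dd))\<bar> + \<bar>Im (sg (g dd))\<bar>" by (rule cmod_le)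
 also have "... <= 2 * et" using 1 2 by linarith
 finally show ?thesis using eta by linarith
 qed
 have "cmod (sg (g dd)) <= C * real t ^ m" if s: "sg : Emb K" for sg
 proof -
 have "2 * cmod (sg (g dd)) <= real Q * (C - 1)" by (rule bound[OF s]) (use dQ in auto)
 also have "... <= real t ^ m * C" using Q C1 by (intro mult_mono) auto
 finally show ?thesis using norm_ge_zero[of "sg (g dd)"] unfolding mult.commute[of C] by linarith
 qed
 thus ?thesis using gO nz small by blast
 qed
 \<comment> \<open>x is at most 8 C t^m / t^n at the m embeddings in E and at most C t^m at the n -
   m others; in the product the powers of t cancel.\<close>
 define N0 where "N0 = (8 * C) ^ m * C ^ (n - m)"
 have "ALL ee>0. EX x:OK. x ~= 0 & (ALL sg:E. cmod (sg x) < ee) & (PROD sg:Emb K. cmod (sg x)) <= N0"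
 proof (intro allI impI)
 fix ee :: real assume eps: "ee > 0"
 define t where "t = nat \<lceil>8 * C / ee\<rceil> + 2"
 have t: "t >= 2" "8 * C / ee < real t" unfolding t_def by linarith+
 obtain x where x: "x : OK" "x ~= 0" "ALL sg:E. cmod (sg x) <= 8 * C * real t ^ m / real t ^ n"
 "ALL sg:Emb K. cmod (sg x) <= C * real t ^ m" using step[OF t(1)] by blast
 have t0: "real t > 0" using t by simp
 have le: "8 * C * real t ^ m / real t ^ n < ee"
 proof -
 have "real t ^ m * real t <= real t ^ n" using power_increasing[of "Suc m" n "real t"] m t by (simp add: mult.commute)
 hence "8 * C * real t ^ m / real t ^ n <= 8 * C * real t ^ m / (real t ^ m * real t)"
 using t0 C1 by (intro divide_left_mono) auto
 also have "... = 8 * C / real t" using t0 by simp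
 also have "... < ee" using t(2) t0 eps by (simp add: field_simps)
 finally show ?thesis .
 qed
 have "(PROD sg:Emb K. cmod (sg x)) = (PROD sg:Emb K - E. cmod (sg x)) * (PROD sg:E. cmod (sg x))"
 by (rule prod.subset_diff[OF E(1) finK])
 also have "... <= (PROD sg:Emb K - E. C * real t ^ m) * (PROD sg:E. 8 * C * real t ^ m / real t ^ n)"
 using x(3,4) C1 by (intro mult_mono prod_mono prod_nonneg) auto
 also have "... = (C * real t ^ m) ^ (n - m) * (8 * C * real t ^ m / real t ^ n) ^ m"
 using m n_card finE E(1) by (simp add: card_Diff_subset)
 also have "... = N0 * ((real t ^ m) ^ (n - m) * (real t ^ m) ^ m / (real t ^ n) ^ m)"
 unfolding N0_def by (simp add: power_mult_distrib power_divide mult_ac)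
 also have "(real t ^ m) ^ (n - m) * (real t ^ m) ^ m = (real t ^ n) ^ m"
 proof -
 have "(n - m) + m = n" using m by simp
 hence "(real t ^ m) ^ (n - m) * (real t ^ m) ^ m = (real t ^ m) ^ n" by (simp only: power_add[symmetric])
 thus ?thesis by (simp only: power_mult[symmetric] mult.commute)
 qed
 finally have "(PROD sg:Emb K. cmod (sg x)) <= N0" using t0 by simp
 thus "EX x:OK. x ~= 0 & (ALL sg:E. cmod (sg x) < ee) & (PROD sg:Emb K. cmod (sg x)) <= N0"
 using x le by force
 qed
 thus ?thesis by (rule that)
qed

text \<open>\<open>small_elements\<close> yields integers of bounded norm that decrease strictly at
  all places except v. Two of them have the same norm and are congruent modulo it, so their quotient
  is a unit, and it is less than 1 at those places.\<close>

lemma dominating_unit: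
 assumes v: "v < length vs" and s2: "2 <= length vs"
 obtains u where "u : UK" "ALL w<length vs. w ~= v --> lg w u < 0"
proof -
 have finK: "finite (Emb K)" by (rule embeddings_finite[OF nf])
 define E where "E = Emb K - {vs ! v, conj_emb K (vs ! v)}"
 have Ecl: "conj_emb K sg : E" if "sg : E" for sg
 using that conj_emb_in[OF sf, of sg] conj_emb_invol[of sg K] conj_emb_invol[OF vs_emb[OF v]] unfolding E_def by auto
 have wE: "vs ! w : E" if w: "w < length vs" "w ~= v" for w
 proof -
 have "vs ! w ~= vs ! v" using vs_distinct w v by (simp add: nth_eq_iff_index_eq)
 moreover have "vs ! w ~= conj_emb K (vs ! v)"
 using vs_ex1[OF vs_emb[OF v]] v w \<open>vs ! w ~= vs ! v\<close> nth_mem by blast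
 ultimately show ?thesis using vs_emb[OF w(1)] by (simp add: E_def)
 qed
 have "EX w<length vs. w ~= v" using s2 by (intro exI[of _ "if v = 0 then 1 else 0"]) auto
 hence "E ~= {}" using wE by blast
 hence m1: "1 <= card E" using finK by (simp add: E_def Suc_le_eq card_gt_0_iff)
 have "card E < card (Emb K)" using vs_emb[OF v] finK unfolding E_def by (intro psubset_card_mono) auto
 hence mn: "card E < n" by (simp add: n_card)
 have Esub: "E <= Emb K" by (auto simp: E_def)
 obtain N0 where N0: "ALL ee>0. EX x:OK. x ~= 0 & (ALL sg:E. cmod (sg x) < ee) & (PROD sg:Emb K. cmod (sg x)) <= N0"
 by (rule small_elements[OF Esub Ecl refl m1 mn])
 define P where "P = (%x. x : OK & x ~= 0 & (PROD sg:Emb K. cmod (sg x)) <= N0)"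
 have finE: "finite E" using Esub finK by (rule finite_subset)
 have "EX f. ALL k. P (f k) & (ALL sg:E. cmod (sg (f (Suc k))) < cmod (sg (f k)))"
 proof (rule dependent_nat_choice[of "%_. P" "%_ x y. ALL sg:E. cmod (sg y) < cmod (sg x)"])
 show "EX x. P x" using N0[rule_format, of 1] unfolding P_def by auto
 fix x and k :: nat assume x: "P x"
 define ee where "ee = Min ((%sg. cmod (sg x)) ` E)"
 have "ee : (%sg. cmod (sg x)) ` E" unfolding ee_def using finE \<open>E ~= {}\<close> by (intro Min_in) auto
 hence e0: "ee > 0" using x emb_cmod_pos OK_K Esub unfolding P_def by auto
 then obtain y where y: "y : OK" "y ~= 0" "ALL sg:E. cmod (sg y) < ee" "(PROD sg:Emb K. cmod (sg y)) <= N0"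
 using N0[rule_format, OF e0] by blast
 have le: "ee <= cmod (sg x)" if "sg : E" for sg unfolding ee_def using that finE by (intro Min_le) auto
 have "ALL sg:E. cmod (sg y) < cmod (sg x)"
 proof
 fix sg assume s: "sg : E"
 show "cmod (sg y) < cmod (sg x)" by (rule less_le_trans[OF bspec[OF y(3) s] le[OF s]])
 qed
 moreover have "P y" using y by (simp add: P_def)
 ultimately show "EX y. P y & (ALL sg:E. cmod (sg y) < cmod (sg x))" by blast
 qed
 then obtain f where f0: "ALL k. P (f k) & (ALL sg:E. cmod (sg (f (Suc k))) < cmod (sg (f k)))" by (rule exE)
 have f: "!!k. P (f k)" "!!k sg. sg : E ==> cmod (sg (f (Suc k))) < cmod (sg (f k))"
 using f0 by blast+
 have dec: "cmod (sg (f j)) < cmod (sg (f i))" if "sg : E" "i < j" for sg i j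
 using lift_Suc_mono_less[of "%k. - cmod (sg (f k))" i j] f(2)[OF that(1)] that(2) by simp
 obtain b where b: "fam_basis \<int> OK n b" using discriminant_basis by blast
 have fO: "f k : OK" "f k ~= 0" for k using f(1)[of k] by (auto simp: P_def)
 define R where "R = (%k (p :: int \<times> 'a \<times> (nat => int)). (PROD sg:Emb K. sg (f k)) = of_int (fst p) & fst (snd p) : OK &
 f k * fst (snd p) = of_int (fst p) & fst p ~= 0 & f k = (\<Sum>l<n. of_int (snd (snd p) l) * b l))"
 have "ALL k. EX p. R k p"
 proof
 fix k
 obtain N :: int and y where "(PROD sg:Emb K. sg (f k)) = of_int N" "y : OK" "f k * y = of_int N" "N = 0 \<longleftrightarrow> f k = 0"
 using norm_int[OF fO(1)] by blast
 moreover obtain c :: "nat => int" where "f k = (\<Sum>l<n. of_int (c l) * b l)"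
 using fam_basis_int_span[OF b fO(1)] by blast
 ultimately show "EX p. R k p" using fO(2)[of k] unfolding R_def by (intro exI[of _ "(N, y, c)"]) simp
 qed
 then obtain p where p: "ALL k. R k (p k)" using choice by blast
 define N where "N = (%k. fst (p k))"
 define y where "y = (%k. fst (snd (p k)))"
 define c where "c = (%k. snd (snd (p k)))"
 have N: "!!k. (PROD sg:Emb K. sg (f k)) = of_int (N k)" "!!k. y k : OK"
 "!!k. f k * y k = of_int (N k)" "!!k. N k ~= 0" "!!k. f k = (\<Sum>l<n. of_int (c k l) * b l)"
 using p unfolding R_def N_def y_def c_def by blast+
 define B where "B = \<lceil>N0\<rceil>"
 have NB: "\<bar>N k\<bar> <= B" for k
 proof -
 have "cmod (PROD sg:Emb K. sg (f k)) <= N0" using f(1)[of k] by (simp add: P_def prod_norm)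
 hence "\<bar>real_of_int (N k)\<bar> <= N0" by (simp add: N(1))
 thus ?thesis unfolding B_def by linarith
 qed
 \<comment> \<open>Equal keys mean equal norms and coordinates congruent modulo the norm. There are
   finitely many keys because the norms are bounded.\<close>
 define key where "key = (%k. (N k, \<lambda>l\<in>{..<n}. c k l mod N k))"
 have "key ` UNIV <= {- B..B} \<times> ({..<n} \<rightarrow>\<^sub>E {- B..B})"
 proof (rule image_subsetI)
 fix k
 have "c k l mod N k : {- B..B}" for l
 proof -
 have "\<bar>c k l mod N k\<bar> < \<bar>N k\<bar>" using N(4) by (rule abs_mod_less)
 thus ?thesis using NB[of k] by auto
 qed
 thus "key k : {- B..B} \<times> ({..<n} \<rightarrow>\<^sub>E {- B..B})" using NB[of k] unfolding key_def by auto
 qed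
 hence "finite (range key)" by (rule finite_subset) (auto intro!: finite_PiE)
 hence "EX a0:UNIV. infinite {a : UNIV. key a = key a0}" by (intro pigeonhole_infinite) auto
 then obtain i where i: "infinite {a. key a = key i}" by auto
 then obtain j where j: "key j = key i" "i < j"
 using infinite_nat_iff_unbounded[of "{a. key a = key i}"] by blast
 have Nij: "N j = N i" and cij: "!!l. l < n ==> c j l mod N i = c i l mod N i"
 proof -
 show Nij: "N j = N i" using arg_cong[OF j(1), of fst] by (simp only: key_def fst_conv)
 fix l assume l: "l < n"
 have "(\<lambda>l\<in>{..<n}. c j l mod N j) = (\<lambda>l\<in>{..<n}. c i l mod N i)"
 using arg_cong[OF j(1), of snd] by (simp only: key_def snd_conv)
 from fun_cong[OF this, of l] show "c j l mod N i = c i l mod N i" using l Nij by simp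
 qed
 define al where "al = (\<Sum>l<n. of_int ((c j l - c i l) div N i) * b l)"
 have aO: "al : OK" unfolding al_def using fam_basis_mem[OF b] by (intro OK_sum OK_closed) auto
 have diff: "f j - f i = of_int (N i) * al"
 proof -
 have "N i dvd c j l - c i l" if "l < n" for l using cij[OF that] by (simp add: mod_eq_dvd_iff)
 hence dv: "N i * ((c j l - c i l) div N i) = c j l - c i l" if "l < n" for l using that by simp
 have "of_int (N i) * (of_int ((c j l - c i l) div N i) * b l) = of_int (c j l) * b l - of_int (c i l) * b l" if "l < n" for l
 unfolding mult.assoc[symmetric] of_int_mult[symmetric] dv[OF that] by (simp add: left_diff_distrib)
 thus ?thesis unfolding al_def sum_distrib_left by (simp add: N(5) sum_subtractf[symmetric])
 qed
 \<comment> \<open>u1 is f j / f i: the difference f j - f i is \<open>N i\<close> times al, and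
   \<open>N i\<close> is f i times y i. Likewise u2 is f i / f j.\<close>
 define u1 where "u1 = 1 + y i * al"
 define u2 where "u2 = 1 - y j * al"
 have one: "1 : OK" using OK_closed(4)[of 1] by simp
 have u12: "u1 : OK" "u2 : OK" unfolding u1_def u2_def using one N(2) aO by (auto intro: OK_closed)
 have f1: "f i * u1 = f j"
 proof -
 have "f i * u1 = f i + (f i * y i) * al" by (simp add: u1_def algebra_simps)
 thus ?thesis unfolding N(3) diff[symmetric] by simp
 qed
 have f2: "f j * u2 = f i"
 proof -
 have "f j * u2 = f j - (f j * y j) * al" by (simp add: u2_def algebra_simps)
 thus ?thesis unfolding N(3) Nij diff[symmetric] by simp
 qed
 have "f i * (u1 * u2) = f i * 1" using f1 f2 by (simp add: mult.assoc[symmetric])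
 hence "u1 * u2 = 1" using fO(2) by (simp only: mult_cancel_left) auto
 hence u: "u1 : UK" unfolding integer_units_def using u12 by blast
 have "lg w u1 < 0" if w: "w < length vs" "w ~= v" for w
 proof -
 have s: "vs ! w : Emb K" by (rule vs_emb[OF w(1)])
 have "(vs ! w) (f i) * (vs ! w) u1 = (vs ! w) (f j)"
 unfolding f1[symmetric] by (rule emb_mult[OF sf s, symmetric]) (use fO u unit_K OK_K in auto)
 hence "cmod ((vs ! w) (f i)) * cmod ((vs ! w) u1) = cmod ((vs ! w) (f j))" by (metis norm_mult)
 also have "... < cmod ((vs ! w) (f i))" by (rule dec[OF wE[OF w] j(2)])
 finally have "cmod ((vs ! w) u1) < 1" using emb_cmod_pos[OF s OK_K[OF fO(1)[of i]] fO(2)] by simp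
 moreover have "cmod ((vs ! w) u1) > 0" using emb_cmod_pos[OF s] unit_K[OF u] unit_nz[OF u] by blast
 ultimately have "ln (cmod ((vs ! w) u1)) < 0" by (rule ln_less_zero[rotated])
 thus ?thesis unfolding lg_def using local_degree_ge[of "vs ! w"] by (intro mult_pos_neg) auto
 qed
 thus ?thesis using that u by blast
qed

text \<open>The rows of T are linear functionals dual to the logarithm vectors of the units a. They
  witness linear independence and later serve as coordinates.\<close>

definition dual_units :: "nat => (nat => 'a) => (nat => nat => real) => bool" where
 "dual_units r a T \<longleftrightarrow> (ALL k<r. a k : UK) &
 (ALL j<r. ALL k<r. (\<Sum>i<r. T j i * lg i (a k)) = (if j = k then 1 else 0))"

text \<open>For dominating units, column j of the logarithm matrix has negative entries off the
  diagonal and, since all r + 1 logarithms add up to zero, a positive sum. So the matrix is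
  diagonally dominant by columns and invertible.\<close>

lemma dual_units_ex:
 assumes r: "length vs = Suc r" shows "EX a T. dual_units r a T"
proof (cases "r = 0")
 case True thus ?thesis by (simp add: dual_units_def)
next
 case False
 have "EX u. u : UK & (ALL w<length vs. w ~= v --> lg w u < 0)" if v: "v < length vs" for v
 proof -
 have "2 <= length vs" using False r by simp
 then obtain u where "u : UK" "ALL w<length vs. w ~= v --> lg w u < 0" by (rule dominating_unit[OF v])
 thus ?thesis by blast
 qed
 hence "ALL v. EX u. v < length vs --> u : UK & (ALL w<length vs. w ~= v --> lg w u < 0)" by blast
 from choice[OF this] obtain u where u0: "ALL v. v < length vs --> u v : UK & (ALL w<length vs. w ~= v --> lg w (u v) < 0)" by (rule exE)
 have u: "!!v. v < length vs ==> u v : UK" "!!v w. v < length vs ==> w < length vs ==> w ~= v ==> lg w (u v) < 0"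
 using u0 by blast+
 define A where "A = mat r r (%(i, j). lg i (u j))"
 have A: "A : carrier_mat r r" by (simp add: A_def)
 have "det A ~= 0"
 proof
 assume "det A = 0"
 hence "det (transpose_mat A) = 0" using det_transpose[OF A] by simp
 moreover have tr: "transpose_mat A : carrier_mat r r" using A by simp
 ultimately have "EX w. w : carrier_vec r & w ~= 0\<^sub>v r & transpose_mat A *\<^sub>v w = 0\<^sub>v r"
 using det_0_iff_vec_prod_zero[OF tr] by simp
 then obtain w where w: "w : carrier_vec r" "w ~= 0\<^sub>v r" "transpose_mat A *\<^sub>v w = 0\<^sub>v r" by (elim exE conjE)
 define c where "c = (%i. w $ i)"
 have z: "(\<Sum>i<r. c i * lg i (u j)) = 0" if j: "j < r" for j
 proof -
 have "(transpose_mat A *\<^sub>v w) $ j = (\<Sum>i<r. lg i (u j) * w $ i)"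
 using j w(1) by (auto simp: A_def scalar_prod_def lessThan_atLeast0)
 thus ?thesis using w(3) j by (simp add: c_def mult.commute)
 qed
 define M where "M = Max ((%i. \<bar>c i\<bar>) ` {..<r})"
 have "M : (%i. \<bar>c i\<bar>) ` {..<r}" unfolding M_def using False by (intro Max_in) auto
 then obtain j where j: "j < r" "M = \<bar>c j\<bar>" by auto
 have mx: "\<bar>c i\<bar> <= \<bar>c j\<bar>" if "i < r" for i unfolding j(2)[symmetric] M_def using that by (intro Max_ge) auto
 have cj: "\<bar>c j\<bar> > 0"
 proof (rule ccontr)
 assume "~ \<bar>c j\<bar> > 0"
 hence "c i = 0" if "i < r" for i using mx[OF that] by simp
 hence "w = 0\<^sub>v r" using w(1) by (intro eq_vecI) (auto simp: c_def)
 thus False using w(2) by simp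
 qed
 have "0 = sgn (c j) * (\<Sum>i<r. c i * lg i (u j))" using z[OF j(1)] by simp
 also have "... = (\<Sum>i<r. (sgn (c j) * c i) * lg i (u j))" by (simp add: sum_distrib_left mult.assoc)
 also have "... >= (\<Sum>i<r. \<bar>c j\<bar> * lg i (u j))"
 proof (rule sum_mono)
 fix i assume "i : {..<r}"
 hence i: "i < r" by simp
 show "\<bar>c j\<bar> * lg i (u j) <= (sgn (c j) * c i) * lg i (u j)"
 proof (cases "i = j")
 case True thus ?thesis by (simp add: abs_sgn mult.commute)
 next
 case False
 hence "lg i (u j) <= 0" using u(2)[of j i] i j r by simp
 moreover have "sgn (c j) * c i <= \<bar>c j\<bar>" using mx[OF i] cj by (cases "c j > 0") simp_all
 ultimately show ?thesis by (rule mult_right_mono_neg[rotated])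
 qed
 qed
 finally have "\<bar>c j\<bar> * (\<Sum>i<r. lg i (u j)) <= 0" by (simp add: sum_distrib_left)
 moreover have "(\<Sum>i<r. lg i (u j)) = - lg r (u j)" using lg_sum[OF u(1), of j] j r by simp
 moreover have "lg r (u j) < 0" using u(2)[of j r] j r by simp
 moreover have "\<bar>c j\<bar> * lg r (u j) < 0" by (rule mult_pos_neg) (use cj calculation in auto)
 ultimately show False by simp
 qed
 then obtain B where B: "B : carrier_mat r r" "B * A = 1\<^sub>m r" using mat_inverse_ex[OF A] by blast
 have "(\<Sum>i<r. B $$ (j, i) * lg i (u k)) = (if j = k then 1 else 0)" if "j < r" "k < r" for j k
 proof -
 have "(B * A) $$ (j, k) = (\<Sum>i<r. B $$ (j, i) * lg i (u k))"
 using that B(1) by (auto simp: A_def scalar_prod_def lessThan_atLeast0)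
 thus ?thesis using B(2) that by simp
 qed
 hence "dual_units r u (%j i. B $$ (j, i))" unfolding dual_units_def using u(1) r by auto
 thus ?thesis by blast
qed

end

section \<open>Fundamental units and the regulator\<close>

lemma power_int_hom:
 fixes x :: "'a::field" and t :: "'a => real"
 assumes U: "1 : U" "!!x y. x : U ==> y : U ==> x * y : U" "!!x. x : U ==> inverse x : U" "0 \<notin> U"
 and t: "!!x y. x : U ==> y : U ==> t (x * y) = t x + t y" and x: "x : U"
 shows "x powi m : U" "t (x powi m) = of_int m * t x"
proof -
 have t1: "t 1 = 0" using t[OF U(1) U(1)] by simp
 have ti: "t (inverse y) = - t y" if "y : U" for y
 proof -
 have "y ~= 0" using that U(4) by auto
 hence "t (y * inverse y) = 0" using t1 by simp
 thus ?thesis using t[OF that U(3)[OF that]] by simp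
 qed
 have p: "x ^ k : U & t (x ^ k) = real k * t x" for k
 by (induction k) (use U t t1 x in "auto simp: algebra_simps")
 show "x powi m : U" "t (x powi m) = of_int m * t x"
 proof -
 have "x powi m : U & t (x powi m) = of_int m * t x"
 proof (cases m rule: int_cases2)
 case (nonneg k) thus ?thesis using p[of k] by simp
 next
 case (nonpos k) thus ?thesis using p[of k] U(3) ti by (simp add: power_int_minus)
 qed
 thus "x powi m : U" "t (x powi m) = of_int m * t x" by auto
 qed
qed

lemma prod_powi_hom:
 fixes b :: "nat => 'a::field" and t :: "'a => real"
 assumes U: "1 : U" "!!x y. x : U ==> y : U ==> x * y : U" "!!x. x : U ==> inverse x : U" "0 \<notin> U"
 and t: "!!x y. x : U ==> y : U ==> t (x * y) = t x + t y" and b: "!!k. k < q ==> b k : U"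
 shows "(\<Prod>k<q. b k powi g k) : U" "t (\<Prod>k<q. b k powi g k) = (\<Sum>k<q. of_int (g k) * t (b k))"
proof -
 have t1: "t 1 = 0" using t[OF U(1) U(1)] by simp
 have "(\<Prod>k<q. b k powi g k) : U & t (\<Prod>k<q. b k powi g k) = (\<Sum>k<q. of_int (g k) * t (b k))"
 using b
 proof (induction q)
 case 0 thus ?case using U(1) t1 by simp
 next
 case (Suc q)
 have bq: "b q : U" using Suc.prems by simp
 have IH: "(\<Prod>k<q. b k powi g k) : U" "t (\<Prod>k<q. b k powi g k) = (\<Sum>k<q. of_int (g k) * t (b k))" using Suc by auto
 note P = power_int_hom[OF U t bq, of "g q"]
 show ?case using U(2)[OF IH(1) P(1)] t[OF IH(1) P(1)] IH(2) P(2) by simp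
 qed
 thus "(\<Prod>k<q. b k powi g k) : U" "t (\<Prod>k<q. b k powi g k) = (\<Sum>k<q. of_int (g k) * t (b k))" by auto
qed

text \<open>
 The element \<open>b k\<close> has the smallest positive value of \<open>t k\<close> among the elements on which
 \<open>t (k + 1), \<dots>, t (r - 1)\<close> vanish.
\<close>

lemma flag_basis:
 fixes U :: "'a::field set" and t :: "nat => 'a => real"
 assumes U: "1 : U" "!!x y. x : U ==> y : U ==> x * y : U" "!!x. x : U ==> inverse x : U" "0 \<notin> U"
 and t: "!!j x y. x : U ==> y : U ==> t j (x * y) = t j x + t j y"
 and fin: "!!C. finite {u : U. ALL j<r. \<bar>t j u\<bar> <= C}"
 and a: "!!k. k < r ==> a k : U" "!!j k. j < r ==> k < r ==> t j (a k) = (if j = k then 1 else 0)"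
 obtains b where "ALL k<r. b k : U" "ALL k<r. t k (b k) > 0" "ALL k<r. ALL j<r. k < j --> t j (b k) = 0"
 "ALL u:U. EX g::nat => int. EX z:U. (ALL j<r. t j z = 0) & u = z * (\<Prod>k<r. b k powi g k)"
proof -
 define G where "G = (%k. {x : U. ALL j<r. k < j --> t j x = 0})"
 have ex: "EX b:G k. t k b > 0 & (ALL x:G k. t k x > 0 --> t k b <= t k x)" if k: "k < r" for k
 proof -
 define B where "B = {x : U. ALL j<r. \<bar>t j x\<bar> <= 1} \<inter> {x : G k. t k x > 0}"
 have finB: "finite B" using fin[of 1] by (simp add: B_def)
 have aB: "a k : B" using k a by (auto simp: B_def G_def)
 define M where "M = Min (t k ` B)"
 have "M : t k ` B" unfolding M_def using finB aB by (intro Min_in) auto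
 then obtain b where b: "b : B" "M = t k b" by blast
 have mn: "t k b <= t k x" if "x : B" for x unfolding b(2)[symmetric] M_def using that finB by simp
 have "t k b <= t k x" if x: "x : G k" "t k x > 0" for x
 proof (cases "t k x >= 1")
 case True
 thus ?thesis using mn[OF aB] a(2)[OF k k] by simp
 next
 case False
 have xU: "x : U" using x by (simp add: G_def)
 \<comment> \<open>Multiplication by y reduces \<open>t j x\<close> modulo 1 for j < k and leaves
   \<open>t k x\<close> alone. So the product lies in the finite box B and competes with b.\<close>
 define y where "y = (\<Prod>j<k. a j powi (- \<lfloor>t j x\<rfloor>))"
 have ak: "!!j. j < k ==> a j : U" using a(1) k by simp
 have yU: "y : U" unfolding y_def by (rule prod_powi_hom(1)[OF U t[of _ _ 0] ak])
 have ty: "t l y = (if l < k then - of_int \<lfloor>t l x\<rfloor> else 0)" if l: "l < r" for l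
 proof -
 have "t l y = (\<Sum>j<k. of_int (- \<lfloor>t j x\<rfloor>) * t l (a j))"
 unfolding y_def by (rule prod_powi_hom(2)[OF U t[of _ _ l] ak])
 also have "... = (\<Sum>j<k. if j = l then - of_int \<lfloor>t l x\<rfloor> else 0)"
 using k l by (intro sum.cong) (auto simp: a(2))
 finally show ?thesis by simp
 qed
 have txy: "t l (x * y) = t l x + t l y" for l by (rule t[OF xU yU])
 have "x * y : B"
 proof -
 have "\<bar>t l (x * y)\<bar> <= 1" if l: "l < r" for l
 proof -
 consider "l < k" | "l = k" | "k < l" by linarith
 thus ?thesis
 proof cases
 case 1
 hence "t l (x * y) = t l x - of_int \<lfloor>t l x\<rfloor>" using txy ty[OF l] by simp
 thus ?thesis by linarith
 next
 case 2 thus ?thesis using txy ty[OF l] False x(2) by simp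
 next
 case 3 thus ?thesis using txy ty[OF l] x(1) l by (simp add: G_def)
 qed
 qed
 moreover have "x * y : G k" using U(2)[OF xU yU] x(1) txy ty by (auto simp: G_def)
 moreover have "t k (x * y) > 0" using txy ty[OF k] x(2) by simp
 ultimately show ?thesis using U(2)[OF xU yU] by (simp add: B_def)
 qed
 thus ?thesis using mn txy ty[OF k] by fastforce
 qed
 thus ?thesis using b(1) by (intro bexI[of _ b]) (auto simp: B_def)
 qed
 hence "ALL k. EX b. k < r --> b : G k & t k b > 0 & (ALL x:G k. t k x > 0 --> t k b <= t k x)" by blast
 from choice[OF this] obtain b where b0: "ALL k. k < r --> b k : G k & t k (b k) > 0 & (ALL x:G k. t k x > 0 --> t k (b k) <= t k x)"
 by (rule exE)
 have b: "b k : G k" "t k (b k) > 0" "!!x. x : G k ==> t k x > 0 ==> t k (b k) <= t k x" if "k < r" for k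
 using b0 that by auto
 have bU: "b k : U" if "k < r" for k using b(1)[OF that] by (simp add: G_def)
 have dec: "EX g::nat => int. EX z:U. (ALL j<r. t j z = 0) & u = z * (\<Prod>l<k. b l powi g l)"
 if "k <= r" "u : U" "!!j. k <= j ==> j < r ==> t j u = 0" for k u
 using that
 proof (induction k arbitrary: u)
 case 0 thus ?case by (intro exI[of _ "%_. 0"] bexI[of _ u]) auto
 next
 case (Suc k)
 have k: "k < r" using Suc.prems by simp
 define m where "m = \<lfloor>t k u / t k (b k)\<rfloor>"
 define y where "y = u * b k powi (- m)"
 have hom: "b k powi (- m) : U" "t j (b k powi (- m)) = of_int (- m) * t j (b k)" for j
 using power_int_hom(1)[OF U t[of _ _ j] bU[OF k]] power_int_hom(2)[where t = "t j", OF U t[of _ _ j] bU[OF k]] by auto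
 have yU: "y : U" unfolding y_def using U(2) Suc.prems(2) hom(1) by blast
 have ty: "t j y = t j u - of_int m * t j (b k)" for j
 unfolding y_def using t[OF Suc.prems(2) hom(1), of j] hom(2)[of j] by simp
 have yG: "y : G k" using yU ty Suc.prems(3) b(1)[OF k] by (auto simp: G_def)
 have pos: "t k (b k) > 0" by (rule b(2)[OF k])
 have "of_int m <= t k u / t k (b k)" "t k u / t k (b k) < of_int m + 1" unfolding m_def by linarith+
 hence "0 <= t k y" "t k y < t k (b k)" using pos ty[of k] by (auto simp: field_simps)
 hence z: "t k y = 0" using b(3)[OF k yG] by linarith
 have "t j y = 0" if "k <= j" "j < r" for j
 using that z yG by (cases "j = k") (auto simp: G_def)
 from Suc.IH[OF _ yU this] k obtain g z where g: "z : U" "ALL j<r. t j z = 0" "y = z * (\<Prod>l<k. b l powi g l)" by auto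
 have bnz: "b k ~= 0" using bU[OF k] U(4) by auto
 have "u = y * b k powi m" unfolding y_def using bnz by (simp add: power_int_minus)
 also have "... = z * (\<Prod>l<Suc k. b l powi (g(k := m)) l)" unfolding g(3) by (simp add: mult.assoc)
 finally show ?case using g by (intro exI[of _ "g(k := m)"] bexI[of _ z]) auto
 qed
 show ?thesis
 proof (rule that[of b])
 show "ALL u:U. EX g::nat => int. EX z:U. (ALL j<r. t j z = 0) & u = z * (\<Prod>k<r. b k powi g k)"
 using dec[OF order.refl] by simp
 qed (use bU b in "auto simp: G_def")
qed

lemma abs_det_row_permute:
 fixes f :: "nat \<times> nat => real"
 assumes p: "p permutes {..<n}"
 shows "\<bar>det (mat n n (%(i, j). f (p i, j)))\<bar> = \<bar>det (mat n n f)\<bar>"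
proof -
 have "mat n n f : carrier_mat n n" by simp
 moreover have "p permutes {0..<n}" using p by (simp add: lessThan_atLeast0)
 ultimately have "det (mat n n (%(i, j). mat n n f $$ (p i, j))) = signof p * det (mat n n f)" by (rule det_permute_rows)
 moreover have "mat n n (%(i, j). mat n n f $$ (p i, j)) = mat n n (%(i, j). f (p i, j))"
 using permutes_in_image[OF p] by (intro eq_matI) auto
 moreover have "\<bar>signof p :: real\<bar> = 1" by (simp add: sign_def)
 ultimately show ?thesis by (simp add: abs_mult)
qed

text \<open>
 If the rows of an \<open>(r + 1) \<times> r\<close> matrix sum to zero, its \<open>r \<times> r\<close> minors agree up to sign:
 each is, up to the factor \<open>r + 1\<close>, the determinant of the matrix with a column of ones added.
\<close>

lemma det_minor_augmented:
 fixes f :: "nat => nat => real"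
 assumes z: "!!j. j < r ==> (\<Sum>i<Suc r. f i j) = 0"
 shows "det (mat (Suc r) (Suc r) (%(i, j). if j < r then f i j else 1)) = real (Suc r) * det (mat r r (%(i, j). f i j))"
proof -
 define M where "M = mat (Suc r) (Suc r) (%(i, j). if j < r then f i j else 1)"
 \<comment> \<open>Left multiplication by E replaces the last row by the sum of all rows, which is 0
   except for r + 1 in the added column.\<close>
 define E where "E = row_mat (Suc r) r (%_. 1)"
 have M: "M : carrier_mat (Suc r) (Suc r)" by (simp add: M_def)
 have E: "E : carrier_mat (Suc r) (Suc r)" by (simp add: E_def)
 have ent: "(E * M) $$ (i, j) = (if i = r then \<Sum>l<Suc r. M $$ (l, j) else M $$ (i, j))" if "i < Suc r" "j < Suc r" for i j
 proof -
 have "(E * M) $$ (i, j) = (\<Sum>l<Suc r. E $$ (i, l) * M $$ (l, j))"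
 using that M E by (auto simp: scalar_prod_def lessThan_atLeast0 simp del: sum.op_ivl_Suc sum.lessThan_Suc)
 also have "... = (if i = r then \<Sum>l<Suc r. M $$ (l, j) else M $$ (i, j))"
 proof (cases "i = r")
 case True thus ?thesis by (auto simp: E_def row_mat_def intro!: sum.cong simp del: sum.lessThan_Suc)
 next
 case False
 have "(\<Sum>l<Suc r. E $$ (i, l) * M $$ (l, j)) = (\<Sum>l<Suc r. if l = i then M $$ (i, j) else 0)"
 using False that by (intro sum.cong) (auto simp: E_def row_mat_def)
 also have "... = M $$ (i, j)" by (subst sum.delta) (use that in auto)
 finally show ?thesis using False by simp
 qed
 finally show ?thesis .
 qed
 have last: "(E * M) $$ (r, j) = (if j = r then real (Suc r) else 0)" if "j < Suc r" for j
 proof -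
 have "(E * M) $$ (r, j) = (\<Sum>l<Suc r. M $$ (l, j))" using ent[of r j] that by (simp del: sum.lessThan_Suc index_mult_mat(1))
 also have "... = (\<Sum>l<Suc r. if j < r then f l j else 1)" using that by (intro sum.cong) (auto simp: M_def)
 also have "... = (if j = r then real (Suc r) else 0)" using z[of j] that by (cases "j = r") (auto simp del: sum.lessThan_Suc)
 finally show ?thesis .
 qed
 have EM: "E * M : carrier_mat (Suc r) (Suc r)" using M E by simp
 have "det (E * M) = (\<Sum>j<Suc r. (E * M) $$ (r, j) * cofactor (E * M) r j)"
 using laplace_expansion_row[OF EM, of r] by (simp only: lessI)
 also have "... = (\<Sum>j<Suc r. if j = r then real (Suc r) * cofactor (E * M) r r else 0)"
 by (intro sum.cong refl) (simp add: last del: index_mult_mat(1))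
 also have "... = real (Suc r) * cofactor (E * M) r r" by (subst sum.delta) auto
 also have "cofactor (E * M) r r = det (mat_delete (E * M) r r)" by (simp add: cofactor_def mult_2[symmetric])
 also have "mat_delete (E * M) r r = mat r r (%(i, j). f i j)"
 proof -
 have e2: "(E * M) $$ (i, j) = f i j" if "i < r" "j < r" for i j
 proof -
 have "(E * M) $$ (i, j) = M $$ (i, j)" using ent[of i j] that by (simp del: index_mult_mat(1) sum.lessThan_Suc)
 thus ?thesis using that by (simp add: M_def del: index_mult_mat(1))
 qed
 have "dim_row (E * M) = Suc r" "dim_col (E * M) = Suc r" using EM by auto
 thus ?thesis by (intro eq_matI) (auto simp: mat_delete_def e2 simp del: index_mult_mat)
 qed
 finally have "det (E * M) = real (Suc r) * det (mat r r (%(i, j). f i j))" .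
 moreover have "det (E * M) = det M" using det_mult[OF E M] det_row_mat[of r "Suc r" "%_. 1"] by (simp add: E_def)
 ultimately show ?thesis by (simp add: M_def)
qed

context places
begin

lemma unit_group: "1 : UK" "!!x y. x : UK ==> y : UK ==> x * y : UK" "!!x. x : UK ==> inverse x : UK" "0 \<notin> UK"
 using unit_1 unit_mult unit_inv unit_nz by blast+

lemma lg_prod:
 fixes q :: nat
 assumes i: "i < length vs" and b: "!!k. k < q ==> b k : UK"
 shows "lg i (\<Prod>k<q. b k powi g k) = (\<Sum>k<q. of_int (g k) * lg i (b k))"
 using prod_powi_hom(2)[of UK "lg i" q b g, OF unit_group lg_mult[OF i] b] by simp

lemma unit_prod: "(!!k. k < (q::nat) ==> b k : UK) ==> (\<Prod>k<q. b k powi g k) : UK"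
 using prod_powi_hom(1)[of UK "lg 0" q b g, OF unit_group lg_mult[OF vs_nonempty]] by simp

lemma root_of_unity_lg:
 assumes z: "z : roots_of_unity_in K" shows "z : UK" "i < length vs ==> lg i z = 0"
proof -
 obtain m where m: "z : K" "m > 0" "z ^ m = 1" using z unfolding roots_of_unity_in_def by blast
 have nz: "z ~= 0" using m by (auto simp: power_0_left)
 have "algebraic_int z" "algebraic_int (inverse z)"
 proof -
 have *: "algebraic_int y" if "y ^ m = 1" for y :: 'a
 using that m(2) algebraic_int_root[of "1::'a" "monom 1 m" y] by (simp add: poly_monom degree_monom_eq)
 show "algebraic_int z" by (rule *[OF m(3)])
 show "algebraic_int (inverse z)" by (rule *) (simp add: power_inverse m(3))
 qed
 thus U: "z : UK" using m nz by (simp add: unit_iff)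
 assume i: "i < length vs"
 have "lg i (z powi int m) = of_int (int m) * lg i z" by (rule power_int_hom(2)[OF unit_group lg_mult[OF i] U])
 moreover have "lg i 1 = 0" by (simp add: lg_def emb_1[OF sf vs_emb[OF i]])
 ultimately show "lg i z = 0" using m by simp
qed

text \<open>Kronecker's argument: all powers of z lie in the finite set of units whose logarithms
  vanish, so two of them agree.\<close>

lemma lg_zero_root_of_unity:
 assumes z: "z : UK" "!!i. i < length vs ==> lg i z = 0" shows "z : roots_of_unity_in K"
proof -
 have hom1: "z powi int m : UK" for m
 by (rule power_int_hom(1)[where U = UK and t = "lg 0"]) (use unit_group lg_mult[OF vs_nonempty] z in auto)
 have hom2: "lg i (z powi int m) = of_int (int m) * lg i z" if "i < length vs" for m i
 by (rule power_int_hom(2)[where U = UK and t = "lg i"]) (use unit_group lg_mult[OF that] z in auto)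
 have "range (%m::nat. z ^ m) <= {u : UK. ALL i<length vs. \<bar>lg i u\<bar> <= 0}"
 using hom1 hom2 z(2) by auto
 hence "finite (range (%m::nat. z ^ m))" using finite_bounded_units finite_subset by blast
 hence "~ inj (%m::nat. z ^ m)" using finite_imageD infinite_UNIV_nat by blast
 then obtain k m where km: "k < m" "z ^ k = z ^ m" unfolding inj_def by (metis linorder_neqE_nat)
 have "k + (m - k) = m" using km(1) by simp
 hence "z ^ k * z ^ (m - k) = z ^ m" by (simp only: power_add[symmetric])
 hence "z ^ k * z ^ (m - k) = z ^ k * 1" using km(2) by (simp only: mult_1_right)
 hence "z ^ (m - k) = 1" using unit_nz[OF z(1)] by (simp only: mult_cancel_left) simp
 thus ?thesis unfolding roots_of_unity_in_def using unit_K[OF z(1)] km(1) by (intro CollectI conjI exI[of _ "m - k"]) auto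
qed

text \<open>Steinitz exchange: if the j-th functional does not vanish at w, then w can replace
  \<open>a j\<close>, and the other functionals are corrected by multiples of the j-th.\<close>

lemma exchange_dual:
 assumes d: "dual_units r a T" and j: "j < r" and w: "w : UK" "(\<Sum>i<r. T j i * lg i w) ~= 0"
 shows "EX T'. dual_units r (a(j := w)) T'"
proof -
 define tt where "tt = (%k. \<Sum>i<r. T k i * lg i w)"
 define T' where "T' = (%k i. if k = j then T j i / tt j else T k i - tt k / tt j * T j i)"
 have nz: "tt j ~= 0" using w by (simp add: tt_def)
 have T': "(\<Sum>i<r. T' k i * x i) = (if k = j then (\<Sum>i<r. T j i * x i) / tt j else (\<Sum>i<r. T k i * x i) - tt k / tt j * (\<Sum>i<r. T j i * x i))" for k x
 unfolding T'_def by (auto simp: sum_divide_distrib sum_subtractf sum_distrib_left left_diff_distrib mult.assoc)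
 have "(\<Sum>i<r. T' k i * lg i ((a(j := w)) l)) = (if k = l then 1 else 0)" if "k < r" "l < r" for k l
 proof (cases "l = j")
 case True
 have s: "(\<Sum>i<r. T m i * lg i w) = tt m" for m by (simp add: tt_def)
 show ?thesis using True nz by (auto simp: T' s)
 next
 case False
 have *: "(\<Sum>i<r. T m i * lg i (a l)) = (if m = l then 1 else 0)" if "m < r" for m
 using d that \<open>l < r\<close> unfolding dual_units_def by blast
 show ?thesis unfolding T' using False *[OF \<open>k < r\<close>] *[OF j] by auto
 qed
 hence "dual_units r (a(j := w)) T'" using d w unfolding dual_units_def by auto
 thus ?thesis by blast
qed

text \<open>Take dual units with as many members in S as possible. A functional belonging to a
  member outside S must vanish on S, since otherwise an exchange would bring in one more element of
  S. The bijection h puts the members from S first.\<close>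

lemma adapted_dual_units:
 assumes r: "length vs = Suc r" and S: "S <= UK"
 obtains a T m where "dual_units r a T" "m <= r" "ALL k<m. a k : S"
 "ALL w:S. ALL j<r. m <= j --> (\<Sum>i<r. T j i * lg i w) = 0"
proof -
 define c where "c = (%p :: (nat => 'a) \<times> (nat => nat => real). card {j. j < r & fst p j : S})"
 define P where "P = (%p :: (nat => 'a) \<times> (nat => nat => real). dual_units r (fst p) (snd p))"
 obtain a0 T0 where a0: "dual_units r a0 T0" using dual_units_ex[OF r] by blast
 have "P (a0, T0)" using a0 by (simp add: P_def)
 moreover have "ALL p. P p --> c p < Suc r"
 proof (intro allI impI)
 fix p :: "(nat => 'a) \<times> (nat => nat => real)"
 have "card {j. j < r & fst p j : S} <= card {..<r}" by (rule card_mono) auto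
 thus "c p < Suc r" by (simp add: c_def)
 qed
 ultimately have "EX p. P p & (ALL q. P q --> c q <= c p)" by (rule Lattices_Big.ex_has_greatest_nat)
 then obtain p where p: "P p" "ALL q. P q --> c q <= c p" by blast
 define a where "a = fst p"
 define T where "T = snd p"
 define J where "J = {j. j < r & a j : S}"
 have d: "dual_units r a T" using p(1) by (simp add: P_def a_def T_def)
 have J: "J <= {..<r}" "finite J" by (auto simp: J_def)
 have zero: "(\<Sum>i<r. T j i * lg i w) = 0" if w: "w : S" and j: "j < r" "j \<notin> J" for w j
 proof (rule ccontr)
 assume "(\<Sum>i<r. T j i * lg i w) ~= 0"
 then obtain T' where T': "dual_units r (a(j := w)) T'" using exchange_dual[OF d j(1)] w S by blast
 have "{k. k < r & (a(j := w)) k : S} = insert j J" using w j by (auto simp: J_def)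
 hence "c (a(j := w), T') = Suc (card J)" using j J by (simp add: c_def)
 moreover have "c (a(j := w), T') <= c p" using p(2) T' by (simp add: P_def)
 ultimately show False by (simp add: c_def J_def a_def)
 qed
 define m where "m = card J"
 have m: "m <= r" using card_mono[OF _ J(1)] by (simp add: m_def)
 obtain f where f: "bij_betw f {..<m} J"
 using ex_bij_betw_nat_finite[OF J(2)] by (auto simp: m_def lessThan_atLeast0)
 have "card {m..<r} = card ({..<r} - J)" using J by (simp add: m_def card_Diff_subset)
 then obtain g where g: "bij_betw g {m..<r} ({..<r} - J)"
 using finite_same_card_bij[of "{m..<r}" "{..<r} - J"] by auto
 define h where "h = (%i. if i < m then f i else g i)"
 have "bij_betw h ({..<m} \<union> {m..<r}) (J \<union> ({..<r} - J))"
 proof (rule bij_betw_combine)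
 show "bij_betw h {..<m} J" using f by (subst bij_betw_cong[of _ _ f]) (auto simp: h_def)
 show "bij_betw h {m..<r} ({..<r} - J)" using g by (subst bij_betw_cong[of _ _ g]) (auto simp: h_def)
 qed auto
 moreover have "{..<m} \<union> {m..<r} = {..<r}" "J \<union> ({..<r} - J) = {..<r}" using m J by auto
 ultimately have h: "bij_betw h {..<r} {..<r}" by simp
 have hr: "h i < r" if "i < r" for i using bij_betwE[OF h] that by auto
 have hJ: "h i : J \<longleftrightarrow> i < m" if "i < r" for i
 using bij_betwE[OF f] bij_betwE[OF g] that by (auto simp: h_def)
 have hinj: "h i = h j \<longleftrightarrow> i = j" if "i < r" "j < r" for i j
 using inj_on_eq_iff[OF bij_betw_imp_inj_on[OF h]] that by auto
 show ?thesis
 proof (rule that[of "%k. a (h k)" "%k. T (h k)" m])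
 show "dual_units r (%k. a (h k)) (%k. T (h k))" using d hr hinj unfolding dual_units_def by simp
 show "ALL k<m. a (h k) : S"
 proof (intro allI impI)
 fix k assume "k < m"
 thus "a (h k) : S" using hJ[of k] m by (simp add: J_def)
 qed
 show "ALL w:S. ALL j<r. m <= j --> (\<Sum>i<r. T (h j) i * lg i w) = 0"
 using zero hr hJ by simp
 qed (rule m)
qed

text \<open>In the coordinates t given by the dual functionals, elements of S have vanishing
  coordinates from m on, and the coordinates of the flag basis b are triangular. So elements of S
  involve only the first m members of b.\<close>

lemma adapted_units:
 assumes r: "length vs = Suc r" and S: "S <= UK"
 obtains b m a where "m <= r" "ALL k<m. a k : S" "mult_independent (map a [0..<m])" "ALL k<r. b k : UK"
 "det (mat r r (%(i, j). lg i (b j))) ~= 0"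
 "ALL u:UK. EX g::nat => int. EX z:roots_of_unity_in K. u = z * (\<Prod>k<r. b k powi g k)"
 "ALL g::nat => int. (\<Prod>k<r. b k powi g k) : S --> (ALL j<r. m <= j --> g j = 0)"
proof -
 obtain a T m where d: "dual_units r a T" "m <= r" "ALL k<m. a k : S"
 "ALL w:S. ALL j<r. m <= j --> (\<Sum>i<r. T j i * lg i w) = 0" by (rule adapted_dual_units[OF r S])
 define t where "t = (%j u. \<Sum>i<r. T j i * lg i u)"
 have hom: "t j (x * y) = t j x + t j y" if "x : UK" "y : UK" for j x y
 unfolding t_def using that r by (simp add: lg_mult distrib_left sum.distrib)
 have aU: "a k : UK" if "k < r" for k using d(1) that by (simp add: dual_units_def)
 have ta: "t j (a k) = (if j = k then 1 else 0)" if "j < r" "k < r" for j k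
 using d(1) that unfolding dual_units_def t_def by blast
 define TM where "TM = mat r r (%(j, i). T j i)"
 define A where "A = mat r r (%(i, k). lg i (a k))"
 have TA: "TM * A = 1\<^sub>m r"
 by (intro eq_matI) (use ta in "auto simp: TM_def A_def t_def scalar_prod_def lessThan_atLeast0")
 have carr: "TM : carrier_mat r r" "A : carrier_mat r r" by (simp_all add: TM_def A_def)
 have AT: "A * TM = 1\<^sub>m r" by (rule mat_mult_left_right_inverse[OF carr TA])
 have lg_back: "lg i u = (\<Sum>k<r. lg i (a k) * t k u)" if i: "i < r" for i u
 proof -
 have "(\<Sum>k<r. lg i (a k) * t k u) = (\<Sum>k<r. \<Sum>l<r. (lg i (a k) * T k l) * lg l u)"
 by (simp add: t_def sum_distrib_left mult.assoc)
 also have "... = (\<Sum>l<r. (\<Sum>k<r. lg i (a k) * T k l) * lg l u)" by (subst sum.swap) (simp add: sum_distrib_right)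
 also have "... = (\<Sum>l<r. if l = i then lg i u else 0)"
 proof (rule sum.cong)
 fix l assume "l : {..<r}"
 hence l: "l < r" by simp
 have "(A * TM) $$ (i, l) = (\<Sum>k<r. lg i (a k) * T k l)"
 using i l by (auto simp: TM_def A_def scalar_prod_def lessThan_atLeast0)
 hence "(\<Sum>k<r. lg i (a k) * T k l) = (if i = l then 1 else 0)" using AT i l by simp
 thus "(\<Sum>k<r. lg i (a k) * T k l) * lg l u = (if l = i then lg i u else 0)" by simp
 qed simp
 finally show ?thesis using i by simp
 qed
 have lg_last: "lg r u = - (\<Sum>i<r. lg i u)" if "u : UK" for u using lg_sum[OF that] r by simp
 have fin: "finite {u : UK. ALL j<r. \<bar>t j u\<bar> <= C}" for C
 proof -
 define M where "M = (\<Sum>i<r. \<Sum>k<r. \<bar>lg i (a k)\<bar> * \<bar>C\<bar>)"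
 have "{u : UK. ALL j<r. \<bar>t j u\<bar> <= C} <= {u : UK. ALL i<length vs. \<bar>lg i u\<bar> <= M}"
 proof
 fix u assume "u : {u : UK. ALL j<r. \<bar>t j u\<bar> <= C}"
 hence u: "u : UK" "!!j. j < r ==> \<bar>t j u\<bar> <= C" by auto
 have le: "\<bar>lg i u\<bar> <= (\<Sum>k<r. \<bar>lg i (a k)\<bar> * \<bar>C\<bar>)" if i: "i < r" for i
 unfolding lg_back[OF i, of u]
 by (intro order.trans[OF sum_abs] sum_mono) (use u(2) in "force simp: abs_mult intro!: mult_left_mono")
 have "\<bar>lg i u\<bar> <= M" if "i < length vs" for i
 proof (cases "i < r")
 case True
 note le[OF True]
 also have "(\<Sum>k<r. \<bar>lg i (a k)\<bar> * \<bar>C\<bar>) <= M" unfolding M_def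
 by (rule member_le_sum[of i "{..<r}"]) (use True in "auto intro!: sum_nonneg")
 finally show ?thesis .
 next
 case False
 hence "i = r" using that r by simp
 hence "\<bar>lg i u\<bar> = \<bar>\<Sum>i<r. lg i u\<bar>" using lg_last[OF u(1)] by simp
 also have "... <= (\<Sum>i<r. \<bar>lg i u\<bar>)" by (rule sum_abs)
 also have "... <= M" unfolding M_def by (rule sum_mono) (use le in auto)
 finally show ?thesis .
 qed
 thus "u : {u : UK. ALL i<length vs. \<bar>lg i u\<bar> <= M}" using u(1) by simp
 qed
 thus ?thesis using finite_bounded_units by (rule finite_subset)
 qed
 obtain b where b: "ALL k<r. b k : UK" "ALL k<r. t k (b k) > 0" "ALL k<r. ALL j<r. k < j --> t j (b k) = 0"
 "ALL u:UK. EX g::nat => int. EX z:UK. (ALL j<r. t j z = 0) & u = z * (\<Prod>k<r. b k powi g k)"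
 by (rule flag_basis[OF unit_group hom fin aU ta])
 have bU: "!!k. k < r ==> b k : UK" using b(1) by blast
 have root: "z : roots_of_unity_in K" if z: "z : UK" "ALL j<r. t j z = 0" for z
 proof (rule lg_zero_root_of_unity[OF z(1)])
 have l0: "lg i z = 0" if "i < r" for i unfolding lg_back[OF that, of z] using z(2) by simp
 fix i assume "i < length vs"
 thus "lg i z = 0" using l0 lg_last[OF z(1)] r by (cases "i < r") (auto simp: less_Suc_eq)
 qed
 define B where "B = mat r r (%(i, j). lg i (b j))"
 have "det B ~= 0"
 proof -
 have B: "B : carrier_mat r r" by (simp add: B_def)
 have ent: "(TM * B) $$ (i, j) = t i (b j)" if "i < r" "j < r" for i j
 using that by (auto simp: TM_def B_def t_def scalar_prod_def lessThan_atLeast0)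
 have up: "upper_triangular (TM * B)"
 proof (rule upper_triangularI)
 fix i j assume "j < i" "i < dim_row (TM * B)"
 thus "(TM * B) $$ (i, j) = 0" using ent[of i j] b(3) by (simp add: TM_def del: index_mult_mat(1))
 qed
 have TB: "TM * B : carrier_mat r r" using carr B by simp
 have "det (TM * B) = (\<Prod>i=0..<r. (TM * B) $$ (i, i))"
 using det_upper_triangular[OF up TB] TB carrier_matD[OF carr(1)]
 by (simp add: diag_mat_def prod.list_conv_set_nth del: index_mult_mat(1))
 also have "... = (\<Prod>i<r. t i (b i))"
 by (rule prod.cong) (auto simp: lessThan_atLeast0 ent simp del: index_mult_mat(1))
 finally have "det (TM * B) = (\<Prod>i<r. t i (b i))" .
 hence "det (TM * B) ~= 0" using b(2) by auto
 thus ?thesis using det_mult[OF carr(1) B] by simp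
 qed
 have tprod: "t j (\<Prod>k<r. b k powi g k) = (\<Sum>k<r. of_int (g k) * t j (b k))" for j g
 by (rule prod_powi_hom(2)[OF unit_group hom bU])
 have flag: "g j = 0" if S: "(\<Prod>k<r. b k powi g k) : S" and j: "j < r" "m <= j" for g j
 proof -
 have z: "(\<Sum>k<r. of_int (g k) * t l (b k)) = 0" if "l < r" "m <= l" for l
 using d(4) S that tprod[of l g] unfolding t_def by simp
 \<comment> \<open>Downward induction on the index: in coordinate l the earlier members of b vanish
   and the later ones have exponent 0 already.\<close>
 have "ALL l. r - k <= l --> m <= l --> l < r --> g l = 0" for k
 proof (induction k)
 case 0 show ?case by simp
 next
 case (Suc k)
 show ?case
 proof (intro allI impI)
 fix l assume l: "r - Suc k <= l" "m <= l" "l < r"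
 have "0 = (\<Sum>k<r. of_int (g k) * t l (b k))" using z[OF l(3,2)] by simp
 also have "... = (\<Sum>k<r. if k = l then of_int (g l) * t l (b l) else 0)"
 proof (rule sum.cong)
 fix k' assume "k' : {..<r}"
 hence k': "k' < r" by simp
 consider "k' < l" | "k' = l" | "l < k'" by linarith
 thus "of_int (g k') * t l (b k') = (if k' = l then of_int (g l) * t l (b l) else 0)"
 proof cases
 case 1 thus ?thesis using b(3) k' l by simp
 next
 case 3
 hence "r - k <= k'" "m <= k'" using l by linarith+
 hence "g k' = 0" using Suc.IH k' by blast
 thus ?thesis using 3 by simp
 qed simp
 qed simp
 finally have "of_int (g l) * t l (b l) = (0::real)" using l by simp
 thus "g l = 0" using b(2) l by auto
 qed
 qed
 from this[of r] show ?thesis using j by simp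
 qed
 have ind: "mult_independent (map a [0..<m])" unfolding mult_independent_def
 proof (intro allI impI)
 fix g :: "nat => int" and i
 assume p: "(\<Prod>i<length (map a [0..<m]). map a [0..<m] ! i powi g i) = 1" and i: "i < length (map a [0..<m])"
 have p': "(\<Prod>k<m. a k powi g k) = 1"
 using p by simp
 have i: "i < r" "i < m" using i d(2) by auto
 have aUm: "!!k. k < m ==> a k : UK" using aU d(2) by simp
 have "t i 1 = 0" using hom[OF unit_1 unit_1, of i] by simp
 hence "0 = t i (\<Prod>k<m. a k powi g k)" using p' by simp
 also have "... = (\<Sum>k<m. of_int (g k) * t i (a k))" by (rule prod_powi_hom(2)[OF unit_group hom aUm])
 also have "... = (\<Sum>k<m. if k = i then of_int (g i) else 0)" using d(2) i by (intro sum.cong) (auto simp: ta)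
 finally show "g i = 0" using i by simp
 qed
 show ?thesis
 proof (rule that[of m a b])
 show "ALL u:UK. EX g::nat => int. EX z:roots_of_unity_in K. u = z * (\<Prod>k<r. b k powi g k)" using b(4) root by meson
 show "ALL g::nat => int. (\<Prod>k<r. b k powi g k) : S --> (ALL j<r. m <= j --> g j = 0)" using flag by blast
 qed (use d b ind \<open>det B ~= 0\<close> in "auto simp: B_def")
qed

end

context places
begin

definition lg_mat :: "nat => (nat => 'a) => real mat" where
 "lg_mat r b = mat r r (%(i, j). lg i (b j))"

lemma lg_mat_carrier [simp]: "lg_mat r b : carrier_mat r r" by (simp add: lg_mat_def)

definition unit_basis :: "nat => (nat => 'a) => bool" where
 "unit_basis r b \<longleftrightarrow> length vs = Suc r & (ALL k<r. b k : UK) & det (lg_mat r b) ~= 0 &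
 (ALL u:UK. EX g::nat => int. EX z:roots_of_unity_in K. u = z * (\<Prod>k<r. b k powi g k))"

lemma lg_mat_kernel:
 assumes d: "det (lg_mat r b) ~= 0" and z: "!!i. i < r ==> (\<Sum>k<r. c k * lg i (b k)) = 0" and k: "k < r"
 shows "c k = 0"
proof -
 have "lg_mat r b *\<^sub>v vec r c = 0\<^sub>v r"
 using z by (intro eq_vecI) (auto simp: lg_mat_def scalar_prod_def lessThan_atLeast0 mult.commute)
 hence "vec r c = 0\<^sub>v r" using det_0_iff_vec_prod_zero[OF lg_mat_carrier] d vec_carrier[of r c] by blast
 hence "vec r c $ k = 0\<^sub>v r $ k" by simp
 thus ?thesis using k by simp
qed

lemma lg_root_prod:
 assumes b: "!!k. k < q ==> b k : UK" and z: "z : roots_of_unity_in K" and i: "i < length vs"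
 shows "lg i (z * (\<Prod>k<(q::nat). b k powi g k)) = (\<Sum>k<q. of_int (g k) * lg i (b k))"
proof -
 have "lg i (z * (\<Prod>k<q. b k powi g k)) = lg i z + lg i (\<Prod>k<q. b k powi g k)"
 by (rule lg_mult[OF i root_of_unity_lg(1)[OF z] unit_prod[OF b]])
 thus ?thesis using root_of_unity_lg(2)[OF z i] lg_prod[OF i b] by simp
qed

text \<open>More than r exponent vectors satisfy a rational relation, integral after clearing
  denominators. The corresponding product has zero logarithms, hence is a root of unity, and a power
  of it is a multiplicative relation.\<close>

lemma mult_independent_length:
 assumes bs: "unit_basis r b" and us: "set us <= UK" "mult_independent us"
 shows "length us <= r"
proof (rule ccontr)
 define q where "q = length us"
 assume "~ length us <= r"
 hence q: "r < q" by (simp add: q_def)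
 have usU: "us ! i : UK" if "i < q" for i using us(1) that by (auto simp: q_def)
 have r: "length vs = Suc r" and bU: "!!k. k < r ==> b k : UK" using bs by (auto simp: unit_basis_def)
 have "ALL i. EX g::nat => int. i < q --> (EX z:roots_of_unity_in K. us ! i = z * (\<Prod>k<r. b k powi g k))"
 using bs usU unfolding unit_basis_def by blast
 from choice[OF this] obtain G :: "nat => nat => int" where
 G: "ALL i. i < q --> (EX z:roots_of_unity_in K. us ! i = z * (\<Prod>k<r. b k powi G i k))" by (rule exE)
 have lgG: "lg l (us ! i) = (\<Sum>k<r. of_int (G i k) * lg l (b k))" if i: "i < q" and l: "l < length vs" for i l
 proof -
 obtain z where z: "z : roots_of_unity_in K" "us ! i = z * (\<Prod>k<r. b k powi G i k)" using G i by blast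
 show ?thesis unfolding z(2) by (rule lg_root_prod[OF bU z(1) l])
 qed
 obtain c :: "nat => rat" where c: "EX i<q. c i ~= 0" "!!j. j < r ==> (\<Sum>i<q. c i * of_int (G i j)) = 0"
 using field_kernel[OF q, of "%i j. of_int (G i j)"] by auto
 obtain N :: int and k :: "nat => int" where N: "N > 0" "!!i. i < q ==> of_int N * c i = of_int (k i)"
 using common_denominator[of q c] by auto
 have kz: "(\<Sum>i<q. k i * G i j) = 0" if "j < r" for j
 proof -
 have "of_int (\<Sum>i<q. k i * G i j) = (\<Sum>i<q. of_int N * (c i * of_int (G i j)) :: rat)"
 unfolding of_int_sum of_int_mult by (rule sum.cong) (auto simp: N(2)[symmetric])
 also have "... = 0" using c(2)[OF that] by (simp add: sum_distrib_left[symmetric])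
 finally show ?thesis by (simp only: of_int_eq_0_iff)
 qed
 define u where "u = (\<Prod>i<q. us ! i powi k i)"
 have uU: "u : UK" unfolding u_def by (rule unit_prod) (rule usU)
 have "u : roots_of_unity_in K"
 proof (rule lg_zero_root_of_unity[OF uU])
 fix l assume l: "l < length vs"
 have "lg l u = (\<Sum>i<q. of_int (k i) * lg l (us ! i))" unfolding u_def by (rule lg_prod[OF l usU])
 also have "... = (\<Sum>i<q. \<Sum>j<r. of_int (k i * G i j) * lg l (b j))"
 by (rule sum.cong) (auto simp: lgG[OF _ l] sum_distrib_left mult.assoc)
 also have "... = (\<Sum>j<r. of_int (\<Sum>i<q. k i * G i j) * lg l (b j))"
 by (subst sum.swap) (simp add: sum_distrib_right)
 also have "... = 0" by (simp add: kz)
 finally show "lg l u = 0" .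
 qed
 then obtain M where M: "M > 0" "u ^ M = 1" unfolding roots_of_unity_in_def by blast
 have "(\<Prod>i<q. us ! i powi (k i * int M)) = u ^ M"
 unfolding u_def prod_power_distrib by (simp add: power_int_mult)
 hence "(\<Prod>i<length us. us ! i powi (k i * int M)) = 1" using M by (simp add: q_def)
 with us(2) have "ALL i<length us. k i * int M = 0"
 unfolding mult_independent_def by (elim allE[of _ "%i. k i * int M"]) simp
 hence "k i * int M = 0" if "i < q" for i using that by (simp add: q_def)
 hence "k i = 0" if "i < q" for i using that M by simp
 hence "c i = 0" if "i < q" for i using N(1) N(2)[OF that] that by simp
 thus False using c(1) by blast
qed

lemma unit_basis_independent:
 assumes bs: "unit_basis r b" and p: "(\<Prod>k<r. b k powi g k) : roots_of_unity_in K" and k: "k < r" shows "g k = 0"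
proof -
 have r: "length vs = Suc r" and bU: "!!k. k < r ==> b k : UK" and d: "det (lg_mat r b) ~= 0" using bs by (auto simp: unit_basis_def)
 have "real_of_int (g k) = 0"
 proof (rule lg_mat_kernel[OF d _ k])
 fix i assume "i < r"
 hence i: "i < length vs" using r by simp
 show "(\<Sum>k<r. real_of_int (g k) * lg i (b k)) = 0" using lg_prod[OF i bU] root_of_unity_lg(2)[OF p i] by simp
 qed
 thus ?thesis by simp
qed

lemma one_root: "1 : roots_of_unity_in K"
 unfolding roots_of_unity_in_def using subfield_1[OF sf] by (auto intro: exI[of _ 1])

text \<open>\<open>unit_rank\<close> is a \<open>Max\<close>, which is informative only for a finite
  set; the bound r on the lengths provides finiteness for all subfields.\<close>

lemma unit_rank_le:
 assumes bs: "unit_basis r b" and F: "is_subfield F" "F <= K"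
 shows "unit_rank F <= r" "set us <= integer_units F ==> mult_independent us ==> length us <= unit_rank F"
proof -
 define X where "X = {length us | us. set us <= integer_units F & mult_independent us}"
 have FU: "integer_units F <= UK" using F by (auto simp: unit_iff integer_units_iff[OF F(1)])
 have "X <= {..r}" unfolding X_def using mult_independent_length[OF bs] FU by blast
 hence fin: "finite X" and le: "!!x. x : X ==> x <= r" using finite_subset by auto
 have "0 : X" unfolding X_def by (auto intro!: exI[of _ "[]"] simp: mult_independent_def)
 hence "Max X : X" using fin by (intro Max_in) auto
 thus "unit_rank F <= r" unfolding unit_rank_def X_def[symmetric] using le by blast
 assume "set us <= integer_units F" "mult_independent us"
 hence "length us : X" unfolding X_def by blast
 thus "length us <= unit_rank F" unfolding unit_rank_def X_def[symmetric] by (rule Max_ge[OF fin])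
qed

lemma unit_rank_eq: assumes bs: "unit_basis r b" shows "unit_rank K = r"
proof (rule antisym)
 show "unit_rank K <= r" by (rule unit_rank_le(1)[OF bs sf order.refl])
 have "mult_independent (map b [0..<r])"
 unfolding mult_independent_def using unit_basis_independent[OF bs] one_root by simp
 moreover have "set (map b [0..<r]) <= UK" using bs by (auto simp: unit_basis_def)
 ultimately have "length (map b [0..<r]) <= unit_rank K" using unit_rank_le(2)[OF bs sf order.refl] by blast
 thus "r <= unit_rank K" by simp
qed

lemma max_subfield_unit_rank_bounds:
 assumes bs: "unit_basis r b" and F: "is_subfield F" "F \<subset> K"
 shows "unit_rank F <= max_subfield_unit_rank K" "max_subfield_unit_rank K <= r"
proof -
 define X where "X = {unit_rank F | F. is_subfield F & F \<subset> K}"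
 have le: "x <= r" if "x : X" for x using that unit_rank_le(1)[OF bs] unfolding X_def by blast
 hence fin: "finite X" using finite_subset[of X "{..r}"] by blast
 have FX: "unit_rank F : X" unfolding X_def using F by blast
 show "unit_rank F <= max_subfield_unit_rank K"
 unfolding max_subfield_unit_rank_def X_def[symmetric] by (rule Max_ge[OF fin FX])
 have "Max X : X" using fin FX by (intro Max_in) auto
 thus "max_subfield_unit_rank K <= r" unfolding max_subfield_unit_rank_def X_def[symmetric] by (rule le)
qed

lemma unit_basis_fundamental:
 assumes bs: "unit_basis r b" shows "fundamental_units K (map b [0..<r])"
 unfolding fundamental_units_def
proof (intro conjI ballI)
 have bU: "!!k. k < r ==> b k : UK" using bs by (auto simp: unit_basis_def)
 show "set (map b [0..<r]) <= UK" using bU by auto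
 fix u assume u: "u : UK"
 then obtain g :: "nat => int" and z where g: "z : roots_of_unity_in K" "u = z * (\<Prod>k<r. b k powi g k)"
 using bs unfolding unit_basis_def by blast
 have prod: "(\<Prod>i<length (map b [0..<r]). map b [0..<r] ! i powi h i) = (\<Prod>k<r. b k powi h k)" for h
 by simp
 show "\<exists>!(z, a). z : roots_of_unity_in K & a : {..<length (map b [0..<r])} \<rightarrow>\<^sub>E UNIV &
 u = z * (\<Prod>i<length (map b [0..<r]). map b [0..<r] ! i powi a i)"
 proof (rule ex1I[of _ "(z, restrict g {..<r})"])
 show "case (z, restrict g {..<r}) of (z, a) => z : roots_of_unity_in K & a : {..<length (map b [0..<r])} \<rightarrow>\<^sub>E UNIV &
 u = z * (\<Prod>i<length (map b [0..<r]). map b [0..<r] ! i powi a i)" using g by simp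
 fix p :: "'a \<times> (nat => int)"
 assume "case p of (z, a) => z : roots_of_unity_in K & a : {..<length (map b [0..<r])} \<rightarrow>\<^sub>E UNIV &
 u = z * (\<Prod>i<length (map b [0..<r]). map b [0..<r] ! i powi a i)"
 then obtain y h where h: "p = (y, h)" "y : roots_of_unity_in K" "h : {..<r} \<rightarrow>\<^sub>E UNIV" "u = y * (\<Prod>k<r. b k powi h k)"
 unfolding prod by (cases p) auto
 have r: "length vs = Suc r" and d: "det (lg_mat r b) ~= 0" using bs by (auto simp: unit_basis_def)
 have "h k = g k" if k: "k < r" for k
 proof -
 have "real_of_int (h k - g k) = 0"
 proof (rule lg_mat_kernel[OF d _ k])
 fix i assume "i < r"
 hence i: "i < length vs" using r by simp
 have "(\<Sum>k<r. of_int (h k) * lg i (b k)) = (\<Sum>k<r. of_int (g k) * lg i (b k))"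
 proof -
 have "lg i u = (\<Sum>k<r. of_int (g k) * lg i (b k))" unfolding g(2) by (rule lg_root_prod[OF bU g(1) i])
 moreover have "lg i u = (\<Sum>k<r. of_int (h k) * lg i (b k))" unfolding h(4) by (rule lg_root_prod[OF bU h(2) i])
 ultimately show ?thesis by simp
 qed
 thus "(\<Sum>k<r. real_of_int (h k - g k) * lg i (b k)) = 0"
 by (simp add: left_diff_distrib sum_subtractf)
 qed
 thus ?thesis by simp
 qed
 hence hg: "h = restrict g {..<r}" by (intro PiE_ext[OF h(3)]) auto
 have eqp: "(\<Prod>k<r. b k powi h k) = (\<Prod>k<r. b k powi g k)" unfolding hg by simp
 have "y * (\<Prod>k<r. b k powi g k) = z * (\<Prod>k<r. b k powi g k)"
 by (rule trans[OF h(4)[unfolded eqp, symmetric] g(2)])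
 moreover have "(\<Prod>k<r. b k powi g k) ~= 0" by (rule unit_nz, rule unit_prod[OF bU])
 ultimately have "y = z" by (metis mult_right_cancel)
 thus "p = (z, restrict g {..<r})" using h(1) hg by simp
 qed
qed

text \<open>Each system expresses the other with integer exponents, so the exponent matrices have
  integer determinants with product 1. The length is at most r by multiplicative independence and at
  least r because the logarithm matrix of b is nonsingular.\<close>

lemma fundamental_lg_mat:
 assumes bs: "unit_basis r b" and fu: "fundamental_units K us"
 shows "length us = r" "\<bar>det (lg_mat r ((!) us))\<bar> = \<bar>det (lg_mat r b)\<bar>"
proof -
 define q where "q = length us"
 have bU: "!!k. k < r ==> b k : UK" and r: "length vs = Suc r" and d: "det (lg_mat r b) ~= 0" using bs by (auto simp: unit_basis_def)
 have usS: "set us <= UK" using fu by (simp add: fundamental_units_def)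
 hence usU: "!!i. i < q ==> us ! i : UK" by (auto simp: q_def)
 have span: "EX g::nat => int. EX z:roots_of_unity_in K. u = z * (\<Prod>i<q. us ! i powi g i)" if "u : UK" for u
 proof -
 have "\<exists>!(z, a). z : roots_of_unity_in K & a : {..<q} \<rightarrow>\<^sub>E (UNIV :: int set) & u = z * (\<Prod>i<q. us ! i powi a i)"
 using fu that unfolding fundamental_units_def q_def by blast
 thus ?thesis by (elim ex1E) (auto split: prod.splits)
 qed
 have "mult_independent us" unfolding mult_independent_def
 proof (intro allI impI)
 fix a :: "nat => int" and i assume a: "(\<Prod>i<length us. us ! i powi a i) = 1" "i < length us"
 define P where "P = (%p :: 'a \<times> (nat => int). case p of (z, a) => z : roots_of_unity_in K & a : {..<q} \<rightarrow>\<^sub>E UNIV & 1 = z * (\<Prod>i<q. us ! i powi a i))"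
 have ex1: "\<exists>!p. P p" using fu unit_1 unfolding fundamental_units_def q_def P_def by blast
 have "P (1, restrict a {..<q})" "P (1, \<lambda>i\<in>{..<q}. 0)" using a(1) one_root by (auto simp: P_def q_def)
 hence "(1::'a, restrict a {..<q}) = (1, \<lambda>i\<in>{..<q}. 0)" using ex1 by (rule_tac ex1E[OF ex1]) metis
 hence "restrict a {..<q} i = (\<lambda>i\<in>{..<q}. 0) i" by simp
 thus "a i = 0" using a(2) by (simp add: q_def)
 qed
 hence qr: "q <= r" unfolding q_def by (rule mult_independent_length[OF bs usS])
 have "ALL k. EX g::nat => int. k < r --> (EX z:roots_of_unity_in K. b k = z * (\<Prod>i<q. us ! i powi g i))"
 using span bU by blast
 from choice[OF this] obtain Q :: "nat => nat => int" where
 Q0: "ALL k. k < r --> (EX z:roots_of_unity_in K. b k = z * (\<Prod>i<q. us ! i powi Q k i))" by (rule exE)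
 have Q: "lg l (b k) = (\<Sum>i<q. of_int (Q k i) * lg l (us ! i))" if k: "k < r" and l: "l < length vs" for k l
 proof -
 obtain z where z: "z : roots_of_unity_in K" "b k = z * (\<Prod>i<q. us ! i powi Q k i)" using Q0 k by blast
 show ?thesis unfolding z(2) by (rule lg_root_prod[OF usU z(1) l])
 qed
 have "~ q < r"
 proof
 assume "q < r"
 obtain c :: "nat => real" where c: "EX k<r. c k ~= 0" "!!i. i < q ==> (\<Sum>k<r. c k * of_int (Q k i)) = 0"
 using field_kernel[OF \<open>q < r\<close>, of "%k i. of_int (Q k i)"] by auto
 have "c k = 0" if "k < r" for k
 proof (rule lg_mat_kernel[OF d _ that])
 fix l assume "l < r"
 hence l: "l < length vs" using r by simp
 have "(\<Sum>k<r. c k * lg l (b k)) = (\<Sum>k<r. \<Sum>i<q. (c k * of_int (Q k i)) * lg l (us ! i))"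
 by (rule sum.cong) (auto simp: Q[OF _ l] sum_distrib_left mult.assoc)
 also have "... = (\<Sum>i<q. (\<Sum>k<r. c k * of_int (Q k i)) * lg l (us ! i))"
 by (subst sum.swap) (simp add: sum_distrib_right)
 also have "... = 0" by (simp add: c(2))
 finally show "(\<Sum>k<r. c k * lg l (b k)) = 0" .
 qed
 thus False using c(1) by blast
 qed
 hence qeq: "q = r" using qr by simp
 thus "length us = r" by (simp add: q_def)
 have "ALL i. EX g::nat => int. i < r --> (EX z:roots_of_unity_in K. us ! i = z * (\<Prod>k<r. b k powi g k))"
 using bs usU unfolding unit_basis_def qeq by blast
 from choice[OF this] obtain P :: "nat => nat => int" where
 P0: "ALL i. i < r --> (EX z:roots_of_unity_in K. us ! i = z * (\<Prod>k<r. b k powi P i k))" by (rule exE)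
 have P: "lg l (us ! i) = (\<Sum>k<r. of_int (P i k) * lg l (b k))" if i: "i < r" and l: "l < length vs" for i l
 proof -
 obtain z where z: "z : roots_of_unity_in K" "us ! i = z * (\<Prod>k<r. b k powi P i k)" using P0 i by blast
 show ?thesis unfolding z(2) by (rule lg_root_prod[OF bU z(1) l])
 qed
 define PM where "PM = mat r r (%(k, i). P i k)"
 define QM where "QM = mat r r (%(i, k). Q k i)"
 have "lg_mat r ((!) us) = lg_mat r b * map_mat of_int PM"
 using r by (intro eq_matI) (auto simp: lg_mat_def PM_def scalar_prod_def lessThan_atLeast0 P mult.commute)
 hence dP: "det (lg_mat r ((!) us)) = det (lg_mat r b) * of_int (det PM)"
 using det_mult[OF lg_mat_carrier, of "map_mat of_int PM" r b] by (simp add: PM_def of_int_hom.hom_det)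
 have "lg_mat r b = lg_mat r ((!) us) * map_mat of_int QM"
 using r by (intro eq_matI) (auto simp: lg_mat_def QM_def scalar_prod_def lessThan_atLeast0 Q qeq mult.commute)
 hence dQ: "det (lg_mat r b) = det (lg_mat r ((!) us)) * of_int (det QM)"
 using det_mult[OF lg_mat_carrier, of "map_mat of_int QM" r "(!) us"] by (simp add: QM_def of_int_hom.hom_det)
 have "det (lg_mat r b) * of_int (det PM * det QM) = det (lg_mat r b) * 1"
 using dP dQ by (simp add: mult.assoc[symmetric])
 hence "real_of_int (det PM * det QM) = 1" using d by (simp only: mult_cancel_left) simp
 hence "det PM * det QM = 1" by (simp only: of_int_eq_1_iff)
 hence "\<bar>det PM\<bar> = 1" using zmult_eq_1_iff by auto
 thus "\<bar>det (lg_mat r ((!) us))\<bar> = \<bar>det (lg_mat r b)\<bar>" unfolding dP abs_mult by (simp flip: of_int_abs)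
qed

text \<open>The lists may differ in order, by conjugation and in the place left out.
  \<open>det_minor_augmented\<close> turns both minors into determinants over all places, which
  differ by a permutation of the rows.\<close>

lemma lg_mat_change_places:
 assumes vs': "arch_places K vs'" and len: "length vs' = Suc r" "length vs = Suc r" and us: "!!j. j < r ==> us j : UK"
 shows "\<bar>det (places.lg_mat K vs' r us)\<bar> = \<bar>det (lg_mat r us)\<bar>"
proof -
 interpret P': places K n e vs' by unfold_locales (rule vs')
 have "ALL i. EX j. i < Suc r --> j < Suc r & (vs ! j = vs' ! i \<or> vs ! j = conj_emb K (vs' ! i))"
 using emb_cases[OF P'.vs_emb] len by metis
 from choice[OF this] obtain p0 where p0: "ALL i. i < Suc r --> p0 i < Suc r & (vs ! p0 i = vs' ! i \<or> vs ! p0 i = conj_emb K (vs' ! i))" by (rule exE)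
 define p where "p = (%i. if i < Suc r then p0 i else i)"
 have p: "p i < Suc r" "vs ! p i = vs' ! i \<or> vs ! p i = conj_emb K (vs' ! i)" if "i < Suc r" for i
 using p0 that by (auto simp: p_def)
 have "inj_on p {..<Suc r}"
 proof (rule inj_onI)
 fix i j assume ij: "i : {..<Suc r}" "j : {..<Suc r}" "p i = p j"
 hence i: "i < length vs'" and j: "j < length vs'" using len by auto
 have ci: "conj_emb K (conj_emb K (vs' ! i)) = vs' ! i" "conj_emb K (conj_emb K (vs' ! j)) = vs' ! j"
 using conj_emb_invol P'.vs_emb i j by auto
 have "vs' ! j = vs' ! i \<or> vs' ! j = conj_emb K (vs' ! i)"
 using p(2)[of i] p(2)[of j] ij ci by (metis lessThan_iff)
 hence "vs' ! j = vs' ! i" using P'.vs_ex1[OF P'.vs_emb[OF i]] nth_mem[OF i] nth_mem[OF j] by blast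
 thus "i = j" using P'.vs_distinct i j by (simp add: nth_eq_iff_index_eq)
 qed
 moreover have "p ` {..<Suc r} <= {..<Suc r}" using p(1) by auto
 ultimately have "bij_betw p {..<Suc r} {..<Suc r}" using endo_inj_surj[of "{..<Suc r}" p] by (auto simp: bij_betw_def)
 hence perm: "p permutes {..<Suc r}" by (rule bij_imp_permutes) (simp add: p_def)
 have lgp: "P'.lg i u = lg (p i) u" if i: "i < Suc r" and u: "u : UK" for i u
 proof -
 have e: "vs' ! i : Emb K" using P'.vs_emb i len by simp
 have "real_embedding K (conj_emb K (vs' ! i)) \<longleftrightarrow> real_embedding K (vs' ! i)"
 using conj_emb_real[OF e] conj_emb_real[OF conj_emb_in[OF sf e]] conj_emb_invol[OF e] by metis
 hence "local_degree K (vs ! p i) = local_degree K (vs' ! i)" "cmod ((vs ! p i) u) = cmod ((vs' ! i) u)"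
 using p(2)[OF i] cmod_conj_emb[OF unit_K[OF u]] by (auto simp: local_degree_def)
 thus ?thesis by (simp add: lg_def P'.lg_def)
 qed
 define f where "f = (%i j. lg i (us j))"
 define f' where "f' = (%i j. P'.lg i (us j))"
 define F where "F = (%(i, j). if j < r then f i j else 1)"
 have "det (mat (Suc r) (Suc r) (%(i, j). if j < r then f' i j else 1)) = real (Suc r) * det (mat r r (%(i, j). f' i j))"
 by (rule det_minor_augmented) (use P'.lg_sum us len in "simp add: f'_def")
 moreover have "mat (Suc r) (Suc r) (%(i, j). if j < r then f' i j else 1) = mat (Suc r) (Suc r) (%(i, j). F (p i, j))"
 by (intro eq_matI) (auto simp: F_def f_def f'_def lgp us)
 moreover have "det (mat (Suc r) (Suc r) F) = real (Suc r) * det (mat r r (%(i, j). f i j))"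
 unfolding F_def by (rule det_minor_augmented) (use lg_sum us len in "simp add: f_def")
 moreover have "\<bar>det (mat (Suc r) (Suc r) (%(i, j). F (p i, j)))\<bar> = \<bar>det (mat (Suc r) (Suc r) F)\<bar>"
 by (rule abs_det_row_permute[OF perm])
 ultimately have "real (Suc r) * \<bar>det (mat r r (%(i, j). f' i j))\<bar> = real (Suc r) * \<bar>det (mat r r (%(i, j). f i j))\<bar>"
 by (simp add: abs_mult)
 thus ?thesis by (simp add: P'.lg_mat_def lg_mat_def f_def f'_def)
qed

theorem regulator_eq:
 assumes bs: "unit_basis r b" shows "regulator K = \<bar>det (lg_mat r b)\<bar>"
 unfolding regulator_def
proof (rule the_equality)
 have lgm: "mat r r (%(i, j). real (local_degree K (vs ! i)) * ln (cmod ((vs ! i) (us j)))) = lg_mat r us" for us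
 by (simp add: lg_mat_def lg_def)
 have "mat r r (%(i, j). real (local_degree K (vs ! i)) * ln (cmod ((vs ! i) (map b [0..<r] ! j)))) = lg_mat r b"
 by (intro eq_matI) (auto simp: lg_mat_def lg_def)
 thus "EX ee vs. fundamental_units K ee & arch_places K vs & \<bar>det (lg_mat r b)\<bar> =
 \<bar>det (mat (length ee) (length ee) (%(i, j). real (local_degree K (vs ! i)) * ln (cmod ((vs ! i) (ee ! j)))))\<bar>"
 by (intro exI[of _ "map b [0..<r]"] exI[of _ vs] conjI unit_basis_fundamental[OF bs] vs) simp
 fix R assume "EX ee vs. fundamental_units K ee & arch_places K vs & R =
 \<bar>det (mat (length ee) (length ee) (%(i, j). real (local_degree K (vs ! i)) * ln (cmod ((vs ! i) (ee ! j)))))\<bar>"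
 then obtain ee vs' where e: "fundamental_units K ee" "arch_places K vs'"
 "R = \<bar>det (mat (length ee) (length ee) (%(i, j). real (local_degree K (vs' ! i)) * ln (cmod ((vs' ! i) (ee ! j)))))\<bar>" by blast
 interpret P': places K n e vs' by unfold_locales (rule e(2))
 have r: "length vs = Suc r" using bs by (simp add: unit_basis_def)
 obtain r' where r': "length vs' = Suc r'" using P'.vs_nonempty by (cases "length vs'") auto
 \<comment> \<open>A unit basis with respect to the other list; as \<open>unit_rank\<close> does not
   depend on the places, both lists have r + 1 entries.\<close>
 obtain b' m' a' where "m' <= r'" "ALL k<r'. b' k : UK" "det (mat r' r' (%(i, j). P'.lg i (b' j))) ~= 0"
 "ALL u:UK. EX g::nat => int. EX z:roots_of_unity_in K. u = z * (\<Prod>k<r'. b' k powi g k)"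
 by (rule P'.adapted_units[OF r' empty_subsetI])
 hence "P'.unit_basis r' b'" by (simp add: P'.unit_basis_def P'.lg_mat_def r')
 hence "r' = r" using P'.unit_rank_eq unit_rank_eq[OF bs] by metis
 hence r'': "length vs' = Suc r" using r' by simp
 note f = fundamental_lg_mat[OF bs e(1)]
 have "set ee <= UK" using e(1) by (simp add: fundamental_units_def)
 hence "!!j. j < r ==> ee ! j : UK" using f(1) by auto
 hence "\<bar>det (P'.lg_mat r ((!) ee))\<bar> = \<bar>det (lg_mat r ((!) ee))\<bar>" by (rule lg_mat_change_places[OF e(2) r'' r])
 thus "R = \<bar>det (lg_mat r b)\<bar>" unfolding e(3) f(1) using f(2) by (simp add: P'.lg_mat_def P'.lg_def)
qed

text \<open>For a unit the positive parts over all places and the negative parts over all places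
  both add up to \<open>log_mahler\<close>. The omitted place contributes to only one of these
  sums.\<close>

lemma log_mahler_le_pos_part_norm:
 assumes r: "length vs = Suc r" and u: "u : UK" shows "log_mahler K u <= pos_part_norm r (%i. lg i u)"
proof (cases "lg r u <= 0")
 case True
 thus ?thesis using log_mahler_lg(1)[OF u] r by (simp add: pos_part_norm_def)
next
 case False
 thus ?thesis using log_mahler_lg(2)[OF u] r by (simp add: pos_part_norm_def)
qed

text \<open>The unit basis is adapted to the set S of units of measure below \<mu>2. As S lies in F,
  its m independent members give m <= \<rho>, and a product with a nonzero exponent at an index from
  m on lies outside S.\<close>

theorem regulator_lower_bound:
 assumes mu: "\<mu>1 > 0" "\<mu>2 > 0"
 and m1: "!!u. u : UK ==> log_mahler K u > 0 ==> \<mu>1 <= log_mahler K u"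
 and F: "is_subfield F" "F \<subset> K" "{u : UK. log_mahler K u < \<mu>2} <= F"
 shows "max_subfield_unit_rank K <= unit_rank K"
 "real (2 * unit_rank K choose unit_rank K) / fact (unit_rank K) * (\<mu>1 / 2) ^ max_subfield_unit_rank K *
 (\<mu>2 / 2) ^ (unit_rank K - max_subfield_unit_rank K) <= regulator K"
proof -
 obtain r where r: "length vs = Suc r" using vs_nonempty by (cases "length vs") auto
 define S where "S = {u : UK. log_mahler K u < \<mu>2}"
 have SU: "S <= UK" by (auto simp: S_def)
 obtain b m a where b: "m <= r" "ALL k<m. a k : S" "mult_independent (map a [0..<m])" "ALL k<r. b k : UK"
 "det (mat r r (%(i, j). lg i (b j))) ~= 0"
 "ALL u:UK. EX g::nat => int. EX z:roots_of_unity_in K. u = z * (\<Prod>k<r. b k powi g k)"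
 "ALL g::nat => int. (\<Prod>k<r. b k powi g k) : S --> (ALL j<r. m <= j --> g j = 0)"
 by (rule adapted_units[OF r SU])
 have bs: "unit_basis r b" using b r by (simp add: unit_basis_def lg_mat_def)
 have rk: "unit_rank K = r" by (rule unit_rank_eq[OF bs])
 have bU: "!!k. k < r ==> b k : UK" using b(4) by blast
 define \<rho> where "\<rho> = max_subfield_unit_rank K"
 have \<rho>r: "\<rho> <= r" unfolding \<rho>_def by (rule max_subfield_unit_rank_bounds(2)[OF bs F(1,2)])
 thus "max_subfield_unit_rank K <= unit_rank K" by (simp add: rk \<rho>_def)
 have FK: "F <= K" using F(2) by auto
 have "a k : UK & a k : F" if "k < m" for k using b(2) that F(3) unfolding S_def by blast
 hence "set (map a [0..<m]) <= integer_units F" by (auto simp: integer_units_iff[OF F(1)] unit_iff)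
 hence "length (map a [0..<m]) <= unit_rank F" by (rule unit_rank_le(2)[OF bs F(1) FK _ b(3)])
 hence m\<rho>: "m <= \<rho>" using max_subfield_unit_rank_bounds(1)[OF bs F(1,2)] by (simp add: \<rho>_def)
 define V where "V = real (2 * r choose r) / fact r"
 have V: "V >= 0" by (simp add: V_def)
 define A where "A = lg_mat r b"
 have A: "A : carrier_mat r r" "det A ~= 0" using bs by (auto simp: A_def unit_basis_def)
 have val: "log_mahler K (\<Prod>k<r. b k powi g k) <= pos_part_norm r (%i. \<Sum>j<r. A $$ (i, j) * of_int (g j))" for g
 proof -
 have "log_mahler K (\<Prod>k<r. b k powi g k) <= pos_part_norm r (%i. lg i (\<Prod>k<r. b k powi g k))"
 by (rule log_mahler_le_pos_part_norm[OF r unit_prod[OF bU]])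
 also have "... = pos_part_norm r (%i. \<Sum>j<r. A $$ (i, j) * of_int (g j))"
 proof (rule pos_part_norm_cong)
 fix i assume i: "i < r"
 have "lg i (\<Prod>k<r. b k powi g k) = (\<Sum>k<r. of_int (g k) * lg i (b k))"
 by (rule lg_prod[OF _ bU]) (use i r in auto)
 also have "... = (\<Sum>j<r. A $$ (i, j) * of_int (g j))"
 using i by (intro sum.cong) (auto simp: A_def lg_mat_def)
 finally show "lg i (\<Prod>k<r. b k powi g k) = (\<Sum>j<r. A $$ (i, j) * of_int (g j))" .
 qed
 finally show ?thesis .
 qed
 have M1: "\<mu>1 <= pos_part_norm r (%i. \<Sum>j<r. A $$ (i, j) * of_int (g j))" if g: "EX j<r. g j ~= 0" for g :: "nat => int"
 proof -
 define u where "u = (\<Prod>k<r. b k powi g k)"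
 have u: "u : UK" unfolding u_def by (rule unit_prod[OF bU])
 have "log_mahler K u ~= 0"
 proof
 assume z: "log_mahler K u = 0"
 have "(\<Sum>i<length vs. max 0 (lg i u)) = 0" "(\<Sum>i<length vs. max 0 (- lg i u)) = 0"
 using z log_mahler_lg[OF u] by auto
 hence "ALL i:{..<length vs}. max 0 (lg i u) = 0" "ALL i:{..<length vs}. max 0 (- lg i u) = 0"
 by (subst (asm) sum_nonneg_eq_0_iff; simp)+
 hence "lg i u = 0" if "i < length vs" for i
 proof -
 assume z1: "ALL i:{..<length vs}. max 0 (lg i u) = 0" and z2: "ALL i:{..<length vs}. max 0 (- lg i u) = 0"
 have "max 0 (lg i u) = 0" "max 0 (- lg i u) = 0" using z1 z2 that by blast+
 thus ?thesis by (simp add: max_def split: if_splits)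
 qed
 hence "u : roots_of_unity_in K" by (rule lg_zero_root_of_unity[OF u])
 thus False using unit_basis_independent[OF bs] g unfolding u_def by blast
 qed
 hence "\<mu>1 <= log_mahler K u" using m1[OF u] log_mahler_nonneg[of K u] by simp
 thus ?thesis using val[of g] unfolding u_def by linarith
 qed
 have M2: "\<mu>2 <= pos_part_norm r (%i. \<Sum>j<r. A $$ (i, j) * of_int (g j))" if g: "EX j<r. m <= j & g j ~= 0" for g :: "nat => int"
 proof -
 have "(\<Prod>k<r. b k powi g k) \<notin> S" using b(7) g by blast
 hence "\<mu>2 <= log_mahler K (\<Prod>k<r. b k powi g k)" using unit_prod[where q = r and b = b and g = g, OF bU] unfolding S_def by simp
 thus ?thesis using val[of g] by linarith
 qed
 have "V * (\<mu>1 / 2) ^ \<rho> * (\<mu>2 / 2) ^ (r - \<rho>) <= \<bar>det A\<bar>"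
 proof (cases "\<mu>1 <= \<mu>2")
 case True
 \<comment> \<open>The lattice bound has the exponent m in place of \<rho>; since m <= \<rho>,
   raising it replaces factors \<mu>2 / 2 by smaller factors \<mu>1 / 2.\<close>
 have "(\<mu>1 / 2) ^ \<rho> * (\<mu>2 / 2) ^ (r - \<rho>) = (\<mu>1 / 2) ^ m * ((\<mu>1 / 2) ^ (\<rho> - m) * (\<mu>2 / 2) ^ (r - \<rho>))"
 using m\<rho> by (simp add: power_add[symmetric] mult.assoc[symmetric])
 also have "... <= (\<mu>1 / 2) ^ m * ((\<mu>2 / 2) ^ (\<rho> - m) * (\<mu>2 / 2) ^ (r - \<rho>))"
 using mu True by (intro mult_left_mono mult_right_mono power_mono) auto
 also have "... = (\<mu>1 / 2) ^ m * (\<mu>2 / 2) ^ (r - m)"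
 using m\<rho> \<rho>r by (simp add: power_add[symmetric])
 finally have "V * ((\<mu>1 / 2) ^ \<rho> * (\<mu>2 / 2) ^ (r - \<rho>)) <= V * ((\<mu>1 / 2) ^ m * (\<mu>2 / 2) ^ (r - m))"
 using V by (rule mult_left_mono)
 also have "... <= \<bar>det A\<bar>"
 using lattice_det_bound[OF A mu(1) True b(1) M1 M2] by (simp add: V_def mult.assoc)
 finally show ?thesis by (simp add: mult.assoc)
 next
 case False
 \<comment> \<open>If \<mu>2 is the smaller value, the bound by \<mu>1 alone is stronger; it is the
   case m = r of the lattice bound.\<close>
 have "(\<mu>1 / 2) ^ \<rho> * (\<mu>2 / 2) ^ (r - \<rho>) <= (\<mu>1 / 2) ^ \<rho> * (\<mu>1 / 2) ^ (r - \<rho>)"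
 using mu False by (intro mult_left_mono power_mono) auto
 also have "... = (\<mu>1 / 2) ^ r" using \<rho>r by (simp add: power_add[symmetric])
 finally have "V * ((\<mu>1 / 2) ^ \<rho> * (\<mu>2 / 2) ^ (r - \<rho>)) <= V * (\<mu>1 / 2) ^ r" using V by (rule mult_left_mono)
 also have "... <= \<bar>det A\<bar>"
 proof -
 have M1': "\<mu>1 <= pos_part_norm r (%i. \<Sum>j<r. A $$ (i, j) * of_int (g j))" if "EX j<r. r <= j & g j ~= 0" for g :: "nat => int"
 using that by auto
 show ?thesis using lattice_det_bound[OF A mu(1) order.refl order.refl M1 M1'] by (simp add: V_def)
 qed
 finally show ?thesis by (simp add: mult.assoc)
 qed
 thus "real (2 * unit_rank K choose unit_rank K) / fact (unit_rank K) * (\<mu>1 / 2) ^ max_subfield_unit_rank K *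
 (\<mu>2 / 2) ^ (unit_rank K - max_subfield_unit_rank K) <= regulator K"
 unfolding rk \<rho>_def[symmetric] V_def[symmetric] regulator_eq[OF bs] A_def .
qed

end

section \<open>The regulator bound\<close>

theorem theorem1p1:
 fixes K :: "'a::field_char_0 set" and d r \<rho> :: nat and D \<gamma> :: real
 assumes "number_field K"
 and "d = ext_degree \<rat> K" and "d \<ge> 3"
 and "\<not> CM_field K"
 and "r = unit_rank K"
 and "D = real_of_int \<bar>discriminant K\<bar>"
 and "\<rho> = max_subfield_unit_rank K"
 and "\<gamma> = 1 / real d ^ d"
 and "1 < \<gamma> * D"
 shows "fact (2 * r) / (fact r) ^ 3 * (ln (ln (real d)) / (2 * ln (real d))) ^ (3 * \<rho>) *
 (ln (\<gamma> * D) / (4 * real d)) ^ (r - \<rho>) \<le> regulator K"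
proof -
 have nf: "number_field K" by (rule assms(1))
 have card: "card (Emb K) = d" using embeddings_card_degree[OF nf] assms(2) by simp
 have "finite (Emb K)" by (rule embeddings_finite[OF nf])
 then obtain e where e: "bij_betw e {..<d} (Emb K)"
 using ex_bij_betw_nat_finite[of "Emb K"] card by (auto simp: lessThan_atLeast0)
 obtain vs where vs: "arch_places K vs" by (rule arch_places_ex[OF nf])
 interpret places K d e vs by unfold_locales (use nf e vs in auto)
 define L where "L = ln (real d)"
 define \<mu>1 where "\<mu>1 = (ln L / L) ^ 3 / 4"
 define \<mu>2 where "\<mu>2 = ln (\<gamma> * D) / (2 * real d)"
 have d0: "real d > 0" using assms(3) by simp
 have L1: "L > 1"
 proof -
 have "exp 1 < (3::real)" by (rule e_less_272[THEN less_trans]) simp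
 hence "exp 1 < real d" using assms(3) by simp
 thus ?thesis unfolding L_def using d0 by (metis exp_less_cancel_iff exp_ln)
 qed
 have mu: "\<mu>1 > 0" "\<mu>2 > 0"
 using L1 assms(9) d0 by (auto simp: \<mu>1_def \<mu>2_def intro!: divide_pos_pos zero_less_power ln_gt_zero)
 have m1: "\<mu>1 <= log_mahler K u" if "u : integer_units K" "log_mahler K u > 0" for u
 unfolding \<mu>1_def L_def by (rule dobrowolski[OF nf _ that assms(3)]) (simp add: card)
 have D0: "D > 0"
 proof -
 have "D ~= 0" using assms(9) by auto
 thus ?thesis using assms(6) by simp
 qed
 have lnD: "ln (\<gamma> * D) = ln D - real d * ln (real d)"
 unfolding assms(8) using D0 d0 by (simp add: ln_div ln_realpow)
 have disc: "real d * ln (real d) + 2 * (real d - 1) * \<mu>2 < ln \<bar>real_of_int (discriminant K)\<bar>"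
 proof -
 \<comment> \<open>The factor (d - 1) / d is what makes the inequality strict.\<close>
 have "2 * (real d - 1) * \<mu>2 = ln (\<gamma> * D) - ln (\<gamma> * D) / real d" unfolding \<mu>2_def using d0 by (simp add: field_simps)
 moreover have "ln (\<gamma> * D) / real d > 0" using assms(9) d0 by (intro divide_pos_pos ln_gt_zero) auto
 moreover have "D = \<bar>real_of_int (discriminant K)\<bar>" using assms(6) by simp
 ultimately show ?thesis using lnD by simp
 qed
 obtain F where F: "is_subfield F" "F \<subset> K" "{u : integer_units K. log_mahler K u < \<mu>2} <= F"
 proof (rule small_height_subfield[OF nf _ _ _ disc card[symmetric], of "{u : integer_units K. log_mahler K u < \<mu>2}"])
 show "{u : integer_units K. log_mahler K u < \<mu>2} <= ring_of_integers K" by (auto simp: integer_units_def)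
 qed (use mu in auto)
 have reg: "real (2 * r choose r) / fact r * (\<mu>1 / 2) ^ \<rho> * (\<mu>2 / 2) ^ (r - \<rho>) <= regulator K"
 unfolding assms(5,7) by (rule regulator_lower_bound(2)[OF mu m1 F])
 have "real (2 * r choose r) = fact (2 * r) / (fact r * fact r)"
 using binomial_fact[of r "2 * r"] by (simp add: mult_2)
 hence 1: "fact (2 * r) / (fact r) ^ 3 = real (2 * r choose r) / fact r"
 by (simp add: power3_eq_cube field_simps)
 have "(ln (ln (real d)) / (2 * ln (real d))) ^ 3 = \<mu>1 / 2"
 unfolding \<mu>1_def L_def by (simp add: power_divide power_mult_distrib)
 hence 2: "(ln (ln (real d)) / (2 * ln (real d))) ^ (3 * \<rho>) = (\<mu>1 / 2) ^ \<rho>" by (simp only: power_mult)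
 have 3: "ln (\<gamma> * D) / (4 * real d) = \<mu>2 / 2" by (simp add: \<mu>2_def)
 show ?thesis unfolding 1 2 3 by (rule reg)
qed

end
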